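(* Let $K$ be an algebraically closed field, $\Lambda = KQ/I$ a basic finite dimensional $K$-algebra ($Q$ a finite quiver, $I$ an admissible ideal), and $\mathbf{d}$ a dimension vector. For a finite dimensional $\Lambda$-module $M$, let $\Gamma(M)$ be the number of those realizable semisimple sequences that govern at least one filtration of $M$. Then the map $$\Gamma_\bullet : \mathbf{Rep}_{\mathbf{d}}(\Lambda)\to\mathbb{N},\qquad x\mapsto \Gamma(M_x),$$ is upper semicontinuous, i.e., $\Gamma_\bullet^{-1}([a,\infty))$ is closed in $\mathbf{Rep}_{\mathbf{d}}(\Lambda)$ for every $a\in\mathbb{N}$. In particular: whenever $\mathcal{C}$ is an irreducible component of some $\mathbf{Rep}\,\mathbb{S}$, where $\mathbb{S}$ is a semisimple sequence with dimension vector $\mathbf{d}$, such that $1\in\Gamma_\bullet(\mathcal{C})$, the closure $\overline{\mathcal{C}}$ of $\mathcal{C}$ in $\mathbf{Rep}_{\mathbf{d}}(\Lambda)$ is an irreducible component of $\mathbf{Rep}_{\mathbf{d}}(\Lambda)$.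
   Context: Modules are finite dimensional left modules. $J$ is the Jacobson radical of $\Lambda$; $L$ is the maximal length of a path in $KQ\setminus I$, equivalently $L$ is minimal with $J^{L+1}=0$. Denote by $e_1,\dots,e_n$ the vertices of $Q$ and by $Q_1$ the set of arrows. Isomorphic semisimple modules are identified. For $\mathbf{d}=(d_1,\dots,d_n)$, $\mathbf{Rep}_{\mathbf{d}}(\Lambda)$ is the affine variety of all tuples $(x_\alpha)_{\alpha\in Q_1} \in \prod_{\alpha\in Q_1}\mathrm{Hom}_K(K^{d_{\mathrm{start}(\alpha)}},K^{d_{\mathrm{end}(\alpha)}})$ which satisfy all relations in $I$ (Zariski topology). A point $x$ determines the $\Lambda$-module $M_x = \bigoplus_i K^{d_i}$ on which each arrow $\alpha$ acts by $x_\alpha$. A semisimple sequence with dimension vector $\mathbf{d}$ is a sequence $\mathbb{S}=(\mathbb{S}_0,\dots,\mathbb{S}_L)$ of (isomorphism classes of) semisimple $\Lambda$-modules with $\sum_{l=0}^L\underline{\dim}\,\mathbb{S}_l=\mathbf{d}$. The radical layering of a module $M$ is $\mathbb{S}(M) = (J^lM/J^{l+1}M)_{0\le l\le L}$. $\mathbf{Rep}\,\mathbb{S}$ is the locally closed subvariety of $\mathbf{Rep}_{\mathbf{d}}(\Lambda)$ consisting of the points $x$ with $\mathbb{S}(M_x)=\mathbb{S}$. The sequence $\mathbb{S}$ is realizable if $\mathbf{Rep}\,\mathbb{S}\neq\varnothing$. A filtration of $M$ governed by $\mathbb{S}$ is a chain of submodules $M=M_0\supseteq M_1\supseteq\cdots\supseteq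 M_{L+1}=0$ with $M_l/M_{l+1}\cong\mathbb{S}_l$ for $0\le l\le L$. *)

theory Defs
  imports
    "HOL-Computational_Algebra.Polynomial"
    "Graph_Theory.Arc_Walk"
    "Jordan_Normal_Form.Matrix"
    "HOL-Algebra.QuotRing"
    "HOL-Algebra.Ideal_Product"
    "HOL-Algebra.Module"
    "HOL-Algebra.Generated_Groups"
    "HOL-Analysis.Abstract_Topology"
    "HOL-Library.Poly_Mapping"
begin

section \<open>Path algebras and admissible ideals\<close>

text \<open>
  A quiver is a finite directed multigraph \<open>Q\<close> (locale \<^locale>\<open>fin_digraph\<close>; loops and parallel
  arrows are allowed). A path is a pair consisting of its starting vertex and the list of its
  arrows in the order in which they are traversed; \<open>(v, [])\<close> is the trivial path at \<open>v\<close>, i.e. the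
  idempotent \<open>e\<^sub>v\<close>.
\<close>

type_synonym ('v, 'a) qpath = "'v \<times> 'a list"

definition path_end :: "('v, 'a) pre_digraph \<Rightarrow> ('v, 'a) qpath \<Rightarrow> 'v" where
  "path_end Q \<pi> = last (pre_digraph.awalk_verts Q (fst \<pi>) (snd \<pi>))"

definition paths :: "('v, 'a) pre_digraph \<Rightarrow> ('v, 'a) qpath set" where
  "paths Q = {\<pi>. pre_digraph.awalk Q (fst \<pi>) (snd \<pi>) (path_end Q \<pi>)}"

text \<open>
  The product \<open>\<sigma> \<rho>\<close> of two paths is ``first \<open>\<rho>\<close>, then \<open>\<sigma>\<close>'', and is zero unless \<open>\<rho>\<close> ends where
  \<open>\<sigma>\<close> starts. This is the convention under which left modules are covariant representations.
\<close>

definition path_mult ::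
  "('v, 'a) pre_digraph \<Rightarrow> (('v, 'a) qpath \<Rightarrow>\<^sub>0 'k) \<Rightarrow> (('v, 'a) qpath \<Rightarrow>\<^sub>0 'k) \<Rightarrow>
    (('v, 'a) qpath \<Rightarrow>\<^sub>0 'k::field)" where
  "path_mult Q f g =
     (\<Sum>\<sigma>\<in>Poly_Mapping.keys f. \<Sum>\<rho>\<in>Poly_Mapping.keys g.
        if path_end Q \<rho> = fst \<sigma>
        then Poly_Mapping.single (fst \<rho>, snd \<rho> @ snd \<sigma>)
               (Poly_Mapping.lookup f \<sigma> * Poly_Mapping.lookup g \<rho>)
        else 0)"

definition path_algebra :: "('v, 'a) pre_digraph \<Rightarrow> (('v, 'a) qpath \<Rightarrow>\<^sub>0 'k::field) ring" where
  "path_algebra Q =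
     \<lparr>carrier = {f. Poly_Mapping.keys f \<subseteq> paths Q},
      mult = path_mult Q,
      one = (\<Sum>v\<in>verts Q. Poly_Mapping.single (v, []) 1),
      zero = 0,
      add = (+)\<rparr>"

text \<open>
  The path algebra of a finite quiver is a ring, so that the notion of an ideal of it is not void.
\<close>

lemma poly_mapping_eq_sum_single:
  "(\<Sum>k\<in>Poly_Mapping.keys f. Poly_Mapping.single k (Poly_Mapping.lookup f k)) = f"
  by (rule poly_mapping_eqI)
    (auto simp: lookup_sum lookup_single when_def not_in_keys_iff_lookup_eq_zero sum.delta)

lemma path_mult_superset:
  assumes "finite A" "finite B" "Poly_Mapping.keys f \<subseteq> A" "Poly_Mapping.keys g \<subseteq> B"
  shows "path_mult Q f g = (\<Sum>\<sigma>\<in>A. \<Sum>\<rho>\<in>B.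
        if path_end Q \<rho> = fst \<sigma>
        then Poly_Mapping.single (fst \<rho>, snd \<rho> @ snd \<sigma>)
               (Poly_Mapping.lookup f \<sigma> * Poly_Mapping.lookup g \<rho>)
        else 0)"
proof -
  let ?t = "\<lambda>\<sigma> \<rho>. if path_end Q \<rho> = fst \<sigma>
        then Poly_Mapping.single (fst \<rho>, snd \<rho> @ snd \<sigma>)
               (Poly_Mapping.lookup f \<sigma> * Poly_Mapping.lookup g \<rho>) else 0"
  have "path_mult Q f g = (\<Sum>\<sigma>\<in>Poly_Mapping.keys f. \<Sum>\<rho>\<in>B. ?t \<sigma> \<rho>)"
    unfolding path_mult_def using assms
    by (intro sum.cong refl sum.mono_neutral_left) (auto simp: in_keys_iff)
  also have "\<dots> = (\<Sum>\<sigma>\<in>A. \<Sum>\<rho>\<in>B. ?t \<sigma> \<rho>)"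
    using assms by (intro sum.mono_neutral_left) (auto simp: in_keys_iff intro!: sum.neutral)
  finally show ?thesis .
qed

lemma path_mult_add_left:
  fixes f :: "('v, 'a) qpath \<Rightarrow>\<^sub>0 'k::field"
  shows "path_mult Q (f + f') g = path_mult Q f g + path_mult Q f' g"
proof -
  let ?A = "Poly_Mapping.keys f \<union> Poly_Mapping.keys f'"
  have fin: "finite ?A" by simp
  have sub: "Poly_Mapping.keys (f + f') \<subseteq> ?A" by (rule keys_add)
  have *: "(if b then Poly_Mapping.single k ((x + x') * y) else 0) =
      (if b then Poly_Mapping.single k (x * y) else 0) +
      (if b then Poly_Mapping.single k (x' * y) else 0)" for b k and x x' y :: 'k
    by (simp add: distrib_right single_add)
  show ?thesis
    unfolding path_mult_superset[OF fin finite_keys sub subset_refl]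
      path_mult_superset[OF fin finite_keys Un_upper1 subset_refl]
      path_mult_superset[OF fin finite_keys Un_upper2 subset_refl]
      lookup_add * sum.distrib ..
qed

lemma path_mult_add_right:
  fixes f :: "('v, 'a) qpath \<Rightarrow>\<^sub>0 'k::field"
  shows "path_mult Q f (g + g') = path_mult Q f g + path_mult Q f g'"
proof -
  let ?A = "Poly_Mapping.keys g \<union> Poly_Mapping.keys g'"
  have fin: "finite ?A" by simp
  have sub: "Poly_Mapping.keys (g + g') \<subseteq> ?A" by (rule keys_add)
  have *: "(if b then Poly_Mapping.single k (y * (x + x')) else 0) =
      (if b then Poly_Mapping.single k (y * x) else 0) +
      (if b then Poly_Mapping.single k (y * x') else 0)" for b k and x x' y :: 'k
    by (simp add: distrib_left single_add)
  show ?thesis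
    unfolding path_mult_superset[OF finite_keys fin subset_refl sub]
      path_mult_superset[OF finite_keys fin subset_refl Un_upper1]
      path_mult_superset[OF finite_keys fin subset_refl Un_upper2]
      lookup_add * sum.distrib ..
qed

lemma path_mult_zero: "path_mult Q 0 g = 0" "path_mult Q f 0 = 0"
  by (simp_all add: path_mult_def)

lemma path_mult_sum_left: "path_mult Q (sum F A) g = (\<Sum>a\<in>A. path_mult Q (F a) g)"
  by (induction A rule: infinite_finite_induct) (simp_all add: path_mult_zero path_mult_add_left)

lemma path_mult_sum_right: "path_mult Q f (sum F A) = (\<Sum>a\<in>A. path_mult Q f (F a))"
  by (induction A rule: infinite_finite_induct) (simp_all add: path_mult_zero path_mult_add_right)

lemma path_mult_single:
  "path_mult Q (Poly_Mapping.single \<sigma> a) (Poly_Mapping.single \<rho> b) =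
    (if path_end Q \<rho> = fst \<sigma> then Poly_Mapping.single (fst \<rho>, snd \<rho> @ snd \<sigma>) (a * b) else 0)"
  by (simp add: path_mult_def)

lemma path_end_append: "path_end Q (u, p @ q) = path_end Q (path_end Q (u, p), q)"
  by (induction p arbitrary: u) (auto simp: path_end_def pre_digraph.awalk_verts.simps
    pre_digraph.awalk_verts_non_Nil)

lemma path_mult_assoc:
  "path_mult Q (path_mult Q f g) h = path_mult Q f (path_mult Q g h)"
proof -
  let ?s = "\<lambda>f k. Poly_Mapping.single k (Poly_Mapping.lookup f k)"
  have s: "path_mult Q (path_mult Q (?s f k) (?s g l)) (?s h m) =
     path_mult Q (?s f k) (path_mult Q (?s g l) (?s h m))" for k l m
    by (cases l; cases m)
      (auto simp: path_mult_single path_mult_zero path_end_append mult.assoc)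
  let ?S = "\<lambda>f. (\<Sum>k\<in>Poly_Mapping.keys f. ?s f k)"
  have "path_mult Q (path_mult Q (?S f) (?S g)) (?S h) =
     path_mult Q (?S f) (path_mult Q (?S g) (?S h))"
    unfolding path_mult_sum_left path_mult_sum_right s ..
  then show ?thesis unfolding poly_mapping_eq_sum_single .
qed

lemma keys_sum_subset:
  assumes "\<And>a. a \<in> A \<Longrightarrow> Poly_Mapping.keys (F a) \<subseteq> B"
  shows "Poly_Mapping.keys (sum F A) \<subseteq> B"
  using assms
proof (induction A rule: infinite_finite_induct)
  case (insert x A)
  then have "Poly_Mapping.keys (F x) \<union> Poly_Mapping.keys (sum F A) \<subseteq> B" by simp
  with insert(1,2) show ?case
    using keys_add[of "F x" "sum F A"] by (simp add: subset_trans)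
qed simp_all

lemma path_mult_carrier:
  fixes f :: "('v, 'a) qpath \<Rightarrow>\<^sub>0 'k::field"
  assumes "Poly_Mapping.keys f \<subseteq> paths Q" "Poly_Mapping.keys g \<subseteq> paths Q"
    and "wf_digraph Q"
  shows "Poly_Mapping.keys (path_mult Q f g) \<subseteq> paths Q"
proof -
  interpret wf_digraph Q by fact
  have "Poly_Mapping.keys (if path_end Q \<rho> = fst \<sigma>
        then Poly_Mapping.single (fst \<rho>, snd \<rho> @ snd \<sigma>) c else 0) \<subseteq> paths Q"
    if "\<sigma> \<in> paths Q" "\<rho> \<in> paths Q" for \<sigma> \<rho> and c :: 'k
    using that by (cases \<sigma>; cases \<rho>) (auto simp: paths_def path_end_append split: if_splits)
  then show ?thesis
    unfolding path_mult_def using assms(1,2)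
    by (intro keys_sum_subset) blast
qed

lemma ring_path_algebra:
  fixes Q :: "('v, 'a) pre_digraph"
  assumes "fin_digraph Q"
  shows "ring (path_algebra Q :: (('v, 'a) qpath \<Rightarrow>\<^sub>0 'k::field) ring)"
proof -
  interpret fin_digraph Q by fact
  let ?R = "path_algebra Q :: (('v, 'a) qpath \<Rightarrow>\<^sub>0 'k::field) ring"
  let ?e = "\<Sum>v\<in>verts Q. Poly_Mapping.single (v, []) (1 :: 'k)"
  have triv: "(v, []) \<in> paths Q" if "v \<in> verts Q" for v
    using that by (simp add: paths_def path_end_def awalk_Nil_iff)
  have one: "Poly_Mapping.keys ?e \<subseteq> paths Q"
    by (rule keys_sum_subset) (use triv in auto)
  have start: "fst \<pi> \<in> verts Q" if "\<pi> \<in> paths Q" for \<pi>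
    using that unfolding paths_def awalk_def by blast
  have endv: "path_end Q \<pi> \<in> verts Q" if "\<pi> \<in> paths Q" for \<pi>
    using that unfolding paths_def by auto
  have sl: "path_mult Q ?e (Poly_Mapping.single \<pi> a) = Poly_Mapping.single \<pi> a"
    if "\<pi> \<in> paths Q" for \<pi> and a :: 'k
    by (simp add: path_mult_sum_left path_mult_single sum.delta endv[OF that])
  have sr: "path_mult Q (Poly_Mapping.single \<pi> a) ?e = Poly_Mapping.single \<pi> a"
    if "\<pi> \<in> paths Q" for \<pi> and a :: 'k
  proof -
    have "path_mult Q (Poly_Mapping.single \<pi> a) ?e =
        (\<Sum>v\<in>verts Q. if v = fst \<pi> then Poly_Mapping.single \<pi> a else 0)"
      unfolding path_mult_sum_right
      by (intro sum.cong refl) (auto simp: path_mult_single path_end_def)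
    then show ?thesis by (simp add: start[OF that])
  qed
  have l: "path_mult Q ?e f = f" and r: "path_mult Q f ?e = f"
    if "Poly_Mapping.keys f \<subseteq> paths Q" for f
  proof -
    let ?S = "\<Sum>k\<in>Poly_Mapping.keys f. Poly_Mapping.single k (Poly_Mapping.lookup f k)"
    have "path_mult Q ?e ?S = ?S"
      unfolding path_mult_sum_right using sl that by (intro sum.cong refl) blast
    then show "path_mult Q ?e f = f" by (simp only: poly_mapping_eq_sum_single)
    have "path_mult Q ?S ?e = ?S"
      unfolding path_mult_sum_left[of Q _ "Poly_Mapping.keys f"]
      using sr that by (intro sum.cong refl) blast
    then show "path_mult Q f ?e = f" by (simp only: poly_mapping_eq_sum_single)
  qed
  show ?thesis
  proof (rule ringI)
    show "abelian_group ?R"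
    proof (rule abelian_groupI)
      fix x assume x: "x \<in> carrier ?R"
      show "\<exists>y\<in>carrier ?R. y \<oplus>\<^bsub>?R\<^esub> x = \<zero>\<^bsub>?R\<^esub>"
        using x by (intro bexI[of _ "- x"]) (auto simp: path_algebra_def in_keys_iff)
    next
      fix x y assume "x \<in> carrier ?R" "y \<in> carrier ?R"
      then show "x \<oplus>\<^bsub>?R\<^esub> y \<in> carrier ?R"
        using keys_add[of x y] by (auto simp: path_algebra_def)
    qed (auto simp: path_algebra_def ac_simps)
    show "monoid ?R"
    proof (rule monoidI)
      fix x y assume "x \<in> carrier ?R" "y \<in> carrier ?R"
      then show "x \<otimes>\<^bsub>?R\<^esub> y \<in> carrier ?R"
        using path_mult_carrier[OF _ _ wf_digraph, of x y] by (simp add: path_algebra_def)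
    qed (simp_all add: path_algebra_def one l r path_mult_assoc)
  qed (auto simp: path_algebra_def path_mult_add_left path_mult_add_right)
qed


primrec ideal_power :: "('r, 'm) ring_scheme \<Rightarrow> 'r set \<Rightarrow> nat \<Rightarrow> 'r set" where
  "ideal_power R A 0 = carrier R"
| "ideal_power R A (Suc n) = ideal_prod R A (ideal_power R A n)"

definition arrow_ideal :: "('v, 'a) pre_digraph \<Rightarrow> (('v, 'a) qpath \<Rightarrow>\<^sub>0 'k::field) set" where
  "arrow_ideal Q =
     genideal (path_algebra Q) {Poly_Mapping.single (tail Q \<alpha>, [\<alpha>]) 1 |\<alpha>. \<alpha> \<in> arcs Q}"

definition admissible_ideal ::
  "('v, 'a) pre_digraph \<Rightarrow> (('v, 'a) qpath \<Rightarrow>\<^sub>0 'k::field) set \<Rightarrow> bool" where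
  "admissible_ideal Q I \<longleftrightarrow>
     ideal I (path_algebra Q) \<and>
     I \<subseteq> ideal_power (path_algebra Q) (arrow_ideal Q) 2 \<and>
     (\<exists>m\<ge>2. ideal_power (path_algebra Q) (arrow_ideal Q) m \<subseteq> I)"

abbreviation quiver_algebra ::
  "('v, 'a) pre_digraph \<Rightarrow> (('v, 'a) qpath \<Rightarrow>\<^sub>0 'k::field) set \<Rightarrow>
    (('v, 'a) qpath \<Rightarrow>\<^sub>0 'k) set ring" where
  "quiver_algebra Q I \<equiv> path_algebra Q Quot I"

text \<open>
  The maximal length \<open>L\<close> of a path outside \<open>I\<close>. On \<^typ>\<open>nat\<close>, \<open>Sup\<close> is the maximum of a nonempty
  finite set and \<open>Sup {} = 0\<close>, which only concerns the quiver without vertices.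
\<close>

definition max_path_length ::
  "('v, 'a) pre_digraph \<Rightarrow> (('v, 'a) qpath \<Rightarrow>\<^sub>0 'k::field) set \<Rightarrow> nat" where
  "max_path_length Q I =
     Sup {length (snd \<pi>) |\<pi>. \<pi> \<in> paths Q \<and> Poly_Mapping.single \<pi> 1 \<notin> I}"


section \<open>Left modules over a ring\<close>

text \<open>
  Left modules over a not necessarily commutative ring \<open>R\<close> are represented by the record type
  \<^typ>\<open>('r, 'm) module\<close>, whose fields \<open>mult\<close> and \<open>one\<close> are irrelevant. Submodules are given by the
  locale \<^locale>\<open>submodule\<close>, which does not presuppose commutativity.
\<close>

definition simple_module :: "('r, 'x) ring_scheme \<Rightarrow> ('r, 'm) module \<Rightarrow> bool" where
  "simple_module R M \<longleftrightarrow>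
     carrier M \<noteq> {\<zero>\<^bsub>M\<^esub>} \<and> (\<forall>N. submodule N R M \<longrightarrow> N = {\<zero>\<^bsub>M\<^esub>} \<or> N = carrier M)"

text \<open>Semisimple: equal to the sum of all simple submodules, the least submodule containing them.\<close>

definition semisimple_module :: "('r, 'x) ring_scheme \<Rightarrow> ('r, 'm) module \<Rightarrow> bool" where
  "semisimple_module R M \<longleftrightarrow>
     (\<forall>N. submodule N R M \<and>
          (\<forall>S. submodule S R M \<and> simple_module R (M\<lparr>carrier := S\<rparr>) \<longrightarrow> S \<subseteq> N)
        \<longrightarrow> N = carrier M)"

definition module_isomorphic ::
  "('r, 'x) ring_scheme \<Rightarrow> ('r, 'm) module \<Rightarrow> ('r, 'n) module \<Rightarrow> bool" where
  "module_isomorphic R M N \<longleftrightarrow>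
     (\<exists>h. bij_betw h (carrier M) (carrier N) \<and>
          (\<forall>x\<in>carrier M. \<forall>y\<in>carrier M. h (x \<oplus>\<^bsub>M\<^esub> y) = h x \<oplus>\<^bsub>N\<^esub> h y) \<and>
          (\<forall>r\<in>carrier R. \<forall>x\<in>carrier M. h (r \<odot>\<^bsub>M\<^esub> x) = r \<odot>\<^bsub>N\<^esub> h x))"

definition quot_module :: "('r, 'm) module \<Rightarrow> 'm set \<Rightarrow> ('r, 'm set) module" where
  "quot_module M N =
     \<lparr>carrier = a_rcosets\<^bsub>M\<^esub> N, mult = undefined, one = undefined,
      zero = N, add = set_add M,
      smult = (\<lambda>r X. \<Union>x\<in>X. N +>\<^bsub>M\<^esub> (r \<odot>\<^bsub>M\<^esub> x))\<rparr>"

definition left_ideal :: "'r set \<Rightarrow> ('r, 'x) ring_scheme \<Rightarrow> bool" where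
  "left_ideal A R \<longleftrightarrow>
     additive_subgroup A R \<and> (\<forall>r\<in>carrier R. \<forall>a\<in>A. r \<otimes>\<^bsub>R\<^esub> a \<in> A)"

definition maximal_left_ideal :: "'r set \<Rightarrow> ('r, 'x) ring_scheme \<Rightarrow> bool" where
  "maximal_left_ideal A R \<longleftrightarrow>
     left_ideal A R \<and> A \<noteq> carrier R \<and>
     (\<forall>B. left_ideal B R \<and> A \<subseteq> B \<longrightarrow> B = A \<or> B = carrier R)"

definition jacobson_radical :: "('r, 'x) ring_scheme \<Rightarrow> 'r set" where
  "jacobson_radical R = {r \<in> carrier R. \<forall>A. maximal_left_ideal A R \<longrightarrow> r \<in> A}"

definition ideal_smult :: "'r set \<Rightarrow> ('r, 'm) module \<Rightarrow> 'm set" where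
  "ideal_smult A M = generate (add_monoid M) {a \<odot>\<^bsub>M\<^esub> x |a x. a \<in> A \<and> x \<in> carrier M}"


section \<open>Representations\<close>

text \<open>
  A dimension vector is a function \<open>d\<close> of which only the values on the vertices matter, and
  \<open>Hom(K\<^sup>m, K\<^sup>n)\<close> is the set of \<open>n \<times> m\<close> matrices.
\<close>

definition rep_space ::
  "('v, 'a) pre_digraph \<Rightarrow> ('v \<Rightarrow> nat) \<Rightarrow> ('a \<Rightarrow> 'k::field mat) set" where
  "rep_space Q d = (\<Pi>\<^sub>E \<alpha>\<in>arcs Q. carrier_mat (d (head Q \<alpha>)) (d (tail Q \<alpha>)))"

primrec path_mat ::
  "('v, 'a) pre_digraph \<Rightarrow> ('v \<Rightarrow> nat) \<Rightarrow> ('a \<Rightarrow> 'k::field mat) \<Rightarrow> 'v \<Rightarrow> 'a list \<Rightarrow> 'k mat" where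
  "path_mat Q d x u [] = 1\<^sub>m (d u)"
| "path_mat Q d x u (\<alpha> # p) = path_mat Q d x (head Q \<alpha>) p * x \<alpha>"

definition rep_vectors :: "('v, 'a) pre_digraph \<Rightarrow> ('v \<Rightarrow> nat) \<Rightarrow> ('v \<Rightarrow> 'k::field vec) set" where
  "rep_vectors Q d = (\<Pi>\<^sub>E v\<in>verts Q. carrier_vec (d v))"

text \<open>The action on \<open>\<Oplus>\<^sub>v K\<^bsup>d v\<^esup>\<close> of an element of the path algebra.\<close>

definition path_action ::
  "('v, 'a) pre_digraph \<Rightarrow> ('v \<Rightarrow> nat) \<Rightarrow> ('a \<Rightarrow> 'k::field mat) \<Rightarrow> (('v, 'a) qpath \<Rightarrow>\<^sub>0 'k) \<Rightarrow>
    ('v \<Rightarrow> 'k vec) \<Rightarrow> ('v \<Rightarrow> 'k vec)" where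
  "path_action Q d x f m =
     (\<lambda>v\<in>verts Q. vec (d v) (\<lambda>i.
        \<Sum>\<pi> | \<pi> \<in> Poly_Mapping.keys f \<and> path_end Q \<pi> = v.
          Poly_Mapping.lookup f \<pi> *
          (path_mat Q d x (fst \<pi>) (snd \<pi>) *\<^sub>v m (fst \<pi>)) $ i))"

definition Rep ::
  "('v, 'a) pre_digraph \<Rightarrow> (('v, 'a) qpath \<Rightarrow>\<^sub>0 'k::field) set \<Rightarrow> ('v \<Rightarrow> nat) \<Rightarrow>
    ('a \<Rightarrow> 'k mat) set" where
  "Rep Q I d =
     {x \<in> rep_space Q d. \<forall>f\<in>I. \<forall>m\<in>rep_vectors Q d.
        path_action Q d x f m = (\<lambda>v\<in>verts Q. 0\<^sub>v (d v))}"

text \<open>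
  The module \<open>M\<^sub>x\<close> of a point \<open>x\<close> of \<open>Rep Q I d\<close>. The scalars are cosets of \<open>I\<close>; since \<open>I\<close> acts by
  zero, the choice of the representative is immaterial.
\<close>

definition rep_module ::
  "('v, 'a) pre_digraph \<Rightarrow> ('v \<Rightarrow> nat) \<Rightarrow> ('a \<Rightarrow> 'k::field mat) \<Rightarrow>
    ((('v, 'a) qpath \<Rightarrow>\<^sub>0 'k) set, 'v \<Rightarrow> 'k vec) module" where
  "rep_module Q d x =
     \<lparr>carrier = rep_vectors Q d, mult = undefined, one = undefined,
      zero = (\<lambda>v\<in>verts Q. 0\<^sub>v (d v)),
      add = (\<lambda>m m'. \<lambda>v\<in>verts Q. m v + m' v),
      smult = (\<lambda>r m. path_action Q d x (SOME f. f \<in> r) m)\<rparr>"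


section \<open>Semisimple sequences and filtrations\<close>

text \<open>
  Every finite dimensional module is isomorphic to some \<open>M\<^sub>z\<close>, so its isomorphism class is
  determined by the set of all \<open>(n, z)\<close> with \<open>z\<close> in \<open>Rep Q I n\<close> such that \<open>M\<^sub>z\<close> is isomorphic to it.
\<close>

type_synonym ('v, 'a, 'k) iso_class = "(('v \<Rightarrow> nat) \<times> ('a \<Rightarrow> 'k mat)) set"

definition iso_class ::
  "('v, 'a) pre_digraph \<Rightarrow> (('v, 'a) qpath \<Rightarrow>\<^sub>0 'k::field) set \<Rightarrow>
    ((('v, 'a) qpath \<Rightarrow>\<^sub>0 'k) set, 'm) module \<Rightarrow> ('v, 'a, 'k) iso_class" where
  "iso_class Q I M =
     {(n, z). z \<in> Rep Q I n \<and> module_isomorphic (quiver_algebra Q I) (rep_module Q n z) M}"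

text \<open>Sequences indexed by \<open>0, \<dots>, L\<close> are extensional functions on \<open>{..L}\<close>.\<close>

definition semisimple_seqs ::
  "('v, 'a) pre_digraph \<Rightarrow> (('v, 'a) qpath \<Rightarrow>\<^sub>0 'k::field) set \<Rightarrow> ('v \<Rightarrow> nat) \<Rightarrow>
    (nat \<Rightarrow> ('v, 'a, 'k) iso_class) set" where
  "semisimple_seqs Q I d =
     {\<lambda>l\<in>{..max_path_length Q I}. iso_class Q I (rep_module Q (n l) (z l)) |n z.
        (\<forall>l\<le>max_path_length Q I. z l \<in> Rep Q I (n l) \<and>
           semisimple_module (quiver_algebra Q I) (rep_module Q (n l) (z l))) \<and>
        (\<forall>v\<in>verts Q. (\<Sum>l\<le>max_path_length Q I. n l v) = d v)}"

definition radical_power ::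
  "('v, 'a) pre_digraph \<Rightarrow> (('v, 'a) qpath \<Rightarrow>\<^sub>0 'k::field) set \<Rightarrow>
    ((('v, 'a) qpath \<Rightarrow>\<^sub>0 'k) set, 'm) module \<Rightarrow> nat \<Rightarrow> 'm set" where
  "radical_power Q I M l =
     ideal_smult (ideal_power (quiver_algebra Q I) (jacobson_radical (quiver_algebra Q I)) l) M"

definition radical_layering ::
  "('v, 'a) pre_digraph \<Rightarrow> (('v, 'a) qpath \<Rightarrow>\<^sub>0 'k::field) set \<Rightarrow>
    ((('v, 'a) qpath \<Rightarrow>\<^sub>0 'k) set, 'm) module \<Rightarrow> nat \<Rightarrow> ('v, 'a, 'k) iso_class" where
  "radical_layering Q I M =
     (\<lambda>l\<in>{..max_path_length Q I}.
        iso_class Q I (quot_module (M\<lparr>carrier := radical_power Q I M l\<rparr>)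
          (radical_power Q I M (Suc l))))"

definition Rep_layer ::
  "('v, 'a) pre_digraph \<Rightarrow> (('v, 'a) qpath \<Rightarrow>\<^sub>0 'k::field) set \<Rightarrow> ('v \<Rightarrow> nat) \<Rightarrow>
    (nat \<Rightarrow> ('v, 'a, 'k) iso_class) \<Rightarrow> ('a \<Rightarrow> 'k mat) set" where
  "Rep_layer Q I d \<S> = {x \<in> Rep Q I d. radical_layering Q I (rep_module Q d x) = \<S>}"

definition realizable ::
  "('v, 'a) pre_digraph \<Rightarrow> (('v, 'a) qpath \<Rightarrow>\<^sub>0 'k::field) set \<Rightarrow>
    (nat \<Rightarrow> ('v, 'a, 'k) iso_class) \<Rightarrow> bool" where
  "realizable Q I \<S> \<longleftrightarrow> (\<exists>d. \<S> \<in> semisimple_seqs Q I d \<and> Rep_layer Q I d \<S> \<noteq> {})"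

definition governs_filtration ::
  "('v, 'a) pre_digraph \<Rightarrow> (('v, 'a) qpath \<Rightarrow>\<^sub>0 'k::field) set \<Rightarrow>
    (nat \<Rightarrow> ('v, 'a, 'k) iso_class) \<Rightarrow> ((('v, 'a) qpath \<Rightarrow>\<^sub>0 'k) set, 'm) module \<Rightarrow>
    (nat \<Rightarrow> 'm set) \<Rightarrow> bool" where
  "governs_filtration Q I \<S> M F \<longleftrightarrow>
     F 0 = carrier M \<and> F (Suc (max_path_length Q I)) = {\<zero>\<^bsub>M\<^esub>} \<and>
     (\<forall>l\<le>Suc (max_path_length Q I). submodule (F l) (quiver_algebra Q I) M) \<and>
     (\<forall>l\<le>max_path_length Q I. F (Suc l) \<subseteq> F l \<and>
        iso_class Q I (quot_module (M\<lparr>carrier := F l\<rparr>) (F (Suc l))) = \<S> l)"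

definition Gamma ::
  "('v, 'a) pre_digraph \<Rightarrow> (('v, 'a) qpath \<Rightarrow>\<^sub>0 'k::field) set \<Rightarrow>
    ((('v, 'a) qpath \<Rightarrow>\<^sub>0 'k) set, 'm) module \<Rightarrow> nat" where
  "Gamma Q I M = card {\<S>. realizable Q I \<S> \<and> (\<exists>F. governs_filtration Q I \<S> M F)}"


section \<open>Zariski topology\<close>

text \<open>
  Polynomials in variables of type \<open>'i\<close> are elements of \<^typ>\<open>('i \<Rightarrow>\<^sub>0 nat) \<Rightarrow>\<^sub>0 'k\<close>. The coordinates
  on \<open>rep_space Q d\<close> are the entries of the matrices; only these may occur as variables.
\<close>

definition poly_eval :: "('i \<Rightarrow> 'k) \<Rightarrow> (('i \<Rightarrow>\<^sub>0 nat) \<Rightarrow>\<^sub>0 'k) \<Rightarrow> 'k::field" where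
  "poly_eval c p =
     (\<Sum>m\<in>Poly_Mapping.keys p. Poly_Mapping.lookup p m *
        (\<Prod>i\<in>Poly_Mapping.keys m. c i ^ Poly_Mapping.lookup m i))"

definition polys_in :: "'i set \<Rightarrow> (('i \<Rightarrow>\<^sub>0 nat) \<Rightarrow>\<^sub>0 'k::field) set" where
  "polys_in V = {p. \<forall>m\<in>Poly_Mapping.keys p. Poly_Mapping.keys m \<subseteq> V}"

definition coords :: "('v, 'a) pre_digraph \<Rightarrow> ('v \<Rightarrow> nat) \<Rightarrow> ('a \<times> nat \<times> nat) set" where
  "coords Q d = {(\<alpha>, i, j). \<alpha> \<in> arcs Q \<and> i < d (head Q \<alpha>) \<and> j < d (tail Q \<alpha>)}"

definition zero_locus ::
  "('v, 'a) pre_digraph \<Rightarrow> ('v \<Rightarrow> nat) \<Rightarrow> (('a \<times> nat \<times> nat \<Rightarrow>\<^sub>0 nat) \<Rightarrow>\<^sub>0 'k::field) set \<Rightarrow>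
    ('a \<Rightarrow> 'k mat) set" where
  "zero_locus Q d P =
     {x \<in> rep_space Q d. \<forall>p\<in>P. poly_eval (\<lambda>(\<alpha>, i, j). x \<alpha> $$ (i, j)) p = 0}"

definition zariski :: "('v, 'a) pre_digraph \<Rightarrow> ('v \<Rightarrow> nat) \<Rightarrow> ('a \<Rightarrow> 'k::field mat) topology" where
  "zariski Q d = topology (\<lambda>U. \<exists>P\<subseteq>polys_in (coords Q d). U = rep_space Q d - zero_locus Q d P)"

lemma poly_eval_superset:
  assumes "finite A" "Poly_Mapping.keys p \<subseteq> A"
  shows "poly_eval c p = (\<Sum>m\<in>A. Poly_Mapping.lookup p m *
        (\<Prod>i\<in>Poly_Mapping.keys m. c i ^ Poly_Mapping.lookup m i))"
  unfolding poly_eval_def using assms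
  by (intro sum.mono_neutral_left) (auto simp: in_keys_iff)

lemma poly_eval_add: "poly_eval c (p + q) = poly_eval c p + poly_eval c q"
proof -
  let ?A = "Poly_Mapping.keys p \<union> Poly_Mapping.keys q"
  have fin: "finite ?A" by simp
  have sub: "Poly_Mapping.keys (p + q) \<subseteq> ?A" by (rule keys_add)
  show ?thesis
    unfolding poly_eval_superset[OF fin sub] poly_eval_superset[OF fin, of p, OF Un_upper1]
      poly_eval_superset[OF fin, of q, OF Un_upper2] lookup_add distrib_right sum.distrib ..
qed

lemma poly_eval_sum: "poly_eval c (sum f A) = (\<Sum>a\<in>A. poly_eval c (f a))"
proof (induction A rule: infinite_finite_induct)
  case (insert x F)
  then show ?case by (simp add: poly_eval_add)
qed (simp_all add: poly_eval_def)

lemma poly_eval_single: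
  "poly_eval c (Poly_Mapping.single m a) =
     a * (\<Prod>i\<in>Poly_Mapping.keys m. c i ^ Poly_Mapping.lookup m i)"
  by (simp add: poly_eval_def)

lemma monomial_eval_superset:
  fixes c :: "'i \<Rightarrow> 'k::field"
  assumes "finite A" "Poly_Mapping.keys m \<subseteq> A"
  shows "(\<Prod>i\<in>Poly_Mapping.keys m. c i ^ Poly_Mapping.lookup m i) =
    (\<Prod>i\<in>A. c i ^ Poly_Mapping.lookup m i)"
  using assms by (intro prod.mono_neutral_left) (auto simp: in_keys_iff)

lemma monomial_eval_add:
  fixes c :: "'i \<Rightarrow> 'k::field"
  shows "(\<Prod>i\<in>Poly_Mapping.keys (m + n). c i ^ Poly_Mapping.lookup (m + n) i) =
    (\<Prod>i\<in>Poly_Mapping.keys m. c i ^ Poly_Mapping.lookup m i) *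
    (\<Prod>i\<in>Poly_Mapping.keys n. c i ^ Poly_Mapping.lookup n i)"
proof -
  let ?A = "Poly_Mapping.keys m \<union> Poly_Mapping.keys n"
  have fin: "finite ?A" by simp
  have sub: "Poly_Mapping.keys (m + n) \<subseteq> ?A" by (rule keys_add)
  have "(\<Prod>i\<in>Poly_Mapping.keys (m + n). c i ^ Poly_Mapping.lookup (m + n) i) =
      (\<Prod>i\<in>?A. c i ^ Poly_Mapping.lookup (m + n) i)"
    by (rule monomial_eval_superset[OF fin sub])
  also have "\<dots> = (\<Prod>i\<in>?A. c i ^ Poly_Mapping.lookup m i) *
      (\<Prod>i\<in>?A. c i ^ Poly_Mapping.lookup n i)"
    by (simp only: lookup_add power_add prod.distrib)
  finally show ?thesis
    using monomial_eval_superset[OF fin, of m c] monomial_eval_superset[OF fin, of n c] by simp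
qed

lemma poly_eval_mult: "poly_eval c (p * q) = poly_eval c p * poly_eval c q"
proof -
  let ?s = "\<lambda>f k. Poly_Mapping.single k (Poly_Mapping.lookup f k)"
  have "p * q = (\<Sum>k\<in>Poly_Mapping.keys p. \<Sum>l\<in>Poly_Mapping.keys q. ?s p k * ?s q l)"
    using sum_product[of "?s p" "Poly_Mapping.keys p" "?s q" "Poly_Mapping.keys q"]
    by (simp add: poly_mapping_eq_sum_single)
  then have "poly_eval c (p * q) =
      (\<Sum>k\<in>Poly_Mapping.keys p. \<Sum>l\<in>Poly_Mapping.keys q. poly_eval c (?s p k * ?s q l))"
    by (simp add: poly_eval_sum)
  also have "\<dots> = poly_eval c p * poly_eval c q"
    unfolding poly_eval_def[of c p] poly_eval_def[of c q] sum_product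
    by (intro sum.cong refl)
      (simp only: mult_single poly_eval_single monomial_eval_add mult.assoc mult.left_commute)
  finally show ?thesis .
qed

lemma polys_in_mult: "p \<in> polys_in V \<Longrightarrow> q \<in> polys_in V \<Longrightarrow> p * q \<in> polys_in V"
  unfolding polys_in_def mem_Collect_eq
proof
  fix m
  assume p: "\<forall>m\<in>Poly_Mapping.keys p. Poly_Mapping.keys m \<subseteq> V"
    and q: "\<forall>m\<in>Poly_Mapping.keys q. Poly_Mapping.keys m \<subseteq> V"
    and "m \<in> Poly_Mapping.keys (p * q)"
  then obtain k l where kl: "k \<in> Poly_Mapping.keys p" "l \<in> Poly_Mapping.keys q" "m = k + l"
    using keys_mult[of p q] by blast
  have "Poly_Mapping.keys m \<subseteq> Poly_Mapping.keys k \<union> Poly_Mapping.keys l"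
    unfolding kl(3) by (rule keys_add)
  also have "\<dots> \<subseteq> V" using p q kl by simp
  finally show "Poly_Mapping.keys m \<subseteq> V" .
qed

lemma istopology_zariski:
  "istopology (\<lambda>U. \<exists>P\<subseteq>polys_in (coords Q d). U = rep_space Q d - zero_locus Q d P)"
  unfolding istopology_def
proof (intro conjI allI impI)
  fix S T :: "('a \<Rightarrow> 'b mat) set"
  assume "\<exists>P\<subseteq>polys_in (coords Q d). S = rep_space Q d - zero_locus Q d P"
    and "\<exists>P\<subseteq>polys_in (coords Q d). T = rep_space Q d - zero_locus Q d P"
  then obtain P P' where P: "P \<subseteq> polys_in (coords Q d)" "S = rep_space Q d - zero_locus Q d P"
    and P': "P' \<subseteq> polys_in (coords Q d)" "T = rep_space Q d - zero_locus Q d P'" by blast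
  let ?R = "{p * q |p q. p \<in> P \<and> q \<in> P'}"
  have "?R \<subseteq> polys_in (coords Q d)" using P P' by (auto intro!: polys_in_mult)
  moreover have "S \<inter> T = rep_space Q d - zero_locus Q d ?R"
  proof (intro Set.set_eqI iffI)
    fix x assume "x \<in> S \<inter> T"
    then obtain p q where x: "x \<in> rep_space Q d"
      and "p \<in> P" "poly_eval (\<lambda>(\<alpha>, i, j). x \<alpha> $$ (i, j)) p \<noteq> 0"
      and "q \<in> P'" "poly_eval (\<lambda>(\<alpha>, i, j). x \<alpha> $$ (i, j)) q \<noteq> 0"
      unfolding P(2) P'(2) zero_locus_def by blast
    then have "p * q \<in> ?R" "poly_eval (\<lambda>(\<alpha>, i, j). x \<alpha> $$ (i, j)) (p * q) \<noteq> 0"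
      by (blast, simp add: poly_eval_mult)
    with x show "x \<in> rep_space Q d - zero_locus Q d ?R" unfolding zero_locus_def by blast
  next
    fix x assume "x \<in> rep_space Q d - zero_locus Q d ?R"
    then show "x \<in> S \<inter> T"
      unfolding P(2) P'(2) zero_locus_def by (auto simp: poly_eval_mult)
  qed
  ultimately show "\<exists>P\<subseteq>polys_in (coords Q d). S \<inter> T = rep_space Q d - zero_locus Q d P" by blast
next
  fix \<K> :: "('a \<Rightarrow> 'b mat) set set"
  assume "\<forall>K\<in>\<K>. \<exists>P\<subseteq>polys_in (coords Q d). K = rep_space Q d - zero_locus Q d P"
  then obtain P where P: "\<And>K. K \<in> \<K> \<Longrightarrow>
      P K \<subseteq> polys_in (coords Q d) \<and> K = rep_space Q d - zero_locus Q d (P K)" by metis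
  have "\<Union>\<K> = rep_space Q d - zero_locus Q d (\<Union>K\<in>\<K>. P K)"
  proof (rule Set.set_eqI)
    fix x
    have "x \<in> \<Union>\<K> \<longleftrightarrow> (\<exists>K\<in>\<K>. x \<in> rep_space Q d - zero_locus Q d (P K))" using P by blast
    then show "x \<in> \<Union>\<K> \<longleftrightarrow> x \<in> rep_space Q d - zero_locus Q d (\<Union>K\<in>\<K>. P K)"
      by (auto simp: zero_locus_def)
  qed
  moreover have "(\<Union>K\<in>\<K>. P K) \<subseteq> polys_in (coords Q d)" using P by blast
  ultimately show "\<exists>P\<subseteq>polys_in (coords Q d). \<Union>\<K> = rep_space Q d - zero_locus Q d P" by blast
qed

lemma openin_zariski:
  "openin (zariski Q d) U \<longleftrightarrow>
     (\<exists>P\<subseteq>polys_in (coords Q d). U = rep_space Q d - zero_locus Q d P)"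
  unfolding zariski_def by (simp add: istopology_zariski topology_inverse')

lemma topspace_zariski: "topspace (zariski Q d) = rep_space Q d"
proof -
  have "zero_locus Q d {1} = {}"
    by (auto simp: zero_locus_def poly_eval_def)
  then have "openin (zariski Q d) (rep_space Q d)"
    unfolding openin_zariski
    by (intro exI[of _ "{1}"]) (auto simp: polys_in_def)
  then have "rep_space Q d \<subseteq> topspace (zariski Q d)" by (rule openin_subset)
  moreover have "topspace (zariski Q d) \<subseteq> rep_space Q d"
    using openin_topspace[of "zariski Q d"] unfolding openin_zariski by auto
  ultimately show ?thesis by (rule subset_antisym[rotated])
qed

lemma closedin_zariski:
  "closedin (zariski Q d) C \<longleftrightarrow> (\<exists>P\<subseteq>polys_in (coords Q d). C = zero_locus Q d P)"
  unfolding closedin_def topspace_zariski openin_zariski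
proof (intro iffI)
  assume "C \<subseteq> rep_space Q d \<and>
    (\<exists>P\<subseteq>polys_in (coords Q d). rep_space Q d - C = rep_space Q d - zero_locus Q d P)"
  then obtain P where "P \<subseteq> polys_in (coords Q d)" "C \<subseteq> rep_space Q d"
    "rep_space Q d - C = rep_space Q d - zero_locus Q d P" by blast
  moreover have "zero_locus Q d P \<subseteq> rep_space Q d" by (auto simp: zero_locus_def)
  ultimately show "\<exists>P\<subseteq>polys_in (coords Q d). C = zero_locus Q d P" by blast
next
  assume "\<exists>P\<subseteq>polys_in (coords Q d). C = zero_locus Q d P"
  then show "C \<subseteq> rep_space Q d \<and>
    (\<exists>P\<subseteq>polys_in (coords Q d). rep_space Q d - C = rep_space Q d - zero_locus Q d P)"
    by (auto simp: zero_locus_def)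
qed

abbreviation Rep_topology ::
  "('v, 'a) pre_digraph \<Rightarrow> (('v, 'a) qpath \<Rightarrow>\<^sub>0 'k::field) set \<Rightarrow> ('v \<Rightarrow> nat) \<Rightarrow>
    ('a \<Rightarrow> 'k mat) topology" where
  "Rep_topology Q I d \<equiv> subtopology (zariski Q d) (Rep Q I d)"

definition irreducible_in :: "'x topology \<Rightarrow> 'x set \<Rightarrow> bool" where
  "irreducible_in T S \<longleftrightarrow>
     S \<subseteq> topspace T \<and> S \<noteq> {} \<and>
     (\<forall>A B. closedin T A \<and> closedin T B \<and> S \<subseteq> A \<union> B \<longrightarrow> S \<subseteq> A \<or> S \<subseteq> B)"

definition irreducible_component :: "'x topology \<Rightarrow> 'x set \<Rightarrow> bool" where
  "irreducible_component T C \<longleftrightarrow>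
     irreducible_in T C \<and> (\<forall>S. irreducible_in T S \<and> C \<subseteq> S \<longrightarrow> S = C)"

end

(*
  Idea.  Write L for the maximal length of a path outside I.  A filtration of M_x governed by a
  semisimple sequence S is the same thing as a flag of graded subspaces, of prescribed dimensions,
  such that every arrow maps each step into the next one; after a base change g in the product of
  the groups GL(d v) it becomes a condition of vanishing of matrix entries, which defines a closed
  set V stable under the Borel subgroup of lower triangular matrices.  The set GV is closed because
  G/B is dominated by a tower of projective lines: G is a product of minimal parabolic subgroups P,
  and passing from a closed B-stable set C to PC is a projection along P/B, a projective line,
  whose completeness is elimination by Sylvester determinants.  Hence the points governed by S form
  a closed set, and the set where Gamma is at least a is a finite union of finite intersections
  of such sets.

  For the second claim let D be a closed irreducible set containing C.  Finitely many strata Rep S'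
  cover D, so D lies in the closure of its intersection with one of them and is governed by S'.  At
  a point of C where Gamma is 1 this forces S' = S, so that this intersection, an irreducible
  subset of Rep S containing C, is C.
*)

theory Submission
  imports Defs "Jordan_Normal_Form.Determinant"
begin

section \<open>Zariski closed sets through polynomial functions\<close>

section \<open>Polynomial functions and the projective line\<close>

text \<open>The image of a closed set under a morphism is in general only constructible, and
  quantifying over base changes takes such an image; so some completeness has to enter. That a flag
  carries all the information of a filtration is due to the algebra being basic: its radical
  consists of the classes of combinations of paths of positive length, a module is semisimple
  exactly when all arrows act by zero, and an isomorphism class of semisimple modules is therefore
  just a dimension vector. Bases of the flags are listed with the top layer first, so that each step
  is the vanishing of initial coordinates; this makes the stabiliser lower triangular. Realizability
  is harmless for two reasons. A sequence that governs a filtration of the module of a point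
  automatically has dimension vector \<open>d\<close>, so \<open>Gamma\<close> counts within a
  finite set of sequences that does not depend on the point. And a sequence that occurs as the
  radical layering of a point is realizable, so the nonempty strata are indexed by sequences that
  \<open>Gamma\<close> takes into account.\<close>

definition polyfun ::
  "('v, 'a) pre_digraph \<Rightarrow> ('v \<Rightarrow> nat) \<Rightarrow> (('a \<Rightarrow> 'k::field mat) \<Rightarrow> 'k) \<Rightarrow> bool" where
  "polyfun Q d h \<longleftrightarrow> (\<exists>p\<in>polys_in (coords Q d). \<forall>x\<in>rep_space Q d.
     h x = poly_eval (\<lambda>(\<alpha>, i, j). x \<alpha> $$ (i, j)) p)"

lemma polyfun_const: "polyfun Q d (\<lambda>x. c)"
  unfolding polyfun_def
  by (rule bexI[of _ "Poly_Mapping.single 0 c"]) (auto simp: poly_eval_single polys_in_def)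

lemma polyfun_coord:
  assumes "(\<alpha>, i, j) \<in> coords Q d"
  shows "polyfun Q d (\<lambda>x. x \<alpha> $$ (i, j))"
  unfolding polyfun_def
  by (rule bexI[of _ "Poly_Mapping.single (Poly_Mapping.single (\<alpha>, i, j) 1) 1"])
    (use assms in \<open>auto simp: poly_eval_single polys_in_def\<close>)

lemma polyfun_if:
  "polyfun Q d h \<Longrightarrow> polyfun Q d k \<Longrightarrow> polyfun Q d (\<lambda>x. if b then h x else k x)"
  by (cases b) simp_all

lemma polyfun_add:
  assumes "polyfun Q d h" "polyfun Q d k"
  shows "polyfun Q d (\<lambda>x. h x + k x)"
proof -
  obtain p q where "p \<in> polys_in (coords Q d)" "q \<in> polys_in (coords Q d)"
    and "\<forall>x\<in>rep_space Q d. h x = poly_eval (\<lambda>(\<alpha>, i, j). x \<alpha> $$ (i, j)) p"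
    and "\<forall>x\<in>rep_space Q d. k x = poly_eval (\<lambda>(\<alpha>, i, j). x \<alpha> $$ (i, j)) q"
    using assms unfolding polyfun_def by blast
  moreover from this have "p + q \<in> polys_in (coords Q d)"
    unfolding polys_in_def using keys_add[of p q] by blast
  ultimately show ?thesis
    unfolding polyfun_def by (intro bexI[of _ "p + q"]) (auto simp: poly_eval_add)
qed

lemma polyfun_mult:
  assumes "polyfun Q d h" "polyfun Q d k"
  shows "polyfun Q d (\<lambda>x. h x * k x)"
proof -
  obtain p q where "p \<in> polys_in (coords Q d)" "q \<in> polys_in (coords Q d)"
    and "\<forall>x\<in>rep_space Q d. h x = poly_eval (\<lambda>(\<alpha>, i, j). x \<alpha> $$ (i, j)) p"
    and "\<forall>x\<in>rep_space Q d. k x = poly_eval (\<lambda>(\<alpha>, i, j). x \<alpha> $$ (i, j)) q"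
    using assms unfolding polyfun_def by blast
  then show ?thesis
    unfolding polyfun_def by (intro bexI[of _ "p * q"]) (auto simp: poly_eval_mult polys_in_mult)
qed

lemma polyfun_sum:
  "(\<And>a. a \<in> A \<Longrightarrow> polyfun Q d (h a)) \<Longrightarrow> polyfun Q d (\<lambda>x. \<Sum>a\<in>A. h a x)"
  by (induction A rule: infinite_finite_induct) (auto intro!: polyfun_const polyfun_add)

lemma polyfun_prod:
  "(\<And>a. a \<in> A \<Longrightarrow> polyfun Q d (h a)) \<Longrightarrow> polyfun Q d (\<lambda>x. \<Prod>a\<in>A. h a x)"
  by (induction A rule: infinite_finite_induct) (auto intro!: polyfun_const polyfun_mult)

text \<open>Closedness is tested one outside point at a time, by a single equation of
  \<open>C\<close> that is nonzero there. This is the form suited to elimination, where the equation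
  is built from the given point.\<close>

lemma closedin_zariski_iff:
  "closedin (zariski Q d) C \<longleftrightarrow> C \<subseteq> rep_space Q d \<and>
     (\<forall>x\<in>rep_space Q d - C. \<exists>h. polyfun Q d h \<and> h x \<noteq> 0 \<and> (\<forall>y\<in>C. h y = 0))"
proof (intro iffI conjI ballI)
  assume C: "closedin (zariski Q d) C"
  then show sub: "C \<subseteq> rep_space Q d"
    using closedin_subset topspace_zariski by blast
  fix x assume x: "x \<in> rep_space Q d - C"
  obtain P where P: "P \<subseteq> polys_in (coords Q d)" "C = zero_locus Q d P"
    using C unfolding closedin_zariski by blast
  with x obtain p where p: "p \<in> P" "poly_eval (\<lambda>(\<alpha>, i, j). x \<alpha> $$ (i, j)) p \<noteq> 0"
    by (auto simp: zero_locus_def)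
  show "\<exists>h. polyfun Q d h \<and> h x \<noteq> 0 \<and> (\<forall>y\<in>C. h y = 0)"
    by (rule exI[of _ "\<lambda>x. poly_eval (\<lambda>(\<alpha>, i, j). x \<alpha> $$ (i, j)) p"])
      (use p P in \<open>auto simp: polyfun_def zero_locus_def\<close>)
next
  assume C: "C \<subseteq> rep_space Q d \<and>
     (\<forall>x\<in>rep_space Q d - C. \<exists>h. polyfun Q d h \<and> h x \<noteq> 0 \<and> (\<forall>y\<in>C. h y = 0))"
  define P where "P = {p \<in> polys_in (coords Q d).
    \<forall>y\<in>C. poly_eval (\<lambda>(\<alpha>, i, j). y \<alpha> $$ (i, j)) p = 0}"
  have "C = zero_locus Q d P"
  proof (intro equalityI subsetI)
    fix x assume "x \<in> C"
    then show "x \<in> zero_locus Q d P" using C by (auto simp: P_def zero_locus_def)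
  next
    fix x assume x: "x \<in> zero_locus Q d P"
    then have xr: "x \<in> rep_space Q d" by (simp add: zero_locus_def)
    show "x \<in> C"
    proof (rule ccontr)
      assume "x \<notin> C"
      then obtain h where h: "polyfun Q d h" "h x \<noteq> 0" "\<forall>y\<in>C. h y = 0" using C xr by blast
      obtain p where p: "p \<in> polys_in (coords Q d)"
        "\<forall>x\<in>rep_space Q d. h x = poly_eval (\<lambda>(\<alpha>, i, j). x \<alpha> $$ (i, j)) p"
        using h(1) unfolding polyfun_def by blast
      have "\<forall>y\<in>C. poly_eval (\<lambda>(\<alpha>, i, j). y \<alpha> $$ (i, j)) p = 0"
      proof
        fix y assume "y \<in> C"
        then show "poly_eval (\<lambda>(\<alpha>, i, j). y \<alpha> $$ (i, j)) p = 0"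
          using p(2)[rule_format, of y] h(3)[rule_format, of y] C by auto
      qed
      then have "p \<in> P" using p(1) by (simp add: P_def)
      then show False using x p(2) xr h(2) by (simp add: zero_locus_def)
    qed
  qed
  moreover have "P \<subseteq> polys_in (coords Q d)" by (simp add: P_def)
  ultimately show "closedin (zariski Q d) C"
    unfolding closedin_zariski by (intro exI[of _ P] conjI)
qed

lemma closedin_zariskiD:
  assumes "closedin (zariski Q d) C" "x \<in> rep_space Q d" "x \<notin> C"
  obtains h where "polyfun Q d h" "h x \<noteq> 0" "\<And>y. y \<in> C \<Longrightarrow> h y = 0"
  using assms unfolding closedin_zariski_iff by blast

section \<open>One-parameter families of polynomials and of points\<close>

text \<open>A polynomial in one further variable whose coefficients are polynomial functions on
  \<open>rep_space Q d\<close>. The degree bound is uniform in \<open>x\<close> because it fixes the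
  size of a Sylvester matrix whose determinant is to be one polynomial function of
  \<open>x\<close>.\<close>

definition polyfam ::
  "('v, 'a) pre_digraph \<Rightarrow> ('v \<Rightarrow> nat) \<Rightarrow> (('a \<Rightarrow> 'k::field mat) \<Rightarrow> 'k poly) \<Rightarrow> bool" where
  "polyfam Q d F \<longleftrightarrow> (\<exists>N. \<forall>x\<in>rep_space Q d. degree (F x) \<le> N) \<and>
     (\<forall>i. polyfun Q d (\<lambda>x. coeff (F x) i))"

lemma polyfam_pCons_const: "polyfun Q d h \<Longrightarrow> polyfam Q d (\<lambda>x. [:h x:])"
  unfolding polyfam_def
proof (intro conjI allI)
  fix i assume "polyfun Q d h"
  then show "polyfun Q d (\<lambda>x. coeff [:h x:] i)" by (cases i) (auto simp: polyfun_const)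
qed auto

lemma polyfam_const: "polyfam Q d (\<lambda>x. q)"
  unfolding polyfam_def by (auto simp: polyfun_const)

lemma polyfam_add:
  assumes "polyfam Q d F" "polyfam Q d G" shows "polyfam Q d (\<lambda>x. F x + G x)"
proof -
  obtain N M where "\<forall>x\<in>rep_space Q d. degree (F x) \<le> N" "\<forall>x\<in>rep_space Q d. degree (G x) \<le> M"
    using assms unfolding polyfam_def by blast
  then have "\<forall>x\<in>rep_space Q d. degree (F x + G x) \<le> max N M"
    by (intro ballI degree_add_le) auto
  then show ?thesis using assms unfolding polyfam_def by (auto intro!: polyfun_add)
qed

lemma polyfam_mult:
  assumes "polyfam Q d F" "polyfam Q d G" shows "polyfam Q d (\<lambda>x. F x * G x)"
proof -
  obtain N M where "\<forall>x\<in>rep_space Q d. degree (F x) \<le> N" "\<forall>x\<in>rep_space Q d. degree (G x) \<le> M"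
    using assms unfolding polyfam_def by blast
  then have "\<forall>x\<in>rep_space Q d. degree (F x * G x) \<le> N + M"
    by (intro ballI order_trans[OF degree_mult_le] add_mono) auto
  then show ?thesis using assms unfolding polyfam_def
    by (auto simp: coeff_mult intro!: polyfun_sum polyfun_mult)
qed

lemma polyfam_sum:
  "(\<And>a. a \<in> A \<Longrightarrow> polyfam Q d (F a)) \<Longrightarrow> polyfam Q d (\<lambda>x. \<Sum>a\<in>A. F a x)"
  by (induction A rule: infinite_finite_induct) (auto intro!: polyfam_const polyfam_add)

lemma polyfam_prod:
  "(\<And>a. a \<in> A \<Longrightarrow> polyfam Q d (F a)) \<Longrightarrow> polyfam Q d (\<lambda>x. \<Prod>a\<in>A. F a x)"
  by (induction A rule: infinite_finite_induct) (auto intro!: polyfam_const polyfam_mult)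

lemma polyfam_power: "polyfam Q d F \<Longrightarrow> polyfam Q d (\<lambda>x. F x ^ n)"
  by (induction n) (auto intro!: polyfam_const polyfam_mult)

text \<open>A morphism from the product of the affine line and \<open>rep_space Q d\<close> to
  \<open>rep_space Q d\<close>, written coordinatewise.\<close>

definition polymap ::
  "('v, 'a) pre_digraph \<Rightarrow> ('v \<Rightarrow> nat) \<Rightarrow> ('k \<Rightarrow> ('a \<Rightarrow> 'k::field mat) \<Rightarrow> ('a \<Rightarrow> 'k mat)) \<Rightarrow> bool" where
  "polymap Q d a \<longleftrightarrow> (\<forall>t. \<forall>x\<in>rep_space Q d. a t x \<in> rep_space Q d) \<and>
     (\<forall>\<alpha> i j. (\<alpha>, i, j) \<in> coords Q d \<longrightarrow>
        (\<exists>F. polyfam Q d F \<and> (\<forall>x\<in>rep_space Q d. \<forall>t. a t x \<alpha> $$ (i, j) = poly (F x) t)))"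

text \<open>Pulling \<open>h\<close> back along \<open>a\<close> is substitution: each variable
  \<open>c\<close> of the polynomial behind \<open>h\<close> is replaced by the family
  \<open>G c\<close> that describes this coordinate of \<open>a t x\<close>.\<close>

lemma polyfun_polymap:
  assumes a: "polymap Q d a" and h: "polyfun Q d h"
  obtains F where "polyfam Q d F" "\<And>x t. x \<in> rep_space Q d \<Longrightarrow> h (a t x) = poly (F x) t"
proof -
  obtain p where p: "p \<in> polys_in (coords Q d)"
    "\<And>x. x \<in> rep_space Q d \<Longrightarrow> h x = poly_eval (\<lambda>(\<alpha>, i, j). x \<alpha> $$ (i, j)) p"
    using h unfolding polyfun_def by blast
  have "\<forall>c. \<exists>F. c \<in> coords Q d \<longrightarrow> polyfam Q d F \<and>
      (\<forall>x\<in>rep_space Q d. \<forall>t. (case c of (\<alpha>, i, j) \<Rightarrow> a t x \<alpha> $$ (i, j)) = poly (F x) t)"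
    using a unfolding polymap_def by (auto split: prod.splits)
  then obtain G where G: "\<And>c. c \<in> coords Q d \<Longrightarrow> polyfam Q d (G c)"
    "\<And>c x t. c \<in> coords Q d \<Longrightarrow> x \<in> rep_space Q d \<Longrightarrow>
       (case c of (\<alpha>, i, j) \<Rightarrow> a t x \<alpha> $$ (i, j)) = poly (G c x) t" by metis
  define F where "F x = (\<Sum>m\<in>Poly_Mapping.keys p. [:Poly_Mapping.lookup p m:] *
        (\<Prod>c\<in>Poly_Mapping.keys m. G c x ^ Poly_Mapping.lookup m c))" for x
  have keys: "c \<in> coords Q d" if "m \<in> Poly_Mapping.keys p" "c \<in> Poly_Mapping.keys m" for m c
    using p(1) that unfolding polys_in_def by blast
  have "polyfam Q d F"
    unfolding F_def by (intro polyfam_sum polyfam_mult polyfam_const polyfam_prod polyfam_power G keys)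
  moreover have "h (a t x) = poly (F x) t" if x: "x \<in> rep_space Q d" for x t
  proof -
    have "a t x \<in> rep_space Q d" using a x unfolding polymap_def by blast
    then have "h (a t x) = (\<Sum>m\<in>Poly_Mapping.keys p. Poly_Mapping.lookup p m *
        (\<Prod>c\<in>Poly_Mapping.keys m. (case c of (\<alpha>, i, j) \<Rightarrow> a t x \<alpha> $$ (i, j)) ^ Poly_Mapping.lookup m c))"
      by (simp add: p(2) poly_eval_def)
    also have "\<dots> = poly (F x) t"
      unfolding F_def poly_sum poly_mult poly_prod poly_power
      by (intro sum.cong refl arg_cong2[where f = "(*)"] arg_cong2[where f = "(^)"] prod.cong)
        (assumption | rule G(2)[OF keys x] | simp)+
    finally show ?thesis .
  qed
  ultimately show ?thesis using that by blast
qed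

section \<open>Sylvester determinants and common roots\<close>

lemma poly_eq_sum_le:
  fixes p :: "'k::field poly"
  assumes "degree p \<le> n"
  shows "poly p t = (\<Sum>i\<le>n. coeff p i * t ^ i)"
  unfolding poly_altdef using assms
  by (intro sum.mono_neutral_left) (auto simp: coeff_eq_0)

text \<open>The Sylvester matrix of two polynomials of formal degree \<open>D\<close>.\<close>

definition syl :: "nat \<Rightarrow> 'k::field poly \<Rightarrow> 'k poly \<Rightarrow> 'k mat" where
  "syl D f g = mat (2 * D) (2 * D)
     (\<lambda>(i, j). coeff (if j < D then monom 1 j * f else monom 1 (j - D) * g) i)"

text \<open>Each column lists the coefficients of a multiple of \<open>f\<close> or \<open>g\<close>
  of degree below \<open>2 * D\<close>, so pairing it with the powers of \<open>t\<close> evaluates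
  that multiple at the common root. The vector of powers is thus a nonzero kernel vector of the
  transpose.\<close>

lemma det_syl_common_root:
  assumes "degree f \<le> D" "degree g \<le> D" "poly f t = 0" "poly g t = 0" "0 < D"
  shows "det (syl D f g) = 0"
proof -
  let ?M = "syl D f g" and ?w = "vec (2 * D) (\<lambda>i. t ^ i)"
  have M: "?M \<in> carrier_mat (2 * D) (2 * D)" by (simp add: syl_def)
  have "?M\<^sup>T *\<^sub>v ?w = 0\<^sub>v (2 * D)"
  proof (rule eq_vecI)
    fix j assume j: "j < dim_vec (0\<^sub>v (2 * D) :: 'a vec)"
    let ?p = "if j < D then monom 1 j * f else monom 1 (j - D) * g"
    have le: "degree ?p \<le> 2 * D - 1"
      using degree_mult_le[of "monom 1 j" f] degree_mult_le[of "monom 1 (j - D)" g]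
        degree_monom_le[of "1 :: 'a" j] degree_monom_le[of "1 :: 'a" "j - D"] assms j by auto
    have "(?M\<^sup>T *\<^sub>v ?w) $ j = (\<Sum>i = 0..<2 * D. coeff ?p i * t ^ i)"
      using j M by (simp add: scalar_prod_def syl_def)
    also have "{0..<2 * D} = {..2 * D - 1}" using assms(5) by auto
    also have "(\<Sum>i\<le>2 * D - 1. coeff ?p i * t ^ i) = poly ?p t"
      by (rule poly_eq_sum_le[OF le, symmetric])
    also have "\<dots> = 0" using assms by simp
    finally show "(?M\<^sup>T *\<^sub>v ?w) $ j = (0\<^sub>v (2 * D)) $ j" using j by simp
  qed (use M in simp)
  moreover have "?w \<noteq> 0\<^sub>v (2 * D)"
  proof
    assume "?w = 0\<^sub>v (2 * D)"
    then have "?w $ 0 = 0\<^sub>v (2 * D) $ 0" by simp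
    then show False using assms(5) by simp
  qed
  ultimately have "det (?M\<^sup>T) = 0"
    using M by (subst det_0_iff_vec_prod_zero_field[where n = "2 * D"]) (auto intro!: exI[of _ ?w])
  then show ?thesis using det_transpose[OF M] by simp
qed

text \<open>Induction on the degree of \<open>g\<close>: a root of \<open>g\<close> is not a root of
  \<open>f\<close>, hence is a root of \<open>u\<close>, and its linear factor can be cancelled from
  both \<open>g\<close> and \<open>u\<close>.\<close>

lemma dvd_mult_no_common_root:
  fixes f g u :: "'k::alg_closed_field poly"
  assumes "g \<noteq> 0" "\<And>t. poly g t = 0 \<Longrightarrow> poly f t \<noteq> 0" "g dvd u * f"
  shows "g dvd u"
  using assms
proof (induction "degree g" arbitrary: g u)
  case 0
  then show ?case by (metis is_unit_iff_degree unit_imp_dvd)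
next
  case (Suc n)
  then obtain t where t: "poly g t = 0" using alg_closed_imp_poly_has_root by (metis zero_less_Suc)
  then obtain g' where g': "g = [:- t, 1:] * g'" by (auto simp: poly_eq_0_iff_dvd elim: dvdE)
  have "poly (u * f) t = 0" using t Suc.prems(3) by (metis dvdE poly_mult mult_zero_left)
  then have "poly u t = 0" using Suc.prems(2)[OF t] by simp
  then obtain u' where u': "u = [:- t, 1:] * u'" by (auto simp: poly_eq_0_iff_dvd elim: dvdE)
  have g'0: "g' \<noteq> 0" using g' Suc.prems(1) by auto
  have "degree g = Suc (degree g')" unfolding g' using g'0 by (subst degree_mult_eq) auto
  then have "n = degree g'" using Suc.hyps(2) by simp
  moreover have "[:- t, 1:] * g' dvd [:- t, 1:] * (u' * f)"
    using Suc.prems(3) unfolding g' u' by (simp only: mult.assoc)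
  then have "g' dvd u' * f" by (subst (asm) dvd_mult_cancel_left) auto
  ultimately have "g' dvd u'"
    using Suc.hyps(1)[of g' u'] g'0 Suc.prems(2) unfolding g' by auto
  then show ?case unfolding g' u' by (rule mult_dvd_mono[OF dvd_refl])
qed

text \<open>A kernel vector encodes polynomials \<open>u\<close> and \<open>v\<close> of degree
  below \<open>D\<close> with \<open>u * f + v * g = 0\<close>. Then \<open>g\<close> divides
  \<open>u\<close>, whose degree is too small unless it is zero. That \<open>g\<close> has degree
  exactly \<open>D\<close> excludes a common root at infinity.\<close>

lemma det_syl_no_common_root:
  fixes f g :: "'k::alg_closed_field poly"
  assumes "degree f \<le> D" "degree g = D" "g \<noteq> 0" "\<And>t. poly g t = 0 \<Longrightarrow> poly f t \<noteq> 0"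
  shows "det (syl D f g) \<noteq> 0"
proof
  let ?M = "syl D f g"
  have M: "?M \<in> carrier_mat (2 * D) (2 * D)" by (simp add: syl_def)
  assume "det ?M = 0"
  then obtain w where w: "w \<in> carrier_vec (2 * D)" "w \<noteq> 0\<^sub>v (2 * D)" "?M *\<^sub>v w = 0\<^sub>v (2 * D)"
    using det_0_iff_vec_prod_zero_field[OF M] by blast
  \<comment> \<open>The two halves of the kernel vector are the coefficients of the cofactors of
    \<open>f\<close> and of \<open>g\<close>.\<close>
  define u where "u = (\<Sum>j<D. monom (w $ j) j)"
  define v where "v = (\<Sum>j<D. monom (w $ (D + j)) j)"
  have cu: "coeff u i = (if i < D then w $ i else 0)" for i
    by (simp add: u_def coeff_sum)
  have cv: "coeff v i = (if i < D then w $ (D + i) else 0)" for i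
    by (simp add: v_def coeff_sum)
  have D: "0 < D" using w by (cases D) auto
  have du: "degree u < D" and dv: "degree v < D"
    using D by (auto intro!: degree_lessI simp: cu cv)
  have *: "monom c j * p = Polynomial.smult c (monom 1 j * p)" for c :: 'k and j p
    by (simp add: smult_monom flip: mult_smult_left)
  have "u * f + v * g = 0"
  proof (rule poly_eqI)
    fix i
    show "coeff (u * f + v * g) i = coeff 0 i"
    proof (cases "i < 2 * D")
      case True
      have "coeff (u * f + v * g) i = (\<Sum>j<D. w $ j * coeff (monom 1 j * f) i)
          + (\<Sum>j<D. w $ (D + j) * coeff (monom 1 j * g) i)"
        unfolding u_def v_def sum_distrib_right *[of "_ $ _"] coeff_add coeff_sum coeff_smult ..
      also have "\<dots> = (\<Sum>j = 0..<2 * D. ?M $$ (i, j) * w $ j)"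
      proof -
        have "(\<Sum>j = 0..<2 * D. ?M $$ (i, j) * w $ j) =
            (\<Sum>j = 0..<D. ?M $$ (i, j) * w $ j) + (\<Sum>j = D..<D + D. ?M $$ (i, j) * w $ j)"
          by (subst sum.atLeastLessThan_concat) (auto simp: mult_2)
        also have "(\<Sum>j = D..<D + D. ?M $$ (i, j) * w $ j) =
            (\<Sum>j = 0..<D. ?M $$ (i, D + j) * w $ (D + j))"
          using sum.shift_bounds_nat_ivl[of "\<lambda>j. ?M $$ (i, j) * w $ j" 0 D D]
          by (simp add: add.commute)
        finally show ?thesis using True
          by (simp add: syl_def mult.commute lessThan_atLeast0)
      qed
      also have "\<dots> = (?M *\<^sub>v w) $ i"
        using True M w(1) by (simp add: scalar_prod_def)
      finally show ?thesis using True w(3) by simp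
    next
      case False
      have "degree (u * f) < 2 * D" "degree (v * g) < 2 * D"
        using degree_mult_le[of u f] degree_mult_le[of v g] du dv assms by auto
      then show ?thesis using False by (simp add: coeff_eq_0)
    qed
  qed
  then have uf: "u * f = - (v * g)" by (simp add: eq_neg_iff_add_eq_0)
  then have "g dvd u * f" by simp
  then have "g dvd u" using dvd_mult_no_common_root[of g f u] assms(3,4) by blast
  then have u0: "u = 0" using du assms(2) dvd_imp_degree_le[of g u] by linarith
  then have v0: "v = 0" using uf assms(3) by simp
  have "w = 0\<^sub>v (2 * D)"
  proof (rule eq_vecI)
    fix i assume i: "i < dim_vec (0\<^sub>v (2 * D) :: 'k vec)"
    show "w $ i = 0\<^sub>v (2 * D) $ i"
    proof (cases "i < D")
      case True then show ?thesis using cu[of i] u0 i by simp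
    next
      case False
      then have "i - D < D" "D + (i - D) = i" using i by simp_all
      then show ?thesis using cv[of "i - D"] v0 i by simp
    qed
  qed (use w in simp)
  then show False using w(2) by simp
qed

section \<open>Avoiding finitely many zeros, and elimination on the projective line\<close>

text \<open>Were the field finite, the product of all its linear factors, increased by 1, would be a
  nonconstant polynomial without a root.\<close>

lemma infinite_alg_closed: "infinite (UNIV :: 'k::alg_closed_field set)"
proof
  assume fin: "finite (UNIV :: 'k set)"
  define p :: "'k poly" where "p = (\<Prod>a\<in>UNIV. [:- a, 1:]) + 1"
  have dp: "degree (\<Prod>a\<in>(UNIV :: 'k set). [:- a, 1:]) = card (UNIV :: 'k set)"
    by (subst degree_prod_eq_sum_degree) auto
  have "0 < card (UNIV :: 'k set)" using fin by (simp add: card_gt_0_iff)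
  with dp have "degree p > 0" unfolding p_def by (subst degree_add_eq_left) auto
  then obtain t where "poly p t = 0" using alg_closed_imp_poly_has_root by blast
  moreover have "(\<Prod>a\<in>UNIV. poly [:- a, 1:] t) = 0"
    using fin by (subst prod_zero_iff) (auto intro!: bexI[of _ t])
  ultimately show False by (simp add: p_def poly_prod)
qed

text \<open>A finite union of proper subspaces of a vector space over an infinite field is proper.\<close>

lemma combine_nonvanishing:
  fixes V :: "('x \<Rightarrow> 'k::field) set"
  assumes inf: "infinite (UNIV :: 'k set)" and fin: "finite R"
    and V: "\<And>f g c. f \<in> V \<Longrightarrow> g \<in> V \<Longrightarrow> (\<lambda>y. f y + c * g y) \<in> V" and f0: "f0 \<in> V"
    and ex: "\<And>r. r \<in> R \<Longrightarrow> \<exists>f\<in>V. f r \<noteq> 0"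
  shows "\<exists>f\<in>V. \<forall>r\<in>R. f r \<noteq> 0"
  using fin ex
proof (induction R rule: finite_induct)
  case (insert r R)
  have "\<exists>f\<in>V. \<forall>r\<in>R. f r \<noteq> 0" by (rule insert.IH) (simp add: insert.prems)
  then obtain f where f: "f \<in> V" "\<forall>r\<in>R. f r \<noteq> 0" by blast
  obtain g where g: "g \<in> V" "g r \<noteq> 0" using insert.prems[of r] by blast
  \<comment> \<open>At a point \<open>s\<close> with \<open>g s \<noteq> 0\<close> exactly one
    \<open>c\<close> makes the combination vanish. If \<open>g s = 0\<close>, then \<open>s\<close>
    is not \<open>r\<close>, so \<open>f s \<noteq> 0\<close> and no \<open>c\<close> does; the
    quotient is then 0 by convention and merely excludes \<open>c = 0\<close>.\<close>
  have "finite ((\<lambda>s. - (f s) / g s) ` insert r R)" using insert by simp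
  then obtain c where c: "c \<notin> (\<lambda>s. - (f s) / g s) ` insert r R"
    using inf by (metis ex_new_if_finite)
  show ?case
  proof (cases "f r = 0")
    case False with f show ?thesis by auto
  next
    case True
    have "f s + c * g s \<noteq> 0" if s: "s \<in> insert r R" for s
    proof
      assume eq: "f s + c * g s = 0"
      show False
      proof (cases "g s = 0")
        case True then show False using eq s f g by auto
      next
        case False
        then have "c = - (f s) / g s" using eq by (simp add: field_simps eq_neg_iff_add_eq_0)
        then show False using c s by blast
      qed
    qed
    then show ?thesis by (intro bexI[OF _ V[OF f(1) g(1), of c]]) simp
  qed
qed (use f0 in auto)

text \<open>
  This is the completeness of the projective line: the points \<open>a t\<close> and \<open>b 0\<close> are the affine chart
  and the point at infinity, and \<open>b s\<close> is the chart around infinity.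
\<close>

lemma closedin_projective_line:
  fixes a b :: "'k::alg_closed_field \<Rightarrow> ('a \<Rightarrow> 'k mat) \<Rightarrow> ('a \<Rightarrow> 'k mat)"
  assumes C: "closedin (zariski Q d) C" and a: "polymap Q d a" and b: "polymap Q d b"
    and ab: "\<And>x t. x \<in> rep_space Q d \<Longrightarrow> t \<noteq> 0 \<Longrightarrow> a t x \<in> C \<longleftrightarrow> b (inverse t) x \<in> C"
  shows "closedin (zariski Q d) {x \<in> rep_space Q d. (\<exists>t. a t x \<in> C) \<or> b 0 x \<in> C}" (is "closedin _ ?E")
  unfolding closedin_zariski_iff
proof (intro conjI ballI)
  fix x0 assume "x0 \<in> rep_space Q d - ?E"
  then have x0: "x0 \<in> rep_space Q d" and nb: "b 0 x0 \<notin> C" and na: "\<And>t. a t x0 \<notin> C" by auto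
  have ar: "a t x \<in> rep_space Q d" and br: "b t x \<in> rep_space Q d" if "x \<in> rep_space Q d" for x t
    using that a b unfolding polymap_def by auto
  \<comment> \<open>An equation of \<open>C\<close> that is nonzero at the point at infinity of the
    line belonging to \<open>x0\<close>.\<close>
  obtain p where p: "polyfun Q d p" "p (b 0 x0) \<noteq> 0" "\<And>y. y \<in> C \<Longrightarrow> p y = 0"
    using closedin_zariskiD[OF C br[OF x0] nb] by blast
  obtain G where G: "polyfam Q d G" "\<And>x t. x \<in> rep_space Q d \<Longrightarrow> p (b t x) = poly (G x) t"
    using polyfun_polymap[OF b p(1)] by blast
  obtain NG where NG: "\<And>x. x \<in> rep_space Q d \<Longrightarrow> degree (G x) \<le> NG"
    using G(1) unfolding polyfam_def by blast
  \<comment> \<open>The equations of \<open>C\<close> restricted to the affine chart of that line: a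
    vector space of functions of the parameter.\<close>
  define V where "V = {\<lambda>t. q (a t x0) |q. polyfun Q d q \<and> (\<forall>y\<in>C. q y = 0)}"
  \<comment> \<open>The equation \<open>p\<close>, given in the coordinate around infinity,
    rewritten in the affine chart: for nonzero \<open>t\<close> its value is
    \<open>t ^ D * p (b (inverse t) x)\<close>. Since \<open>D\<close> exceeds the degree bound
    \<open>NG\<close>, it vanishes at 0, and its coefficient at \<open>D\<close> is
    \<open>p (b 0 x)\<close>.\<close>
  define rev where "rev D x = (\<Sum>i\<le>NG. monom (coeff (G x) i) (D - i))" for D x
  have poly_rev: "poly (rev D x) t = t ^ D * p (b (inverse t) x)"
    if "x \<in> rep_space Q d" "t \<noteq> 0" "NG < D" for x t D
  proof -
    have "poly (rev D x) t = (\<Sum>i\<le>NG. coeff (G x) i * t ^ (D - i))"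
      by (simp add: rev_def poly_sum poly_monom)
    also have "\<dots> = (\<Sum>i\<le>NG. t ^ D * (coeff (G x) i * inverse t ^ i))"
      using that by (intro sum.cong refl) (simp add: power_diff field_simps)
    also have "\<dots> = t ^ D * poly (G x) (inverse t)"
      by (simp add: poly_eq_sum_le[OF NG[OF that(1)]] sum_distrib_left)
    finally show ?thesis using G(2)[OF that(1)] by simp
  qed
  have poly_rev0: "poly (rev D x) 0 = 0" if "NG < D" for x D
    unfolding rev_def poly_sum poly_monom using that by (intro sum.neutral) auto
  have coeff_rev: "coeff (rev D x) i = (if D - NG \<le> i \<and> i \<le> D then coeff (G x) (D - i) else 0)"
    if "NG < D" for D x i
  proof -
    have "coeff (rev D x) i = (\<Sum>j\<le>NG. if j = D - i \<and> i \<le> D then coeff (G x) j else 0)"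
      unfolding rev_def coeff_sum using that by (intro sum.cong refl) auto
    also have "\<dots> = (if D - NG \<le> i \<and> i \<le> D then coeff (G x) (D - i) else 0)"
      using that by (cases "i \<le> D") (auto simp: sum.delta)
    finally show ?thesis .
  qed
  have coeffD: "coeff (rev D x) D = p (b 0 x)" if "NG < D" "x \<in> rep_space Q d" for D x
    using that by (simp add: coeff_rev G(2) poly_0_coeff_0)
  have deg_rev: "degree (rev D x) \<le> D" if "NG < D" for D x
    using that by (intro degree_le) (auto simp: coeff_rev)
  \<comment> \<open>The final \<open>D\<close> will depend on \<open>q\<close>, and \<open>q\<close>
    must be adapted to the roots of \<open>rev D x0\<close>. There is no circle, because these roots
    are the same for every \<open>D > NG\<close>: zero, and the nonzero \<open>t\<close> with
    \<open>p (b (inverse t) x0) = 0\<close>.\<close>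
  let ?r0 = "rev (Suc NG) x0"
  define R where "R = {t. poly ?r0 t = 0}"
  have "coeff ?r0 (Suc NG) \<noteq> 0" using coeffD x0 p(2) by simp
  then have "?r0 \<noteq> 0" by auto
  then have finR: "finite R" unfolding R_def by (rule poly_roots_finite)
  \<comment> \<open>No point \<open>a t x0\<close> lies in \<open>C\<close>, so at each root some
    equation is nonzero; one linear combination serves the finitely many roots together.\<close>
  have "\<exists>f\<in>V. \<forall>r\<in>R. f r \<noteq> 0"
  proof (rule combine_nonvanishing[OF infinite_alg_closed finR])
    fix f g c assume "f \<in> V" "g \<in> V"
    then obtain q q' where "f = (\<lambda>t. q (a t x0))" "g = (\<lambda>t. q' (a t x0))"
      "polyfun Q d q" "polyfun Q d q'" "\<forall>y\<in>C. q y = 0" "\<forall>y\<in>C. q' y = 0" by (auto simp: V_def)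
    then show "(\<lambda>y. f y + c * g y) \<in> V"
      unfolding V_def by (auto intro!: exI[of _ "\<lambda>y. q y + c * q' y"]
        polyfun_add polyfun_mult polyfun_const)
  next
    show "(\<lambda>t. 0) \<in> V" unfolding V_def by (auto intro!: exI[of _ "\<lambda>y. 0"] polyfun_const)
  next
    fix t
    obtain q where "polyfun Q d q" "q (a t x0) \<noteq> 0" "\<And>y. y \<in> C \<Longrightarrow> q y = 0"
      using closedin_zariskiD[OF C ar[OF x0] na] by blast
    then have "(\<lambda>t. q (a t x0)) \<in> V" by (auto simp: V_def)
    then show "\<exists>f\<in>V. f t \<noteq> 0" using \<open>q (a t x0) \<noteq> 0\<close> by (intro bexI)
  qed
  then obtain q where q: "polyfun Q d q" "\<forall>y\<in>C. q y = 0" "\<forall>r\<in>R. q (a r x0) \<noteq> 0"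
    by (auto simp: V_def)
  obtain F where F: "polyfam Q d F" "\<And>x t. x \<in> rep_space Q d \<Longrightarrow> q (a t x) = poly (F x) t"
    using polyfun_polymap[OF a q(1)] by blast
  obtain NF where NF: "\<And>x. x \<in> rep_space Q d \<Longrightarrow> degree (F x) \<le> NF"
    using F(1) unfolding polyfam_def by blast
  define D where "D = Suc (max NF NG)"
  have D: "NG < D" "NF < D" "0 < D" by (auto simp: D_def)
  \<comment> \<open>The first factor vanishes at points that \<open>b 0\<close> carries into
    \<open>C\<close>, the second at points that some \<open>a t\<close> carries into
    \<open>C\<close>.\<close>
  define h where "h x = p (b 0 x) * det (syl D (F x) (rev D x))" for x
  have entry: "polyfun Q d (\<lambda>x. coeff (if j < D then monom 1 j * F x else monom 1 (j - D) * rev D x) i)"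
    for i j
  proof -
    have "polyfun Q d (\<lambda>x. coeff (F x) i)" "polyfun Q d (\<lambda>x. coeff (G x) i)" for i
      using F(1) G(1) by (auto simp: polyfam_def)
    then show ?thesis
      by (cases "j < D") (auto simp: coeff_monom_mult coeff_rev[OF D(1)] intro!: polyfun_if polyfun_const)
  qed
  have "polyfun Q d (\<lambda>x. p (b 0 x))"
  proof -
    have "polyfun Q d (\<lambda>x. coeff (G x) 0)" using G(1) unfolding polyfam_def by blast
    then show ?thesis
      unfolding polyfun_def by (auto simp: G(2) poly_0_coeff_0)
  qed
  \<comment> \<open>Leibniz expansion; the size \<open>2 * D\<close> is the same for all
    \<open>x\<close>, so this is one polynomial expression in the entries.\<close>
  moreover have "polyfun Q d (\<lambda>x. det (syl D (F x) (rev D x)))"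
  proof -
    have "(\<lambda>x. det (syl D (F x) (rev D x))) = (\<lambda>x. \<Sum>\<sigma> | \<sigma> permutes {0..<2 * D}. signof \<sigma> *
       (\<Prod>i = 0..<2 * D. coeff (if \<sigma> i < D then monom 1 (\<sigma> i) * F x
           else monom 1 (\<sigma> i - D) * rev D x) i))"
    proof
      fix x
      have *: "syl D (F x) (rev D x) $$ (i, \<sigma> i) = coeff (if \<sigma> i < D then monom 1 (\<sigma> i) * F x
           else monom 1 (\<sigma> i - D) * rev D x) i" if "\<sigma> permutes {0..<2 * D}" "i < 2 * D" for \<sigma> i
        using permutes_in_image[OF that(1), of i] that(2) by (simp add: syl_def)
      show "det (syl D (F x) (rev D x)) = (\<Sum>\<sigma> | \<sigma> permutes {0..<2 * D}. signof \<sigma> *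
       (\<Prod>i = 0..<2 * D. coeff (if \<sigma> i < D then monom 1 (\<sigma> i) * F x
           else monom 1 (\<sigma> i - D) * rev D x) i))"
        by (subst det_def'[of _ "2 * D"]) (simp add: syl_def, intro sum.cong refl
          arg_cong2[where f = "(*)"] prod.cong, use * in simp)
    qed
    then show ?thesis by (auto intro!: polyfun_sum polyfun_mult polyfun_prod polyfun_const entry)
  qed
  ultimately have "polyfun Q d h" unfolding h_def by (rule polyfun_mult)
  moreover have "h x0 \<noteq> 0"
  proof -
    \<comment> \<open>That \<open>p\<close> is nonzero at infinity makes the degree of
      \<open>rev D x0\<close> exactly \<open>D\<close>, as the determinant criterion
      requires.\<close>
    have lead: "coeff (rev D x0) D \<noteq> 0" using coeffD[OF D(1) x0] p(2) by simp
    then have deg: "degree (rev D x0) = D" using deg_rev[OF D(1), of x0] le_degree by (metis le_antisym)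
    have n0: "rev D x0 \<noteq> 0" using lead by auto
    have "poly (F x0) t \<noteq> 0" if t: "poly (rev D x0) t = 0" for t
    proof -
      have "t \<in> R"
      proof (cases "t = 0")
        case True then show ?thesis by (simp add: R_def poly_rev0)
      next
        case False then show ?thesis using t poly_rev[OF x0 False] D by (simp add: R_def)
      qed
      then show ?thesis using q(3) F(2)[OF x0] by auto
    qed
    moreover have "degree (F x0) \<le> D" using NF[OF x0] D by simp
    ultimately have "det (syl D (F x0) (rev D x0)) \<noteq> 0"
      using det_syl_no_common_root[OF _ deg n0] by blast
    then show ?thesis using p(2) by (simp add: h_def)
  qed
  moreover have "h y = 0" if "y \<in> ?E" for y
  proof -
    have y: "y \<in> rep_space Q d" using that by simp
    show ?thesis
    proof (cases "b 0 y \<in> C")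
      case True then show ?thesis using p(3) by (simp add: h_def)
    next
      case False
      then obtain t where t: "a t y \<in> C" using \<open>y \<in> ?E\<close> by blast
      \<comment> \<open>The parameter \<open>t\<close> is a common root: of \<open>F y\<close> since
        \<open>q\<close> vanishes on \<open>C\<close>, and of \<open>rev D y\<close> since the
        charts agree away from 0 and \<open>rev\<close> vanishes at 0.\<close>
      have "poly (F y) t = 0" using F(2)[OF y] q(2) t by metis
      moreover have "poly (rev D y) t = 0"
      proof (cases "t = 0")
        case True then show ?thesis using poly_rev0 D by simp
      next
        case False
        then have "b (inverse t) y \<in> C" using ab[OF y] t by simp
        then show ?thesis using poly_rev[OF y False D(1)] p(3) by simp
      qed
      ultimately have "det (syl D (F y) (rev D y)) = 0"
        using det_syl_common_root[OF _ deg_rev[OF D(1)] _ _ D(3)] NF[OF y] D(2) by simp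
      then show ?thesis by (simp add: h_def)
    qed
  qed
  ultimately show "\<exists>h. polyfun Q d h \<and> h x0 \<noteq> 0 \<and> (\<forall>y\<in>?E. h y = 0)" by blast
qed auto

section \<open>The product of the general linear groups acting by base change\<close>

section \<open>Saturation under the general linear groups\<close>

text \<open>The inverse of \<open>g\<close> is a separate argument \<open>g'\<close>, tied to it
  only through \<open>gl_pair\<close>; the action is then visibly polynomial in the entries of the
  pair.\<close>

definition base_change ::
  "('v, 'a) pre_digraph \<Rightarrow> ('v \<Rightarrow> 'k::field mat) \<Rightarrow> ('v \<Rightarrow> 'k mat) \<Rightarrow> ('a \<Rightarrow> 'k mat) \<Rightarrow> ('a \<Rightarrow> 'k mat)" where
  "base_change Q g g' x = (\<lambda>\<alpha>\<in>arcs Q. g (head Q \<alpha>) * x \<alpha> * g' (tail Q \<alpha>))"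

definition gl_pair ::
  "('v, 'a) pre_digraph \<Rightarrow> ('v \<Rightarrow> nat) \<Rightarrow> ('v \<Rightarrow> 'k::field mat) \<Rightarrow> ('v \<Rightarrow> 'k mat) \<Rightarrow> bool" where
  "gl_pair Q d g g' \<longleftrightarrow> (\<forall>v\<in>verts Q. g v \<in> carrier_mat (d v) (d v) \<and> g' v \<in> carrier_mat (d v) (d v) \<and>
     g v * g' v = 1\<^sub>m (d v) \<and> g' v * g v = 1\<^sub>m (d v))"

lemma rep_space_carrier:
  "x \<in> rep_space Q d \<Longrightarrow> \<alpha> \<in> arcs Q \<Longrightarrow> x \<alpha> \<in> carrier_mat (d (head Q \<alpha>)) (d (tail Q \<alpha>))"
  unfolding rep_space_def by auto

lemma index_mult_mat_sum:
  assumes "A \<in> carrier_mat m n" "B \<in> carrier_mat n k" "i < m" "j < k"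
  shows "(A * B) $$ (i, j) = (\<Sum>p<n. A $$ (i, p) * B $$ (p, j))"
  using assms by (simp add: scalar_prod_def lessThan_atLeast0)

lemma index_mult_mat3:
  assumes "A \<in> carrier_mat m n" "X \<in> carrier_mat n k" "B \<in> carrier_mat k l" "i < m" "j < l"
  shows "(A * X * B) $$ (i, j) = (\<Sum>q<k. \<Sum>p<n. A $$ (i, p) * X $$ (p, q) * B $$ (q, j))"
proof -
  have AX: "A * X \<in> carrier_mat m k" using assms by simp
  have "(A * X * B) $$ (i, j) = (\<Sum>q<k. (A * X) $$ (i, q) * B $$ (q, j))"
    by (rule index_mult_mat_sum[OF AX assms(3-5)])
  also have "\<dots> = (\<Sum>q<k. (\<Sum>p<n. A $$ (i, p) * X $$ (p, q)) * B $$ (q, j))"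
    by (intro sum.cong refl) (simp only: index_mult_mat_sum[OF assms(1,2,4)] lessThan_iff)
  finally have "(A * X * B) $$ (i, j) = (\<Sum>q<k. (\<Sum>p<n. A $$ (i, p) * X $$ (p, q)) * B $$ (q, j))" .
  then show ?thesis by (simp add: sum_distrib_right)
qed

context wf_digraph
begin

lemma base_change_closed:
  assumes "gl_pair G d g g'" "x \<in> rep_space G d"
  shows "base_change G g g' x \<in> rep_space G d"
  unfolding rep_space_def base_change_def
proof (intro PiE_I)
  fix \<alpha> assume \<alpha>: "\<alpha> \<in> arcs G"
  then show "(\<lambda>\<alpha>\<in>arcs G. g (head G \<alpha>) * x \<alpha> * g' (tail G \<alpha>)) \<alpha>
      \<in> carrier_mat (d (head G \<alpha>)) (d (tail G \<alpha>))"
    using assms(1) rep_space_carrier[OF assms(2) \<alpha>] unfolding gl_pair_def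
    by (auto intro!: mult_carrier_mat)
qed auto

lemma base_change_comp:
  assumes "gl_pair G d g g'" "gl_pair G d h h'" "x \<in> rep_space G d"
  shows "base_change G g g' (base_change G h h' x) =
    base_change G (\<lambda>v. g v * h v) (\<lambda>v. h' v * g' v) x"
proof
  fix \<alpha>
  show "base_change G g g' (base_change G h h' x) \<alpha> =
    base_change G (\<lambda>v. g v * h v) (\<lambda>v. h' v * g' v) x \<alpha>"
  proof (cases "\<alpha> \<in> arcs G")
    case True
    let ?h = "head G \<alpha>" and ?t = "tail G \<alpha>"
    have c: "g ?h \<in> carrier_mat (d ?h) (d ?h)" "h ?h \<in> carrier_mat (d ?h) (d ?h)"
      "g' ?t \<in> carrier_mat (d ?t) (d ?t)" "h' ?t \<in> carrier_mat (d ?t) (d ?t)"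
      using assms(1,2) True unfolding gl_pair_def by auto
    have x: "x \<alpha> \<in> carrier_mat (d ?h) (d ?t)" using rep_space_carrier[OF assms(3) True] .
    have "g ?h * (h ?h * x \<alpha> * h' ?t) * g' ?t = (g ?h * h ?h) * x \<alpha> * (h' ?t * g' ?t)"
      using c x by (smt (verit) assoc_mult_mat mult_carrier_mat)
    then show ?thesis using True by (simp add: base_change_def)
  qed (simp add: base_change_def)
qed

lemma gl_pair_mult:
  assumes "gl_pair G d g g'" "gl_pair G d h h'"
  shows "gl_pair G d (\<lambda>v. g v * h v) (\<lambda>v. h' v * g' v)"
  unfolding gl_pair_def
proof (intro ballI conjI)
  fix v assume "v \<in> verts G"
  then have c: "g v \<in> carrier_mat (d v) (d v)" "g' v \<in> carrier_mat (d v) (d v)"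
    "h v \<in> carrier_mat (d v) (d v)" "h' v \<in> carrier_mat (d v) (d v)"
    and m: "g v * g' v = 1\<^sub>m (d v)" "g' v * g v = 1\<^sub>m (d v)" "h v * h' v = 1\<^sub>m (d v)" "h' v * h v = 1\<^sub>m (d v)"
    using assms unfolding gl_pair_def by auto
  show "g v * h v \<in> carrier_mat (d v) (d v)" "h' v * g' v \<in> carrier_mat (d v) (d v)" using c by auto
  have "g v * h v * (h' v * g' v) = g v * (h v * h' v) * g' v"
    using c by (smt (verit) assoc_mult_mat mult_carrier_mat)
  then show "g v * h v * (h' v * g' v) = 1\<^sub>m (d v)" using c m by simp
  have "h' v * g' v * (g v * h v) = h' v * (g' v * g v) * h v"
    using c by (smt (verit) assoc_mult_mat mult_carrier_mat)
  then show "h' v * g' v * (g v * h v) = 1\<^sub>m (d v)" using c m by simp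
qed

lemma gl_pair_swap: "gl_pair G d g g' \<Longrightarrow> gl_pair G d g' g"
  unfolding gl_pair_def by auto

lemma base_change_one:
  assumes "\<And>v. v \<in> verts G \<Longrightarrow> g v = 1\<^sub>m (d v)" "\<And>v. v \<in> verts G \<Longrightarrow> g' v = 1\<^sub>m (d v)" "x \<in> rep_space G d"
  shows "base_change G g g' x = x"
proof
  fix \<alpha>
  show "base_change G g g' x \<alpha> = x \<alpha>"
  proof (cases "\<alpha> \<in> arcs G")
    case True
    then show ?thesis using rep_space_carrier[OF assms(3) True] assms(1,2)
      by (simp add: base_change_def)
  next
    case False
    then show ?thesis using assms(3) by (auto simp: base_change_def rep_space_def PiE_def extensional_def)
  qed
qed

lemma base_change_inverse:
  assumes "gl_pair G d g g'" "x \<in> rep_space G d"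
  shows "base_change G g' g (base_change G g g' x) = x"
  using assms unfolding base_change_comp[OF gl_pair_swap[OF assms(1)] assms]
  by (intro base_change_one) (auto simp: gl_pair_def)

lemma base_change_cong:
  assumes "\<And>v. v \<in> verts G \<Longrightarrow> g v = h v" "\<And>v. v \<in> verts G \<Longrightarrow> g' v = h' v"
  shows "base_change G g g' x = base_change G h h' x"
  unfolding base_change_def using assms by (intro restrict_ext) simp

text \<open>An entry of a transformed matrix is a finite sum of products of an entry of
  \<open>g t\<close>, an entry of \<open>x\<close> and an entry of \<open>g' t\<close>; hence
  polynomial dependence on \<open>t\<close> is asked of the matrices and of their inverses.\<close>

lemma polymap_base_change:
  fixes g g' :: "'k::field \<Rightarrow> 'a \<Rightarrow> 'k mat"
  assumes gl: "\<And>t. gl_pair G d (g t) (g' t)"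
    and g: "\<And>v i j. v \<in> verts G \<Longrightarrow> i < d v \<Longrightarrow> j < d v \<Longrightarrow> \<exists>p. \<forall>t. g t v $$ (i, j) = poly p t"
    and g': "\<And>v i j. v \<in> verts G \<Longrightarrow> i < d v \<Longrightarrow> j < d v \<Longrightarrow> \<exists>p. \<forall>t. g' t v $$ (i, j) = poly p t"
  shows "polymap G d (\<lambda>t. base_change G (g t) (g' t))"
  unfolding polymap_def
proof (intro conjI allI impI ballI)
  fix t and x :: "'b \<Rightarrow> 'k mat" assume "x \<in> rep_space G d"
  then show "base_change G (g t) (g' t) x \<in> rep_space G d" using base_change_closed gl by blast
next
  fix \<alpha> i j assume "(\<alpha>, i, j) \<in> coords G d"
  then have \<alpha>: "\<alpha> \<in> arcs G" and i: "i < d (head G \<alpha>)" and j: "j < d (tail G \<alpha>)"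
    by (auto simp: coords_def)
  let ?h = "head G \<alpha>" and ?t = "tail G \<alpha>"
  have ht: "?h \<in> verts G" "?t \<in> verts G" using \<alpha> by auto
  have "\<forall>p. \<exists>r. p < d ?h \<longrightarrow> (\<forall>t. g t ?h $$ (i, p) = poly r t)" using g[OF ht(1) i] by blast
  then obtain r where r: "\<And>p t. p < d ?h \<Longrightarrow> g t ?h $$ (i, p) = poly (r p) t" by metis
  have "\<forall>p. \<exists>r. p < d ?t \<longrightarrow> (\<forall>t. g' t ?t $$ (p, j) = poly r t)" using g'[OF ht(2) _ j] by blast
  then obtain s where s: "\<And>p t. p < d ?t \<Longrightarrow> g' t ?t $$ (p, j) = poly (s p) t" by metis
  define F where "F x = (\<Sum>q<d ?t. \<Sum>p<d ?h. r p * [:x \<alpha> $$ (p, q):] * s q)" for x :: "'b \<Rightarrow> 'k mat"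
  have "polyfam G d F"
    unfolding F_def using \<alpha> by (intro polyfam_sum polyfam_mult polyfam_const polyfam_pCons_const polyfun_coord)
      (auto simp: coords_def)
  moreover have "base_change G (g t) (g' t) x \<alpha> $$ (i, j) = poly (F x) t" if x: "x \<in> rep_space G d" for x t
  proof -
    have "g t ?h \<in> carrier_mat (d ?h) (d ?h)" "g' t ?t \<in> carrier_mat (d ?t) (d ?t)"
      using gl[of t] ht unfolding gl_pair_def by auto
    then have "base_change G (g t) (g' t) x \<alpha> $$ (i, j) =
       (\<Sum>q<d ?t. \<Sum>p<d ?h. g t ?h $$ (i, p) * x \<alpha> $$ (p, q) * g' t ?t $$ (q, j))"
      using \<alpha> by (simp only: base_change_def restrict_apply' index_mult_mat3[OF _ rep_space_carrier[OF x \<alpha>] _ i j])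
    also have "\<dots> = poly (F x) t" by (simp add: F_def poly_sum r s ac_simps)
    finally show ?thesis .
  qed
  ultimately show "\<exists>F. polyfam G d F \<and> (\<forall>x\<in>rep_space G d. \<forall>t.
      base_change G (g t) (g' t) x \<alpha> $$ (i, j) = poly (F x) t)" by blast
qed

end

section \<open>Two by two blocks, and sets of matrices with prescribed zeros\<close>

text \<open>The identity matrix with a 2 by 2 matrix, rows \<open>p q\<close> and
  \<open>r s\<close>, inserted at the indices \<open>c\<close> and \<open>Suc c\<close>. The
  invertible ones generate, together with the invertible lower triangular matrices, a minimal
  parabolic subgroup.\<close>

definition block2 :: "nat \<Rightarrow> nat \<Rightarrow> 'k \<Rightarrow> 'k \<Rightarrow> 'k \<Rightarrow> 'k \<Rightarrow> 'k::field mat" where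
  "block2 n c p q r s = mat n n (\<lambda>(i, j).
     if i = c \<and> j = c then p else if i = c \<and> j = Suc c then q
     else if i = Suc c \<and> j = c then r else if i = Suc c \<and> j = Suc c then s
     else if i = j then 1 else 0)"

lemma block2_carrier: "block2 n c p q r s \<in> carrier_mat n n"
  by (simp add: block2_def)

lemma index_mult_block2:
  assumes M: "M \<in> carrier_mat m n" and "Suc c < n" "i < m" "j < n"
  shows "(M * block2 n c p q r s) $$ (i, j) =
    (if j = c then M $$ (i, c) * p + M $$ (i, Suc c) * r
     else if j = Suc c then M $$ (i, c) * q + M $$ (i, Suc c) * s else M $$ (i, j))"
proof -
  have "(M * block2 n c p q r s) $$ (i, j) = (\<Sum>k = 0..<n. M $$ (i, k) * block2 n c p q r s $$ (k, j))"
    using assms by (simp add: scalar_prod_def block2_def)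
  also have "\<dots> = (\<Sum>k = 0..<n. (if k = c then M $$ (i, c) * (if j = c then p else if j = Suc c then q else 0) else 0)
     + (if k = Suc c then M $$ (i, Suc c) * (if j = c then r else if j = Suc c then s else 0) else 0)
     + (if k = j then (if j = c \<or> j = Suc c then 0 else M $$ (i, j)) else 0))"
    using assms by (intro sum.cong refl) (auto simp: block2_def)
  also have "\<dots> = (if j = c then M $$ (i, c) * p + M $$ (i, Suc c) * r
     else if j = Suc c then M $$ (i, c) * q + M $$ (i, Suc c) * s else M $$ (i, j))"
    using assms by (simp add: sum.distrib sum.delta)
  finally show ?thesis .
qed

lemma block2_mult:
  assumes "Suc c < n"
  shows "block2 n c p q r s * block2 n c p' q' r' s' =
    block2 n c (p * p' + q * r') (p * q' + q * s') (r * p' + s * r') (r * q' + s * s')" (is "?l = ?r")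
proof (rule eq_matI)
  fix i j assume "i < dim_row ?r" "j < dim_col ?r"
  then have i: "i < n" and j: "j < n" by (auto simp: block2_def)
  show "?l $$ (i, j) = ?r $$ (i, j)"
    unfolding index_mult_block2[OF block2_carrier assms i j]
    using assms i j by (auto simp: block2_def)
qed (auto simp: block2_def)

lemma block2_one: "block2 n c 1 0 0 1 = (1\<^sub>m n :: 'k::field mat)"
proof -
  have "(if i = c \<and> j = c then 1 else if i = c \<and> j = Suc c then 0
     else if i = Suc c \<and> j = c then 0 else if i = Suc c \<and> j = Suc c then 1
     else if i = j then 1 else 0) = (if i = j then 1 else (0 :: 'k))" for i j
    by (cases "i = j"; cases "i = c"; cases "j = c"; auto)
  then show ?thesis by (simp only: block2_def one_mat_def)
qed

definition at_vertex :: "('v \<Rightarrow> nat) \<Rightarrow> 'v \<Rightarrow> 'k::field mat \<Rightarrow> 'v \<Rightarrow> 'k mat" where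
  "at_vertex d v M u = (if u = v then M else 1\<^sub>m (d u))"

lemma gl_pair_at_vertex:
  assumes "B \<in> carrier_mat (d v) (d v)" "B' \<in> carrier_mat (d v) (d v)" "B * B' = 1\<^sub>m (d v)" "B' * B = 1\<^sub>m (d v)"
  shows "gl_pair Q d (at_vertex d v B) (at_vertex d v B')"
  using assms by (auto simp: gl_pair_def at_vertex_def)

lemma at_vertex_block2_poly:
  assumes "i < d u" "j < d u"
  shows "\<exists>f. \<forall>t. at_vertex d v (block2 (d v) c (poly p t) (poly q t) (poly r t) (poly s t)) u $$ (i, j) = poly f t"
proof -
  define f where "f = (if u = v then (if i = c \<and> j = c then p else if i = c \<and> j = Suc c then q
     else if i = Suc c \<and> j = c then r else if i = Suc c \<and> j = Suc c then s
     else if i = j then 1 else 0) else if i = j then 1 else 0)"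
  have "at_vertex d v (block2 (d v) c (poly p t) (poly q t) (poly r t) (poly s t)) u $$ (i, j) = poly f t" for t
    unfolding f_def at_vertex_def block2_def using assms
    by (cases "u = v"; cases "i = j"; cases "i = c"; cases "j = c"; cases "i = Suc c"; cases "j = Suc c"; simp)
  then show ?thesis by blast
qed

lemma at_vertex_mult:
  assumes "M \<in> carrier_mat (d v) (d v)" "N \<in> carrier_mat (d v) (d v)"
  shows "at_vertex d v M u * at_vertex d v N u = at_vertex d v (M * N) u"
  using assms by (auto simp: at_vertex_def)

text \<open>Points moved into \<open>C\<close> by some element of the product group with zeros at
  the positions \<open>S\<close>. The pattern interpolates between the Borel subgroup,
  \<open>S v i j = (i < j)\<close>, and the whole group, \<open>S v i j = False\<close>. The
  matrices of an intermediate pattern need not form a group.\<close>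

definition saturation ::
  "('v, 'a) pre_digraph \<Rightarrow> ('v \<Rightarrow> nat) \<Rightarrow> ('a \<Rightarrow> 'k::field mat) set \<Rightarrow> ('v \<Rightarrow> nat \<Rightarrow> nat \<Rightarrow> bool) \<Rightarrow>
    ('a \<Rightarrow> 'k mat) set" where
  "saturation Q d C S = {x \<in> rep_space Q d. \<exists>g g'. gl_pair Q d g g' \<and>
     (\<forall>v\<in>verts Q. \<forall>i<d v. \<forall>j<d v. S v i j \<longrightarrow> g v $$ (i, j) = 0) \<and> base_change Q g g' x \<in> C}"

lemma saturation_cong:
  assumes "\<And>v i j. v \<in> verts Q \<Longrightarrow> i < d v \<Longrightarrow> j < d v \<Longrightarrow> S v i j = S' v i j"
  shows "saturation Q d C S = saturation Q d C S'"
proof -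
  have "(\<forall>v\<in>verts Q. \<forall>i<d v. \<forall>j<d v. S v i j \<longrightarrow> g v $$ (i, j) = 0) \<longleftrightarrow>
    (\<forall>v\<in>verts Q. \<forall>i<d v. \<forall>j<d v. S' v i j \<longrightarrow> g v $$ (i, j) = 0)" for g :: "'a \<Rightarrow> 'c mat"
    using assms by auto
  then show ?thesis unfolding saturation_def by simp
qed

lemma saturationI:
  assumes "x \<in> rep_space Q d" "gl_pair Q d g g'"
    and "\<And>v i j. v \<in> verts Q \<Longrightarrow> i < d v \<Longrightarrow> j < d v \<Longrightarrow> S v i j \<Longrightarrow> g v $$ (i, j) = 0"
    and "base_change Q g g' x \<in> C"
  shows "x \<in> saturation Q d C S"
  unfolding saturation_def using assms by (intro CollectI conjI exI[of _ g] exI[of _ g']) auto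

lemma saturationE:
  assumes "x \<in> saturation Q d C S"
  obtains g g' where "x \<in> rep_space Q d" "gl_pair Q d g g'"
    and "\<And>v i j. v \<in> verts Q \<Longrightarrow> i < d v \<Longrightarrow> j < d v \<Longrightarrow> S v i j \<Longrightarrow> g v $$ (i, j) = 0"
    and "base_change Q g g' x \<in> C"
  using assms unfolding saturation_def by auto


text \<open>Induction on the row. For \<open>i \<le> j\<close> the entry \<open>(i, j)\<close> of
  \<open>g * g'\<close> reduces to \<open>g $$ (i, i) * g' $$ (i, j)\<close>: summands with smaller
  inner index vanish by induction, those with larger one because \<open>g\<close> is lower
  triangular. The case \<open>i = j\<close> shows that the diagonal entry of \<open>g\<close> is
  nonzero.\<close>

lemma lower_triangular_inverse:
  assumes g: "g \<in> carrier_mat n n" "g' \<in> carrier_mat n n" "g * g' = (1\<^sub>m n :: 'k::field mat)"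
    and low: "\<And>i j. i < n \<Longrightarrow> j < n \<Longrightarrow> i < j \<Longrightarrow> g $$ (i, j) = 0"
  shows "i < n \<Longrightarrow> j < n \<Longrightarrow> i < j \<Longrightarrow> g' $$ (i, j) = 0"
proof (induction i arbitrary: j rule: less_induct)
  case (less i)
  have *: "(if i = j then 1 else 0) = g $$ (i, i) * g' $$ (i, j)" if j: "j < n" "i \<le> j" for j
  proof -
    have "(if i = j then 1 else 0) = (g * g') $$ (i, j)" using g(3) less.prems(1) j by simp
    also have "\<dots> = (\<Sum>k = 0..<n. g $$ (i, k) * g' $$ (k, j))"
      using g(1,2) less.prems(1) j by (simp add: scalar_prod_def)
    also have "\<dots> = (\<Sum>k = 0..<n. if k = i then g $$ (i, i) * g' $$ (i, j) else 0)"
    proof (intro sum.cong refl)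
      fix k assume k: "k \<in> {0..<n}"
      consider "k < i" | "k = i" | "i < k" by linarith
      then show "g $$ (i, k) * g' $$ (k, j) = (if k = i then g $$ (i, i) * g' $$ (i, j) else 0)"
      proof cases
        case 1
        then show ?thesis using less.IH[of k j] k j less.prems by simp
      qed (use low[of i k] less.prems k in auto)
    qed
    also have "\<dots> = g $$ (i, i) * g' $$ (i, j)" using less.prems by (simp add: sum.delta)
    finally show ?thesis .
  qed
  have "g $$ (i, i) \<noteq> 0" using *[of i] less.prems by auto
  then show ?case using *[of j] less.prems by simp
qed

section \<open>From the Borel subgroup to the whole group, one minimal parabolic at a time\<close>

context wf_digraph
begin

text \<open>If \<open>g\<close> moves the translate of \<open>y\<close> by \<open>B'\<close> into
  \<open>C\<close>, then the product of \<open>g\<close> and \<open>B'\<close> moves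
  \<open>y\<close> itself there. This product differs from \<open>g\<close> only at
  \<open>v\<close>, so the zeros have to be checked anew only at \<open>v\<close>.\<close>

lemma saturation_shift:
  assumes B: "B \<in> carrier_mat (d v) (d v)" "B' \<in> carrier_mat (d v) (d v)" "B * B' = 1\<^sub>m (d v)" "B' * B = 1\<^sub>m (d v)"
    and y: "y \<in> rep_space G d" and v: "v \<in> verts G"
    and gl: "gl_pair G d g g'"
    and S: "\<And>u i j. u \<in> verts G \<Longrightarrow> i < d u \<Longrightarrow> j < d u \<Longrightarrow> u \<noteq> v \<Longrightarrow> S u i j \<Longrightarrow> g u $$ (i, j) = 0"
    and Sv: "\<And>i j. i < d v \<Longrightarrow> j < d v \<Longrightarrow> S v i j \<Longrightarrow> (g v * B') $$ (i, j) = 0"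
    and C: "base_change G g g' (base_change G (at_vertex d v B') (at_vertex d v B) y) \<in> C"
  shows "y \<in> saturation G d C S"
proof -
  let ?h = "\<lambda>u. g u * at_vertex d v B' u" and ?h' = "\<lambda>u. at_vertex d v B u * g' u"
  have gB: "gl_pair G d (at_vertex d v B') (at_vertex d v B)" by (rule gl_pair_at_vertex) (use B in auto)
  have "gl_pair G d ?h ?h'" by (rule gl_pair_mult[OF gl gB])
  moreover have "base_change G ?h ?h' y \<in> C" using C base_change_comp[OF gl gB y] by simp
  moreover have "?h u $$ (i, j) = 0" if "u \<in> verts G" "i < d u" "j < d u" "S u i j" for u i j
  proof (cases "u = v")
    case True then show ?thesis using Sv that by (simp add: at_vertex_def)
  next
    case False
    have "g u \<in> carrier_mat (d u) (d u)" using gl that(1) unfolding gl_pair_def by auto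
    then show ?thesis using S[OF that(1,2,3) False that(4)] False by (simp add: at_vertex_def)
  qed
  ultimately show ?thesis using saturationI[OF y] by simp
qed

text \<open>
  Entries required to vanish. Raising \<open>c\<close> to the last column and then lowering \<open>r\<close>, one passes from
  the lower triangular matrices to all matrices by multiplications with one minimal parabolic each.
\<close>

definition (in -) row_pattern :: "nat \<Rightarrow> nat \<Rightarrow> nat \<Rightarrow> nat \<Rightarrow> bool" where
  "row_pattern r c i j \<longleftrightarrow> i < r \<and> i < j \<or> i = r \<and> c < j"

text \<open>Column operations on \<open>c\<close> and \<open>Suc c\<close> free just the entry
  \<open>(r, Suc c)\<close>: the rows above \<open>r\<close> vanish in both columns because
  \<open>r \<le> c\<close>. The larger saturation is therefore swept out by a projective line of
  translates of the smaller one.\<close>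

lemma closedin_saturation_step:
  fixes C :: "('b \<Rightarrow> 'k::alg_closed_field mat) set"
  assumes v: "v \<in> verts G" and rc: "r \<le> c" "Suc c < d v"
    and cl: "closedin (zariski G d) (saturation G d C (S(v := row_pattern r c)))"
  shows "closedin (zariski G d) (saturation G d C (S(v := row_pattern r (Suc c))))"
proof -
  let ?n = "d v"
  let ?D = "saturation G d C (S(v := row_pattern r c))" and ?D' = "saturation G d C (S(v := row_pattern r (Suc c)))"
  \<comment> \<open>\<open>?A t\<close> represents the cosets of the lower triangular blocks other
    than the trivial one, \<open>?E t\<close> those in a neighbourhood of the trivial coset, which
    plays the role of the point at infinity. The primed blocks are the inverses.\<close>
  let ?A = "\<lambda>t :: 'k. block2 ?n c 0 1 1 t" and ?A' = "\<lambda>t :: 'k. block2 ?n c (- t) 1 1 0"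
  let ?E = "\<lambda>t :: 'k. block2 ?n c 1 t 0 1" and ?E' = "\<lambda>t :: 'k. block2 ?n c 1 (- t) 0 1"
  note bl = block2_mult[OF rc(2)] block2_carrier block2_one
  define a where "a t = base_change G (at_vertex d v (?A' t)) (at_vertex d v (?A t))" for t
  define b where "b t = base_change G (at_vertex d v (?E' t)) (at_vertex d v (?E t))" for t
  have glA: "gl_pair G d (at_vertex d v (?A' t)) (at_vertex d v (?A t))" for t
    by (rule gl_pair_at_vertex) (simp_all add: bl)
  have glE: "gl_pair G d (at_vertex d v (?E' t)) (at_vertex d v (?E t))" for t
    by (rule gl_pair_at_vertex) (simp_all add: bl)
  note entries = at_vertex_block2_poly[where d = d and v = v and c = c]
  have a: "polymap G d a"
    unfolding a_def
  proof (rule polymap_base_change[OF glA])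
    fix u i j assume "i < d u" "j < d u"
    then show "\<exists>p. \<forall>t. at_vertex d v (?A' t) u $$ (i, j) = poly p t"
      and "\<exists>p. \<forall>t. at_vertex d v (?A t) u $$ (i, j) = poly p t"
      using entries[of i u j "[:0, -1:]" 1 1 0] entries[of i u j 0 1 1 "[:0, 1:]"] by simp_all
  qed
  have b: "polymap G d b"
    unfolding b_def
  proof (rule polymap_base_change[OF glE])
    fix u i j assume "i < d u" "j < d u"
    then show "\<exists>p. \<forall>t. at_vertex d v (?E' t) u $$ (i, j) = poly p t"
      and "\<exists>p. \<forall>t. at_vertex d v (?E t) u $$ (i, j) = poly p t"
      using entries[of i u j 1 "[:0, -1:]" 0 1] entries[of i u j 1 "[:0, 1:]" 0 1] by simp_all
  qed
  have ar: "a t x \<in> rep_space G d" and br: "b t x \<in> rep_space G d" if "x \<in> rep_space G d" for t x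
    unfolding a_def b_def by (rule base_change_closed[OF glA that], rule base_change_closed[OF glE that])
  \<comment> \<open>A lower triangular block adds a multiple of a column only to the column on its
    left, which respects the zero pattern; so the smaller saturation is stable under such
    blocks.\<close>
  have lower: "y \<in> ?D"
    if y: "y \<in> rep_space G d" and T: "p * p' = 1" "s * s' = 1" "r1 * p' + s * r1' = 0" "r1' * p + s' * r1 = 0"
      and D: "base_change G (at_vertex d v (block2 ?n c p' 0 r1' s')) (at_vertex d v (block2 ?n c p 0 r1 s)) y \<in> ?D"
    for y p p' s s' r1 r1'
  proof -
    obtain g g' where g: "gl_pair G d g g'"
      "\<And>u i j. u \<in> verts G \<Longrightarrow> i < d u \<Longrightarrow> j < d u \<Longrightarrow> (S(v := row_pattern r c)) u i j \<Longrightarrow> g u $$ (i, j) = 0"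
      "base_change G g g' (base_change G (at_vertex d v (block2 ?n c p' 0 r1' s')) (at_vertex d v (block2 ?n c p 0 r1 s)) y) \<in> C"
      using D by (rule saturationE) blast
    have gv: "g v \<in> carrier_mat ?n ?n" using g(1) v unfolding gl_pair_def by auto
    have gz: "g v $$ (i, j) = 0" if "i < ?n" "j < ?n" "row_pattern r c i j" for i j
      using g(2)[OF v, of i j] that by simp
    show ?thesis
    proof (rule saturation_shift[OF _ _ _ _ y v g(1) _ _ g(3)])
      fix i j assume ij: "i < ?n" "j < ?n" "(S(v := row_pattern r c)) v i j"
      then show "(g v * block2 ?n c p' 0 r1' s') $$ (i, j) = 0"
        unfolding index_mult_block2[OF gv rc(2) ij(1,2)]
        using gz[of i c] gz[of i "Suc c"] gz[of i j] rc by (auto simp: row_pattern_def)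
    next
      fix u i j assume "u \<in> verts G" "i < d u" "j < d u" "u \<noteq> v" "(S(v := row_pattern r c)) u i j"
      then show "g u $$ (i, j) = 0" using g(2) by blast
    qed (use T in \<open>simp_all add: bl mult.commute\<close>)
  qed
  \<comment> \<open>\<open>A t = E (1 / t) T\<close> with \<open>T\<close> lower triangular, so the two charts agree up to the stabiliser of \<open>D\<close>.\<close>
  have ab: "a t x \<in> ?D \<longleftrightarrow> b (inverse t) x \<in> ?D" if x: "x \<in> rep_space G d" and t: "t \<noteq> 0" for x t
  proof -
    let ?T = "block2 ?n c (- inverse t) 0 1 t" and ?T' = "block2 ?n c (- t) 0 1 (inverse t)"
    have glT: "gl_pair G d (at_vertex d v ?T') (at_vertex d v ?T)"
      by (rule gl_pair_at_vertex) (use t in \<open>simp_all add: bl\<close>)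
    have "a t x = base_change G (at_vertex d v ?T') (at_vertex d v ?T) (b (inverse t) x)"
      unfolding a_def b_def base_change_comp[OF glT glE x]
      by (intro base_change_cong) (use t in \<open>simp_all add: at_vertex_mult bl\<close>)
    moreover from this have "b (inverse t) x = base_change G (at_vertex d v ?T) (at_vertex d v ?T') (a t x)"
      using base_change_inverse[OF glT br[OF x]] by simp
    ultimately show ?thesis
      using lower[OF br[OF x], of "- inverse t" "- t" t "inverse t" 1 1 "inverse t"]
        lower[OF ar[OF x], of "- t" "- inverse t" "inverse t" t 1 1 t] t by auto
  qed
  have b0: "b 0 x = x" if "x \<in> rep_space G d" for x
    unfolding b_def using that by (intro base_change_one) (auto simp: at_vertex_def bl)
  \<comment> \<open>The operation \<open>?A' t\<close> puts column \<open>c\<close>, whose entry in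
    row \<open>r\<close> is free, in the place of column \<open>Suc c\<close>, where the larger
    pattern imposes nothing on row \<open>r\<close>.\<close>
  have up: "y \<in> ?D'"
    if y: "y \<in> rep_space G d" and D: "a t y \<in> ?D" for y t
  proof -
    obtain g g' where g: "gl_pair G d g g'"
      "\<And>u i j. u \<in> verts G \<Longrightarrow> i < d u \<Longrightarrow> j < d u \<Longrightarrow> (S(v := row_pattern r c)) u i j \<Longrightarrow> g u $$ (i, j) = 0"
      "base_change G g g' (a t y) \<in> C"
      using D by (rule saturationE) blast
    have gv: "g v \<in> carrier_mat ?n ?n" using g(1) v unfolding gl_pair_def by auto
    have gz: "g v $$ (i, j) = 0" if "i < ?n" "j < ?n" "row_pattern r c i j" for i j
      using g(2)[OF v, of i j] that by simp
    show ?thesis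
    proof (rule saturation_shift[OF _ _ _ _ y v g(1) _ _ g(3)[unfolded a_def]])
      fix i j assume ij: "i < ?n" "j < ?n" "(S(v := row_pattern r (Suc c))) v i j"
      then show "(g v * ?A' t) $$ (i, j) = 0"
        unfolding index_mult_block2[OF gv rc(2) ij(1,2)]
        using gz[of i c] gz[of i "Suc c"] gz[of i j] rc by (auto simp: row_pattern_def)
    next
      fix u i j assume "u \<in> verts G" "i < d u" "j < d u" "u \<noteq> v" "(S(v := row_pattern r (Suc c))) u i j"
      then show "g u $$ (i, j) = 0" using g(2)[of u i j] by simp
    qed (simp_all add: bl)
  qed
  have mono: "?D \<subseteq> ?D'"
  proof -
    have "(S(v := row_pattern r (Suc c))) u i j \<Longrightarrow> (S(v := row_pattern r c)) u i j" for u i j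
      by (auto simp: row_pattern_def split: if_splits)
    then show ?thesis by (auto elim!: saturationE intro!: saturationI)
  qed
  have down: "(\<exists>t. a t y \<in> ?D) \<or> b 0 y \<in> ?D" if "y \<in> ?D'" for y
  proof -
    obtain g g' where y: "y \<in> rep_space G d" and g: "gl_pair G d g g'"
      "\<And>u i j. u \<in> verts G \<Longrightarrow> i < d u \<Longrightarrow> j < d u \<Longrightarrow> (S(v := row_pattern r (Suc c))) u i j \<Longrightarrow> g u $$ (i, j) = 0"
      "base_change G g g' y \<in> C"
      using \<open>y \<in> ?D'\<close> by (rule saturationE) blast
    have gv: "g v \<in> carrier_mat ?n ?n" using g(1) v unfolding gl_pair_def by auto
    have gz: "g v $$ (i, j) = 0" if "i < ?n" "j < ?n" "row_pattern r (Suc c) i j" for i j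
      using g(2)[OF v, of i j] that by simp
    show ?thesis
    proof (cases "g v $$ (r, Suc c) = 0")
      case True
      have *: "g u $$ (i, j) = 0" if "u \<in> verts G" "i < d u" "j < d u" "(S(v := row_pattern r c)) u i j" for u i j
      proof (cases "u = v")
        case True': True
        then show ?thesis
          using that gz[of i j] True by (cases "i = r \<and> j = Suc c") (auto simp: row_pattern_def)
      next
        case False then show ?thesis using g(2)[of u i j] that by simp
      qed
      have "y \<in> ?D" by (rule saturationI[OF y g(1) * g(3)])
      then show ?thesis using b0[OF y] by simp
    next
      case False
      \<comment> \<open>The parameter for which the column operation \<open>?A t\<close> cancels the
        entry \<open>(r, Suc c)\<close>. When that entry is already zero, the point at infinity,
        that is the identity, does the job.\<close>
      define t where "t = - (g v $$ (r, c)) / g v $$ (r, Suc c)"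
      have t: "g v $$ (r, c) + g v $$ (r, Suc c) * t = 0" using False by (simp add: t_def)
      have "a t y \<in> ?D"
      proof (rule saturation_shift[where B = "?A' t" and B' = "?A t", OF _ _ _ _ ar[OF y] v g(1)])
        fix i j assume ij: "i < ?n" "j < ?n" "(S(v := row_pattern r c)) v i j"
        then show "(g v * ?A t) $$ (i, j) = 0"
          unfolding index_mult_block2[OF gv rc(2) ij(1,2)]
          using gz[of i c] gz[of i "Suc c"] gz[of i j] rc t by (auto simp: row_pattern_def)
      next
        fix u i j assume "u \<in> verts G" "i < d u" "j < d u" "u \<noteq> v" "(S(v := row_pattern r c)) u i j"
        then show "g u $$ (i, j) = 0" using g(2)[of u i j] by simp
      next
        show "base_change G g g' (base_change G (at_vertex d v (?A t)) (at_vertex d v (?A' t)) (a t y)) \<in> C"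
          unfolding a_def base_change_inverse[OF glA y] by (rule g(3))
      qed (simp_all add: bl)
      then show ?thesis by blast
    qed
  qed
  have eq: "?D' = {x \<in> rep_space G d. (\<exists>t. a t x \<in> ?D) \<or> b 0 x \<in> ?D}" (is "_ = ?R")
  proof (intro equalityI subsetI)
    fix y assume y: "y \<in> ?D'"
    then have "y \<in> rep_space G d" by (simp add: saturation_def)
    then show "y \<in> ?R" using down[OF y] by blast
  next
    fix y assume "y \<in> ?R"
    then show "y \<in> ?D'" using up b0 mono by auto
  qed
  show ?thesis unfolding eq by (rule closedin_projective_line[OF cl a b]) (rule ab)
qed

text \<open>With \<open>c = r\<close> the pattern says that the rows up to \<open>r\<close> are
  lower triangular; with \<open>c\<close> the last column it leaves row \<open>r\<close>
  unrestricted. The induction on \<open>c\<close> frees row \<open>r\<close> from the diagonal to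
  the right.\<close>

lemma closedin_saturation_row:
  fixes C :: "('b \<Rightarrow> 'k::alg_closed_field mat) set"
  assumes v: "v \<in> verts G" and r: "Suc r \<le> d v"
    and cl: "closedin (zariski G d) (saturation G d C (S(v := \<lambda>i j. i < Suc r \<and> i < j)))"
  shows "closedin (zariski G d) (saturation G d C (S(v := \<lambda>i j. i < r \<and> i < j)))"
proof -
  have "closedin (zariski G d) (saturation G d C (S(v := row_pattern r c)))" if "r \<le> c" "c < d v" for c
    using that
  proof (induction c rule: dec_induct)
    case base
    have "row_pattern r r = (\<lambda>i j. i < Suc r \<and> i < j)" by (auto simp: row_pattern_def fun_eq_iff)
    then show ?case using cl by (simp only:)
  next
    case (step c)
    show ?case
      by (rule closedin_saturation_step[OF v step.hyps(1)]) (use step.prems in simp, rule step.IH, use step.prems in simp)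
  qed
  then have "closedin (zariski G d) (saturation G d C (S(v := row_pattern r (d v - 1))))" using r by simp
  also have "saturation G d C (S(v := row_pattern r (d v - 1))) =
      saturation G d C (S(v := \<lambda>i j. i < r \<and> i < j))"
    by (rule saturation_cong) (auto simp: row_pattern_def)
  finally show ?thesis .
qed

text \<open>Rows are freed from the bottom upwards, because the step for row \<open>r\<close> relies
  on the zeros of the rows above it.\<close>

lemma closedin_saturation_vertex:
  fixes C :: "('b \<Rightarrow> 'k::alg_closed_field mat) set"
  assumes v: "v \<in> verts G" 
    and cl: "closedin (zariski G d) (saturation G d C (S(v := \<lambda>i j. i < j)))"
  shows "closedin (zariski G d) (saturation G d C (S(v := \<lambda>i j. False)))"
proof -
  have "closedin (zariski G d) (saturation G d C (S(v := \<lambda>i j. i < r \<and> i < j)))" if "r \<le> d v" for r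
    using that
  proof (induction r rule: inc_induct)
    case base
    have "saturation G d C (S(v := \<lambda>i j. i < j)) = saturation G d C (S(v := \<lambda>i j. i < d v \<and> i < j))"
      by (rule saturation_cong) auto
    then show ?case using cl by (simp only:)
  next
    case (step r)
    show ?case by (rule closedin_saturation_row[OF v]) (use step.hyps in simp, rule step.IH)
  qed
  from this[of 0] show ?thesis by simp
qed

section \<open>Coordinate subspaces stable under the Borel subgroup, and their saturation\<close>

definition (in -) block_locus ::
  "('v, 'a) pre_digraph \<Rightarrow> ('v \<Rightarrow> nat) \<Rightarrow> ('a \<times> nat \<times> nat) set \<Rightarrow> ('a \<Rightarrow> 'k::field mat) set" where
  "block_locus Q d Z = {x \<in> rep_space Q d. \<forall>\<alpha> i j. (\<alpha>, i, j) \<in> coords Q d \<inter> Z \<longrightarrow> x \<alpha> $$ (i, j) = 0}"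

lemma (in -) closedin_block_locus: "closedin (zariski Q d) (block_locus Q d Z)"
  unfolding closedin_zariski_iff
proof (intro conjI ballI)
  fix x assume "x \<in> rep_space Q d - block_locus Q d Z"
  then obtain \<alpha> i j where *: "(\<alpha>, i, j) \<in> coords Q d" "(\<alpha>, i, j) \<in> Z" "x \<alpha> $$ (i, j) \<noteq> 0"
    by (auto simp: block_locus_def)
  then show "\<exists>h. polyfun Q d h \<and> h x \<noteq> 0 \<and> (\<forall>y\<in>block_locus Q d Z. h y = 0)"
    by (intro exI[of _ "\<lambda>x. x \<alpha> $$ (i, j)"]) (auto simp: block_locus_def polyfun_coord)
qed (auto simp: block_locus_def)

end

context fin_digraph
begin

text \<open>The hypothesis on \<open>Z\<close> lets zeros propagate upwards and to the right, which
  makes the coordinate subspace stable under lower triangular base change. Its saturation under the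
  Borel subgroup is thus the subspace itself, and the vertices are then released one at a
  time.\<close>

theorem closedin_gl_saturation:
  fixes C :: "('b \<Rightarrow> 'k::alg_closed_field mat) set"
  assumes Z: "\<And>\<alpha> i j i' j'. (\<alpha>, i, j) \<in> Z \<Longrightarrow> i' \<le> i \<Longrightarrow> j \<le> j' \<Longrightarrow> (\<alpha>, i', j') \<in> Z"
  shows "closedin (zariski G d) {x :: 'b \<Rightarrow> 'k mat. x \<in> rep_space G d \<and>
    (\<exists>g g'. gl_pair G d g g' \<and> base_change G g g' x \<in> block_locus G d Z)}"
proof -
  let ?C = "block_locus G d Z :: ('b \<Rightarrow> 'k mat) set"
  let ?S = "\<lambda>W v. if v \<in> W then (\<lambda>i j. False) else (\<lambda>i j :: nat. i < j)"
  have base: "saturation G d ?C (?S {}) = ?C"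
  proof (intro equalityI subsetI)
    fix x assume x: "x \<in> ?C"
    then have xr: "x \<in> rep_space G d" by (simp add: block_locus_def)
    have "gl_pair G d (\<lambda>v. 1\<^sub>m (d v)) (\<lambda>v. 1\<^sub>m (d v))" by (simp add: gl_pair_def)
    moreover have "base_change G (\<lambda>v. 1\<^sub>m (d v)) (\<lambda>v. 1\<^sub>m (d v)) x = x"
      using xr by (intro base_change_one) auto
    ultimately show "x \<in> saturation G d ?C (?S {})" using x xr by (intro saturationI) auto
  next
    fix x assume "x \<in> saturation G d ?C (?S {})"
    then obtain g g' where x: "x \<in> rep_space G d" and gl: "gl_pair G d g g'"
      and low: "\<And>v i j. v \<in> verts G \<Longrightarrow> i < d v \<Longrightarrow> j < d v \<Longrightarrow> i < j \<Longrightarrow> g v $$ (i, j) = 0"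
      and y: "base_change G g g' x \<in> ?C" by (rule saturationE) auto
    define y where "y = base_change G g g' x"
    have yr: "y \<in> rep_space G d" using base_change_closed[OF gl x] by (simp add: y_def)
    have xy: "x = base_change G g' g y" using base_change_inverse[OF gl x] by (simp add: y_def)
    have low': "g' v $$ (i, j) = 0" if "v \<in> verts G" "i < d v" "j < d v" "i < j" for v i j
      using lower_triangular_inverse[of "g v" "d v" "g' v" i j] gl low that unfolding gl_pair_def by auto
    have "x \<alpha> $$ (i, j) = 0" if ij: "(\<alpha>, i, j) \<in> coords G d" "(\<alpha>, i, j) \<in> Z" for \<alpha> i j
    proof -
      have \<alpha>: "\<alpha> \<in> arcs G" and i: "i < d (head G \<alpha>)" and j: "j < d (tail G \<alpha>)"
        using ij by (auto simp: coords_def)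
      let ?h = "head G \<alpha>" and ?t = "tail G \<alpha>"
      have c: "g' ?h \<in> carrier_mat (d ?h) (d ?h)" "g ?t \<in> carrier_mat (d ?t) (d ?t)"
        using gl \<alpha> unfolding gl_pair_def by auto
      have "x \<alpha> $$ (i, j) = (\<Sum>q<d ?t. \<Sum>p<d ?h. g' ?h $$ (i, p) * y \<alpha> $$ (p, q) * g ?t $$ (q, j))"
        using \<alpha> index_mult_mat3[OF c(1) rep_space_carrier[OF yr \<alpha>] c(2) i j]
        by (simp add: xy base_change_def)
      also have "\<dots> = 0"
      proof (intro sum.neutral ballI)
        fix q p assume qp: "q \<in> {..<d ?t}" "p \<in> {..<d ?h}"
        show "g' ?h $$ (i, p) * y \<alpha> $$ (p, q) * g ?t $$ (q, j) = 0"
        \<comment> \<open>By triangularity the outer factors are both nonzero only if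
          \<open>p \<le> i\<close> and \<open>j \<le> q\<close>, and then the position in the middle
          belongs to \<open>Z\<close> again.\<close>
        proof (cases "p \<le> i \<and> j \<le> q")
          case True
          then have "(\<alpha>, p, q) \<in> Z" using Z ij(2) by blast
          moreover have "(\<alpha>, p, q) \<in> coords G d" using \<alpha> qp by (simp add: coords_def)
          ultimately have "y \<alpha> $$ (p, q) = 0" using y by (auto simp: y_def block_locus_def)
          then show ?thesis by simp
        next
          case False
          then show ?thesis using low[of ?t q j] low'[of ?h i p] \<alpha> i j qp by auto
        qed
      qed
      finally show ?thesis .
    qed
    then show "x \<in> ?C" using x by (auto simp: block_locus_def)
  qed
  have "closedin (zariski G d) (saturation G d ?C (?S W))" if "finite W" "W \<subseteq> verts G" for W
    using that
  proof (induction W rule: finite_induct)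
    case empty
    then show ?case using closedin_block_locus by (simp only: base)
  next
    case (insert v W)
    have *: "?S W = (?S W)(v := \<lambda>i j. i < j)" "?S (insert v W) = (?S W)(v := \<lambda>i j. False)"
      using insert by (auto simp: fun_eq_iff)
    show ?case unfolding *(2) using insert *(1)
      by (intro closedin_saturation_vertex) auto
  qed
  from this[OF finite_verts subset_refl]
  have "closedin (zariski G d) (saturation G d ?C (?S (verts G)))" .
  also have "saturation G d ?C (?S (verts G)) = {x \<in> rep_space G d.
    (\<exists>g g'. gl_pair G d g g' \<and> base_change G g g' x \<in> ?C)}"
    by (auto simp: saturation_def)
  finally show ?thesis by simp
qed

end

section \<open>Paths by length, admissible ideals, and the Jacobson radical\<close>

section \<open>The path algebra and its radical\<close>

text \<open>For a finite quiver this is the \<open>l\<close>-th power of the arrow ideal, described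
  by supports so that membership can be read off the paths that occur.\<close>

definition long_paths :: "('v, 'a) pre_digraph \<Rightarrow> nat \<Rightarrow> (('v, 'a) qpath \<Rightarrow>\<^sub>0 'k::field) set" where
  "long_paths Q l = {f. Poly_Mapping.keys f \<subseteq> paths Q \<and> (\<forall>\<pi>\<in>Poly_Mapping.keys f. l \<le> length (snd \<pi>))}"

lemma path_end_Nil [simp]: "path_end Q (u, []) = u"
  by (simp add: path_end_def pre_digraph.awalk_verts.simps)

lemma path_end_Cons [simp]: "path_end Q (u, \<alpha> # p) = path_end Q (head Q \<alpha>, p)"
  using path_end_append[of Q u "[\<alpha>]" p] by (simp add: path_end_def pre_digraph.awalk_verts.simps)

lemma keys_path_mult:
  "Poly_Mapping.keys (path_mult Q f g) \<subseteq>
    {(fst \<rho>, snd \<rho> @ snd \<sigma>) |\<sigma> \<rho>. \<sigma> \<in> Poly_Mapping.keys f \<and> \<rho> \<in> Poly_Mapping.keys g \<and> path_end Q \<rho> = fst \<sigma>}"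
  unfolding path_mult_def
proof (intro keys_sum_subset)
  fix \<sigma> \<rho> assume *: "\<sigma> \<in> Poly_Mapping.keys f" "\<rho> \<in> Poly_Mapping.keys g"
  show "Poly_Mapping.keys (if path_end Q \<rho> = fst \<sigma> then Poly_Mapping.single (fst \<rho>, snd \<rho> @ snd \<sigma>)
      (Poly_Mapping.lookup f \<sigma> * Poly_Mapping.lookup g \<rho>) else 0) \<subseteq>
    {(fst \<rho>, snd \<rho> @ snd \<sigma>) |\<sigma> \<rho>. \<sigma> \<in> Poly_Mapping.keys f \<and> \<rho> \<in> Poly_Mapping.keys g \<and> path_end Q \<rho> = fst \<sigma>}" (is "_ \<subseteq> ?R")
  proof (cases "path_end Q \<rho> = fst \<sigma>")
    case True
    then have "(fst \<rho>, snd \<rho> @ snd \<sigma>) \<in> ?R" using *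
      by (intro CollectI exI[of _ \<sigma>] exI[of _ \<rho>] conjI refl)
    then show ?thesis by simp
  qed simp
qed

text \<open>A trivial path is a product of two paths only if both are trivial. For a vertex
  \<open>v\<close> this makes reading off the coefficient at \<open>(v, [])\<close> the
  one-dimensional representation at \<open>v\<close>.\<close>

lemma lookup_path_mult_trivial:
  fixes f g :: "('v, 'a) qpath \<Rightarrow>\<^sub>0 'k::field"
  shows "Poly_Mapping.lookup (path_mult Q f g) (v, []) =
    Poly_Mapping.lookup f (v, []) * Poly_Mapping.lookup g (v, [])"
proof -
  have "Poly_Mapping.lookup (path_mult Q f g) (v, []) =
    (\<Sum>\<sigma>\<in>Poly_Mapping.keys f. \<Sum>\<rho>\<in>Poly_Mapping.keys g.
      if \<rho> = (v, []) then (if \<sigma> = (v, []) then Poly_Mapping.lookup f (v, []) * Poly_Mapping.lookup g (v, []) else 0) else 0)"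
    unfolding path_mult_def lookup_sum
  proof (intro sum.cong refl)
    fix \<sigma> \<rho> :: "('v, 'a) qpath"
    obtain u p w q where "\<sigma> = (u, p)" "\<rho> = (w, q)" by (cases \<sigma>; cases \<rho>)
    then show "Poly_Mapping.lookup (if path_end Q \<rho> = fst \<sigma> then Poly_Mapping.single (fst \<rho>, snd \<rho> @ snd \<sigma>)
          (Poly_Mapping.lookup f \<sigma> * Poly_Mapping.lookup g \<rho>) else 0) (v, []) =
        (if \<rho> = (v, []) then (if \<sigma> = (v, []) then Poly_Mapping.lookup f (v, []) * Poly_Mapping.lookup g (v, []) else 0) else 0)"
      by (cases p; cases q) (auto simp: lookup_single when_def)
  qed
  also have "\<dots> = Poly_Mapping.lookup f (v, []) * Poly_Mapping.lookup g (v, [])"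
    by (cases "Poly_Mapping.lookup g (v, []) = 0") (auto simp: sum.delta in_keys_iff)
  finally show ?thesis .
qed

lemma path_algebra_simps [simp]:
  "carrier (path_algebra Q) = {f. Poly_Mapping.keys f \<subseteq> paths Q}"
  "mult (path_algebra Q) = path_mult Q" "zero (path_algebra Q) = 0" "add (path_algebra Q) = (+)"
  "one (path_algebra Q) = (\<Sum>v\<in>verts Q. Poly_Mapping.single (v, []) 1)"
  by (simp_all add: path_algebra_def)

text \<open>The sum of \<open>A\<close> and the left ideal generated by \<open>a\<close>, against
  which the maximality of a left ideal is tested.\<close>

lemma (in ring) left_ideal_insert:
  assumes "left_ideal A R" "a \<in> carrier R"
  shows "left_ideal {m \<oplus> r \<otimes> a |m r. m \<in> A \<and> r \<in> carrier R} R"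
proof -
  interpret A: additive_subgroup A R using assms(1) by (simp add: left_ideal_def)
  have l: "r \<otimes> m \<in> A" if "r \<in> carrier R" "m \<in> A" for r m
    using assms(1) that by (simp add: left_ideal_def)
  show ?thesis
    unfolding left_ideal_def
  proof (intro conjI ballI additive_subgroup.intro add.subgroupI)
    have "\<zero> \<oplus> \<zero> \<otimes> a \<in> {m \<oplus> r \<otimes> a |m r. m \<in> A \<and> r \<in> carrier R}"
      using A.zero_closed zero_closed by (intro CollectI exI[of _ "\<zero>"] conjI refl)
    then show "{m \<oplus> r \<otimes> a |m r. m \<in> A \<and> r \<in> carrier R} \<noteq> {}" by blast
  next
    fix x assume "x \<in> {m \<oplus> r \<otimes> a |m r. m \<in> A \<and> r \<in> carrier R}"
    then obtain m r where x: "x = m \<oplus> r \<otimes> a" "m \<in> A" "r \<in> carrier R" by blast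
    then have "\<ominus> x = (\<ominus> m) \<oplus> (\<ominus> r) \<otimes> a" using assms(2) by (simp add: minus_add l_minus)
    then show "\<ominus> x \<in> {m \<oplus> r \<otimes> a |m r. m \<in> A \<and> r \<in> carrier R}" using x by blast
    fix s assume s: "s \<in> carrier R"
    then have "s \<otimes> x = (s \<otimes> m) \<oplus> (s \<otimes> r) \<otimes> a" using x assms(2) by (simp add: r_distr m_assoc)
    then show "s \<otimes> x \<in> {m \<oplus> r \<otimes> a |m r. m \<in> A \<and> r \<in> carrier R}" using x s l by blast
  next
    fix x y assume "x \<in> {m \<oplus> r \<otimes> a |m r. m \<in> A \<and> r \<in> carrier R}"
      "y \<in> {m \<oplus> r \<otimes> a |m r. m \<in> A \<and> r \<in> carrier R}"
    then obtain m r m' r' where x: "x = m \<oplus> r \<otimes> a" "m \<in> A" "r \<in> carrier R"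
      "y = m' \<oplus> r' \<otimes> a" "m' \<in> A" "r' \<in> carrier R" by blast
    then have "x \<oplus> y = (m \<oplus> m') \<oplus> (r \<oplus> r') \<otimes> a" using assms(2) by (simp add: l_distr a_ac)
    then show "x \<oplus> y \<in> {m \<oplus> r \<otimes> a |m r. m \<in> A \<and> r \<in> carrier R}" using x by blast
  qed (use assms(2) in auto)
qed

locale admissible_quiver = fin_digraph Q
  for Q :: "('v, 'a) pre_digraph" +
  fixes I :: "(('v, 'a) qpath \<Rightarrow>\<^sub>0 'k::field) set"
  assumes admissible: "admissible_ideal Q I"
begin

abbreviation KQ :: "(('v, 'a) qpath \<Rightarrow>\<^sub>0 'k) ring" where "KQ \<equiv> path_algebra Q"
abbreviation \<Lambda> :: "(('v, 'a) qpath \<Rightarrow>\<^sub>0 'k) set ring" where "\<Lambda> \<equiv> quiver_algebra Q I"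
abbreviation L :: nat where "L \<equiv> max_path_length Q I"
abbreviation cl :: "(('v, 'a) qpath \<Rightarrow>\<^sub>0 'k) \<Rightarrow> (('v, 'a) qpath \<Rightarrow>\<^sub>0 'k) set" where
  "cl f \<equiv> I +>\<^bsub>KQ\<^esub> f"
abbreviation Jac :: "(('v, 'a) qpath \<Rightarrow>\<^sub>0 'k) set set" where "Jac \<equiv> jacobson_radical \<Lambda>"

sublocale KQ: ring KQ by (rule ring_path_algebra) (rule fin_digraph_axioms)
sublocale idl: ideal I KQ using admissible by (simp add: admissible_ideal_def)
sublocale \<Lambda>: ring \<Lambda> by (rule idl.quotient_is_ring)
sublocale cl: ring_hom_ring KQ \<Lambda> cl by (rule idl.rcos_ring_hom_ring)

lemma long_paths_carrier: "f \<in> long_paths Q l \<Longrightarrow> f \<in> carrier KQ"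
  by (simp add: long_paths_def)

lemma long_paths_0: "long_paths Q 0 = carrier KQ"
  by (auto simp: long_paths_def)

lemma long_paths_mult:
  assumes "f \<in> long_paths Q k" "g \<in> long_paths Q l"
  shows "path_mult Q f g \<in> long_paths Q (k + l)"
proof -
  have "Poly_Mapping.keys (path_mult Q f g) \<subseteq> paths Q"
    using path_mult_carrier[OF _ _ wf_digraph, of f g] assms by (simp add: long_paths_def)
  moreover have "k + l \<le> length (snd \<pi>)" if "\<pi> \<in> Poly_Mapping.keys (path_mult Q f g)" for \<pi>
  proof -
    obtain \<sigma> \<rho> where "\<pi> = (fst \<rho>, snd \<rho> @ snd \<sigma>)" "\<sigma> \<in> Poly_Mapping.keys f" "\<rho> \<in> Poly_Mapping.keys g"
      using subsetD[OF keys_path_mult \<open>\<pi> \<in> _\<close>] by blast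
    moreover from this have "k \<le> length (snd \<sigma>)" "l \<le> length (snd \<rho>)"
      using assms unfolding long_paths_def by blast+
    ultimately show ?thesis by simp
  qed
  ultimately show ?thesis by (simp add: long_paths_def)
qed

lemma long_paths_antimono: "k \<le> l \<Longrightarrow> long_paths Q l \<subseteq> long_paths Q k"
  by (auto simp: long_paths_def)

lemma uminus_KQ: "f \<in> carrier KQ \<Longrightarrow> \<ominus>\<^bsub>KQ\<^esub> f = - f"
  by (rule KQ.minus_equality) (auto simp: in_keys_iff)

lemma ideal_long_paths: "ideal (long_paths Q l) KQ"
proof (rule idealI)
  show "ring KQ" by (rule KQ.ring_axioms)
  show "subgroup (long_paths Q l) (add_monoid KQ)"
  proof (rule KQ.add.subgroupI)
    have "(0 :: ('v, 'a) qpath \<Rightarrow>\<^sub>0 'k) \<in> long_paths Q l" by (simp add: long_paths_def)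
    then show "(long_paths Q l :: (('v, 'a) qpath \<Rightarrow>\<^sub>0 'k) set) \<noteq> {}" by blast
    fix f :: "('v, 'a) qpath \<Rightarrow>\<^sub>0 'k" assume f: "f \<in> long_paths Q l"
    then show "\<ominus>\<^bsub>KQ\<^esub> f \<in> long_paths Q l"
      by (subst uminus_KQ) (auto simp: long_paths_def in_keys_iff)
    fix g :: "('v, 'a) qpath \<Rightarrow>\<^sub>0 'k" assume g: "g \<in> long_paths Q l"
    show "f \<oplus>\<^bsub>KQ\<^esub> g \<in> long_paths Q l"
      using f g keys_add[of f g] unfolding long_paths_def by auto
  qed (auto simp: long_paths_def)
  fix f g :: "('v, 'a) qpath \<Rightarrow>\<^sub>0 'k" assume *: "f \<in> long_paths Q l" "g \<in> carrier KQ"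
  then have g: "g \<in> long_paths Q 0" by (simp add: long_paths_0)
  show "g \<otimes>\<^bsub>KQ\<^esub> f \<in> long_paths Q l" using long_paths_mult[OF g *(1)] by simp
  show "f \<otimes>\<^bsub>KQ\<^esub> g \<in> long_paths Q l" using long_paths_mult[OF *(1) g] by simp
qed

lemma sum_singles_mem:
  assumes H: "additive_subgroup H KQ" and f: "\<And>\<pi>. \<pi> \<in> Poly_Mapping.keys f \<Longrightarrow> Poly_Mapping.single \<pi> (Poly_Mapping.lookup f \<pi>) \<in> H"
  shows "f \<in> H"
proof -
  have "(\<Sum>\<pi>\<in>A. Poly_Mapping.single \<pi> (Poly_Mapping.lookup f \<pi>)) \<in> H"
    if "finite A" "A \<subseteq> Poly_Mapping.keys f" for A
    using that
  proof (induction A rule: finite_induct)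
    case empty
    then show ?case using additive_subgroup.zero_closed[OF H] by simp
  next
    case (insert \<pi> A)
    then show ?case using additive_subgroup.a_closed[OF H f] by simp
  qed
  from this[OF finite_keys subset_refl] show ?thesis by (simp add: poly_mapping_eq_sum_single)
qed

lemma trivial_path: "v \<in> verts Q \<Longrightarrow> (v, []) \<in> paths Q"
  by (simp add: paths_def awalk_Nil_iff)

lemma arrow_path: "\<alpha> \<in> arcs Q \<Longrightarrow> (tail Q \<alpha>, [\<alpha>]) \<in> paths Q"
  by (simp add: paths_def awalk_Cons_iff awalk_Nil_iff)

lemma path_ends: "\<pi> \<in> paths Q \<Longrightarrow> fst \<pi> \<in> verts Q \<and> path_end Q \<pi> \<in> verts Q"
  unfolding paths_def by (auto dest: awalk_hd_in_verts awalk_last_in_verts)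

lemma path_end_awalk: "awalk u p v \<Longrightarrow> path_end Q (u, p) = v"
  by (simp add: path_end_def)

lemma path_snoc:
  assumes "(u, p @ [\<alpha>]) \<in> paths Q"
  shows "(u, p) \<in> paths Q" "\<alpha> \<in> arcs Q" "path_end Q (u, p) = tail Q \<alpha>"
proof -
  have "awalk u p (tail Q \<alpha>)" "\<alpha> \<in> arcs Q"
    using assms unfolding paths_def by (auto simp: path_end_append awalk_Cons_iff awalk_Nil_iff)
  then show "(u, p) \<in> paths Q" "\<alpha> \<in> arcs Q" "path_end Q (u, p) = tail Q \<alpha>"
    using path_end_awalk[of u p "tail Q \<alpha>"] by (simp_all add: paths_def)
qed

lemma ideal_arrow_ideal: "ideal (arrow_ideal Q) KQ"
  unfolding arrow_ideal_def by (rule KQ.genideal_ideal) (auto simp: arrow_path)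

lemma arrow_in_arrow_ideal:
  "\<alpha> \<in> arcs Q \<Longrightarrow> Poly_Mapping.single (tail Q \<alpha>, [\<alpha>]) 1 \<in> (arrow_ideal Q :: (('v, 'a) qpath \<Rightarrow>\<^sub>0 'k) set)"
  unfolding arrow_ideal_def by (rule subsetD[OF KQ.genideal_self]) (auto simp: arrow_path)

lemma arrow_ideal_subset: "arrow_ideal Q \<subseteq> (long_paths Q 1 :: (('v, 'a) qpath \<Rightarrow>\<^sub>0 'k) set)"
  unfolding arrow_ideal_def
  by (rule KQ.genideal_minimal[OF ideal_long_paths]) (auto simp: long_paths_def arrow_path)

text \<open>Admissibility puts \<open>I\<close> into the square of the arrow ideal, hence into the
  arrow ideal; so no trivial path occurs in an element of \<open>I\<close>.\<close>

lemma I_subset: "I \<subseteq> long_paths Q 1"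
proof -
  have "ideal (ideal_prod KQ (arrow_ideal Q) (carrier KQ)) KQ"
    by (rule KQ.ideal_prod_is_ideal[OF ideal_arrow_ideal KQ.oneideal])
  then have "ideal_prod KQ (arrow_ideal Q) (ideal_prod KQ (arrow_ideal Q) (carrier KQ)) \<subseteq> arrow_ideal Q"
    using KQ.ideal_prod_inter[OF ideal_arrow_ideal] by blast
  then show ?thesis
    using admissible arrow_ideal_subset by (auto simp: admissible_ideal_def numeral_2_eq_2)
qed

lemma path_in_ideal_power:
  "(u, p) \<in> paths Q \<Longrightarrow> Poly_Mapping.single (u, p) 1 \<in> ideal_power KQ (arrow_ideal Q) (length p)"
proof (induction p rule: rev_induct)
  case Nil then show ?case by simp
next
  case (snoc \<alpha> p)
  note * = path_snoc[OF snoc.prems]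
  have "Poly_Mapping.single (u, p @ [\<alpha>]) (1 :: 'k) =
      Poly_Mapping.single (tail Q \<alpha>, [\<alpha>]) 1 \<otimes>\<^bsub>KQ\<^esub> Poly_Mapping.single (u, p) 1"
    by (simp add: path_mult_single *(3))
  also have "\<dots> \<in> ideal_power KQ (arrow_ideal Q) (Suc (length p))"
    unfolding ideal_power.simps
    by (rule ideal_prod.prod[OF arrow_in_arrow_ideal[OF *(2)] snoc.IH[OF *(1)]])
  finally show ?case by simp
qed

text \<open>An ideal of the ring \<open>KQ\<close> is not by definition a subspace; scaling a path
  by \<open>c\<close> is left multiplication by \<open>c\<close> times the trivial path at its
  end.\<close>

lemma single_in_I:
  assumes "(u, p) \<in> paths Q" "Poly_Mapping.single (u, p) 1 \<in> I"
  shows "Poly_Mapping.single (u, p) c \<in> I"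
proof -
  have "Poly_Mapping.single (path_end Q (u, p), []) c \<otimes>\<^bsub>KQ\<^esub> Poly_Mapping.single (u, p) 1 \<in> I"
    using assms path_ends[OF assms(1)] by (intro idl.I_l_closed) (auto simp: trivial_path)
  then show ?thesis by (simp add: path_mult_single)
qed

text \<open>The power of the arrow ideal inside \<open>I\<close> is seen to contain the paths of
  length exactly \<open>m\<close>; longer paths follow by multiplying with further arrows on the
  left.\<close>

lemma ex_long_paths_subset: "\<exists>m. long_paths Q m \<subseteq> I"
proof -
  obtain m where m: "ideal_power KQ (arrow_ideal Q) m \<subseteq> I"
    using admissible by (auto simp: admissible_ideal_def)
  have single: "Poly_Mapping.single (u, p) 1 \<in> I" if "(u, p) \<in> paths Q" "m \<le> length p" for u p
    using that
  proof (induction p rule: rev_induct)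
    case Nil then show ?case using path_in_ideal_power[of u "[]"] m by auto
  next
    case (snoc \<alpha> p)
    note * = path_snoc[OF snoc.prems(1)]
    show ?case
    proof (cases "m \<le> length p")
      case True
      then have "Poly_Mapping.single (tail Q \<alpha>, [\<alpha>]) 1 \<otimes>\<^bsub>KQ\<^esub> Poly_Mapping.single (u, p) 1 \<in> I"
        using snoc.IH[OF *(1)] *(2) by (intro idl.I_l_closed) (auto simp: arrow_path)
      then show ?thesis by (simp add: path_mult_single *(3))
    next
      case False
      then have "m = length (p @ [\<alpha>])" using snoc.prems(2) by simp
      then show ?thesis using path_in_ideal_power[OF snoc.prems(1)] m by blast
    qed
  qed
  have "f \<in> I" if f: "f \<in> long_paths Q m" for f
  proof (rule sum_singles_mem[OF idl.additive_subgroup_axioms])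
    fix \<pi> assume "\<pi> \<in> Poly_Mapping.keys f"
    then have "\<pi> \<in> paths Q" "m \<le> length (snd \<pi>)" using f by (auto simp: long_paths_def)
    then show "Poly_Mapping.single \<pi> (Poly_Mapping.lookup f \<pi>) \<in> I"
      using single_in_I[of "fst \<pi>" "snd \<pi>"] single[of "fst \<pi>" "snd \<pi>"] by simp
  qed
  then show ?thesis by blast
qed

text \<open>Paths of length at least some \<open>m\<close> lie in \<open>I\<close>, so the set of
  lengths defining \<open>L\<close> is bounded. Its supremum in the natural numbers is therefore an
  upper bound, and every path longer than \<open>L\<close> lies in \<open>I\<close>.\<close>

lemma long_paths_subset_I: "long_paths Q (Suc L) \<subseteq> I"
proof
  fix f :: "('v, 'a) qpath \<Rightarrow>\<^sub>0 'k" assume f: "f \<in> long_paths Q (Suc L)"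
  obtain m where m: "long_paths Q m \<subseteq> I" using ex_long_paths_subset by blast
  let ?S = "{length (snd \<pi>) |\<pi>. \<pi> \<in> paths Q \<and> Poly_Mapping.single \<pi> 1 \<notin> I}"
  have bdd: "bdd_above ?S"
  proof (rule bdd_aboveI)
    fix n assume "n \<in> ?S"
    then obtain \<pi> where \<pi>: "n = length (snd \<pi>)" "\<pi> \<in> paths Q" "Poly_Mapping.single \<pi> 1 \<notin> I" by blast
    then have "Poly_Mapping.single \<pi> (1 :: 'k) \<notin> long_paths Q m" using m by blast
    then show "n \<le> m" using \<pi> by (auto simp: long_paths_def)
  qed
  show "f \<in> I"
  proof (rule sum_singles_mem[OF idl.additive_subgroup_axioms])
    fix \<pi> assume \<pi>: "\<pi> \<in> Poly_Mapping.keys f"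
    then have p: "\<pi> \<in> paths Q" "Suc L \<le> length (snd \<pi>)" using f by (auto simp: long_paths_def)
    have "Poly_Mapping.single \<pi> 1 \<in> I"
    proof (rule ccontr)
      assume "Poly_Mapping.single \<pi> 1 \<notin> I"
      then have "length (snd \<pi>) \<in> ?S" using p by blast
      then have "length (snd \<pi>) \<le> L" unfolding max_path_length_def by (rule cSup_upper[OF _ bdd])
      then show False using p by simp
    qed
    then show "Poly_Mapping.single \<pi> (Poly_Mapping.lookup f \<pi>) \<in> I"
      using single_in_I[of "fst \<pi>" "snd \<pi>"] p by simp
  qed
qed

lemma carrier_\<Lambda>: "carrier \<Lambda> = cl ` carrier KQ"
  unfolding FactRing_def A_RCOSETS_def RCOSETS_def a_r_coset_def
  by (simp only: partial_object.simps UNION_singleton_eq_range)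

lemma carrier_\<Lambda>E:
  assumes "r \<in> carrier \<Lambda>"
  obtains f where "r = cl f" "f \<in> carrier KQ"
  using assms unfolding carrier_\<Lambda> by (rule imageE)

lemma zero_\<Lambda>: "\<zero>\<^bsub>\<Lambda>\<^esub> = I"
  by (simp add: FactRing_def)

lemma cl_eq_iff:
  assumes "f \<in> carrier KQ" "g \<in> carrier KQ"
  shows "cl f = cl g \<longleftrightarrow> f - g \<in> I"
proof -
  have "f \<ominus>\<^bsub>KQ\<^esub> g = f - g" using assms uminus_KQ[of g] by (simp add: a_minus_def)
  moreover have "cl f = cl g \<longleftrightarrow> f \<in> cl g"
    using assms idl.a_rcos_self idl.a_repr_independence' by metis
  ultimately show ?thesis using idl.a_rcos_module_minus[OF KQ.ring_axioms assms(2,1)] by simp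
qed

lemma lookup_trivial_I: "f \<in> I \<Longrightarrow> Poly_Mapping.lookup f (v, []) = 0"
  using I_subset by (force simp: long_paths_def in_keys_iff)

text \<open>Descending induction on the length \<open>l\<close>. If \<open>f\<close> were outside a
  maximal left ideal \<open>A\<close>, then \<open>1 = a + r f\<close> with \<open>a\<close> in
  \<open>A\<close>, whence \<open>f = f a + f r f\<close>. The first summand is in \<open>A\<close>,
  and the second is made of paths of length at least \<open>2 * l\<close>, so it is in
  \<open>A\<close> by induction.\<close>

lemma long_paths_subset_Jac: "f \<in> long_paths Q 1 \<Longrightarrow> cl f \<in> Jac"
proof -
  assume f1: "f \<in> long_paths Q 1"
  have "cl f \<in> A" if A: "maximal_left_ideal A \<Lambda>" for A
  proof -
    have lA: "left_ideal A \<Lambda>" using A by (simp add: maximal_left_ideal_def)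
    interpret A: additive_subgroup A \<Lambda> using lA by (simp add: left_ideal_def)
    have mA: "r \<otimes>\<^bsub>\<Lambda>\<^esub> a \<in> A" if "r \<in> carrier \<Lambda>" "a \<in> A" for r a
      using lA that by (simp add: left_ideal_def)
    obtain m where m: "long_paths Q m \<subseteq> I" using ex_long_paths_subset by blast
    \<comment> \<open>The descent starts at \<open>max 1 m\<close> so that it reaches length 1 for
      every \<open>m\<close>, including 0.\<close>
    have "\<forall>f\<in>long_paths Q l. cl f \<in> A" if "1 \<le> l" "l \<le> max 1 m" for l
      using that(2,1)
    proof (induction l rule: inc_induct)
      case base
      show ?case
      proof
        fix f :: "('v, 'a) qpath \<Rightarrow>\<^sub>0 'k" assume "f \<in> long_paths Q (max 1 m)"
        then have "f \<in> I" using m long_paths_antimono[of m "max 1 m"] by auto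
        then show "cl f \<in> A" using A.zero_closed by (simp add: idl.a_rcos_const zero_\<Lambda>)
      qed
    next
      case (step l)
      show ?case
      proof (rule ballI, rule ccontr)
        fix f assume f: "f \<in> long_paths Q l" and nf: "cl f \<notin> A"
        have fc: "f \<in> carrier KQ" using f by (rule long_paths_carrier)
        have cf: "cl f \<in> carrier \<Lambda>" using fc by (rule cl.hom_closed)
        let ?B = "{m \<oplus>\<^bsub>\<Lambda>\<^esub> r \<otimes>\<^bsub>\<Lambda>\<^esub> cl f |m r. m \<in> A \<and> r \<in> carrier \<Lambda>}"
        have "left_ideal ?B \<Lambda>" by (rule \<Lambda>.left_ideal_insert[OF lA cf])
        moreover have "A \<subseteq> ?B"
        proof
          fix a assume a: "a \<in> A"
          then have "a = a \<oplus>\<^bsub>\<Lambda>\<^esub> \<zero>\<^bsub>\<Lambda>\<^esub> \<otimes>\<^bsub>\<Lambda>\<^esub> cl f" using cf by simp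
          then show "a \<in> ?B" using a \<Lambda>.zero_closed by (intro CollectI exI conjI)
        qed
        moreover have "cl f \<in> ?B"
        proof -
          have "cl f = \<zero>\<^bsub>\<Lambda>\<^esub> \<oplus>\<^bsub>\<Lambda>\<^esub> \<one>\<^bsub>\<Lambda>\<^esub> \<otimes>\<^bsub>\<Lambda>\<^esub> cl f" using cf by simp
          then show ?thesis using A.zero_closed \<Lambda>.one_closed by (intro CollectI exI conjI)
        qed
        ultimately have "?B = carrier \<Lambda>" using A nf unfolding maximal_left_ideal_def by blast
        then have "\<one>\<^bsub>\<Lambda>\<^esub> \<in> ?B" by simp
        then obtain a r where ar: "\<one>\<^bsub>\<Lambda>\<^esub> = a \<oplus>\<^bsub>\<Lambda>\<^esub> r \<otimes>\<^bsub>\<Lambda>\<^esub> cl f" "a \<in> A" "r \<in> carrier \<Lambda>" by blast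
        obtain h where h: "r = cl h" "h \<in> carrier KQ" using ar(3) by (rule carrier_\<Lambda>E)
        have "cl f = cl f \<otimes>\<^bsub>\<Lambda>\<^esub> (a \<oplus>\<^bsub>\<Lambda>\<^esub> r \<otimes>\<^bsub>\<Lambda>\<^esub> cl f)" using arg_cong[OF ar(1), of "\<lambda>z. cl f \<otimes>\<^bsub>\<Lambda>\<^esub> z"] cf by simp
        also have "\<dots> = cl f \<otimes>\<^bsub>\<Lambda>\<^esub> a \<oplus>\<^bsub>\<Lambda>\<^esub> cl f \<otimes>\<^bsub>\<Lambda>\<^esub> (r \<otimes>\<^bsub>\<Lambda>\<^esub> cl f)"
          using ar cf by (simp add: \<Lambda>.r_distr)
        also have "cl f \<otimes>\<^bsub>\<Lambda>\<^esub> (r \<otimes>\<^bsub>\<Lambda>\<^esub> cl f) = cl (f \<otimes>\<^bsub>KQ\<^esub> (h \<otimes>\<^bsub>KQ\<^esub> f))"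
          using fc h by (simp del: path_algebra_simps)
        finally have eq: "cl f = cl f \<otimes>\<^bsub>\<Lambda>\<^esub> a \<oplus>\<^bsub>\<Lambda>\<^esub> cl (f \<otimes>\<^bsub>KQ\<^esub> (h \<otimes>\<^bsub>KQ\<^esub> f))" .
        have "cl (f \<otimes>\<^bsub>KQ\<^esub> (h \<otimes>\<^bsub>KQ\<^esub> f)) \<in> A"
        proof -
          have "h \<in> long_paths Q 0" using h by (simp add: long_paths_0)
          then have "f \<otimes>\<^bsub>KQ\<^esub> (h \<otimes>\<^bsub>KQ\<^esub> f) \<in> long_paths Q (l + (0 + l))"
            unfolding path_algebra_simps by (intro long_paths_mult f)
          then have "f \<otimes>\<^bsub>KQ\<^esub> (h \<otimes>\<^bsub>KQ\<^esub> f) \<in> long_paths Q (Suc l)"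
            using long_paths_antimono[of "Suc l" "l + (0 + l)"] step.prems by auto
          then show ?thesis using step.IH by simp
        qed
        then have "cl f \<otimes>\<^bsub>\<Lambda>\<^esub> a \<oplus>\<^bsub>\<Lambda>\<^esub> cl (f \<otimes>\<^bsub>KQ\<^esub> (h \<otimes>\<^bsub>KQ\<^esub> f)) \<in> A"
          by (rule A.a_closed[OF mA[OF cf ar(2)]])
        then show False using nf by (simp only: eq[symmetric])
      qed
    qed
    from this[OF order_refl max.cobounded1] show ?thesis using f1 by blast
  qed
  then show ?thesis using f1 cl.hom_closed long_paths_carrier
    unfolding jacobson_radical_def by blast
qed

text \<open>The kernel of the one-dimensional representation at \<open>v\<close>, well defined on
  \<open>\<Lambda>\<close> because elements of \<open>I\<close> have no coefficient at a trivial
  path. Having codimension one, it is maximal.\<close>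

lemma maximal_left_ideal_vertex:
  assumes v: "v \<in> verts Q"
  shows "maximal_left_ideal (cl ` {f \<in> carrier KQ. Poly_Mapping.lookup f (v, []) = 0}) \<Lambda>" (is "maximal_left_ideal ?M \<Lambda>")
  unfolding maximal_left_ideal_def
proof (intro conjI allI impI)
  show "left_ideal ?M \<Lambda>"
    unfolding left_ideal_def
  proof (intro conjI ballI additive_subgroup.intro \<Lambda>.add.subgroupI)
    show "?M \<subseteq> carrier \<Lambda>" unfolding carrier_\<Lambda> by blast
    have "(0 :: ('v, 'a) qpath \<Rightarrow>\<^sub>0 'k) \<in> {f \<in> carrier KQ. Poly_Mapping.lookup f (v, []) = 0}" by simp
    then show "?M \<noteq> {}" by blast
  next
    fix x assume "x \<in> ?M"
    then obtain f where f: "x = cl f" "f \<in> carrier KQ" "Poly_Mapping.lookup f (v, []) = 0" by blast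
    have "\<ominus>\<^bsub>\<Lambda>\<^esub> x = cl (\<ominus>\<^bsub>KQ\<^esub> f)" by (simp only: f(1) cl.hom_a_inv[OF f(2)])
    moreover have "Poly_Mapping.lookup (\<ominus>\<^bsub>KQ\<^esub> f) (v, []) = 0" using f uminus_KQ by simp
    ultimately show "\<ominus>\<^bsub>\<Lambda>\<^esub> x \<in> ?M" using KQ.a_inv_closed[OF f(2)] by blast
    fix r assume "r \<in> carrier \<Lambda>"
    then obtain h where h: "r = cl h" "h \<in> carrier KQ" by (rule carrier_\<Lambda>E)
    have "r \<otimes>\<^bsub>\<Lambda>\<^esub> x = cl (h \<otimes>\<^bsub>KQ\<^esub> f)" using f h by (simp del: path_algebra_simps)
    moreover have "Poly_Mapping.lookup (h \<otimes>\<^bsub>KQ\<^esub> f) (v, []) = 0" using f by (simp add: lookup_path_mult_trivial)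
    ultimately show "r \<otimes>\<^bsub>\<Lambda>\<^esub> x \<in> ?M" using KQ.m_closed[OF h(2) f(2)] by blast
  next
    fix x y assume "x \<in> ?M" "y \<in> ?M"
    then obtain f g where f: "x = cl f" "f \<in> carrier KQ" "Poly_Mapping.lookup f (v, []) = 0"
      and g: "y = cl g" "g \<in> carrier KQ" "Poly_Mapping.lookup g (v, []) = 0" by blast
    have "x \<oplus>\<^bsub>\<Lambda>\<^esub> y = cl (f \<oplus>\<^bsub>KQ\<^esub> g)" using f g by (simp del: path_algebra_simps)
    moreover have "Poly_Mapping.lookup (f \<oplus>\<^bsub>KQ\<^esub> g) (v, []) = 0" using f g by (simp add: lookup_add)
    ultimately show "x \<oplus>\<^bsub>\<Lambda>\<^esub> y \<in> ?M" using KQ.a_closed[OF f(2) g(2)] by blast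
  qed
  let ?e = "\<lambda>c :: 'k. Poly_Mapping.single (v, [] :: 'a list) c"
  have e: "?e c \<in> carrier KQ" for c using trivial_path[OF v] by simp
  show "?M \<noteq> carrier \<Lambda>"
  proof
    assume "?M = carrier \<Lambda>"
    then have "cl (?e 1) \<in> ?M" using cl.hom_closed[OF e] by blast
    then obtain f where f: "cl (?e 1) = cl f" "f \<in> carrier KQ" "Poly_Mapping.lookup f (v, []) = 0" by blast
    then have "?e 1 - f \<in> I" using cl_eq_iff[OF e f(2)] by simp
    from lookup_trivial_I[OF this, of v] show False using f(3) by (simp add: lookup_minus)
  qed
  fix B assume B: "left_ideal B \<Lambda> \<and> ?M \<subseteq> B"
  interpret B: additive_subgroup B \<Lambda> using B by (simp add: left_ideal_def)
  show "B = ?M \<or> B = carrier \<Lambda>"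
  proof (cases "B = ?M")
    case False
    then obtain b where b: "b \<in> B" "b \<notin> ?M" using B by blast
    obtain f where f: "b = cl f" "f \<in> carrier KQ" using B.a_Hcarr[OF b(1)] by (rule carrier_\<Lambda>E)
    define c where "c = Poly_Mapping.lookup f (v, [])"
    have c: "c \<noteq> 0" using b(2) f by (auto simp: c_def)
    have "x \<in> B" if "x \<in> carrier \<Lambda>" for x
    proof -
      obtain h where h: "x = cl h" "h \<in> carrier KQ" using \<open>x \<in> carrier \<Lambda>\<close> by (rule carrier_\<Lambda>E)
      \<comment> \<open>The multiple of the trivial path for which \<open>h\<close> and the product
        of \<open>?g\<close> with \<open>f\<close> have the same coefficient at
        \<open>(v, [])\<close>.\<close>
      let ?g = "?e (Poly_Mapping.lookup h (v, []) / c)"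
      let ?h = "h \<ominus>\<^bsub>KQ\<^esub> ?g \<otimes>\<^bsub>KQ\<^esub> f"
      have gf: "?g \<otimes>\<^bsub>KQ\<^esub> f \<in> carrier KQ" by (rule KQ.m_closed[OF e f(2)])
      have "?h = h - ?g \<otimes>\<^bsub>KQ\<^esub> f" using uminus_KQ[OF gf] by (simp add: a_minus_def)
      then have "Poly_Mapping.lookup ?h (v, []) = 0"
        using c by (simp add: lookup_minus lookup_path_mult_trivial c_def)
      then have 1: "cl ?h \<in> B" using B KQ.minus_closed[OF h(2) gf] by blast
      have 2: "cl ?g \<otimes>\<^bsub>\<Lambda>\<^esub> cl f \<in> B"
        using B b(1) f cl.hom_closed[OF e] by (simp add: left_ideal_def)
      have "?h \<oplus>\<^bsub>KQ\<^esub> ?g \<otimes>\<^bsub>KQ\<^esub> f = h" using uminus_KQ[OF gf] by (simp add: a_minus_def)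
      then have "x = cl (?h \<oplus>\<^bsub>KQ\<^esub> ?g \<otimes>\<^bsub>KQ\<^esub> f)" using h by simp
      also have "\<dots> = cl ?h \<oplus>\<^bsub>\<Lambda>\<^esub> cl ?g \<otimes>\<^bsub>\<Lambda>\<^esub> cl f"
        using cl.hom_add[OF KQ.minus_closed[OF h(2) gf] gf] cl.hom_mult[OF e f(2)] by simp
      finally show ?thesis using 1 2 by simp
    qed
    then show ?thesis using B.a_subset by blast
  qed simp
qed

text \<open>An element of the radical lies in the maximal left ideals at all vertices, so no trivial
  path occurs in a representative of it.\<close>

lemma Jac_eq: "Jac = cl ` long_paths Q 1"
proof (intro equalityI subsetI)
  fix r assume r: "r \<in> Jac"
  then have "r \<in> carrier \<Lambda>" by (simp add: jacobson_radical_def)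
  then obtain f where f: "r = cl f" "f \<in> carrier KQ" by (rule carrier_\<Lambda>E)
  have "Poly_Mapping.lookup f (v, []) = 0" if v: "v \<in> verts Q" for v
  proof -
    have "cl f \<in> cl ` {f \<in> carrier KQ. Poly_Mapping.lookup f (v, []) = 0}"
      using r f maximal_left_ideal_vertex[OF v] unfolding jacobson_radical_def by blast
    then obtain g where g: "cl f = cl g" "g \<in> carrier KQ" "Poly_Mapping.lookup g (v, []) = 0" by blast
    then have "f - g \<in> I" using cl_eq_iff[OF f(2) g(2)] by simp
    from lookup_trivial_I[OF this, of v] show ?thesis using g(3) by (simp add: lookup_minus)
  qed
  then have "1 \<le> length (snd \<pi>)" if "\<pi> \<in> Poly_Mapping.keys f" for \<pi>
    using that path_ends[of \<pi>] f(2) by (cases \<pi>; cases "snd \<pi>") (auto simp: in_keys_iff)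
  then have "f \<in> long_paths Q 1" using f(2) by (auto simp: long_paths_def)
  then show "r \<in> cl ` long_paths Q 1" using f(1) by blast
qed (use long_paths_subset_Jac in blast)

lemma JacE:
  assumes "r \<in> Jac"
  obtains f where "r = cl f" "f \<in> long_paths Q 1"
  using assms unfolding Jac_eq by (rule imageE)

lemma Jac_power_subset: "ideal_power \<Lambda> Jac l \<subseteq> cl ` long_paths Q l"
proof (induction l)
  case 0 then show ?case by (simp add: carrier_\<Lambda> long_paths_0 del: path_algebra_simps)
next
  case (Suc l)
  show ?case
  proof
    fix r assume "r \<in> ideal_power \<Lambda> Jac (Suc l)"
    then have "r \<in> ideal_prod \<Lambda> Jac (ideal_power \<Lambda> Jac l)" by simp
    then show "r \<in> cl ` long_paths Q (Suc l)"
    proof (induction r rule: ideal_prod.induct)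
      case (prod i j)
      obtain f where f: "i = cl f" "f \<in> long_paths Q 1" using prod(1) by (rule JacE)
      obtain g where g: "j = cl g" "g \<in> long_paths Q l" using subsetD[OF Suc prod(2)] by (rule imageE)
      have "i \<otimes>\<^bsub>\<Lambda>\<^esub> j = cl (f \<otimes>\<^bsub>KQ\<^esub> g)"
        using f g cl.hom_mult[OF long_paths_carrier long_paths_carrier] by simp
      moreover have "f \<otimes>\<^bsub>KQ\<^esub> g \<in> long_paths Q (Suc l)" using long_paths_mult[OF f(2) g(2)] by simp
      ultimately show ?case by blast
    next
      case (sum s1 s2)
      then obtain f g where f: "s1 = cl f" "f \<in> long_paths Q (Suc l)" and g: "s2 = cl g" "g \<in> long_paths Q (Suc l)"
        by blast
      have "s1 \<oplus>\<^bsub>\<Lambda>\<^esub> s2 = cl (f \<oplus>\<^bsub>KQ\<^esub> g)"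
        using f g cl.hom_add[OF long_paths_carrier long_paths_carrier] by simp
      moreover have "f \<oplus>\<^bsub>KQ\<^esub> g \<in> long_paths Q (Suc l)"
        using additive_subgroup.a_closed[OF ideal.axioms(1)[OF ideal_long_paths] f(2) g(2)] .
      ultimately show ?case by blast
    qed
  qed
qed

lemma Jac_power_carrier: "ideal_power \<Lambda> Jac l \<subseteq> carrier \<Lambda>"
  using Jac_power_subset[of l] long_paths_carrier unfolding carrier_\<Lambda> by blast

lemma Jac_subset: "Jac \<subseteq> carrier \<Lambda>"
  by (auto simp: jacobson_radical_def)

lemma Jac_left: "r \<in> carrier \<Lambda> \<Longrightarrow> a \<in> Jac \<Longrightarrow> r \<otimes>\<^bsub>\<Lambda>\<^esub> a \<in> Jac"
proof -
  assume "r \<in> carrier \<Lambda>" "a \<in> Jac"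
  then obtain h f where "r = cl h" "h \<in> carrier KQ" "a = cl f" "f \<in> long_paths Q 1"
    by (elim JacE carrier_\<Lambda>E)
  then have "r \<otimes>\<^bsub>\<Lambda>\<^esub> a = cl (h \<otimes>\<^bsub>KQ\<^esub> f)" "h \<otimes>\<^bsub>KQ\<^esub> f \<in> long_paths Q 1"
    using cl.hom_mult[OF _ long_paths_carrier] ideal.I_l_closed[OF ideal_long_paths] by auto
  then show ?thesis by (simp only: Jac_eq imageI)
qed

lemma Jac_power_left: "r \<in> carrier \<Lambda> \<Longrightarrow> a \<in> ideal_power \<Lambda> Jac l \<Longrightarrow> r \<otimes>\<^bsub>\<Lambda>\<^esub> a \<in> ideal_power \<Lambda> Jac l"
proof (induction l)
  case (Suc l)
  from Suc.prems(2) have "a \<in> ideal_prod \<Lambda> Jac (ideal_power \<Lambda> Jac l)" by simp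
  then have "a \<in> carrier \<Lambda> \<and> r \<otimes>\<^bsub>\<Lambda>\<^esub> a \<in> ideal_prod \<Lambda> Jac (ideal_power \<Lambda> Jac l)"
  proof (induction a rule: ideal_prod.induct)
    case (prod i j)
    then have ij: "i \<in> carrier \<Lambda>" "j \<in> carrier \<Lambda>" using Jac_subset Jac_power_carrier by auto
    then have "r \<otimes>\<^bsub>\<Lambda>\<^esub> (i \<otimes>\<^bsub>\<Lambda>\<^esub> j) = (r \<otimes>\<^bsub>\<Lambda>\<^esub> i) \<otimes>\<^bsub>\<Lambda>\<^esub> j" using Suc.prems(1) by (simp add: \<Lambda>.m_assoc)
    then show ?case using ideal_prod.prod[OF Jac_left[OF Suc.prems(1) prod(1)] prod(2)] ij by simp
  next
    case (sum s1 s2)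
    then show ?case using Suc.prems(1) by (auto simp: \<Lambda>.r_distr intro: ideal_prod.sum)
  qed
  then show ?case by simp
qed simp

lemma Jac_power_add:
  "a \<in> ideal_power \<Lambda> Jac l \<Longrightarrow> b \<in> ideal_power \<Lambda> Jac l \<Longrightarrow> a \<oplus>\<^bsub>\<Lambda>\<^esub> b \<in> ideal_power \<Lambda> Jac l"
  by (cases l) (auto intro: ideal_prod.sum)

lemma Jac_power_antimono: "ideal_power \<Lambda> Jac (Suc l) \<subseteq> ideal_power \<Lambda> Jac l"
proof
  fix a assume "a \<in> ideal_power \<Lambda> Jac (Suc l)"
  then have "a \<in> ideal_prod \<Lambda> Jac (ideal_power \<Lambda> Jac l)" by simp
  then show "a \<in> ideal_power \<Lambda> Jac l"
    by (induction a rule: ideal_prod.induct) (use Jac_subset Jac_power_left Jac_power_add in blast)+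
qed

lemma Jac_power_Suc_I:
  "a \<in> Jac \<Longrightarrow> b \<in> ideal_power \<Lambda> Jac l \<Longrightarrow> a \<otimes>\<^bsub>\<Lambda>\<^esub> b \<in> ideal_power \<Lambda> Jac (Suc l)"
  by (simp add: ideal_prod.prod)

text \<open>This is where \<open>L\<close> enters: such an element is represented by paths longer
  than \<open>L\<close>, all of which lie in \<open>I\<close>.\<close>

lemma Jac_power_zero: "a \<in> ideal_power \<Lambda> Jac (Suc L) \<Longrightarrow> a = \<zero>\<^bsub>\<Lambda>\<^esub>"
  using Jac_power_subset[of "Suc L"] long_paths_subset_I by (force simp: zero_\<Lambda> idl.a_rcos_const)

end

section \<open>Linear algebra of flags over a field\<close>

section \<open>Bases adapted to flags of subspaces\<close>

definition lin_subspace :: "nat \<Rightarrow> 'k::field vec set \<Rightarrow> bool" where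
  "lin_subspace n U \<longleftrightarrow> U \<subseteq> carrier_vec n \<and> 0\<^sub>v n \<in> U \<and> (\<forall>u\<in>U. \<forall>w\<in>U. u + w \<in> U) \<and> (\<forall>c. \<forall>u\<in>U. c \<cdot>\<^sub>v u \<in> U)"

text \<open>The columns of \<open>B\<close> induce a basis of \<open>U / W\<close>.\<close>

definition quot_basis :: "nat \<Rightarrow> nat \<Rightarrow> 'k::field mat \<Rightarrow> 'k vec set \<Rightarrow> 'k vec set \<Rightarrow> bool" where
  "quot_basis n m B U W \<longleftrightarrow> B \<in> carrier_mat n m \<and> (\<forall>c\<in>carrier_vec m. B *\<^sub>v c \<in> U) \<and>
     (\<forall>c\<in>carrier_vec m. B *\<^sub>v c \<in> W \<longrightarrow> c = 0\<^sub>v m) \<and>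
     (\<forall>u\<in>U. \<exists>c\<in>carrier_vec m. \<exists>w\<in>W. u = B *\<^sub>v c + w)"

definition hcat :: "'k mat \<Rightarrow> 'k mat \<Rightarrow> 'k mat" where
  "hcat A B = mat (dim_row A) (dim_col A + dim_col B)
     (\<lambda>(i, j). if j < dim_col A then A $$ (i, j) else B $$ (i, j - dim_col A))"

lemma lin_subspaceD:
  assumes "lin_subspace n U"
  shows "u \<in> U \<Longrightarrow> u \<in> carrier_vec n" "0\<^sub>v n \<in> U" "u \<in> U \<Longrightarrow> w \<in> U \<Longrightarrow> u + w \<in> U" "u \<in> U \<Longrightarrow> c \<cdot>\<^sub>v u \<in> U"
  using assms by (auto simp: lin_subspace_def)

lemma lin_subspace_diff:
  assumes "lin_subspace n U" "u + w \<in> U" "w \<in> U" "u \<in> carrier_vec n"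
  shows "u \<in> U"
proof -
  have w: "w \<in> carrier_vec n" using lin_subspaceD(1)[OF assms(1,3)] .
  have "(u + w) + (- 1) \<cdot>\<^sub>v w \<in> U" using lin_subspaceD(3,4)[OF assms(1)] assms(2,3) by blast
  also have "(u + w) + (- 1) \<cdot>\<^sub>v w = u" using w assms(4) by (intro eq_vecI) auto
  finally show ?thesis .
qed

lemma mult_mat_zero_vec: "B \<in> carrier_mat n m \<Longrightarrow> B *\<^sub>v 0\<^sub>v m = (0\<^sub>v n :: 'k::field vec)"
  by (intro eq_vecI) (auto simp: scalar_prod_def)

lemma hcat_carrier: "A \<in> carrier_mat n k \<Longrightarrow> B \<in> carrier_mat n l \<Longrightarrow> hcat A B \<in> carrier_mat n (k + l)"
  by (auto simp: hcat_def)

lemma hcat_mult_vec: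
  assumes A: "A \<in> carrier_mat n k" and B: "B \<in> carrier_mat n l" and c: "c \<in> carrier_vec (k + l)"
  shows "hcat A B *\<^sub>v c = A *\<^sub>v vec k (\<lambda>i. c $ i) + B *\<^sub>v vec l (\<lambda>i. c $ (k + i))"
proof (rule eq_vecI)
  fix i assume "i < dim_vec (A *\<^sub>v vec k (\<lambda>i. c $ i) + B *\<^sub>v vec l (\<lambda>i. c $ (k + i)))"
  then have i: "i < n" using B by simp
  have "(hcat A B *\<^sub>v c) $ i = (\<Sum>j = 0..<k + l. hcat A B $$ (i, j) * c $ j)"
    using i A B c by (simp add: scalar_prod_def hcat_def)
  also have "\<dots> = (\<Sum>j = 0..<k. hcat A B $$ (i, j) * c $ j) + (\<Sum>j = k..<k + l. hcat A B $$ (i, j) * c $ j)"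
    by (simp add: sum.atLeastLessThan_concat)
  also have "(\<Sum>j = k..<k + l. hcat A B $$ (i, j) * c $ j) = (\<Sum>j = 0..<l. hcat A B $$ (i, k + j) * c $ (k + j))"
    using sum.shift_bounds_nat_ivl[of "\<lambda>j. hcat A B $$ (i, j) * c $ j" 0 k l] by (simp add: add.commute)
  also have "(\<Sum>j = 0..<k. hcat A B $$ (i, j) * c $ j) = (A *\<^sub>v vec k (\<lambda>i. c $ i)) $ i"
    using i A B by (simp add: scalar_prod_def hcat_def)
  also have "(\<Sum>j = 0..<l. hcat A B $$ (i, k + j) * c $ (k + j)) = (B *\<^sub>v vec l (\<lambda>i. c $ (k + i))) $ i"
    using i A B by (simp add: scalar_prod_def hcat_def)
  finally show "(hcat A B *\<^sub>v c) $ i = (A *\<^sub>v vec k (\<lambda>i. c $ i) + B *\<^sub>v vec l (\<lambda>i. c $ (k + i))) $ i"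
    using i B by simp
qed (use A B in \<open>simp add: hcat_def\<close>)

text \<open>Padding with zero rows gives a square matrix whose transpose kills a unit vector; its
  determinant is therefore zero.\<close>

lemma wide_matrix_kernel:
  fixes B :: "'k::field mat"
  assumes B: "B \<in> carrier_mat n m" and nm: "n < m"
  obtains c where "c \<in> carrier_vec m" "c \<noteq> 0\<^sub>v m" "B *\<^sub>v c = 0\<^sub>v n"
proof -
  define P where "P = mat m m (\<lambda>(i, j). if i < n then B $$ (i, j) else 0)"
  have P: "P \<in> carrier_mat m m" by (simp add: P_def)
  have "P\<^sup>T *\<^sub>v unit_vec m n = 0\<^sub>v m"
    using nm by (intro eq_vecI) (auto simp: P_def)
  moreover have "unit_vec m n \<noteq> (0\<^sub>v m :: 'k vec)" using nm by (metis index_unit_vec(1) index_zero_vec(1) zero_neq_one)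
  ultimately have "det (P\<^sup>T) = 0"
    using P by (subst det_0_iff_vec_prod_zero_field[of _ m]) (auto intro!: exI[of _ "unit_vec m n"])
  then have "det P = 0" using det_transpose[OF P] by simp
  then obtain c where c: "c \<in> carrier_vec m" "c \<noteq> 0\<^sub>v m" "P *\<^sub>v c = 0\<^sub>v m"
    using det_0_iff_vec_prod_zero_field[OF P] by blast
  have "B *\<^sub>v c = 0\<^sub>v n"
  proof (rule eq_vecI)
    fix i assume "i < dim_vec (0\<^sub>v n :: 'k vec)"
    then have i: "i < n" by simp
    have "(B *\<^sub>v c) $ i = (P *\<^sub>v c) $ i"
      using i nm B c(1) by (simp add: P_def scalar_prod_def)
    then show "(B *\<^sub>v c) $ i = 0\<^sub>v n $ i" using i nm c(3) by simp
  qed (use B in simp)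
  then show ?thesis using that c by blast
qed

lemma injective_matrix_dim:
  fixes B :: "'k::field mat"
  assumes "B \<in> carrier_mat n m" "\<And>c. c \<in> carrier_vec m \<Longrightarrow> B *\<^sub>v c = 0\<^sub>v n \<Longrightarrow> c = 0\<^sub>v (m :: nat)"
  shows "m \<le> n"
  using wide_matrix_kernel[OF assms(1)] assms(2) by (metis not_le)

text \<open>At most \<open>n\<close> columns are independent modulo \<open>W\<close>, so there is a
  matrix with the largest possible number of them. A vector of \<open>U\<close> that it does not
  reach could be adjoined as one more column.\<close>

lemma quot_basis_exists:
  fixes U W :: "'k::field vec set"
  assumes U: "lin_subspace n U" and W: "lin_subspace n W"
  shows "\<exists>m B. quot_basis n m B U W"
proof -
  define S where "S = {m. \<exists>B\<in>carrier_mat n m. (\<forall>c\<in>carrier_vec m. B *\<^sub>v c \<in> U) \<and>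
     (\<forall>c\<in>carrier_vec m. B *\<^sub>v c \<in> W \<longrightarrow> c = 0\<^sub>v m)}"
  have "0 \<in> S"
  proof -
    have "(0\<^sub>m n 0 :: 'k mat) *\<^sub>v c = 0\<^sub>v n" if "c \<in> carrier_vec 0" for c
      using that by (intro eq_vecI) (auto simp: scalar_prod_def)
    then show ?thesis unfolding S_def using lin_subspaceD(2)[OF U]
      by (intro CollectI bexI[of _ "0\<^sub>m n 0"]) auto
  qed
  moreover have bound: "m \<le> n" if "m \<in> S" for m
    using that lin_subspaceD(2)[OF W] unfolding S_def by (auto intro: injective_matrix_dim)
  ultimately obtain m where m: "m \<in> S" "\<And>k. k \<in> S \<Longrightarrow> k \<le> m"
    using Max_in[of S] Max_ge[of S] finite_subset[of S "{..n}"] by (metis atMost_iff empty_iff finite_atMost subsetI)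
  then obtain B where B: "B \<in> carrier_mat n m" "\<And>c. c \<in> carrier_vec m \<Longrightarrow> B *\<^sub>v c \<in> U"
    "\<And>c. c \<in> carrier_vec m \<Longrightarrow> B *\<^sub>v c \<in> W \<Longrightarrow> c = 0\<^sub>v m" unfolding S_def by blast
  have "\<exists>c\<in>carrier_vec m. \<exists>w\<in>W. u = B *\<^sub>v c + w" if u: "u \<in> U" for u
  proof (rule ccontr)
    assume no: "\<not> (\<exists>c\<in>carrier_vec m. \<exists>w\<in>W. u = B *\<^sub>v c + w)"
    have uc: "u \<in> carrier_vec n" using lin_subspaceD(1)[OF U u] .
    define A where "A = mat n 1 (\<lambda>(i, j). u $ i)"
    have A: "A \<in> carrier_mat n 1" by (simp add: A_def)
    have mA: "A *\<^sub>v vec 1 f = f 0 \<cdot>\<^sub>v u" for f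
      using uc by (intro eq_vecI) (auto simp: A_def scalar_prod_def)
    have mult: "hcat B A *\<^sub>v c = B *\<^sub>v vec m (\<lambda>i. c $ i) + c $ m \<cdot>\<^sub>v u" if "c \<in> carrier_vec (m + 1)" for c
      using hcat_mult_vec[OF B(1) A that] by (simp only: mA add_0_right)
    have "m + 1 \<in> S"
      unfolding S_def
    proof (intro CollectI bexI[OF _ hcat_carrier[OF B(1) A]] conjI ballI impI)
      fix c :: "'k vec" assume c: "c \<in> carrier_vec (m + 1)"
      let ?c = "vec m (\<lambda>i. c $ i)" and ?a = "c $ m"
      show "hcat B A *\<^sub>v c \<in> U"
        unfolding mult[OF c] using B(2)[of ?c] u lin_subspaceD(3,4)[OF U] by simp
      assume "hcat B A *\<^sub>v c \<in> W"
      then have W': "B *\<^sub>v ?c + ?a \<cdot>\<^sub>v u \<in> W" unfolding mult[OF c] .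
      have Bc: "B *\<^sub>v ?c \<in> carrier_vec n" using B(1) by simp
      \<comment> \<open>With a nonzero coefficient, \<open>u\<close> could be expressed through the
        old columns and \<open>W\<close>, contrary to \<open>no\<close>.\<close>
      have a0: "?a = 0"
      proof (rule ccontr)
        assume a: "?a \<noteq> 0"
        have "u = B *\<^sub>v ((- inverse ?a) \<cdot>\<^sub>v ?c) + inverse ?a \<cdot>\<^sub>v (B *\<^sub>v ?c + ?a \<cdot>\<^sub>v u)"
        proof -
          have "u = (- inverse ?a) \<cdot>\<^sub>v b + inverse ?a \<cdot>\<^sub>v (b + ?a \<cdot>\<^sub>v u)" if "b \<in> carrier_vec n" for b
            using a uc that by (intro eq_vecI) (auto simp: field_simps)
          from this[OF Bc] show ?thesis by (subst mult_mat_vec[OF B(1)]) simp_all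
        qed
        moreover have "inverse ?a \<cdot>\<^sub>v (B *\<^sub>v ?c + ?a \<cdot>\<^sub>v u) \<in> W" using W' lin_subspaceD(4)[OF W] by blast
        moreover have "(- inverse ?a) \<cdot>\<^sub>v ?c \<in> carrier_vec m" by simp
        ultimately show False using no by blast
      qed
      have "b + 0 \<cdot>\<^sub>v u = b" if "b \<in> carrier_vec n" for b using uc that by (intro eq_vecI) auto
      then have "B *\<^sub>v ?c \<in> W" using W' Bc unfolding a0 by simp
      then have "?c = 0\<^sub>v m" using B(3) by simp
      then have "c $ i = 0" if "i < m" for i using that by (metis index_vec index_zero_vec(1))
      then show "c = 0\<^sub>v (m + 1)" using c a0 by (intro eq_vecI) (auto simp: less_Suc_eq)
    qed
    then show False using m(2) by fastforce
  qed
  then have "quot_basis n m B U W" using B by (simp add: quot_basis_def)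
  then show ?thesis by blast
qed

lemma quot_basis_append:
  fixes B1 B2 :: "'k::field mat"
  assumes 1: "quot_basis n m1 B1 U W" and 2: "quot_basis n m2 B2 W Z"
    and U: "lin_subspace n U" and W: "lin_subspace n W" and Z: "lin_subspace n Z" and sub: "Z \<subseteq> W" "W \<subseteq> U"
  shows "quot_basis n (m1 + m2) (hcat B1 B2) U Z"
proof -
  have B: "B1 \<in> carrier_mat n m1" "B2 \<in> carrier_mat n m2" using 1 2 by (auto simp: quot_basis_def)
  note mult = hcat_mult_vec[OF B]
  show ?thesis
    unfolding quot_basis_def
  proof (intro conjI ballI impI hcat_carrier[OF B])
    fix c :: "'k vec" assume c: "c \<in> carrier_vec (m1 + m2)"
    let ?c1 = "vec m1 (\<lambda>i. c $ i)" and ?c2 = "vec m2 (\<lambda>i. c $ (m1 + i))"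
    have b1: "B1 *\<^sub>v ?c1 \<in> U" and b2: "B2 *\<^sub>v ?c2 \<in> W" using 1 2 by (auto simp: quot_basis_def)
    show "hcat B1 B2 *\<^sub>v c \<in> U"
      unfolding mult[OF c] by (rule lin_subspaceD(3)[OF U b1 subsetD[OF sub(2) b2]])
    assume Z': "hcat B1 B2 *\<^sub>v c \<in> Z"
    have "B1 *\<^sub>v ?c1 + B2 *\<^sub>v ?c2 \<in> W" using subsetD[OF sub(1) Z'] unfolding mult[OF c] .
    from lin_subspace_diff[OF W this b2] have "B1 *\<^sub>v ?c1 \<in> W" using B by simp
    then have c1: "?c1 = 0\<^sub>v m1" using 1 by (simp add: quot_basis_def)
    have "B1 *\<^sub>v 0\<^sub>v m1 = 0\<^sub>v n" by (rule mult_mat_zero_vec[OF B(1)])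
    then have "B2 *\<^sub>v ?c2 \<in> Z" using Z' B unfolding mult[OF c] c1 by simp
    then have c2: "?c2 = 0\<^sub>v m2" using 2 by (simp add: quot_basis_def)
    show "c = 0\<^sub>v (m1 + m2)"
    proof (rule eq_vecI)
      fix i assume "i < dim_vec (0\<^sub>v (m1 + m2) :: 'k vec)"
      then have i: "i < m1 + m2" by simp
      show "c $ i = 0\<^sub>v (m1 + m2) $ i"
      proof (cases "i < m1")
        case True
        then have "?c1 $ i = c $ i" by simp
        then show ?thesis unfolding c1 using True by simp
      next
        case False
        then have "i - m1 < m2" "m1 + (i - m1) = i" using i by simp_all
        then have "?c2 $ (i - m1) = c $ i" by simp
        then show ?thesis unfolding c2 using False i by simp
      qed
    qed (use c in simp)
  next
    fix u assume u: "u \<in> U"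
    then obtain c1 w where c1: "c1 \<in> carrier_vec m1" "w \<in> W" "u = B1 *\<^sub>v c1 + w"
      using 1 unfolding quot_basis_def by blast
    then obtain c2 z where c2: "c2 \<in> carrier_vec m2" "z \<in> Z" "w = B2 *\<^sub>v c2 + z"
      using 2 unfolding quot_basis_def by blast
    let ?c = "c1 @\<^sub>v c2"
    have c: "?c \<in> carrier_vec (m1 + m2)" using c1 c2 by simp
    have "vec m1 (\<lambda>i. ?c $ i) = c1" "vec m2 (\<lambda>i. ?c $ (m1 + i)) = c2"
      using c1(1) c2(1) by auto
    then have "hcat B1 B2 *\<^sub>v ?c = B1 *\<^sub>v c1 + B2 *\<^sub>v c2" using mult[OF c] by simp
    moreover have "z \<in> carrier_vec n" using lin_subspaceD(1)[OF Z c2(2)] .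
    ultimately have "u = hcat B1 B2 *\<^sub>v ?c + z" using c1 c2 B by (simp add: assoc_add_vec[of _ n])
    then show "\<exists>c\<in>carrier_vec (m1 + m2). \<exists>w\<in>Z. u = hcat B1 B2 *\<^sub>v c + w" using c c2(2) by blast
  qed
qed

text \<open>Bases of the successive quotients are joined with the top layer first. The coordinates
  belonging to the layers above \<open>U j\<close> then form an initial segment, and
  \<open>U j\<close> is where they vanish.\<close>

lemma flag_basis:
  fixes U :: "nat \<Rightarrow> 'k::field vec set"
  assumes "\<And>l. l \<le> k \<Longrightarrow> lin_subspace n (U l)" "\<And>l. l < k \<Longrightarrow> U (Suc l) \<subseteq> U l"
    and "\<And>l. l < k \<Longrightarrow> quot_basis n (m l) (B l) (U l) (U (Suc l))"
  shows "\<exists>g. quot_basis n (\<Sum>l<k. m l) g (U 0) (U k) \<and>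
    (\<forall>j\<le>k. \<forall>c\<in>carrier_vec (\<Sum>l<k. m l). g *\<^sub>v c \<in> U j \<longleftrightarrow> (\<forall>i<(\<Sum>l<j. m l). c $ i = 0))"
  using assms
proof (induction k)
  case 0
  have *: "(0\<^sub>m n 0 :: 'k mat) *\<^sub>v c = 0\<^sub>v n" if "c \<in> carrier_vec 0" for c
    using that by (intro eq_vecI) (auto simp: scalar_prod_def)
  note U = lin_subspaceD[OF 0(1)[OF order_refl]]
  have "quot_basis n 0 (0\<^sub>m n 0) (U 0) (U 0)"
    unfolding quot_basis_def
  proof (intro conjI ballI)
    fix u assume "u \<in> U 0"
    then show "\<exists>c\<in>carrier_vec 0. \<exists>w\<in>U 0. u = 0\<^sub>m n 0 *\<^sub>v c + w"
      using * U(1)[of u] by (intro bexI[of _ "0\<^sub>v 0"] bexI[of _ u]) auto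
  qed (use * U(2) in auto)
  then show ?case using * U(2) by (intro exI[of _ "0\<^sub>m n 0"]) auto
next
  case (Suc k)
  let ?N = "\<Sum>l<k. m l"
  have mono: "U k \<subseteq> U j" if "j \<le> k" for j
    using that
  proof (induction j rule: inc_induct)
    case (step j) then show ?case using Suc.prems(2)[of j] by auto
  qed simp
  obtain g where g: "quot_basis n ?N g (U 0) (U k)"
    "\<And>j c. j \<le> k \<Longrightarrow> c \<in> carrier_vec ?N \<Longrightarrow> g *\<^sub>v c \<in> U j \<longleftrightarrow> (\<forall>i<(\<Sum>l<j. m l). c $ i = 0)"
    using Suc.IH Suc.prems by (metis le_SucI less_SucI)
  have Bk: "quot_basis n (m k) (B k) (U k) (U (Suc k))" using Suc.prems(3) by simp
  have gc: "g \<in> carrier_mat n ?N" and Bc: "B k \<in> carrier_mat n (m k)" using g(1) Bk by (auto simp: quot_basis_def)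
  have q: "quot_basis n (?N + m k) (hcat g (B k)) (U 0) (U (Suc k))"
    using Suc.prems mono by (intro quot_basis_append[OF g(1) Bk]) auto
  have "hcat g (B k) *\<^sub>v c \<in> U j \<longleftrightarrow> (\<forall>i<(\<Sum>l<j. m l). c $ i = 0)"
    if j: "j \<le> Suc k" and c: "c \<in> carrier_vec (?N + m k)" for j c
  proof (cases "j = Suc k")
    case True
    have "c = 0\<^sub>v (?N + m k)" if "\<forall>i<?N + m k. c $ i = 0" using that c by (intro eq_vecI) auto
    moreover have "hcat g (B k) *\<^sub>v 0\<^sub>v (?N + m k) = 0\<^sub>v n"
      by (rule mult_mat_zero_vec[OF hcat_carrier[OF gc Bc]])
    moreover have "0\<^sub>v n \<in> U (Suc k)" using lin_subspaceD(2) Suc.prems(1) by blast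
    moreover have "hcat g (B k) *\<^sub>v c \<in> U (Suc k) \<Longrightarrow> c = 0\<^sub>v (?N + m k)"
      using q c by (simp add: quot_basis_def)
    ultimately show ?thesis using True by auto
  next
    case False
    then have jk: "j \<le> k" using j by simp
    let ?c1 = "vec ?N (\<lambda>i. c $ i)" and ?c2 = "vec (m k) (\<lambda>i. c $ (?N + i))"
    \<comment> \<open>The new columns lie in \<open>U k\<close> and hence in \<open>U j\<close>, so
      membership in \<open>U j\<close> is decided by the first block of coordinates.\<close>
    have "B k *\<^sub>v ?c2 \<in> U k" using Bk by (simp add: quot_basis_def)
    then have b: "B k *\<^sub>v ?c2 \<in> U j" using mono[OF jk] by blast
    have Uj: "lin_subspace n (U j)" using Suc.prems(1) j by simp
    have "hcat g (B k) *\<^sub>v c \<in> U j \<longleftrightarrow> g *\<^sub>v ?c1 \<in> U j"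
      unfolding hcat_mult_vec[OF gc Bc c]
      using lin_subspace_diff[OF Uj _ b, of "g *\<^sub>v ?c1"] lin_subspaceD(3)[OF Uj _ b] gc by auto
    also have "\<dots> \<longleftrightarrow> (\<forall>i<(\<Sum>l<j. m l). ?c1 $ i = 0)" by (rule g(2)[OF jk]) simp
    also have "\<dots> \<longleftrightarrow> (\<forall>i<(\<Sum>l<j. m l). c $ i = 0)"
    proof -
      have "(\<Sum>l<j. m l) \<le> ?N" using jk by (intro sum_mono2) auto
      then show ?thesis by auto
    qed
    finally show ?thesis .
  qed
  then show ?case using q by (intro exI[of _ "hcat g (B k)"]) simp
qed

text \<open>Surjectivity yields a right inverse column by column. A matrix with a left inverse is
  injective, so both inequalities between \<open>m\<close> and \<open>n\<close> follow from
  \<open>injective_matrix_dim\<close>.\<close>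

lemma quot_basis_full:
  fixes g :: "'k::field mat"
  assumes "quot_basis n m g (carrier_vec n) {0\<^sub>v n}"
  shows "m = n" "\<exists>g'\<in>carrier_mat n n. g * g' = 1\<^sub>m n \<and> g' * g = 1\<^sub>m n"
proof -
  have g: "g \<in> carrier_mat n m" "\<And>c. c \<in> carrier_vec m \<Longrightarrow> g *\<^sub>v c = 0\<^sub>v n \<Longrightarrow> c = 0\<^sub>v m"
    using assms by (auto simp: quot_basis_def)
  have "\<exists>c\<in>carrier_vec m. u = g *\<^sub>v c" if "u \<in> carrier_vec n" for u
    using assms that g(1) unfolding quot_basis_def
    by (metis mult_mat_vec_carrier right_zero_vec singletonD)
  then have "\<forall>j. \<exists>c. j < n \<longrightarrow> c \<in> carrier_vec m \<and> unit_vec n j = g *\<^sub>v c" by (metis unit_vec_carrier)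
  then obtain c where c: "\<And>j. j < n \<Longrightarrow> c j \<in> carrier_vec m" "\<And>j. j < n \<Longrightarrow> unit_vec n j = g *\<^sub>v c j" by metis
  define C where "C = mat m n (\<lambda>(i, j). c j $ i)"
  have C: "C \<in> carrier_mat m n" by (simp add: C_def)
  have gC: "g * C = 1\<^sub>m n"
  proof (rule eq_matI)
    fix i j assume "i < dim_row (1\<^sub>m n :: 'k mat)" "j < dim_col (1\<^sub>m n :: 'k mat)"
    then have ij: "i < n" "j < n" by simp_all
    have "col C j = c j" using c(1)[OF ij(2)] ij by (intro eq_vecI) (auto simp: C_def)
    then have "(g * C) $$ (i, j) = (g *\<^sub>v c j) $ i" using ij g(1) C by simp
    also have "\<dots> = unit_vec n j $ i" using c(2)[OF ij(2)] by simp
    finally show "(g * C) $$ (i, j) = 1\<^sub>m n $$ (i, j)" using ij by simp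
  qed (use g C in auto)
  have "v = 0\<^sub>v n" if v: "v \<in> carrier_vec n" "C *\<^sub>v v = 0\<^sub>v m" for v
  proof -
    have "v = (g * C) *\<^sub>v v" using gC v by simp
    also have "\<dots> = g *\<^sub>v (C *\<^sub>v v)" by (rule assoc_mult_mat_vec[OF g(1) C v(1)])
    also have "\<dots> = 0\<^sub>v n" using v mult_mat_zero_vec[OF g(1)] by simp
    finally show ?thesis .
  qed
  then have "n \<le> m" by (rule injective_matrix_dim[OF C])
  moreover have "m \<le> n" using injective_matrix_dim[OF g] .
  ultimately show mn: "m = n" by simp
  show "\<exists>g'\<in>carrier_mat n n. g * g' = 1\<^sub>m n \<and> g' * g = 1\<^sub>m n"
    using C gC g(1) mat_mult_left_right_inverse[of g n C] unfolding mn by blast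
qed

text \<open>The map is compared with the matrix of its values on unit vectors, by induction on the
  number of leading coordinates that are kept; the bound for injective matrices then
  applies.\<close>

lemma linear_injective_dim:
  fixes \<phi> :: "'k::field vec \<Rightarrow> 'k vec"
  assumes c: "\<And>c. c \<in> carrier_vec m \<Longrightarrow> \<phi> c \<in> carrier_vec n"
    and add: "\<And>c c'. c \<in> carrier_vec m \<Longrightarrow> c' \<in> carrier_vec m \<Longrightarrow> \<phi> (c + c') = \<phi> c + \<phi> c'"
    and smult: "\<And>a c. c \<in> carrier_vec m \<Longrightarrow> \<phi> (a \<cdot>\<^sub>v c) = a \<cdot>\<^sub>v \<phi> c"
    and inj: "\<And>c. c \<in> carrier_vec m \<Longrightarrow> \<phi> c = 0\<^sub>v n \<Longrightarrow> c = 0\<^sub>v m"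
  shows "m \<le> n"
proof -
  define A where "A = mat n m (\<lambda>(i, j). \<phi> (unit_vec m j) $ i)"
  have A: "A \<in> carrier_mat n m" by (simp add: A_def)
  have unit: "A *\<^sub>v unit_vec m j = \<phi> (unit_vec m j)" if "j < m" for j
    using that c[of "unit_vec m j"] by (intro eq_vecI) (auto simp: A_def)
  have "A *\<^sub>v x = \<phi> x" if x: "x \<in> carrier_vec m" for x
  proof -
    let ?t = "\<lambda>k. vec m (\<lambda>i. if i < k then x $ i else 0)"
    have "A *\<^sub>v ?t k = \<phi> (?t k)" if "k \<le> m" for k
      using that
    proof (induction k)
      case 0
      have "\<phi> (0 \<cdot>\<^sub>v 0\<^sub>v m) = 0 \<cdot>\<^sub>v \<phi> (0\<^sub>v m)" by (rule smult) simp
      moreover have "0 \<cdot>\<^sub>v \<phi> (0\<^sub>v m) = 0\<^sub>v n" using c[of "0\<^sub>v m"] by (intro eq_vecI) auto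
      moreover have "?t 0 = 0\<^sub>v m" by (intro eq_vecI) auto
      moreover have "0 \<cdot>\<^sub>v 0\<^sub>v m = (0\<^sub>v m :: 'k vec)" by (intro eq_vecI) auto
      ultimately show ?case using mult_mat_zero_vec[OF A] by simp
    next
      case (Suc k)
      have t: "?t (Suc k) = ?t k + x $ k \<cdot>\<^sub>v unit_vec m k"
        using Suc.prems by (intro eq_vecI) (auto simp: less_Suc_eq)
      have "A *\<^sub>v ?t (Suc k) = A *\<^sub>v ?t k + x $ k \<cdot>\<^sub>v (A *\<^sub>v unit_vec m k)"
        unfolding t using A by (simp add: mult_add_distrib_mat_vec[OF A] mult_mat_vec[OF A])
      also have "\<dots> = \<phi> (?t k) + \<phi> (x $ k \<cdot>\<^sub>v unit_vec m k)"
        using Suc unit by (simp add: smult)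
      also have "\<dots> = \<phi> (?t (Suc k))" unfolding t by (rule add[symmetric]) simp_all
      finally show ?case .
    qed
    moreover have "?t m = x" using x by (intro eq_vecI) auto
    ultimately show ?thesis using order_refl by metis
  qed
  then show ?thesis using inj by (intro injective_matrix_dim[OF A]) auto
qed

section \<open>The module of a point, and submodules as families of subspaces\<close>

section \<open>Representations as modules and their submodules\<close>

lemma rep_module_simps [simp]:
  "carrier (rep_module Q d x) = rep_vectors Q d"
  "zero (rep_module Q d x) = (\<lambda>v\<in>verts Q. 0\<^sub>v (d v))"
  "add (rep_module Q d x) = (\<lambda>m m'. \<lambda>v\<in>verts Q. m v + m' v)"
  by (simp_all add: rep_module_def)

lemma rep_vectors_eqI:
  assumes "m \<in> rep_vectors Q d" "m' \<in> rep_vectors Q d" "\<And>v. v \<in> verts Q \<Longrightarrow> m v = m' v"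
  shows "m = m'"
  using assms unfolding rep_vectors_def by (intro PiE_ext) auto

lemma rep_vectors_carrier: "m \<in> rep_vectors Q d \<Longrightarrow> v \<in> verts Q \<Longrightarrow> m v \<in> carrier_vec (d v)"
  by (auto simp: rep_vectors_def)

lemma restrict_rep_vectors: "(\<And>v. v \<in> verts Q \<Longrightarrow> f v \<in> carrier_vec (d v)) \<Longrightarrow> (\<lambda>v\<in>verts Q. f v) \<in> rep_vectors Q d"
  by (auto simp: rep_vectors_def)

lemma index_path_action_superset:
  assumes "finite A" "Poly_Mapping.keys f \<subseteq> A" "v \<in> verts Q" "i < d v"
  shows "path_action Q d x f m v $ i = (\<Sum>\<pi>\<in>A. if path_end Q \<pi> = v
    then Poly_Mapping.lookup f \<pi> * (path_mat Q d x (fst \<pi>) (snd \<pi>) *\<^sub>v m (fst \<pi>)) $ i else 0)"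
proof -
  have "path_action Q d x f m v $ i = (\<Sum>\<pi>\<in>Poly_Mapping.keys f. if path_end Q \<pi> = v
    then Poly_Mapping.lookup f \<pi> * (path_mat Q d x (fst \<pi>) (snd \<pi>) *\<^sub>v m (fst \<pi>)) $ i else 0)"
    using assms(3,4) by (simp add: path_action_def sum.inter_filter)
  also have "\<dots> = (\<Sum>\<pi>\<in>A. if path_end Q \<pi> = v
    then Poly_Mapping.lookup f \<pi> * (path_mat Q d x (fst \<pi>) (snd \<pi>) *\<^sub>v m (fst \<pi>)) $ i else 0)"
    using assms(1,2) by (intro sum.mono_neutral_left) (auto simp: in_keys_iff)
  finally show ?thesis .
qed

lemmas index_path_action = index_path_action_superset[OF finite_keys subset_refl]

lemma path_action_closed: "path_action Q d x f m \<in> rep_vectors Q d"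
  by (auto simp: path_action_def intro!: restrict_rep_vectors)

lemma path_action_eqI:
  assumes "m' \<in> rep_vectors Q d" "\<And>v i. v \<in> verts Q \<Longrightarrow> i < d v \<Longrightarrow> path_action Q d x f m v $ i = m' v $ i"
  shows "path_action Q d x f m = m'"
proof (rule rep_vectors_eqI[OF path_action_closed assms(1)])
  fix v assume v: "v \<in> verts Q"
  show "path_action Q d x f m v = m' v"
    using carrier_vecD[OF rep_vectors_carrier[OF path_action_closed v, of d x f m]]
      carrier_vecD[OF rep_vectors_carrier[OF assms(1) v]] assms(2)[OF v]
    by (intro eq_vecI) simp_all
qed

lemma lin_subspace_sum:
  assumes U: "lin_subspace n U" and fin: "finite A" and b: "\<And>a. a \<in> A \<Longrightarrow> b a \<in> U"
  shows "vec n (\<lambda>i. \<Sum>a\<in>A. c a * b a $ i) \<in> U"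
  using fin b
proof (induction A rule: finite_induct)
  case empty
  have "vec n (\<lambda>i. \<Sum>a\<in>{}. c a * b a $ i) = 0\<^sub>v n" by (intro eq_vecI) auto
  then show ?case using lin_subspaceD(2)[OF U] by simp
next
  case (insert a A)
  have "b a \<in> carrier_vec n" using lin_subspaceD(1)[OF U insert.prems] by simp
  then have "vec n (\<lambda>i. \<Sum>a\<in>insert a A. c a * b a $ i) = c a \<cdot>\<^sub>v b a + vec n (\<lambda>i. \<Sum>a\<in>A. c a * b a $ i)"
    using insert(1,2) by (intro eq_vecI) auto
  moreover have "c a \<cdot>\<^sub>v b a \<in> U" using lin_subspaceD(4)[OF U] insert.prems by simp
  ultimately show ?case using lin_subspaceD(3)[OF U] insert by simp
qed

context wf_digraph
begin

lemma path_Cons_D: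
  assumes "(u, \<alpha> # p) \<in> paths G"
  shows "u = tail G \<alpha>" "\<alpha> \<in> arcs G" "(head G \<alpha>, p) \<in> paths G"
  using assms by (auto simp: paths_def awalk_Cons_iff)

lemma path_mat_carrier:
  assumes "x \<in> rep_space G d"
  shows "(u, p) \<in> paths G \<Longrightarrow> path_mat G d x u p \<in> carrier_mat (d (path_end G (u, p))) (d u)"
proof (induction p arbitrary: u)
  case (Cons \<alpha> p)
  note * = path_Cons_D[OF Cons.prems]
  show ?case using Cons.IH[OF *(3)] rep_space_carrier[OF assms *(2)] *(1) by (simp add: mult_carrier_mat)
qed simp

lemma path_mat_append:
  assumes "x \<in> rep_space G d"
  shows "(u, p) \<in> paths G \<Longrightarrow> (path_end G (u, p), q) \<in> paths G \<Longrightarrow>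
    path_mat G d x u (p @ q) = path_mat G d x (path_end G (u, p)) q * path_mat G d x u p"
proof (induction p arbitrary: u)
  case Nil
  then show ?case using path_mat_carrier[OF assms, of u q] by simp
next
  case (Cons \<alpha> p)
  note * = path_Cons_D[OF Cons.prems(1)]
  have "path_mat G d x (head G \<alpha>) (p @ q) =
      path_mat G d x (path_end G (head G \<alpha>, p)) q * path_mat G d x (head G \<alpha>) p"
    using Cons.IH[OF *(3)] Cons.prems(2) by simp
  then show ?case
    using assoc_mult_mat[OF path_mat_carrier[OF assms Cons.prems(2)]
        _ rep_space_carrier[OF assms *(2)]] path_mat_carrier[OF assms *(3)] by simp
qed

lemma path_mat_preserves:
  assumes x: "x \<in> rep_space G d" and U: "\<And>v. v \<in> verts G \<Longrightarrow> U v \<subseteq> carrier_vec (d v)"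
    and arr: "\<And>\<alpha> u. \<alpha> \<in> arcs G \<Longrightarrow> u \<in> U (tail G \<alpha>) \<Longrightarrow> x \<alpha> *\<^sub>v u \<in> U (head G \<alpha>)"
  shows "(u, p) \<in> paths G \<Longrightarrow> w \<in> U u \<Longrightarrow> path_mat G d x u p *\<^sub>v w \<in> U (path_end G (u, p))"
proof (induction p arbitrary: u w)
  case Nil
  then have "u \<in> verts G" by (simp add: paths_def awalk_Nil_iff)
  then show ?case using Nil U[of u] by auto
next
  case (Cons \<alpha> p)
  note * = path_Cons_D[OF Cons.prems(1)]
  have "w \<in> carrier_vec (d (tail G \<alpha>))" using U[of "tail G \<alpha>"] * Cons.prems(2) by auto
  then have "path_mat G d x u (\<alpha> # p) *\<^sub>v w = path_mat G d x (head G \<alpha>) p *\<^sub>v (x \<alpha> *\<^sub>v w)"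
    using assoc_mult_mat_vec[OF path_mat_carrier[OF x *(3)] rep_space_carrier[OF x *(2)]] by simp
  also have "\<dots> \<in> U (path_end G (head G \<alpha>, p))"
    using Cons.IH[OF *(3)] arr[OF *(2)] Cons.prems(2) *(1) by simp
  finally show ?case by simp
qed

end

lemma path_action_add: "path_action Q d x (f + g) m v $ i = path_action Q d x f m v $ i + path_action Q d x g m v $ i"
  if "v \<in> verts Q" "i < d v"
proof -
  let ?A = "Poly_Mapping.keys f \<union> Poly_Mapping.keys g"
  have A: "finite ?A" "Poly_Mapping.keys (f + g) \<subseteq> ?A" "Poly_Mapping.keys f \<subseteq> ?A" "Poly_Mapping.keys g \<subseteq> ?A"
    using keys_add[of f g] by auto
  show ?thesis
    unfolding index_path_action_superset[where d = d, OF A(1,2) that] index_path_action_superset[where d = d, OF A(1,3) that]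
      index_path_action_superset[where d = d, OF A(1,4) that] sum.distrib[symmetric] lookup_add
    by (intro sum.cong refl) (simp add: algebra_simps)
qed

lemma path_action_zero: "v \<in> verts Q \<Longrightarrow> i < d v \<Longrightarrow> path_action Q d x 0 m v $ i = 0"
  by (simp add: index_path_action)

lemma path_action_sum:
  "v \<in> verts Q \<Longrightarrow> i < d v \<Longrightarrow> path_action Q d x (sum F A) m v $ i = (\<Sum>a\<in>A. path_action Q d x (F a) m v $ i)"
  by (induction A rule: infinite_finite_induct) (simp_all add: path_action_zero path_action_add)

lemma path_action_single:
  assumes "v \<in> verts Q" "i < d v"
  shows "path_action Q d x (Poly_Mapping.single \<pi> c) m v $ i =
    (if path_end Q \<pi> = v then c * (path_mat Q d x (fst \<pi>) (snd \<pi>) *\<^sub>v m (fst \<pi>)) $ i else 0)"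
  using assms by (simp add: index_path_action)

lemma mult_mat_vec_sum:
  assumes "P \<in> carrier_mat k n" "i < k" "w \<in> carrier_vec n" "\<And>j. j < n \<Longrightarrow> w $ j = (\<Sum>r\<in>R. if C r then a r * b r $ j else 0)"
    "\<And>r. r \<in> R \<Longrightarrow> C r \<Longrightarrow> b r \<in> carrier_vec n"
  shows "(P *\<^sub>v w) $ i = (\<Sum>r\<in>R. if C r then a r * (P *\<^sub>v b r) $ i else (0 :: 'k::field))"
proof -
  have "(P *\<^sub>v w) $ i = (\<Sum>j = 0..<n. P $$ (i, j) * (\<Sum>r\<in>R. if C r then a r * b r $ j else 0))"
    using assms(1-4) by (simp add: scalar_prod_def)
  also have "\<dots> = (\<Sum>j = 0..<n. \<Sum>r\<in>R. if C r then a r * (P $$ (i, j) * b r $ j) else 0)"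
    unfolding sum_distrib_left by (intro sum.cong refl) simp
  also have "\<dots> = (\<Sum>r\<in>R. \<Sum>j = 0..<n. if C r then a r * (P $$ (i, j) * b r $ j) else 0)"
    by (rule sum.swap)
  also have "\<dots> = (\<Sum>r\<in>R. if C r then a r * (P *\<^sub>v b r) $ i else 0)"
  proof (intro sum.cong refl)
    fix r assume r: "r \<in> R"
    show "(\<Sum>j = 0..<n. if C r then a r * (P $$ (i, j) * b r $ j) else 0) = (if C r then a r * (P *\<^sub>v b r) $ i else 0)"
    proof (cases "C r")
      case True
      have "(P *\<^sub>v b r) $ i = (\<Sum>j = 0..<n. P $$ (i, j) * b r $ j)"
        using assms(1,2) carrier_vecD[OF assms(5)[OF r True]] by (simp add: scalar_prod_def)
      then show ?thesis using True by (simp add: sum_distrib_left)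
    qed simp
  qed
  finally show ?thesis .
qed

text \<open>The matrix of a concatenated path is the product of the two matrices. Paths that do not
  compose contribute to neither side, since the component of a \<open>path_action\<close> at a
  vertex collects only the paths ending there.\<close>

lemma (in wf_digraph) path_action_mult:
  fixes f g :: "('a, 'b) qpath \<Rightarrow>\<^sub>0 'k::field"
  assumes x: "x \<in> rep_space G d" and f: "Poly_Mapping.keys f \<subseteq> paths G" and g: "Poly_Mapping.keys g \<subseteq> paths G"
    and m: "m \<in> rep_vectors G d"
  shows "path_action G d x (path_mult G f g) m = path_action G d x f (path_action G d x g m)"
proof (rule path_action_eqI[OF path_action_closed])
  fix v i assume v: "v \<in> verts G" and i: "i < d v"
  let ?P = "\<lambda>\<pi>. path_mat G d x (fst \<pi>) (snd \<pi>)"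
  let ?f = "Poly_Mapping.lookup f" and ?g = "Poly_Mapping.lookup g"
  have "path_action G d x (path_mult G f g) m v $ i = (\<Sum>\<sigma>\<in>Poly_Mapping.keys f. \<Sum>\<rho>\<in>Poly_Mapping.keys g.
      path_action G d x (if path_end G \<rho> = fst \<sigma> then Poly_Mapping.single (fst \<rho>, snd \<rho> @ snd \<sigma>) (?f \<sigma> * ?g \<rho>) else 0) m v $ i)"
    unfolding path_mult_def path_action_sum[where d = d, OF v i] ..
  also have "\<dots> = (\<Sum>\<sigma>\<in>Poly_Mapping.keys f. if path_end G \<sigma> = v then ?f \<sigma> * (?P \<sigma> *\<^sub>v path_action G d x g m (fst \<sigma>)) $ i else 0)"
  proof (rule sum.cong[OF refl])
    fix \<sigma> assume "\<sigma> \<in> Poly_Mapping.keys f"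
    then have \<sigma>: "\<sigma> \<in> paths G" using f by blast
    then have s: "fst \<sigma> \<in> verts G" by (auto simp: paths_def dest: awalk_hd_in_verts)
    have P: "?P \<sigma> \<in> carrier_mat (d (path_end G \<sigma>)) (d (fst \<sigma>))"
      using path_mat_carrier[OF x, of "fst \<sigma>" "snd \<sigma>"] \<sigma> by simp
    have Pr: "?P \<rho> *\<^sub>v m (fst \<rho>) \<in> carrier_vec (d (path_end G \<rho>))" if "\<rho> \<in> Poly_Mapping.keys g" for \<rho>
    proof -
      have "\<rho> \<in> paths G" using g that by blast
      then show ?thesis using path_mat_carrier[OF x, of "fst \<rho>" "snd \<rho>"] by (intro carrier_vecI) auto
    qed
    have "(\<Sum>\<rho>\<in>Poly_Mapping.keys g. path_action G d x (if path_end G \<rho> = fst \<sigma>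
          then Poly_Mapping.single (fst \<rho>, snd \<rho> @ snd \<sigma>) (?f \<sigma> * ?g \<rho>) else 0) m v $ i)
        = (if path_end G \<sigma> = v then ?f \<sigma> * (\<Sum>\<rho>\<in>Poly_Mapping.keys g.
            if path_end G \<rho> = fst \<sigma> then ?g \<rho> * (?P \<sigma> *\<^sub>v (?P \<rho> *\<^sub>v m (fst \<rho>))) $ i else 0) else 0)"
    proof -
      have "path_action G d x (if path_end G \<rho> = fst \<sigma>
          then Poly_Mapping.single (fst \<rho>, snd \<rho> @ snd \<sigma>) (?f \<sigma> * ?g \<rho>) else 0) m v $ i =
        (if path_end G \<sigma> = v then ?f \<sigma> * (if path_end G \<rho> = fst \<sigma> then ?g \<rho> * (?P \<sigma> *\<^sub>v (?P \<rho> *\<^sub>v m (fst \<rho>))) $ i else 0) else 0)"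
        if r: "\<rho> \<in> Poly_Mapping.keys g" for \<rho>
      proof (cases "path_end G \<rho> = fst \<sigma>")
        case True
        have \<rho>: "\<rho> \<in> paths G" using g r by blast
        then have mr: "m (fst \<rho>) \<in> carrier_vec (d (fst \<rho>))"
          using m by (intro rep_vectors_carrier) (auto simp: paths_def dest: awalk_hd_in_verts)
        have pe: "path_end G (fst \<rho>, snd \<rho> @ snd \<sigma>) = path_end G \<sigma>"
          using True path_end_append[of G "fst \<rho>" "snd \<rho>" "snd \<sigma>"] by simp
        have "path_mat G d x (fst \<rho>) (snd \<rho> @ snd \<sigma>) = ?P \<sigma> * ?P \<rho>"
          using path_mat_append[OF x, of "fst \<rho>" "snd \<rho>" "snd \<sigma>"] \<rho> \<sigma> True by simp
        moreover have "?P \<rho> \<in> carrier_mat (d (fst \<sigma>)) (d (fst \<rho>))"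
          using path_mat_carrier[OF x, of "fst \<rho>" "snd \<rho>"] \<rho> True by simp
        ultimately have "path_mat G d x (fst \<rho>) (snd \<rho> @ snd \<sigma>) *\<^sub>v m (fst \<rho>) = ?P \<sigma> *\<^sub>v (?P \<rho> *\<^sub>v m (fst \<rho>))"
          using assoc_mult_mat_vec[OF P _ mr] by simp
        then show ?thesis using True pe by (simp add: path_action_single[where d = d, OF v i])
      qed (simp add: path_action_zero[where d = d, OF v i])
      then show ?thesis by (simp add: sum_distrib_left)
    qed
    also have "\<dots> = (if path_end G \<sigma> = v then ?f \<sigma> * (?P \<sigma> *\<^sub>v path_action G d x g m (fst \<sigma>)) $ i else 0)"
    proof (cases "path_end G \<sigma> = v")
      case True
      have "(?P \<sigma> *\<^sub>v path_action G d x g m (fst \<sigma>)) $ i = (\<Sum>\<rho>\<in>Poly_Mapping.keys g.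
            if path_end G \<rho> = fst \<sigma> then ?g \<rho> * (?P \<sigma> *\<^sub>v (?P \<rho> *\<^sub>v m (fst \<rho>))) $ i else 0)"
      proof (rule mult_mat_vec_sum[OF P])
        show "i < d (path_end G \<sigma>)" using i True by simp
        show "path_action G d x g m (fst \<sigma>) \<in> carrier_vec (d (fst \<sigma>))"
          by (rule rep_vectors_carrier[OF path_action_closed s])
        fix j assume "j < d (fst \<sigma>)"
        then show "path_action G d x g m (fst \<sigma>) $ j = (\<Sum>\<rho>\<in>Poly_Mapping.keys g.
            if path_end G \<rho> = fst \<sigma> then ?g \<rho> * (?P \<rho> *\<^sub>v m (fst \<rho>)) $ j else 0)"
          by (rule index_path_action[where d = d, OF s])
      next
        fix \<rho> assume "\<rho> \<in> Poly_Mapping.keys g" "path_end G \<rho> = fst \<sigma>"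
        then show "?P \<rho> *\<^sub>v m (fst \<rho>) \<in> carrier_vec (d (fst \<sigma>))" using Pr[of \<rho>] by simp
      qed
      then show ?thesis by simp
    qed simp
    finally show "(\<Sum>\<rho>\<in>Poly_Mapping.keys g. path_action G d x (if path_end G \<rho> = fst \<sigma>
          then Poly_Mapping.single (fst \<rho>, snd \<rho> @ snd \<sigma>) (?f \<sigma> * ?g \<rho>) else 0) m v $ i) =
        (if path_end G \<sigma> = v then ?f \<sigma> * (?P \<sigma> *\<^sub>v path_action G d x g m (fst \<sigma>)) $ i else 0)" .
  qed
  also have "\<dots> = path_action G d x f (path_action G d x g m) v $ i"
    by (rule index_path_action[where d = d, OF v i, symmetric])
  finally show "path_action G d x (path_mult G f g) m v $ i = path_action G d x f (path_action G d x g m) v $ i" .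
qed

lemma (in wf_digraph) path_action_add_vec:
  assumes x: "x \<in> rep_space G d" and f: "Poly_Mapping.keys f \<subseteq> paths G"
    and m: "m \<in> rep_vectors G d" "m' \<in> rep_vectors G d"
  shows "path_action G d x f (\<lambda>v\<in>verts G. m v + m' v) =
    (\<lambda>v\<in>verts G. path_action G d x f m v + path_action G d x f m' v)"
proof (rule path_action_eqI)
  show "(\<lambda>v\<in>verts G. path_action G d x f m v + path_action G d x f m' v) \<in> rep_vectors G d"
    by (intro restrict_rep_vectors add_carrier_vec rep_vectors_carrier[OF path_action_closed])
  fix v i assume v: "v \<in> verts G" and i: "i < d v"
  have "path_action G d x f (\<lambda>v\<in>verts G. m v + m' v) v $ i =
    path_action G d x f m v $ i + path_action G d x f m' v $ i"
    unfolding index_path_action[where d = d, OF v i] sum.distrib[symmetric]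
  proof (intro sum.cong refl)
    fix \<pi> assume "\<pi> \<in> Poly_Mapping.keys f"
    then have \<pi>: "\<pi> \<in> paths G" using f by blast
    then have s: "fst \<pi> \<in> verts G" by (auto simp: paths_def dest: awalk_hd_in_verts)
    have P: "path_mat G d x (fst \<pi>) (snd \<pi>) \<in> carrier_mat (d (path_end G \<pi>)) (d (fst \<pi>))"
      using path_mat_carrier[OF x, of "fst \<pi>" "snd \<pi>"] \<pi> by simp
    show "(if path_end G \<pi> = v then Poly_Mapping.lookup f \<pi> *
          (path_mat G d x (fst \<pi>) (snd \<pi>) *\<^sub>v (\<lambda>v\<in>verts G. m v + m' v) (fst \<pi>)) $ i else 0) =
      (if path_end G \<pi> = v then Poly_Mapping.lookup f \<pi> * (path_mat G d x (fst \<pi>) (snd \<pi>) *\<^sub>v m (fst \<pi>)) $ i else 0) +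
      (if path_end G \<pi> = v then Poly_Mapping.lookup f \<pi> * (path_mat G d x (fst \<pi>) (snd \<pi>) *\<^sub>v m' (fst \<pi>)) $ i else 0)"
      using s i P mult_add_distrib_mat_vec[OF P rep_vectors_carrier[OF m(1) s] rep_vectors_carrier[OF m(2) s]]
      by (auto simp: algebra_simps)
  qed
  also have "\<dots> = (path_action G d x f m v + path_action G d x f m' v) $ i"
    using i rep_vectors_carrier[OF path_action_closed v, of d x f m'] by simp
  finally show "path_action G d x f (\<lambda>v\<in>verts G. m v + m' v) v $ i =
    (\<lambda>v\<in>verts G. path_action G d x f m v + path_action G d x f m' v) v $ i" using v by simp
qed

definition graded_vectors :: "('v, 'a) pre_digraph \<Rightarrow> ('v \<Rightarrow> nat) \<Rightarrow> ('v \<Rightarrow> 'k::field vec set) \<Rightarrow> ('v \<Rightarrow> 'k vec) set" where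
  "graded_vectors Q d U = {m \<in> rep_vectors Q d. \<forall>v\<in>verts Q. m v \<in> U v}"

definition vertex_vector :: "('v, 'a) pre_digraph \<Rightarrow> ('v \<Rightarrow> nat) \<Rightarrow> 'v \<Rightarrow> 'k::field vec \<Rightarrow> ('v \<Rightarrow> 'k vec)" where
  "vertex_vector Q d v w = (\<lambda>u\<in>verts Q. if u = v then w else 0\<^sub>v (d u))"

locale quiver_rep = admissible_quiver Q I
  for Q :: "('v, 'a) pre_digraph" and I :: "(('v, 'a) qpath \<Rightarrow>\<^sub>0 'k::field) set" +
  fixes d :: "'v \<Rightarrow> nat" and x :: "'a \<Rightarrow> 'k mat"
  assumes rep: "x \<in> Rep Q I d"
begin

abbreviation M :: "((('v, 'a) qpath \<Rightarrow>\<^sub>0 'k) set, 'v \<Rightarrow> 'k vec) module" where "M \<equiv> rep_module Q d x"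
abbreviation act :: "(('v, 'a) qpath \<Rightarrow>\<^sub>0 'k) \<Rightarrow> ('v \<Rightarrow> 'k vec) \<Rightarrow> ('v \<Rightarrow> 'k vec)" where
  "act \<equiv> path_action Q d x"
abbreviation vadd (infixl "\<oplus>v" 65) where "m \<oplus>v m' \<equiv> m \<oplus>\<^bsub>M\<^esub> m'"
abbreviation vzero where "vzero \<equiv> \<zero>\<^bsub>M\<^esub>"

lemma rep_space: "x \<in> rep_space Q d"
  using rep by (simp add: Rep_def)

lemma vzero_closed: "vzero \<in> rep_vectors Q d"
  by (auto intro!: restrict_rep_vectors)

lemma vadd_closed: "m \<in> rep_vectors Q d \<Longrightarrow> m' \<in> rep_vectors Q d \<Longrightarrow> m \<oplus>v m' \<in> rep_vectors Q d"
  unfolding rep_module_simps by (intro restrict_rep_vectors add_carrier_vec rep_vectors_carrier)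

lemma act_I: "f \<in> I \<Longrightarrow> m \<in> rep_vectors Q d \<Longrightarrow> act f m = vzero"
  using rep by (simp add: Rep_def)

lemma act_add: "act (f + g) m = act f m \<oplus>v act g m"
proof (rule path_action_eqI[OF vadd_closed[OF path_action_closed path_action_closed]])
  fix v i assume v: "v \<in> verts Q" and i: "i < d v"
  have "act g m v \<in> carrier_vec (d v)" by (rule rep_vectors_carrier[OF path_action_closed v])
  then show "act (f + g) m v $ i = (act f m \<oplus>v act g m) v $ i"
    using v i by (simp add: path_action_add)
qed

lemma vzero_add: "m \<in> rep_vectors Q d \<Longrightarrow> vzero \<oplus>v m = m"
  by (rule rep_vectors_eqI[OF vadd_closed[OF vzero_closed]]) (auto dest: rep_vectors_carrier)

lemma abelian_group_M: "abelian_group M"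
proof (rule abelian_groupI)
  fix m assume m: "m \<in> carrier M"
  let ?n = "\<lambda>v\<in>verts Q. - m v"
  have "?n \<in> rep_vectors Q d" using rep_vectors_carrier m by (intro restrict_rep_vectors) auto
  moreover have "?n \<oplus>v m = vzero"
    using m by (auto intro!: restrict_ext uminus_l_inv_vec dest: rep_vectors_carrier)
  ultimately show "\<exists>y\<in>carrier M. y \<oplus>v m = vzero"
    unfolding rep_module_simps(1) by (intro bexI[of _ ?n])
next
  fix m m' assume "m \<in> carrier M" "m' \<in> carrier M"
  then show "m \<oplus>v m' = m' \<oplus>v m"
    by (auto intro!: restrict_ext comm_add_vec dest: rep_vectors_carrier)
next
  fix m m' m'' assume "m \<in> carrier M" "m' \<in> carrier M" "m'' \<in> carrier M"
  then show "m \<oplus>v m' \<oplus>v m'' = m \<oplus>v (m' \<oplus>v m'')"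
    by (auto intro!: restrict_ext assoc_add_vec dest: rep_vectors_carrier)
next
  fix m m' assume "m \<in> carrier M" "m' \<in> carrier M"
  then show "m \<oplus>v m' \<in> carrier M" using vadd_closed by simp
qed (use vzero_closed vzero_add in \<open>simp_all only: rep_module_simps(1)\<close>)

sublocale M: abelian_group M by (rule abelian_group_M)

text \<open>The representative picked by \<open>SOME\<close> differs from \<open>f\<close> by an
  element of \<open>I\<close>, which acts by zero at a point of \<open>Rep Q I d\<close>.\<close>

lemma smult_cl:
  assumes f: "f \<in> carrier KQ" and m: "m \<in> rep_vectors Q d"
  shows "cl f \<odot>\<^bsub>M\<^esub> m = act f m"
proof -
  have "(SOME g. g \<in> cl f) \<in> cl f" using idl.a_rcos_self[OF f] by (rule someI)
  then obtain h where h: "h \<in> I" "(SOME g. g \<in> cl f) = h + f"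
    unfolding a_r_coset_def r_coset_def by auto
  have "cl f \<odot>\<^bsub>M\<^esub> m = act (h + f) m" unfolding h(2)[symmetric] by (simp add: rep_module_def)
  also have "\<dots> = act f m"
    unfolding act_add act_I[OF h(1) m] by (rule vzero_add[OF path_action_closed])
  finally show ?thesis .
qed

lemma smult_closed: "r \<in> carrier \<Lambda> \<Longrightarrow> m \<in> carrier M \<Longrightarrow> r \<odot>\<^bsub>M\<^esub> m \<in> carrier M"
  by (elim carrier_\<Lambda>E) (auto simp: smult_cl path_action_closed simp del: path_algebra_simps)

lemma smult_add:
  assumes "r \<in> carrier \<Lambda>" "m \<in> carrier M" "m' \<in> carrier M"
  shows "r \<odot>\<^bsub>M\<^esub> (m \<oplus>v m') = r \<odot>\<^bsub>M\<^esub> m \<oplus>v r \<odot>\<^bsub>M\<^esub> m'"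
proof -
  obtain f where f: "r = cl f" "f \<in> carrier KQ" using assms(1) by (rule carrier_\<Lambda>E)
  have m: "m \<in> rep_vectors Q d" "m' \<in> rep_vectors Q d" using assms by simp_all
  have "act f (m \<oplus>v m') = act f m \<oplus>v act f m'"
    unfolding rep_module_simps using f(2) m rep_space by (intro path_action_add_vec) auto
  then show ?thesis unfolding f(1) using smult_cl[OF f(2)] m vadd_closed[OF m] by simp
qed

lemma smult_assoc:
  assumes "r \<in> carrier \<Lambda>" "s \<in> carrier \<Lambda>" "m \<in> carrier M"
  shows "(r \<otimes>\<^bsub>\<Lambda>\<^esub> s) \<odot>\<^bsub>M\<^esub> m = r \<odot>\<^bsub>M\<^esub> (s \<odot>\<^bsub>M\<^esub> m)"
proof -
  obtain f where f: "r = cl f" "f \<in> carrier KQ" using assms(1) by (rule carrier_\<Lambda>E)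
  obtain g where g: "s = cl g" "g \<in> carrier KQ" using assms(2) by (rule carrier_\<Lambda>E)
  have m: "m \<in> rep_vectors Q d" using assms by simp
  have "(r \<otimes>\<^bsub>\<Lambda>\<^esub> s) \<odot>\<^bsub>M\<^esub> m = cl (f \<otimes>\<^bsub>KQ\<^esub> g) \<odot>\<^bsub>M\<^esub> m"
    unfolding f(1) g(1) cl.hom_mult[OF f(2) g(2)] ..
  also have "\<dots> = act (path_mult Q f g) m" using smult_cl[OF KQ.m_closed[OF f(2) g(2)] m] by simp
  also have "\<dots> = act f (act g m)"
    using f(2) g(2) by (intro path_action_mult[OF rep_space _ _ m]) auto
  also have "\<dots> = r \<odot>\<^bsub>M\<^esub> (s \<odot>\<^bsub>M\<^esub> m)"
    unfolding f(1) g(1) smult_cl[OF g(2) m] smult_cl[OF f(2) path_action_closed] ..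
  finally show ?thesis .
qed

lemma smult_one:
  assumes "m \<in> carrier M"
  shows "\<one>\<^bsub>\<Lambda>\<^esub> \<odot>\<^bsub>M\<^esub> m = m"
proof -
  have m: "m \<in> rep_vectors Q d" using assms by simp
  have "\<one>\<^bsub>\<Lambda>\<^esub> \<odot>\<^bsub>M\<^esub> m = act (\<one>\<^bsub>KQ\<^esub>) m"
    using smult_cl[OF KQ.one_closed m] cl.hom_one by simp
  also have "\<dots> = m"
  proof (rule path_action_eqI[OF m])
    fix v i assume v: "v \<in> verts Q" and i: "i < d v"
    have "act (\<one>\<^bsub>KQ\<^esub>) m v $ i = (\<Sum>u\<in>verts Q. if u = v then m v $ i else 0)"
      unfolding path_algebra_simps path_action_sum[where d = d, OF v i] path_action_single[where d = d, OF v i]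
      using rep_vectors_carrier[OF m v] by (intro sum.cong refl) auto
    then show "act (\<one>\<^bsub>KQ\<^esub>) m v $ i = m v $ i" using v by simp
  qed
  finally show ?thesis .
qed

lemma act_vertex:
  assumes v: "v \<in> verts Q" and m: "m \<in> rep_vectors Q d"
  shows "act (Poly_Mapping.single (v, []) c) m = vertex_vector Q d v (c \<cdot>\<^sub>v m v)"
proof (rule path_action_eqI)
  show "vertex_vector Q d v (c \<cdot>\<^sub>v m v) \<in> rep_vectors Q d"
    unfolding vertex_vector_def using rep_vectors_carrier[OF m v] by (intro restrict_rep_vectors) auto
  fix u i assume "u \<in> verts Q" "i < d u"
  then show "act (Poly_Mapping.single (v, []) c) m u $ i = vertex_vector Q d v (c \<cdot>\<^sub>v m v) u $ i"
    using rep_vectors_carrier[OF m v] by (auto simp: path_action_single vertex_vector_def)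
qed

lemma act_arrow:
  assumes \<alpha>: "\<alpha> \<in> arcs Q" and m: "m \<in> rep_vectors Q d"
  shows "act (Poly_Mapping.single (tail Q \<alpha>, [\<alpha>]) 1) m = vertex_vector Q d (head Q \<alpha>) (x \<alpha> *\<^sub>v m (tail Q \<alpha>))"
proof (rule path_action_eqI)
  have X: "x \<alpha> \<in> carrier_mat (d (head Q \<alpha>)) (d (tail Q \<alpha>))" by (rule rep_space_carrier[OF rep_space \<alpha>])
  show "vertex_vector Q d (head Q \<alpha>) (x \<alpha> *\<^sub>v m (tail Q \<alpha>)) \<in> rep_vectors Q d"
    unfolding vertex_vector_def using X by (intro restrict_rep_vectors carrier_vecI) auto
  fix u i assume "u \<in> verts Q" "i < d u"
  then show "act (Poly_Mapping.single (tail Q \<alpha>, [\<alpha>]) 1) m u $ i =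
      vertex_vector Q d (head Q \<alpha>) (x \<alpha> *\<^sub>v m (tail Q \<alpha>)) u $ i"
    using X by (auto simp: path_action_single vertex_vector_def)
qed

lemma KQ_single: "\<pi> \<in> paths Q \<Longrightarrow> Poly_Mapping.single \<pi> c \<in> carrier KQ"
  by simp

lemma submodule_actI:
  assumes sub: "N \<subseteq> carrier M" and ne: "N \<noteq> {}"
    and add: "\<And>m m'. m \<in> N \<Longrightarrow> m' \<in> N \<Longrightarrow> m \<oplus>v m' \<in> N"
    and sm: "\<And>f m. f \<in> carrier KQ \<Longrightarrow> m \<in> N \<Longrightarrow> act f m \<in> N"
  shows "submodule N \<Lambda> M"
proof (rule submodule.intro)
  show "subgroup N (add_monoid M)"
  proof (rule M.add.subgroupI[OF sub ne])
    fix m assume m: "m \<in> N"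
    then have mc: "m \<in> carrier M" using sub by blast
    \<comment> \<open>Additive inverses come from a representative \<open>f\<close> of minus one:
      the sum of \<open>f\<close> and the unit of \<open>KQ\<close> lies in \<open>I\<close> and so
      acts by zero.\<close>
    have "\<ominus>\<^bsub>\<Lambda>\<^esub> \<one>\<^bsub>\<Lambda>\<^esub> \<in> carrier \<Lambda>" by simp
    then obtain f where f: "\<ominus>\<^bsub>\<Lambda>\<^esub> \<one>\<^bsub>\<Lambda>\<^esub> = cl f" "f \<in> carrier KQ" by (rule carrier_\<Lambda>E)
    have one: "\<one>\<^bsub>\<Lambda>\<^esub> = cl \<one>\<^bsub>KQ\<^esub>" using cl.hom_one by simp
    have "cl (f \<oplus>\<^bsub>KQ\<^esub> \<one>\<^bsub>KQ\<^esub>) = \<zero>\<^bsub>\<Lambda>\<^esub>"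
      unfolding cl.hom_add[OF f(2) KQ.one_closed] f(1)[symmetric] one[symmetric] by (simp add: \<Lambda>.l_neg)
    moreover have fo: "f \<oplus>\<^bsub>KQ\<^esub> \<one>\<^bsub>KQ\<^esub> \<in> carrier KQ" by (rule KQ.a_closed[OF f(2) KQ.one_closed])
    ultimately have "f \<oplus>\<^bsub>KQ\<^esub> \<one>\<^bsub>KQ\<^esub> \<in> I" using idl.a_rcos_self[OF fo] by (simp add: zero_\<Lambda>)
    then have "act (f \<oplus>\<^bsub>KQ\<^esub> \<one>\<^bsub>KQ\<^esub>) m = vzero" using mc act_I by simp
    moreover have "act \<one>\<^bsub>KQ\<^esub> m = m"
      using smult_one[OF mc] smult_cl[OF KQ.one_closed] mc one by simp
    ultimately have "act f m \<oplus>v m = vzero" using act_add[of f "\<one>\<^bsub>KQ\<^esub>" m] by simp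
    then have "\<ominus>\<^bsub>M\<^esub> m = act f m"
      by (intro M.minus_equality) (use mc path_action_closed in simp_all)
    then show "\<ominus>\<^bsub>M\<^esub> m \<in> N" using sm[OF f(2) m] by simp
  qed (rule add)
  show "submodule_axioms N \<Lambda> M"
  proof (rule submodule_axioms.intro)
    fix r m assume "r \<in> carrier \<Lambda>" "m \<in> N"
    then show "r \<odot>\<^bsub>M\<^esub> m \<in> N"
      using sub sm smult_cl by (elim carrier_\<Lambda>E) (auto simp del: path_algebra_simps)
  qed
qed

lemma submodule_act: "submodule N \<Lambda> M \<Longrightarrow> f \<in> carrier KQ \<Longrightarrow> m \<in> N \<Longrightarrow> act f m \<in> N"
proof -
  assume N: "submodule N \<Lambda> M" and f: "f \<in> carrier KQ" and m: "m \<in> N"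
  have "m \<in> rep_vectors Q d" using subgroup.subset[OF submodule.axioms(1)[OF N]] m by auto
  then show "act f m \<in> N"
    using submodule.smult_closed[OF N cl.hom_closed[OF f] m] smult_cl[OF f] by simp
qed

text \<open>A path of positive length maps \<open>U\<close> into \<open>W\<close>, so modulo \<open>W\<close> only the trivial paths act.\<close>

lemma act_modulo:
  assumes U: "\<And>v. v \<in> verts Q \<Longrightarrow> lin_subspace (d v) (U v)" and W: "\<And>v. v \<in> verts Q \<Longrightarrow> lin_subspace (d v) (W v)"
    and WU: "\<And>v. v \<in> verts Q \<Longrightarrow> W v \<subseteq> U v"
    and arr: "\<And>\<alpha> u. \<alpha> \<in> arcs Q \<Longrightarrow> u \<in> U (tail Q \<alpha>) \<Longrightarrow> x \<alpha> *\<^sub>v u \<in> W (head Q \<alpha>)"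
    and f: "f \<in> carrier KQ" and m: "m \<in> graded_vectors Q d U" and v: "v \<in> verts Q"
  shows "\<exists>w\<in>W v. act f m v = w + Poly_Mapping.lookup f (v, []) \<cdot>\<^sub>v m v"
proof -
  have mr: "m \<in> rep_vectors Q d" using m by (simp add: graded_vectors_def)
  let ?A = "{\<pi> \<in> Poly_Mapping.keys f. path_end Q \<pi> = v \<and> snd \<pi> \<noteq> []}"
  let ?b = "\<lambda>\<pi>. path_mat Q d x (fst \<pi>) (snd \<pi>) *\<^sub>v m (fst \<pi>)"
  let ?w = "vec (d v) (\<lambda>i. \<Sum>\<pi>\<in>?A. Poly_Mapping.lookup f \<pi> * ?b \<pi> $ i)"
  have "?w \<in> W v"
  proof (rule lin_subspace_sum[OF W[OF v]])
    fix \<pi> assume \<pi>: "\<pi> \<in> ?A"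
    then obtain u \<alpha> p where p: "\<pi> = (u, \<alpha> # p)" by (metis (mono_tags) list.exhaust mem_Collect_eq prod.collapse)
    have pp: "(u, \<alpha> # p) \<in> paths Q" using \<pi> f p by auto
    note * = path_Cons_D[OF pp]
    have mu: "m u \<in> U u" using m path_ends[OF pp] by (simp add: graded_vectors_def)
    \<comment> \<open>The path is split at its first arrow, which carries \<open>U\<close> into
      \<open>W\<close>; the remaining arrows preserve \<open>W\<close> because it is contained in
      \<open>U\<close>.\<close>
    have "path_mat Q d x (head Q \<alpha>) p *\<^sub>v (x \<alpha> *\<^sub>v m u) \<in> W (path_end Q (head Q \<alpha>, p))"
    proof (rule path_mat_preserves[OF rep_space _ _ *(3)])
      fix \<beta> w assume "\<beta> \<in> arcs Q" "w \<in> W (tail Q \<beta>)"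
      then show "x \<beta> *\<^sub>v w \<in> W (head Q \<beta>)" using arr WU[of "tail Q \<beta>"] by auto
    qed (use W arr * mu in \<open>auto simp: lin_subspace_def\<close>)
    moreover have "?b \<pi> = path_mat Q d x (head Q \<alpha>) p *\<^sub>v (x \<alpha> *\<^sub>v m u)"
      using assoc_mult_mat_vec[OF path_mat_carrier[OF rep_space *(3)] rep_space_carrier[OF rep_space *(2)], of "m u"]
        rep_vectors_carrier[OF mr, of u] path_ends[OF pp] *(1) p by simp
    ultimately show "?b \<pi> \<in> W v" using \<pi> p by simp
  qed simp
  moreover have "act f m v = ?w + Poly_Mapping.lookup f (v, []) \<cdot>\<^sub>v m v"
  proof (rule eq_vecI)
    note mv = rep_vectors_carrier[OF mr v]
    fix i assume "i < dim_vec (?w + Poly_Mapping.lookup f (v, []) \<cdot>\<^sub>v m v)"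
    then have i: "i < d v" using mv by simp
    let ?t = "\<lambda>\<pi>. if path_end Q \<pi> = v then Poly_Mapping.lookup f \<pi> * ?b \<pi> $ i else 0"
    \<comment> \<open>The trivial path is added to the support, possibly with coefficient zero, so
      that it can always be split off.\<close>
    have "act f m v $ i = (\<Sum>\<pi>\<in>insert (v, []) (Poly_Mapping.keys f). ?t \<pi>)"
      by (rule index_path_action_superset[where d = d, OF _ _ v i]) auto
    also have "\<dots> = ?t (v, []) + (\<Sum>\<pi>\<in>insert (v, []) (Poly_Mapping.keys f) - {(v, [])}. ?t \<pi>)"
      by (rule sum.remove) auto
    also have "(\<Sum>\<pi>\<in>insert (v, []) (Poly_Mapping.keys f) - {(v, [])}. ?t \<pi>) = (\<Sum>\<pi>\<in>?A. Poly_Mapping.lookup f \<pi> * ?b \<pi> $ i)"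
    proof (rule sum.mono_neutral_cong_right)
      show "\<forall>\<pi>\<in>insert (v, []) (Poly_Mapping.keys f) - {(v, [])} - ?A. ?t \<pi> = 0"
        by (auto simp: path_end_def)
    qed auto
    also have "?t (v, []) = Poly_Mapping.lookup f (v, []) * m v $ i" using mv by simp
    finally show "act f m v $ i = (?w + Poly_Mapping.lookup f (v, []) \<cdot>\<^sub>v m v) $ i"
      using i mv by simp
  qed (use rep_vectors_carrier[OF path_action_closed v, of d x f m] rep_vectors_carrier[OF mr v] in auto)
  ultimately show ?thesis by blast
qed

lemma graded_submodule:
  assumes U: "\<And>v. v \<in> verts Q \<Longrightarrow> lin_subspace (d v) (U v)"
    and arr: "\<And>\<alpha> u. \<alpha> \<in> arcs Q \<Longrightarrow> u \<in> U (tail Q \<alpha>) \<Longrightarrow> x \<alpha> *\<^sub>v u \<in> U (head Q \<alpha>)"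
  shows "submodule (graded_vectors Q d U) \<Lambda> M"
proof (rule submodule_actI)
  have "vzero \<in> graded_vectors Q d U"
    using vzero_closed U by (auto simp: graded_vectors_def dest: lin_subspaceD(2))
  then show "graded_vectors Q d U \<noteq> {}" by blast
next
  fix m m' assume "m \<in> graded_vectors Q d U" "m' \<in> graded_vectors Q d U"
  then show "m \<oplus>v m' \<in> graded_vectors Q d U"
    using vadd_closed[of m m'] U by (auto simp: graded_vectors_def dest: lin_subspaceD(3))
next
  fix f m assume f: "f \<in> carrier KQ" and m: "m \<in> graded_vectors Q d U"
  have "act f m v \<in> U v" if v: "v \<in> verts Q" for v
  proof -
    obtain w where w: "w \<in> U v" "act f m v = w + Poly_Mapping.lookup f (v, []) \<cdot>\<^sub>v m v"
      using act_modulo[OF U U subset_refl arr f m v] by blast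
    have "m v \<in> U v" using m v by (simp add: graded_vectors_def)
    then show ?thesis unfolding w(2) using lin_subspaceD(3,4)[OF U[OF v]] w(1) by blast
  qed
  then show "act f m \<in> graded_vectors Q d U" by (simp add: graded_vectors_def path_action_closed)
qed (auto simp: graded_vectors_def)

text \<open>Acting with the trivial path at \<open>v\<close> projects a submodule to its component
  at \<open>v\<close> without leaving it, so it is the direct sum of its components. Acting with
  arrows gives their stability.\<close>

lemma submodule_graded:
  assumes N: "submodule N \<Lambda> M"
  obtains U where "N = graded_vectors Q d U" "\<And>v. v \<in> verts Q \<Longrightarrow> lin_subspace (d v) (U v)"
    "\<And>\<alpha> u. \<alpha> \<in> arcs Q \<Longrightarrow> u \<in> U (tail Q \<alpha>) \<Longrightarrow> x \<alpha> *\<^sub>v u \<in> U (head Q \<alpha>)"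
proof -
  define U where "U v = {m v |m. m \<in> N}" for v
  have Nc: "m \<in> rep_vectors Q d" if "m \<in> N" for m
    using subgroup.subset[OF submodule.axioms(1)[OF N]] that by auto
  have Nadd: "m \<oplus>v m' \<in> N" if "m \<in> N" "m' \<in> N" for m m'
    using subgroup.m_closed[OF submodule.axioms(1)[OF N]] that by simp
  have N0: "vzero \<in> N" using subgroup.one_closed[OF submodule.axioms(1)[OF N]] by simp
  have vert: "vertex_vector Q d v (c \<cdot>\<^sub>v m v) \<in> N" if v: "v \<in> verts Q" and m: "m \<in> N" for v c m
    using submodule_act[OF N KQ_single[OF trivial_path[OF v]] m] act_vertex[OF v Nc[OF m]] by metis
  have lin: "lin_subspace (d v) (U v)" if v: "v \<in> verts Q" for v
    unfolding lin_subspace_def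
  proof (intro conjI ballI allI)
    show "U v \<subseteq> carrier_vec (d v)" using rep_vectors_carrier[OF Nc v] by (auto simp: U_def)
    have "vzero v \<in> U v" using N0 unfolding U_def by blast
    then show "0\<^sub>v (d v) \<in> U v" using v by simp
  next
    fix u w assume "u \<in> U v" "w \<in> U v"
    then obtain m m' where m: "m \<in> N" "u = m v" "m' \<in> N" "w = m' v" by (auto simp: U_def)
    have "(m \<oplus>v m') v \<in> U v" unfolding U_def using Nadd[OF m(1,3)] by blast
    then show "u + w \<in> U v" using v m by simp
  next
    fix c u assume "u \<in> U v"
    then obtain m where m: "m \<in> N" "u = m v" by (auto simp: U_def)
    have "vertex_vector Q d v (c \<cdot>\<^sub>v m v) v \<in> U v" unfolding U_def using vert[OF v m(1)] by blast
    then show "c \<cdot>\<^sub>v u \<in> U v" using v m by (simp add: vertex_vector_def)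
  qed
  have arr: "x \<alpha> *\<^sub>v u \<in> U (head Q \<alpha>)" if \<alpha>: "\<alpha> \<in> arcs Q" and u: "u \<in> U (tail Q \<alpha>)" for \<alpha> u
  proof -
    obtain m where m: "m \<in> N" "u = m (tail Q \<alpha>)" using u by (auto simp: U_def)
    have "vertex_vector Q d (head Q \<alpha>) (x \<alpha> *\<^sub>v m (tail Q \<alpha>)) \<in> N"
      using submodule_act[OF N KQ_single[OF arrow_path[OF \<alpha>]] m(1)] act_arrow[OF \<alpha> Nc[OF m(1)]] by metis
    then have "vertex_vector Q d (head Q \<alpha>) (x \<alpha> *\<^sub>v m (tail Q \<alpha>)) (head Q \<alpha>) \<in> U (head Q \<alpha>)"
      unfolding U_def by blast
    then show ?thesis using \<alpha> m by (simp add: vertex_vector_def)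
  qed
  have "N = graded_vectors Q d U"
  proof (intro equalityI subsetI)
    fix m assume "m \<in> N"
    then show "m \<in> graded_vectors Q d U" using Nc by (auto simp: graded_vectors_def U_def)
  next
    fix m assume m: "m \<in> graded_vectors Q d U"
    then have mr: "m \<in> rep_vectors Q d" by (simp add: graded_vectors_def)
    \<comment> \<open>The vector \<open>m\<close> is reassembled from its components by adding one
      vertex at a time.\<close>
    have "(\<lambda>u\<in>verts Q. if u \<in> W then m u else 0\<^sub>v (d u)) \<in> N" if "finite W" "W \<subseteq> verts Q" for W
      using that
    proof (induction W rule: finite_induct)
      case empty then show ?case using N0 by (simp only: rep_module_simps empty_iff if_False)
    next
      case (insert v W)
      then have v: "v \<in> verts Q" by simp
      then have "m v \<in> U v" using m by (simp add: graded_vectors_def)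
      then obtain m' where m': "m' \<in> N" "m v = m' v" by (auto simp: U_def)
      have "vertex_vector Q d v (1 \<cdot>\<^sub>v m' v) \<oplus>v (\<lambda>u\<in>verts Q. if u \<in> W then m u else 0\<^sub>v (d u)) \<in> N"
        by (intro Nadd vert v m' insert.IH) (use insert.prems in simp)
      also have "vertex_vector Q d v (1 \<cdot>\<^sub>v m' v) \<oplus>v (\<lambda>u\<in>verts Q. if u \<in> W then m u else 0\<^sub>v (d u)) =
          (\<lambda>u\<in>verts Q. if u \<in> insert v W then m u else 0\<^sub>v (d u))"
        using insert(2) m'(2) rep_vectors_carrier[OF mr] rep_vectors_carrier[OF Nc[OF m'(1)] v]
        by (auto simp: vertex_vector_def intro!: restrict_ext)
      finally show ?case .
    qed
    from this[OF finite_verts subset_refl] have "(\<lambda>u\<in>verts Q. if u \<in> verts Q then m u else 0\<^sub>v (d u)) \<in> N" .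
    also have "(\<lambda>u\<in>verts Q. if u \<in> verts Q then m u else 0\<^sub>v (d u)) = m"
      by (rule rep_vectors_eqI[OF _ mr]) (use rep_vectors_carrier[OF mr] in \<open>auto intro!: restrict_rep_vectors\<close>)
    finally show "m \<in> N" .
  qed
  then show ?thesis using that[of U] lin arr by blast
qed

end

section \<open>Quotients on which all arrows act by zero\<close>

section \<open>Semisimple quotients\<close>

lemma module_isomorphic_refl: "module_isomorphic R M M"
  unfolding module_isomorphic_def by (rule exI[of _ id]) auto

lemma module_isomorphic_trans:
  assumes "module_isomorphic R M N" "module_isomorphic R N P"
  shows "module_isomorphic R M P"
proof -
  obtain h where h: "bij_betw h (carrier M) (carrier N)"
    "\<And>x y. x \<in> carrier M \<Longrightarrow> y \<in> carrier M \<Longrightarrow> h (x \<oplus>\<^bsub>M\<^esub> y) = h x \<oplus>\<^bsub>N\<^esub> h y"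
    "\<And>r x. r \<in> carrier R \<Longrightarrow> x \<in> carrier M \<Longrightarrow> h (r \<odot>\<^bsub>M\<^esub> x) = r \<odot>\<^bsub>N\<^esub> h x"
    using assms(1) unfolding module_isomorphic_def by auto
  obtain k where k: "bij_betw k (carrier N) (carrier P)"
    "\<And>x y. x \<in> carrier N \<Longrightarrow> y \<in> carrier N \<Longrightarrow> k (x \<oplus>\<^bsub>N\<^esub> y) = k x \<oplus>\<^bsub>P\<^esub> k y"
    "\<And>r x. r \<in> carrier R \<Longrightarrow> x \<in> carrier N \<Longrightarrow> k (r \<odot>\<^bsub>N\<^esub> x) = r \<odot>\<^bsub>P\<^esub> k x"
    using assms(2) unfolding module_isomorphic_def by auto
  have hc: "h x \<in> carrier N" if "x \<in> carrier M" for x using h(1) that by (auto simp: bij_betw_def)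
  show ?thesis
    unfolding module_isomorphic_def
    by (rule exI[of _ "k \<circ> h"]) (use bij_betw_trans[OF h(1) k(1)] h(2,3) k(2,3) hc in auto)
qed

text \<open>Since \<open>module_isomorphic\<close> speaks about bare records, closure of
  \<open>M\<close> under its operations is an explicit assumption; it lets the homomorphism laws
  pass through the inverse bijection.\<close>

lemma module_isomorphic_sym:
  assumes iso: "module_isomorphic R M N"
    and add: "\<And>x y. x \<in> carrier M \<Longrightarrow> y \<in> carrier M \<Longrightarrow> x \<oplus>\<^bsub>M\<^esub> y \<in> carrier M"
    and sm: "\<And>r x. r \<in> carrier R \<Longrightarrow> x \<in> carrier M \<Longrightarrow> r \<odot>\<^bsub>M\<^esub> x \<in> carrier M"
  shows "module_isomorphic R N M"
proof -
  obtain h where h: "bij_betw h (carrier M) (carrier N)"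
    "\<And>x y. x \<in> carrier M \<Longrightarrow> y \<in> carrier M \<Longrightarrow> h (x \<oplus>\<^bsub>M\<^esub> y) = h x \<oplus>\<^bsub>N\<^esub> h y"
    "\<And>r x. r \<in> carrier R \<Longrightarrow> x \<in> carrier M \<Longrightarrow> h (r \<odot>\<^bsub>M\<^esub> x) = r \<odot>\<^bsub>N\<^esub> h x"
    using iso unfolding module_isomorphic_def by auto
  define k where "k = inv_into (carrier M) h"
  have kh: "k (h x) = x" if "x \<in> carrier M" for x
    using h(1) that by (simp add: k_def bij_betw_inv_into_left)
  have ex: "\<exists>x\<in>carrier M. y = h x" if "y \<in> carrier N" for y using h(1) that by (auto simp: bij_betw_def)
  show ?thesis
    unfolding module_isomorphic_def
  proof (intro exI[of _ k] conjI ballI)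
    show "bij_betw k (carrier N) (carrier M)" unfolding k_def by (rule bij_betw_inv_into[OF h(1)])
  next
    fix y y' assume "y \<in> carrier N" "y' \<in> carrier N"
    then obtain x x' where "x \<in> carrier M" "y = h x" "x' \<in> carrier M" "y' = h x'" using ex by blast
    then show "k (y \<oplus>\<^bsub>N\<^esub> y') = k y \<oplus>\<^bsub>M\<^esub> k y'" using kh add h(2)[symmetric] by simp
  next
    fix r y assume r: "r \<in> carrier R" and "y \<in> carrier N"
    then obtain x where "x \<in> carrier M" "y = h x" using ex by blast
    then show "k (r \<odot>\<^bsub>N\<^esub> y) = r \<odot>\<^bsub>M\<^esub> k y" using kh sm[OF r] h(3)[OF r, symmetric] by simp
  qed
qed

text \<open>The point of \<open>rep_space Q n\<close> whose module is the semisimple one with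
  dimension vector \<open>n\<close>.\<close>

definition zero_rep :: "('v, 'a) pre_digraph \<Rightarrow> ('v \<Rightarrow> nat) \<Rightarrow> ('a \<Rightarrow> 'k::field mat)" where
  "zero_rep Q n = (\<lambda>\<alpha>\<in>arcs Q. 0\<^sub>m (n (head Q \<alpha>)) (n (tail Q \<alpha>)))"

abbreviation ss_module ::
  "('v, 'a) pre_digraph \<Rightarrow> ('v \<Rightarrow> nat) \<Rightarrow> ((('v, 'a) qpath \<Rightarrow>\<^sub>0 'k::field) set, 'v \<Rightarrow> 'k vec) module" where
  "ss_module Q n \<equiv> rep_module Q n (zero_rep Q n)"

lemma zero_rep_mult: "\<alpha> \<in> arcs Q \<Longrightarrow> u \<in> carrier_vec (n (tail Q \<alpha>)) \<Longrightarrow> zero_rep Q n \<alpha> *\<^sub>v u = 0\<^sub>v (n (head Q \<alpha>))"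
  by (auto simp: zero_rep_def scalar_prod_def intro!: eq_vecI)

lemma lin_subspace_carrier: "lin_subspace n (carrier_vec n)"
  by (simp add: lin_subspace_def)

lemma lin_subspace_zero: "lin_subspace n {0\<^sub>v n}"
  by (auto simp: lin_subspace_def)

lemma graded_vectors_carrier: "graded_vectors Q d (\<lambda>v. carrier_vec (d v)) = rep_vectors Q d"
  by (auto simp: graded_vectors_def rep_vectors_carrier)

context admissible_quiver
begin

text \<open>Elements of \<open>I\<close> are combinations of paths of positive length, and such a
  path acts by zero because its first arrow does.\<close>

lemma zero_rep_in_Rep: "zero_rep Q n \<in> Rep Q I n"
proof -
  have sp: "(zero_rep Q n :: 'a \<Rightarrow> 'k mat) \<in> rep_space Q n" by (auto simp: zero_rep_def rep_space_def)
  have path: "path_mat Q n (zero_rep Q n) (fst \<pi>) (snd \<pi>) *\<^sub>v w = (0\<^sub>v (n (path_end Q \<pi>)) :: 'k vec)"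
    if \<pi>: "\<pi> \<in> paths Q" and ne: "snd \<pi> \<noteq> []" and w: "w \<in> carrier_vec (n (fst \<pi>))" for \<pi> w
  proof -
    obtain u \<alpha> p where p: "\<pi> = (u, \<alpha> # p)" using ne by (metis list.exhaust prod.collapse)
    note * = path_Cons_D[OF \<pi>[unfolded p]]
    note P = path_mat_carrier[OF sp *(3)]
    have "path_mat Q n (zero_rep Q n) u (\<alpha> # p) *\<^sub>v w = path_mat Q n (zero_rep Q n) (head Q \<alpha>) p *\<^sub>v (zero_rep Q n \<alpha> *\<^sub>v w)"
      using assoc_mult_mat_vec[OF P rep_space_carrier[OF sp *(2)], of w] w *(1) p by simp
    also have "\<dots> = 0\<^sub>v (n (path_end Q (head Q \<alpha>, p)))"
      using zero_rep_mult[OF *(2), of w n] w *(1) p mult_mat_zero_vec[OF P] by simp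
    finally show ?thesis by (simp add: p)
  qed
  have "path_action Q n (zero_rep Q n) f m = (\<lambda>v\<in>verts Q. 0\<^sub>v (n v))" if f: "f \<in> I" and m: "m \<in> rep_vectors Q n" for f m
  proof (rule path_action_eqI)
    show "(\<lambda>v\<in>verts Q. 0\<^sub>v (n v)) \<in> rep_vectors Q n" by (intro restrict_rep_vectors) simp
    fix v i assume v: "v \<in> verts Q" and i: "i < n v"
    have "path_action Q n (zero_rep Q n) f m v $ i = 0"
      unfolding index_path_action[where d = n, OF v i]
    proof (intro sum.neutral ballI)
      fix \<pi> assume \<pi>: "\<pi> \<in> Poly_Mapping.keys f"
      then have "\<pi> \<in> paths Q" "1 \<le> length (snd \<pi>)" using subsetD[OF I_subset f] by (auto simp: long_paths_def)
      then have "\<pi> \<in> paths Q" "snd \<pi> \<noteq> []" by auto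
      then show "(if path_end Q \<pi> = v then Poly_Mapping.lookup f \<pi> *
          (path_mat Q n (zero_rep Q n) (fst \<pi>) (snd \<pi>) *\<^sub>v m (fst \<pi>)) $ i else 0) = 0"
        using path[of \<pi> "m (fst \<pi>)"] rep_vectors_carrier[OF m] path_ends[of \<pi>] i by auto
    qed
    then show "path_action Q n (zero_rep Q n) f m v $ i = (\<lambda>v\<in>verts Q. 0\<^sub>v (n v)) v $ i"
      using v i by simp
  qed
  then show ?thesis using sp by (simp add: Rep_def)
qed

lemma quiver_repI: "x \<in> Rep Q I d \<Longrightarrow> quiver_rep Q I d x"
  by (intro quiver_rep.intro quiver_rep_axioms.intro admissible_quiver_axioms)

lemma quiver_rep_zero: "quiver_rep Q I n (zero_rep Q n)"
  by (rule quiver_repI[OF zero_rep_in_Rep])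

text \<open>The instance of \<open>act_modulo\<close> in which all arrows map into zero
  spaces.\<close>

lemma act_zero_rep:
  assumes f: "f \<in> carrier KQ" and m: "m \<in> rep_vectors Q n" and v: "v \<in> verts Q"
  shows "path_action Q n (zero_rep Q n) f m v = Poly_Mapping.lookup f (v, []) \<cdot>\<^sub>v m v"
proof -
  interpret E: quiver_rep Q I n "zero_rep Q n" by (rule quiver_rep_zero)
  have "\<exists>w\<in>{0\<^sub>v (n v)}. path_action Q n (zero_rep Q n) f m v = w + Poly_Mapping.lookup f (v, []) \<cdot>\<^sub>v m v"
  proof (rule E.act_modulo[of "\<lambda>v. carrier_vec (n v)" "\<lambda>v. {0\<^sub>v (n v)}"])
    fix \<alpha> and u :: "'k vec" assume "\<alpha> \<in> arcs Q" "u \<in> carrier_vec (n (tail Q \<alpha>))"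
    then show "zero_rep Q n \<alpha> *\<^sub>v u \<in> {0\<^sub>v (n (head Q \<alpha>))}" using zero_rep_mult by auto
  qed (use f m v in \<open>auto simp: lin_subspace_carrier lin_subspace_zero graded_vectors_carrier simp del: path_algebra_simps\<close>)
  then show ?thesis using rep_vectors_carrier[OF m v] by auto
qed

end

context quiver_rep
begin

abbreviation coset :: "('v \<Rightarrow> 'k vec) set \<Rightarrow> ('v \<Rightarrow> 'k vec) \<Rightarrow> ('v \<Rightarrow> 'k vec) set" where
  "coset N m \<equiv> N +>\<^bsub>M\<^esub> m"

lemma quot_module_simps:
  "carrier (quot_module (M\<lparr>carrier := F\<rparr>) N) = coset N ` F"
  "add (quot_module (M\<lparr>carrier := F\<rparr>) N) = set_add M"
  "smult (quot_module (M\<lparr>carrier := F\<rparr>) N) = (\<lambda>r X. \<Union>m\<in>X. coset N (r \<odot>\<^bsub>M\<^esub> m))"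
proof -
  have c: "N +>\<^bsub>M\<lparr>carrier := F\<rparr>\<^esub> m = coset N m" for m by (simp add: a_r_coset_def r_coset_def)
  show "carrier (quot_module (M\<lparr>carrier := F\<rparr>) N) = coset N ` F"
    by (auto simp: quot_module_def A_RCOSETS_def RCOSETS_def a_r_coset_def r_coset_def)
  show "add (quot_module (M\<lparr>carrier := F\<rparr>) N) = set_add M"
    by (simp add: quot_module_def set_add_def set_mult_def fun_eq_iff)
  show "smult (quot_module (M\<lparr>carrier := F\<rparr>) N) = (\<lambda>r X. \<Union>m\<in>X. coset N (r \<odot>\<^bsub>M\<^esub> m))"
    by (simp add: quot_module_def c)
qed

lemma submodule_carrier: "submodule N \<Lambda> M \<Longrightarrow> N \<subseteq> rep_vectors Q d"
proof -
  assume "submodule N \<Lambda> M"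
  from subgroup.subset[OF submodule.axioms(1)[OF this]] show ?thesis by simp
qed

lemma submodule_abelian_subgroup: "submodule N \<Lambda> M \<Longrightarrow> abelian_subgroup N M"
  by (intro abelian_subgroupI3 additive_subgroup.intro submodule.axioms(1) abelian_group_M)

lemma coset_eq_iff:
  assumes N: "submodule N \<Lambda> M" and m: "m \<in> carrier M" "m' \<in> carrier M"
  shows "coset N m = coset N m' \<longleftrightarrow> (\<exists>k\<in>N. m = k \<oplus>v m')"
proof -
  interpret N: abelian_subgroup N M by (rule submodule_abelian_subgroup[OF N])
  have "coset N m = coset N m' \<longleftrightarrow> m \<in> coset N m'"
    using N.a_repr_independence'[of m m'] N.a_rcos_self[OF m(1)] m by auto
  also have "\<dots> \<longleftrightarrow> (\<exists>k\<in>N. m = k \<oplus>v m')" by (auto simp: a_r_coset_def r_coset_def)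
  finally show ?thesis .
qed

lemma coset_eqI:
  assumes N: "submodule N \<Lambda> M" and k: "k \<in> N" and m': "m' \<in> carrier M" and m: "m = k \<oplus>v m'"
  shows "coset N m = coset N m'"
proof -
  have "k \<in> rep_vectors Q d" using submodule_carrier[OF N] k by blast
  then have "m \<in> carrier M" using vadd_closed[of k m'] m' unfolding m rep_module_simps(1) by blast
  then show ?thesis using coset_eq_iff[OF N _ m'] k m by blast
qed

lemma coset_add:
  assumes N: "submodule N \<Lambda> M" and m: "m \<in> carrier M" "m' \<in> carrier M"
  shows "coset N m <+>\<^bsub>M\<^esub> coset N m' = coset N (m \<oplus>v m')"
proof -
  interpret N: abelian_subgroup N M by (rule submodule_abelian_subgroup[OF N])
  show ?thesis by (rule N.a_rcos_sum[OF m])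
qed

lemma coset_smult:
  assumes N: "submodule N \<Lambda> M" and r: "r \<in> carrier \<Lambda>" and m: "m \<in> carrier M"
  shows "(\<Union>m'\<in>coset N m. coset N (r \<odot>\<^bsub>M\<^esub> m')) = coset N (r \<odot>\<^bsub>M\<^esub> m)"
proof -
  interpret N: abelian_subgroup N M by (rule submodule_abelian_subgroup[OF N])
  have "coset N (r \<odot>\<^bsub>M\<^esub> m') = coset N (r \<odot>\<^bsub>M\<^esub> m)" if "m' \<in> coset N m" for m'
  proof -
    obtain k where k: "k \<in> N" "m' = k \<oplus>v m" using \<open>m' \<in> coset N m\<close> by (auto simp: a_r_coset_def r_coset_def)
    have kc: "k \<in> carrier M" using k(1) N.a_subset by blast
    have rk: "r \<odot>\<^bsub>M\<^esub> k \<in> N" by (rule submodule.smult_closed[OF N r k(1)])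
    have "r \<odot>\<^bsub>M\<^esub> m' = r \<odot>\<^bsub>M\<^esub> k \<oplus>v r \<odot>\<^bsub>M\<^esub> m" unfolding k(2) by (rule smult_add[OF r kc m])
    moreover have "k \<oplus>v m \<in> carrier M" by (rule M.a_closed[OF kc m])
    ultimately show ?thesis
      using coset_eq_iff[OF N smult_closed[OF r] smult_closed[OF r m], of m'] rk k(2) by blast
  qed
  moreover have "m \<in> coset N m" by (rule N.a_rcos_self[OF m])
  ultimately show ?thesis by blast
qed

lemma add_idem_zero:
  assumes m: "m \<in> rep_vectors Q d" and "m \<oplus>v m = m"
  shows "m = vzero"
proof (rule rep_vectors_eqI[OF m vzero_closed])
  fix v assume v: "v \<in> verts Q"
  note mv = carrier_vecD[OF rep_vectors_carrier[OF m v]]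
  have e: "m v + m v = m v" using fun_cong[OF assms(2), of v] v by simp
  have "m v $ i = 0" if "i < d v" for i
  proof -
    have "m v $ i + m v $ i = (m v + m v) $ i" using that mv by simp
    also have "\<dots> = m v $ i + 0" unfolding e by simp
    finally show ?thesis by (rule add_left_imp_eq)
  qed
  then show "m v = vzero v" using v mv by (intro eq_vecI) auto
qed

lemma smult_zero_vec:
  assumes r: "r \<in> carrier \<Lambda>"
  shows "r \<odot>\<^bsub>M\<^esub> vzero = vzero"
proof -
  have z: "vzero \<in> carrier M" by (rule M.zero_closed)
  have "r \<odot>\<^bsub>M\<^esub> vzero \<oplus>v r \<odot>\<^bsub>M\<^esub> vzero = r \<odot>\<^bsub>M\<^esub> vzero"
    unfolding smult_add[OF r z z, symmetric] by (simp only: M.l_zero[OF z])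
  then show ?thesis using smult_closed[OF r z] unfolding rep_module_simps(1) by (intro add_idem_zero)
qed

lemma graded_vectors_mono: "(\<And>v. v \<in> verts Q \<Longrightarrow> W v \<subseteq> U v) \<Longrightarrow> graded_vectors Q d W \<subseteq> graded_vectors Q d U"
  by (auto simp: graded_vectors_def)

text \<open>The columns of \<open>B v\<close> identify the space of dimension \<open>n v\<close>
  with the quotient of \<open>U v\<close> by \<open>W v\<close>. As arrows map \<open>U\<close> into
  \<open>W\<close>, an element of the path algebra acts modulo \<open>W\<close> through its
  coefficients at trivial paths, just as on \<open>ss_module Q n\<close>.\<close>

lemma quot_isomorphic_ss:
  assumes U: "\<And>v. v \<in> verts Q \<Longrightarrow> lin_subspace (d v) (U v)" and W: "\<And>v. v \<in> verts Q \<Longrightarrow> lin_subspace (d v) (W v)"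
    and WU: "\<And>v. v \<in> verts Q \<Longrightarrow> W v \<subseteq> U v"
    and arr: "\<And>\<alpha> u. \<alpha> \<in> arcs Q \<Longrightarrow> u \<in> U (tail Q \<alpha>) \<Longrightarrow> x \<alpha> *\<^sub>v u \<in> W (head Q \<alpha>)"
    and B: "\<And>v. v \<in> verts Q \<Longrightarrow> quot_basis (d v) (n v) (B v) (U v) (W v)"
  shows "module_isomorphic \<Lambda> (ss_module Q n)
    (quot_module (M\<lparr>carrier := graded_vectors Q d U\<rparr>) (graded_vectors Q d W))"
proof -
  interpret E: quiver_rep Q I n "zero_rep Q n" by (rule quiver_rep_zero)
  let ?F = "graded_vectors Q d U" and ?N = "graded_vectors Q d W"
  have N: "submodule ?N \<Lambda> M"
  proof (rule graded_submodule[OF W])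
    fix \<alpha> u assume "\<alpha> \<in> arcs Q" "u \<in> W (tail Q \<alpha>)"
    then show "x \<alpha> *\<^sub>v u \<in> W (head Q \<alpha>)" using arr WU[of "tail Q \<alpha>"] by auto
  qed
  define b where "b y = (\<lambda>v\<in>verts Q. B v *\<^sub>v y v)" for y :: "'v \<Rightarrow> 'k vec"
  have Bc: "B v \<in> carrier_mat (d v) (n v)" if "v \<in> verts Q" for v using B[OF that] by (simp add: quot_basis_def)
  have bF: "b y \<in> ?F" if "y \<in> rep_vectors Q n" for y
    unfolding graded_vectors_def
  proof (intro CollectI conjI ballI)
    show "b y \<in> rep_vectors Q d" unfolding b_def by (intro restrict_rep_vectors carrier_vecI) (use Bc in auto)
    fix v assume v: "v \<in> verts Q"
    then show "b y v \<in> U v" using B[OF v] rep_vectors_carrier[OF that v] by (simp add: b_def quot_basis_def)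
  qed
  have bc: "b y \<in> carrier M" if "y \<in> rep_vectors Q n" for y using bF[OF that] by (simp add: graded_vectors_def)
  have badd: "b (y \<oplus>\<^bsub>E.M\<^esub> y') = b y \<oplus>v b y'" if "y \<in> rep_vectors Q n" "y' \<in> rep_vectors Q n" for y y'
    unfolding b_def rep_module_simps
    using mult_add_distrib_mat_vec[OF Bc rep_vectors_carrier[OF that(1)] rep_vectors_carrier[OF that(2)]]
    by (auto intro!: restrict_ext)
  define h where "h y = coset ?N (b y)" for y
  have "bij_betw h (rep_vectors Q n) (coset ?N ` ?F)"
  proof (rule bij_betwI')
    fix y y' :: "'v \<Rightarrow> 'k vec" assume y: "y \<in> rep_vectors Q n" "y' \<in> rep_vectors Q n"
    show "(h y = h y') = (y = y')"
    proof
      assume "h y = h y'"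
      then obtain k where k: "k \<in> ?N" "b y = k \<oplus>v b y'"
        unfolding h_def coset_eq_iff[OF N bc[OF y(1)] bc[OF y(2)]] by blast
      show "y = y'"
      proof (rule rep_vectors_eqI[OF y])
        fix v assume v: "v \<in> verts Q"
        note c = rep_vectors_carrier[OF y(1) v] rep_vectors_carrier[OF y(2) v]
        have kv: "k v \<in> W v" "k v \<in> carrier_vec (d v)"
          using k(1) v by (auto simp: graded_vectors_def rep_vectors_carrier)
        have e: "B v *\<^sub>v y v = k v + B v *\<^sub>v y' v"
          using fun_cong[OF k(2), of v] v by (simp add: b_def)
        have "B v *\<^sub>v (y v - y' v) = B v *\<^sub>v y v - B v *\<^sub>v y' v"
          by (rule mult_minus_distrib_mat_vec[OF Bc[OF v] c])
        also have "\<dots> = k v" unfolding e using kv(2) Bc[OF v] by (intro eq_vecI) auto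
        finally have "B v *\<^sub>v (y v - y' v) \<in> W v" using kv(1) by simp
        then have "y v - y' v = 0\<^sub>v (n v)" using B[OF v] c by (simp add: quot_basis_def)
        then have "(y v - y' v) $ i = 0" if "i < n v" for i using that by simp
        then show "y v = y' v" using c by (intro eq_vecI) auto
      qed
    qed simp
  next
    fix y :: "'v \<Rightarrow> 'k vec" assume "y \<in> rep_vectors Q n"
    then show "h y \<in> coset ?N ` ?F" unfolding h_def by (intro imageI bF)
  next
    fix X assume "X \<in> coset ?N ` ?F"
    then obtain m where m: "X = coset ?N m" "m \<in> ?F" by blast
    have mr: "m \<in> rep_vectors Q d" using m(2) by (simp add: graded_vectors_def)
    have "\<forall>v. \<exists>c w. v \<in> verts Q \<longrightarrow> c \<in> carrier_vec (n v) \<and> w \<in> W v \<and> m v = B v *\<^sub>v c + w"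
      using B m(2) unfolding graded_vectors_def quot_basis_def by blast
    then obtain c w where cw: "\<And>v. v \<in> verts Q \<Longrightarrow> c v \<in> carrier_vec (n v)" "\<And>v. v \<in> verts Q \<Longrightarrow> w v \<in> W v"
      "\<And>v. v \<in> verts Q \<Longrightarrow> m v = B v *\<^sub>v c v + w v" by metis
    have wc: "w v \<in> carrier_vec (d v)" if "v \<in> verts Q" for v using lin_subspaceD(1)[OF W cw(2)] that by blast
    let ?y = "\<lambda>v\<in>verts Q. c v" and ?w = "\<lambda>v\<in>verts Q. w v"
    have y: "?y \<in> rep_vectors Q n" using cw(1) by (intro restrict_rep_vectors)
    have w: "?w \<in> ?N" unfolding graded_vectors_def using wc cw(2) by (auto intro!: restrict_rep_vectors)
    have "m = ?w \<oplus>v b ?y"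
    proof (rule rep_vectors_eqI[OF mr])
      show "?w \<oplus>v b ?y \<in> rep_vectors Q d"
        by (rule vadd_closed) (use w bc[OF y] in \<open>simp_all add: graded_vectors_def\<close>)
      fix v assume v: "v \<in> verts Q"
      then show "m v = (?w \<oplus>v b ?y) v"
        using cw(3)[OF v] comm_add_vec[of "B v *\<^sub>v c v" "d v" "w v"] wc[OF v] Bc[OF v] cw(1)[OF v]
        by (simp add: b_def)
    qed
    then have "coset ?N m = coset ?N (b ?y)"
      by (rule coset_eqI[OF N w bc[OF y]])
    then show "\<exists>y\<in>rep_vectors Q n. X = h y" using y m(1) by (auto simp: h_def)
  qed
  moreover have "h (y \<oplus>\<^bsub>E.M\<^esub> y') = h y <+>\<^bsub>M\<^esub> h y'" if "y \<in> rep_vectors Q n" "y' \<in> rep_vectors Q n" for y y'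
    unfolding h_def badd[OF that] coset_add[OF N bc[OF that(1)] bc[OF that(2)]] ..
  moreover have "h (r \<odot>\<^bsub>E.M\<^esub> y) = (\<Union>m\<in>h y. coset ?N (r \<odot>\<^bsub>M\<^esub> m))" if r: "r \<in> carrier \<Lambda>" and y: "y \<in> rep_vectors Q n" for r y
  proof -
    obtain f where f: "r = cl f" "f \<in> carrier KQ" using r by (rule carrier_\<Lambda>E)
    have br: "b y \<in> rep_vectors Q d" using bc[OF y] by simp
    have ey: "r \<odot>\<^bsub>E.M\<^esub> y = path_action Q n (zero_rep Q n) f y" unfolding f(1) by (rule E.smult_cl[OF f(2) y])
    have eyc: "r \<odot>\<^bsub>E.M\<^esub> y \<in> rep_vectors Q n" unfolding ey by (rule path_action_closed)
    have "\<exists>w\<in>W v. act f (b y) v = w + b (r \<odot>\<^bsub>E.M\<^esub> y) v" if v: "v \<in> verts Q" for v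
    proof -
      have "b (r \<odot>\<^bsub>E.M\<^esub> y) v = Poly_Mapping.lookup f (v, []) \<cdot>\<^sub>v b y v"
        using v act_zero_rep[OF f(2) y v] mult_mat_vec[OF Bc[OF v] rep_vectors_carrier[OF y v]]
        by (simp add: b_def ey)
      then show ?thesis using act_modulo[OF U W WU arr f(2) bF[OF y] v] by simp
    qed
    then have "\<forall>v. \<exists>w. v \<in> verts Q \<longrightarrow> w \<in> W v \<and> act f (b y) v = w + b (r \<odot>\<^bsub>E.M\<^esub> y) v" by blast
    then obtain w where w: "\<And>v. v \<in> verts Q \<Longrightarrow> w v \<in> W v"
      "\<And>v. v \<in> verts Q \<Longrightarrow> act f (b y) v = w v + b (r \<odot>\<^bsub>E.M\<^esub> y) v" by metis
    let ?w = "\<lambda>v\<in>verts Q. w v"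
    have wr: "?w \<in> rep_vectors Q d" using lin_subspaceD(1)[OF W w(1)] by (intro restrict_rep_vectors)
    then have wN: "?w \<in> ?N" using w(1) by (simp add: graded_vectors_def)
    have "act f (b y) = ?w \<oplus>v b (r \<odot>\<^bsub>E.M\<^esub> y)"
      by (rule rep_vectors_eqI[OF path_action_closed vadd_closed[OF wr]]) (use bc[OF eyc] w(2) in simp_all)
    then have "coset ?N (act f (b y)) = coset ?N (b (r \<odot>\<^bsub>E.M\<^esub> y))"
      by (rule coset_eqI[OF N wN bc[OF eyc]])
    then show ?thesis
      unfolding h_def coset_smult[OF N r bc[OF y]] unfolding f(1) smult_cl[OF f(2) br] by simp
  qed
  ultimately show ?thesis
    unfolding module_isomorphic_def quot_module_simps by (intro exI[of _ h]) simp
qed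

text \<open>A converse to \<open>quot_isomorphic_ss\<close>: on \<open>ss_module Q n\<close> the
  class of an arrow acts like the class of 0, and the isomorphism transports this to the
  quotient.\<close>

lemma quot_iso_arrows:
  assumes iso: "module_isomorphic \<Lambda> (ss_module Q n) (quot_module (M\<lparr>carrier := graded_vectors Q d U\<rparr>) (graded_vectors Q d W))"
    and U: "\<And>v. v \<in> verts Q \<Longrightarrow> lin_subspace (d v) (U v)"
    and N: "submodule (graded_vectors Q d W) \<Lambda> M"
    and \<alpha>: "\<alpha> \<in> arcs Q" and u: "u \<in> U (tail Q \<alpha>)"
  shows "x \<alpha> *\<^sub>v u \<in> W (head Q \<alpha>)"
proof -
  interpret E: quiver_rep Q I n "zero_rep Q n" by (rule quiver_rep_zero)
  let ?F = "graded_vectors Q d U" and ?N = "graded_vectors Q d W"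
  obtain h where bij: "bij_betw h (rep_vectors Q n) (coset ?N ` ?F)"
    and hs: "\<And>r y. r \<in> carrier \<Lambda> \<Longrightarrow> y \<in> rep_vectors Q n \<Longrightarrow> h (r \<odot>\<^bsub>E.M\<^esub> y) = (\<Union>m\<in>h y. coset ?N (r \<odot>\<^bsub>M\<^esub> m))"
    using iso unfolding module_isomorphic_def quot_module_simps by auto
  let ?a = "Poly_Mapping.single (tail Q \<alpha>, [\<alpha>]) (1 :: 'k)"
  have a: "?a \<in> carrier KQ" by (rule KQ_single[OF arrow_path[OF \<alpha>]])
  have tv: "tail Q \<alpha> \<in> verts Q" "head Q \<alpha> \<in> verts Q" using \<alpha> by auto
  define m where "m = vertex_vector Q d (tail Q \<alpha>) u"
  have mF: "m \<in> ?F"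
    using u lin_subspaceD(1,2)[OF U] tv
    by (auto simp: m_def vertex_vector_def graded_vectors_def intro!: restrict_rep_vectors)
  then have mr: "m \<in> rep_vectors Q d" by (simp add: graded_vectors_def)
  then have mc: "m \<in> carrier M" by simp
  have zero_KQ: "0 \<in> carrier KQ" by simp
  have "coset ?N m \<in> h ` rep_vectors Q n" using bij mF by (simp add: bij_betw_def)
  then obtain y where y: "coset ?N m = h y" "y \<in> rep_vectors Q n" by (rule imageE)
  \<comment> \<open>Stated as an equality of two scalar actions, this passes through
    \<open>h\<close> without an argument that \<open>h\<close> preserves zero.\<close>
  have "cl ?a \<odot>\<^bsub>E.M\<^esub> y = cl 0 \<odot>\<^bsub>E.M\<^esub> y"
  proof -
    have "path_action Q n (zero_rep Q n) ?a y = path_action Q n (zero_rep Q n) 0 y"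
      by (rule rep_vectors_eqI[OF path_action_closed path_action_closed])
        (use act_zero_rep[OF a y(2)] act_zero_rep[OF _ y(2), of 0] in \<open>simp add: lookup_single\<close>)
    then show ?thesis by (simp only: E.smult_cl[OF a y(2)] E.smult_cl[OF zero_KQ y(2)])
  qed
  then have "h (cl ?a \<odot>\<^bsub>E.M\<^esub> y) = h (cl 0 \<odot>\<^bsub>E.M\<^esub> y)" by (rule arg_cong)
  then have "coset ?N (cl ?a \<odot>\<^bsub>M\<^esub> m) = coset ?N (cl 0 \<odot>\<^bsub>M\<^esub> m)"
    unfolding hs[OF cl.hom_closed[OF a] y(2)] hs[OF cl.hom_closed[OF zero_KQ] y(2)] y(1)[symmetric]
      coset_smult[OF N cl.hom_closed[OF a] mc] coset_smult[OF N cl.hom_closed[OF zero_KQ] mc] .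
  moreover have "cl ?a \<odot>\<^bsub>M\<^esub> m = act ?a m" by (rule smult_cl[OF a mr])
  moreover have "cl 0 \<odot>\<^bsub>M\<^esub> m = vzero"
    using smult_cl[OF zero_KQ mr] act_I[OF _ mr, of 0] additive_subgroup.zero_closed[OF idl.additive_subgroup_axioms] by simp
  ultimately have "coset ?N (act ?a m) = coset ?N vzero" by simp
  then obtain k where k: "k \<in> ?N" "act ?a m = k \<oplus>v vzero"
    using coset_eq_iff[OF N, of "act ?a m" vzero] path_action_closed[of Q d x ?a m] vzero_closed by auto
  have "k \<in> carrier M" using k(1) by (simp add: graded_vectors_def)
  then have "act ?a m \<in> ?N" using k M.r_zero by simp
  then have "act ?a m (head Q \<alpha>) \<in> W (head Q \<alpha>)" using tv by (simp add: graded_vectors_def)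
  then show ?thesis using tv unfolding act_arrow[OF \<alpha> mr] by (simp add: vertex_vector_def m_def)
qed

end

context admissible_quiver
begin

text \<open>An isomorphism commutes with all multiples of the trivial path at \<open>v\<close>. It
  therefore restricts to a map between the components at \<open>v\<close> that is linear over the
  field, and injectivity bounds the dimension.\<close>

lemma ss_module_dim_le:
  assumes iso: "module_isomorphic \<Lambda> (ss_module Q n) (ss_module Q n')" and v: "v \<in> verts Q"
  shows "n v \<le> n' v"
proof -
  interpret E: quiver_rep Q I n "zero_rep Q n" by (rule quiver_rep_zero)
  interpret E': quiver_rep Q I n' "zero_rep Q n'" by (rule quiver_rep_zero)
  obtain h where bij: "bij_betw h (rep_vectors Q n) (rep_vectors Q n')"
    and ha: "\<And>y y'. y \<in> rep_vectors Q n \<Longrightarrow> y' \<in> rep_vectors Q n \<Longrightarrow> h (y \<oplus>\<^bsub>E.M\<^esub> y') = h y \<oplus>\<^bsub>E'.M\<^esub> h y'"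
    and hs: "\<And>r y. r \<in> carrier \<Lambda> \<Longrightarrow> y \<in> rep_vectors Q n \<Longrightarrow> h (r \<odot>\<^bsub>E.M\<^esub> y) = r \<odot>\<^bsub>E'.M\<^esub> h y"
    using iso unfolding module_isomorphic_def rep_module_simps(1) by auto
  have hc: "h y \<in> rep_vectors Q n'" if "y \<in> rep_vectors Q n" for y using bij that by (auto simp: bij_betw_def)
  have single: "Poly_Mapping.single (v, []) c \<in> carrier KQ" for c :: 'k by (rule E.KQ_single[OF trivial_path[OF v]])
  have hv: "h (vertex_vector Q n v (c \<cdot>\<^sub>v y v)) = vertex_vector Q n' v (c \<cdot>\<^sub>v h y v)" if y: "y \<in> rep_vectors Q n" for y c
    using hs[OF cl.hom_closed[OF single] y, of c] E.smult_cl[OF single y, of c] E'.smult_cl[OF single hc[OF y], of c]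
      E.act_vertex[OF v y] E'.act_vertex[OF v hc[OF y]] by simp
  have vc: "vertex_vector Q n v c \<in> rep_vectors Q n" if "c \<in> carrier_vec (n v)" for c :: "'k vec"
    unfolding vertex_vector_def using that by (intro restrict_rep_vectors) auto
  have vv: "vertex_vector Q n v c v = c" for c :: "'k vec" using v by (simp add: vertex_vector_def)
  have supp: "h (vertex_vector Q n v c) = vertex_vector Q n' v (h (vertex_vector Q n v c) v)" if c: "c \<in> carrier_vec (n v)" for c
    using hv[OF vc[OF c], of 1] vv[of c] by simp
  show ?thesis
  proof (rule linear_injective_dim[where \<phi> = "\<lambda>c. h (vertex_vector Q n v c) v"])
    fix c :: "'k vec" assume c: "c \<in> carrier_vec (n v)"
    show "h (vertex_vector Q n v c) v \<in> carrier_vec (n' v)" by (rule rep_vectors_carrier[OF hc[OF vc[OF c]] v])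
    fix a
    have "h (vertex_vector Q n v (a \<cdot>\<^sub>v c)) = vertex_vector Q n' v (a \<cdot>\<^sub>v h (vertex_vector Q n v c) v)"
      using hv[OF vc[OF c], of a] vv[of c] by simp
    then show "h (vertex_vector Q n v (a \<cdot>\<^sub>v c)) v = a \<cdot>\<^sub>v h (vertex_vector Q n v c) v"
      using v by (simp add: vertex_vector_def)
  next
    fix c c' :: "'k vec" assume c: "c \<in> carrier_vec (n v)" "c' \<in> carrier_vec (n v)"
    have "vertex_vector Q n v (c + c') = vertex_vector Q n v c \<oplus>\<^bsub>E.M\<^esub> vertex_vector Q n v c'"
      by (auto simp: vertex_vector_def intro!: restrict_ext)
    then show "h (vertex_vector Q n v (c + c')) v = h (vertex_vector Q n v c) v + h (vertex_vector Q n v c') v"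
      using ha[OF vc[OF c(1)] vc[OF c(2)]] v by simp
  next
    fix c :: "'k vec" assume c: "c \<in> carrier_vec (n v)" and 0: "h (vertex_vector Q n v c) v = 0\<^sub>v (n' v)"
    have z: "E.vzero \<in> rep_vectors Q n" by (rule E.vzero_closed)
    \<comment> \<open>The image of zero is idempotent for addition and hence is zero.\<close>
    have "h E.vzero \<oplus>\<^bsub>E'.M\<^esub> h E.vzero = h E.vzero"
      unfolding ha[OF z z, symmetric] E.vzero_add[OF z] ..
    then have "h E.vzero = E'.vzero"
      by (rule E'.add_idem_zero[OF hc[OF z]])
    moreover have "h (vertex_vector Q n v c) = E'.vzero"
      by (subst supp[OF c], unfold 0) (auto simp: vertex_vector_def intro!: restrict_ext)
    ultimately have "vertex_vector Q n v c = E.vzero"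
      using bij vc[OF c] z unfolding bij_betw_def inj_on_def by metis
    from fun_cong[OF this, of v] show "c = 0\<^sub>v (n v)" using v by (simp add: vertex_vector_def)
  qed
qed

lemma ss_module_sym:
  "module_isomorphic \<Lambda> (ss_module Q n) N \<Longrightarrow> module_isomorphic \<Lambda> N (ss_module Q n)"
proof -
  interpret E: quiver_rep Q I n "zero_rep Q n" by (rule quiver_rep_zero)
  assume "module_isomorphic \<Lambda> (ss_module Q n) N"
  then show ?thesis
    by (rule module_isomorphic_sym) (rule E.M.a_closed E.smult_closed; assumption)+
qed

lemma ss_module_dim_eq:
  assumes "module_isomorphic \<Lambda> (ss_module Q n) (ss_module Q n')" "v \<in> verts Q"
  shows "n v = n' v"
  using ss_module_dim_le[OF assms] ss_module_dim_le[OF ss_module_sym[OF assms(1)] assms(2)] by simp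

end

section \<open>The socle, and semisimple sequences as tables of dimensions\<close>

section \<open>Semisimple sequences\<close>

lemma ex_step: "P 0 \<Longrightarrow> \<not> P n \<Longrightarrow> \<exists>l. P l \<and> \<not> P (Suc l)"
  by (induction n) auto

context quiver_rep
begin

lemma submodule_zero: "submodule N \<Lambda> M \<Longrightarrow> vzero \<in> N"
  using subgroup.one_closed[OF submodule.axioms(1)] by fastforce

lemma submodule_add: "submodule N \<Lambda> M \<Longrightarrow> m \<in> N \<Longrightarrow> m' \<in> N \<Longrightarrow> m \<oplus>v m' \<in> N"
  using subgroup.m_closed[OF submodule.axioms(1)] by fastforce

lemma submodule_restrict:
  assumes T: "submodule T \<Lambda> M" and S: "submodule S \<Lambda> M" and sub: "T \<subseteq> S"
  shows "submodule T \<Lambda> (M\<lparr>carrier := S\<rparr>)"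
proof (rule submodule.intro)
  have "subgroup T ((add_monoid M)\<lparr>carrier := S\<rparr>)"
    by (rule M.add.subgroup_incl[OF submodule.axioms(1)[OF T] submodule.axioms(1)[OF S] sub])
  then show "subgroup T (add_monoid (M\<lparr>carrier := S\<rparr>))" by simp
  show "submodule_axioms T \<Lambda> (M\<lparr>carrier := S\<rparr>)"
    by (rule submodule_axioms.intro) (use submodule.smult_closed[OF T] in simp)
qed

lemma submodule_Int:
  assumes T: "submodule T \<Lambda> M" and S: "submodule S \<Lambda> M"
  shows "submodule (T \<inter> S) \<Lambda> M"
proof (rule submodule_actI)
  show "T \<inter> S \<subseteq> carrier M" using submodule_carrier[OF T] by auto
  show "T \<inter> S \<noteq> {}" using submodule_zero[OF T] submodule_zero[OF S] by blast
qed (use submodule_add[OF T] submodule_add[OF S] submodule_act[OF T] submodule_act[OF S] in \<open>blast+\<close>)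

lemma vertex_vector_in_graded:
  assumes U: "\<And>v. v \<in> verts Q \<Longrightarrow> lin_subspace (d v) (U v)" and v: "v \<in> verts Q"
  shows "vertex_vector Q d v u \<in> graded_vectors Q d U \<longleftrightarrow> u \<in> U v"
proof
  assume "vertex_vector Q d v u \<in> graded_vectors Q d U"
  then show "u \<in> U v" using v by (auto simp: graded_vectors_def vertex_vector_def)
next
  assume u: "u \<in> U v"
  then show "vertex_vector Q d v u \<in> graded_vectors Q d U"
    using lin_subspaceD(1,2)[OF U] by (auto simp: graded_vectors_def vertex_vector_def intro!: restrict_rep_vectors)
qed

text \<open>The component at \<open>v\<close> of the socle of the module.\<close>

abbreviation arrow_socle :: "'v \<Rightarrow> 'k vec set" where
  "arrow_socle v \<equiv> {u \<in> carrier_vec (d v). \<forall>\<alpha>\<in>arcs Q. tail Q \<alpha> = v \<longrightarrow> x \<alpha> *\<^sub>v u = 0\<^sub>v (d (head Q \<alpha>))}"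

lemma arrow_socle_subspace: "lin_subspace (d v) (arrow_socle v)"
proof -
  have X: "x \<alpha> \<in> carrier_mat (d (head Q \<alpha>)) (d (tail Q \<alpha>))" if "\<alpha> \<in> arcs Q" for \<alpha>
    by (rule rep_space_carrier[OF rep_space that])
  show ?thesis
    unfolding lin_subspace_def
    using mult_mat_zero_vec[OF X] mult_add_distrib_mat_vec[OF X] mult_mat_vec[OF X]
    by (auto simp: smult_zero_vec)
qed

lemma arrow_socle_submodule: "submodule (graded_vectors Q d arrow_socle) \<Lambda> M"
proof (rule graded_submodule[OF arrow_socle_subspace])
  fix \<alpha> u assume "\<alpha> \<in> arcs Q" "u \<in> arrow_socle (tail Q \<alpha>)"
  then have "x \<alpha> *\<^sub>v u = 0\<^sub>v (d (head Q \<alpha>))" by auto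
  then show "x \<alpha> *\<^sub>v u \<in> arrow_socle (head Q \<alpha>)"
    using lin_subspaceD(2)[OF arrow_socle_subspace] by simp
qed

text \<open>Paths longer than \<open>L\<close> kill \<open>m\<close> and the unit does not, so there
  is a last length \<open>l\<close> at which some combination \<open>f\<close> of paths of length at
  least \<open>l\<close> does not kill \<open>m\<close>. Then \<open>act f m\<close> is nonzero and
  killed by every arrow.\<close>

lemma submodule_meets_socle:
  assumes S: "submodule S \<Lambda> M" and ne: "S \<noteq> {vzero}"
  shows "\<exists>m\<in>S \<inter> graded_vectors Q d arrow_socle. m \<noteq> vzero"
proof -
  obtain m where m: "m \<in> S" "m \<noteq> vzero" using ne submodule_zero[OF S] by blast
  then have mr: "m \<in> rep_vectors Q d" using submodule_carrier[OF S] by blast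
  let ?P = "\<lambda>l. \<exists>f\<in>long_paths Q l. act f m \<noteq> vzero"
  have "act \<one>\<^bsub>KQ\<^esub> m = m"
    using smult_one[of m] smult_cl[OF KQ.one_closed mr] mr cl.hom_one by simp
  then have "?P 0" using m(2) KQ.one_closed unfolding long_paths_0 by (intro bexI[of _ "\<one>\<^bsub>KQ\<^esub>"]) simp_all
  moreover have "\<not> ?P (Suc L)"
  proof
    assume "?P (Suc L)"
    then obtain f where f: "f \<in> long_paths Q (Suc L)" "act f m \<noteq> vzero" by (rule bexE)
    show False using f(2) act_I[OF subsetD[OF long_paths_subset_I f(1)] mr] by simp
  qed
  ultimately have "\<exists>l. ?P l \<and> \<not> ?P (Suc l)" by (rule ex_step)
  then obtain l where l: "?P l" "\<not> ?P (Suc l)" by (elim exE conjE)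
  from l(1) obtain f where f: "f \<in> long_paths Q l" "act f m \<noteq> vzero" by (rule bexE)
  have fc: "f \<in> carrier KQ" by (rule long_paths_carrier[OF f(1)])
  have yr: "act f m \<in> rep_vectors Q d" by (rule path_action_closed)
  have "act f m \<in> S" by (rule submodule_act[OF S fc m(1)])
  moreover have "act f m \<in> graded_vectors Q d arrow_socle"
    unfolding graded_vectors_def
  proof (intro CollectI conjI ballI impI yr)
    fix v assume v: "v \<in> verts Q"
    show "act f m v \<in> carrier_vec (d v)" by (rule rep_vectors_carrier[OF yr v])
    fix \<alpha> assume \<alpha>: "\<alpha> \<in> arcs Q" "tail Q \<alpha> = v"
    let ?a = "Poly_Mapping.single (tail Q \<alpha>, [\<alpha>]) (1 :: 'k)"
    have a: "?a \<in> long_paths Q 1" using arrow_path[OF \<alpha>(1)] by (simp add: long_paths_def)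
    have "path_mult Q ?a f \<in> long_paths Q (Suc l)" using long_paths_mult[OF a f(1)] by simp
    then have "act (path_mult Q ?a f) m = vzero" using l(2) by blast
    moreover have "act (path_mult Q ?a f) m = act ?a (act f m)"
      using a fc by (intro path_action_mult[OF rep_space _ _ mr]) (auto simp: long_paths_def)
    ultimately have "vertex_vector Q d (head Q \<alpha>) (x \<alpha> *\<^sub>v act f m (tail Q \<alpha>)) = vzero"
      using act_arrow[OF \<alpha>(1) yr] by simp
    from fun_cong[OF this, of "head Q \<alpha>"] show "x \<alpha> *\<^sub>v act f m v = 0\<^sub>v (d (head Q \<alpha>))"
      using \<alpha> by (simp add: vertex_vector_def)
  qed
  ultimately show ?thesis using f(2) by blast
qed

text \<open>A simple submodule meets the socle and so lies inside it. If the simple submodules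
  generate the module, the socle is everything and the arrows vanish.\<close>

lemma semisimple_imp_zero:
  assumes ss: "semisimple_module \<Lambda> M"
  shows "x = zero_rep Q d"
proof -
  let ?N = "graded_vectors Q d arrow_socle"
  have "S \<subseteq> ?N" if S: "submodule S \<Lambda> M" and simple: "simple_module \<Lambda> (M\<lparr>carrier := S\<rparr>)" for S
  proof -
    have sT: "submodule (S \<inter> ?N) \<Lambda> (M\<lparr>carrier := S\<rparr>)"
      by (rule submodule_restrict[OF submodule_Int[OF S arrow_socle_submodule] S]) blast
    have "S \<noteq> {vzero}" using simple by (simp add: simple_module_def)
    then have "S \<inter> ?N \<noteq> {vzero}" using submodule_meets_socle[OF S] by blast
    then have "S \<inter> ?N = S" using simple sT unfolding simple_module_def by auto
    then show ?thesis by blast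
  qed
  then have N: "?N = rep_vectors Q d"
    using ss arrow_socle_submodule unfolding semisimple_module_def by auto
  show ?thesis
  proof (rule ext)
    fix \<alpha>
    show "x \<alpha> = zero_rep Q d \<alpha>"
    proof (cases "\<alpha> \<in> arcs Q")
      case True
      have X: "x \<alpha> \<in> carrier_mat (d (head Q \<alpha>)) (d (tail Q \<alpha>))" by (rule rep_space_carrier[OF rep_space True])
      have t: "tail Q \<alpha> \<in> verts Q" using True by simp
      have z: "x \<alpha> *\<^sub>v u = 0\<^sub>v (d (head Q \<alpha>))" if u: "u \<in> carrier_vec (d (tail Q \<alpha>))" for u
      proof -
        have "vertex_vector Q d (tail Q \<alpha>) u \<in> rep_vectors Q d"
          using u by (auto simp: vertex_vector_def intro!: restrict_rep_vectors)
        then have "vertex_vector Q d (tail Q \<alpha>) u \<in> ?N" using N by simp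
        then have "u \<in> arrow_socle (tail Q \<alpha>)" using vertex_vector_in_graded[OF arrow_socle_subspace t] by blast
        then show ?thesis using True by simp
      qed
      have "x \<alpha> = 0\<^sub>m (d (head Q \<alpha>)) (d (tail Q \<alpha>))"
      proof (rule eq_matI)
        fix i j assume "i < dim_row (0\<^sub>m (d (head Q \<alpha>)) (d (tail Q \<alpha>)) :: 'k mat)" "j < dim_col (0\<^sub>m (d (head Q \<alpha>)) (d (tail Q \<alpha>)) :: 'k mat)"
        then have ij: "i < d (head Q \<alpha>)" "j < d (tail Q \<alpha>)" by simp_all
        have "(x \<alpha> *\<^sub>v unit_vec (d (tail Q \<alpha>)) j) $ i = x \<alpha> $$ (i, j)" using X ij by simp
        then show "x \<alpha> $$ (i, j) = 0\<^sub>m (d (head Q \<alpha>)) (d (tail Q \<alpha>)) $$ (i, j)"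
          using z[of "unit_vec (d (tail Q \<alpha>)) j"] ij by simp
      qed (use X in auto)
      then show ?thesis using True by (simp add: zero_rep_def)
    next
      case False
      then show ?thesis using rep_space by (auto simp: zero_rep_def rep_space_def PiE_def extensional_def)
    qed
  qed
qed

end

context admissible_quiver
begin

text \<open>The line through a nonzero vector concentrated at one vertex is a submodule since arrows
  act by zero, and it is simple since multiples of the trivial path act on it by all scalars. A
  submodule containing all these lines is everything.\<close>

lemma semisimple_ss_module: "semisimple_module \<Lambda> (ss_module Q n)"
proof -
  interpret E: quiver_rep Q I n "zero_rep Q n" by (rule quiver_rep_zero)
  have "N = rep_vectors Q n"
    if N: "submodule N \<Lambda> E.M" and simple: "\<And>S. submodule S \<Lambda> E.M \<Longrightarrow> simple_module \<Lambda> (E.M\<lparr>carrier := S\<rparr>) \<Longrightarrow> S \<subseteq> N" for N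
  proof -
    have vert: "vertex_vector Q n v w \<in> N" if v: "v \<in> verts Q" and w: "w \<in> carrier_vec (n v)" for v w
    proof (cases "w = 0\<^sub>v (n v)")
      case True
      then have "vertex_vector Q n v w = E.vzero" by (auto simp: vertex_vector_def intro!: restrict_ext)
      then show ?thesis using E.submodule_zero[OF N] by simp
    next
      case False
      define U where "U u = (if u = v then {c \<cdot>\<^sub>v w |c. True} else {0\<^sub>v (n u)})" for u
      have U: "lin_subspace (n u) (U u)" for u
      proof (cases "u = v")
        case True
        have "\<exists>c. 0\<^sub>v (n v) = c \<cdot>\<^sub>v w" using w by (intro exI[of _ 0] eq_vecI) auto
        moreover have "a \<cdot>\<^sub>v w + b \<cdot>\<^sub>v w = (a + b) \<cdot>\<^sub>v w" for a b by (rule add_smult_distrib_vec[symmetric])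
        ultimately show ?thesis using w True by (auto simp: U_def lin_subspace_def smult_smult_assoc)
      qed (simp add: U_def lin_subspace_zero)
      let ?S = "graded_vectors Q n U"
      have S: "submodule ?S \<Lambda> E.M"
      proof (rule E.graded_submodule[OF U])
        fix \<alpha> u assume \<alpha>: "\<alpha> \<in> arcs Q" and "u \<in> U (tail Q \<alpha>)"
        then have "u \<in> carrier_vec (n (tail Q \<alpha>))" using lin_subspaceD(1)[OF U] by blast
        then show "zero_rep Q n \<alpha> *\<^sub>v u \<in> U (head Q \<alpha>)"
          by (simp add: zero_rep_mult[OF \<alpha>] lin_subspaceD(2)[OF U])
      qed
      have wU: "w \<in> U v" unfolding U_def by (auto intro!: exI[of _ 1])
      then have wS: "vertex_vector Q n v w \<in> ?S" using E.vertex_vector_in_graded[OF U v] by blast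
      have "simple_module \<Lambda> (E.M\<lparr>carrier := ?S\<rparr>)"
        unfolding simple_module_def
      proof (intro conjI allI impI)
        have "vertex_vector Q n v w \<noteq> E.vzero"
        proof
          assume "vertex_vector Q n v w = E.vzero"
          from fun_cong[OF this, of v] show False using v False by (simp add: vertex_vector_def)
        qed
        then show "carrier (E.M\<lparr>carrier := ?S\<rparr>) \<noteq> {\<zero>\<^bsub>E.M\<lparr>carrier := ?S\<rparr>\<^esub>}" using wS by auto
        fix T assume T: "submodule T \<Lambda> (E.M\<lparr>carrier := ?S\<rparr>)"
        have TS: "T \<subseteq> ?S" using subgroup.subset[OF submodule.axioms(1)[OF T]] by simp
        have T0: "E.vzero \<in> T" using subgroup.one_closed[OF submodule.axioms(1)[OF T]] by simp
        have Tsm: "r \<odot>\<^bsub>E.M\<^esub> t \<in> T" if "r \<in> carrier \<Lambda>" "t \<in> T" for r t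
          using submodule.smult_closed[OF T that] by simp
        show "T = {\<zero>\<^bsub>E.M\<lparr>carrier := ?S\<rparr>\<^esub>} \<or> T = carrier (E.M\<lparr>carrier := ?S\<rparr>)"
        proof (cases "T = {E.vzero}")
          case False
          then obtain t where t: "t \<in> T" "t \<noteq> E.vzero" using T0 by blast
          have tr: "t \<in> rep_vectors Q n" and tU: "\<And>u. u \<in> verts Q \<Longrightarrow> t u \<in> U u"
            using t(1) TS by (auto simp: graded_vectors_def)
          obtain a where a: "t v = a \<cdot>\<^sub>v w" using tU[OF v] by (auto simp: U_def)
          have a0: "a \<noteq> 0"
          proof
            assume "a = 0"
            then have "t v = 0\<^sub>v (n v)" using a w by (auto intro!: eq_vecI)
            then have "t u = E.vzero u" if "u \<in> verts Q" for u
              using tU[OF that] that by (cases "u = v") (auto simp: U_def)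
            then have "t = E.vzero" by (rule rep_vectors_eqI[OF tr E.vzero_closed])
            then show False using t(2) by blast
          qed
          have "s \<in> T" if s: "s \<in> ?S" for s
          proof -
            have sr: "s \<in> rep_vectors Q n" and sU: "\<And>u. u \<in> verts Q \<Longrightarrow> s u \<in> U u"
              using s by (auto simp: graded_vectors_def)
            obtain b where b: "s v = b \<cdot>\<^sub>v w" using sU[OF v] by (auto simp: U_def)
            \<comment> \<open>The scalar carrying \<open>t\<close>, which at \<open>v\<close> is
              \<open>a\<close> times \<open>w\<close>, to \<open>s\<close>, which there is
              \<open>b\<close> times \<open>w\<close>.\<close>
            let ?f = "Poly_Mapping.single (v, []) (b / a)"
            have f: "?f \<in> carrier KQ" by (rule E.KQ_single[OF trivial_path[OF v]])
            have "cl ?f \<odot>\<^bsub>E.M\<^esub> t = vertex_vector Q n v ((b / a) \<cdot>\<^sub>v t v)"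
              unfolding E.smult_cl[OF f tr] by (rule E.act_vertex[OF v tr])
            also have "(b / a) \<cdot>\<^sub>v t v = s v" using a0 unfolding a b by (simp add: smult_smult_assoc)
            also have "vertex_vector Q n v (s v) = s"
            proof (rule rep_vectors_eqI[OF _ sr])
              show "vertex_vector Q n v (s v) \<in> rep_vectors Q n"
                using rep_vectors_carrier[OF sr] by (auto simp: vertex_vector_def intro!: restrict_rep_vectors)
              fix u assume "u \<in> verts Q"
              then show "vertex_vector Q n v (s v) u = s u"
                using sU[of u] by (auto simp: vertex_vector_def U_def)
            qed
            finally show ?thesis using Tsm[OF cl.hom_closed[OF f] t(1)] by simp
          qed
          then show ?thesis using TS by auto
        qed simp
      qed
      from simple[OF S this] show ?thesis using wS by blast
    qed
    obtain U where U: "N = graded_vectors Q n U" "\<And>v. v \<in> verts Q \<Longrightarrow> lin_subspace (n v) (U v)"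
      using E.submodule_graded[OF N] by metis
    show ?thesis
    proof
      show "N \<subseteq> rep_vectors Q n" by (rule E.submodule_carrier[OF N])
      show "rep_vectors Q n \<subseteq> N"
      proof
        fix m :: "'v \<Rightarrow> 'k vec" assume m: "m \<in> rep_vectors Q n"
        have "m v \<in> U v" if v: "v \<in> verts Q" for v
          using vert[OF v rep_vectors_carrier[OF m v]] E.vertex_vector_in_graded[OF U(2) v] unfolding U(1) by blast
        then show "m \<in> N" unfolding U(1) graded_vectors_def using m by blast
      qed
    qed
  qed
  then show ?thesis unfolding semisimple_module_def by auto
qed

text \<open>The class of \<open>ss_module Q n\<close> contains the pair
  \<open>(n, zero_rep Q n)\<close>, so equal classes yield an isomorphism. Conversely, composing
  with an isomorphism and with its inverse identifies the classes.\<close>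

lemma iso_class_eq_ss_iff:
  "iso_class Q I N = iso_class Q I (ss_module Q n) \<longleftrightarrow> module_isomorphic \<Lambda> (ss_module Q n) N"
proof
  have "(n, zero_rep Q n) \<in> iso_class Q I (ss_module Q n)"
    using zero_rep_in_Rep module_isomorphic_refl by (simp add: iso_class_def)
  moreover assume "iso_class Q I N = iso_class Q I (ss_module Q n)"
  ultimately show "module_isomorphic \<Lambda> (ss_module Q n) N" by (auto simp: iso_class_def)
next
  assume iso: "module_isomorphic \<Lambda> (ss_module Q n) N"
  have "module_isomorphic \<Lambda> (rep_module Q k z) N \<longleftrightarrow> module_isomorphic \<Lambda> (rep_module Q k z) (ss_module Q n)" for k z
    using module_isomorphic_trans[OF _ iso] module_isomorphic_trans[OF _ ss_module_sym[OF iso]] by blast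
  then show "iso_class Q I N = iso_class Q I (ss_module Q n)" by (simp add: iso_class_def)
qed

lemma ss_module_cong:
  assumes "\<And>v. v \<in> verts Q \<Longrightarrow> n v = n' v"
  shows "module_isomorphic \<Lambda> (ss_module Q n) (ss_module Q n')"
proof -
  interpret E: quiver_rep Q I n "zero_rep Q n" by (rule quiver_rep_zero)
  interpret E': quiver_rep Q I n' "zero_rep Q n'" by (rule quiver_rep_zero)
  have c: "rep_vectors Q n = (rep_vectors Q n' :: ('v \<Rightarrow> 'k vec) set)"
    unfolding rep_vectors_def using assms by (intro PiE_cong) simp
  have "r \<odot>\<^bsub>E.M\<^esub> m = r \<odot>\<^bsub>E'.M\<^esub> m" if r: "r \<in> carrier \<Lambda>" and m: "m \<in> rep_vectors Q n" for r m
  proof -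
    obtain f where f: "r = cl f" "f \<in> carrier KQ" using r by (rule carrier_\<Lambda>E)
    have m': "m \<in> rep_vectors Q n'" using m c by blast
    have "path_action Q n (zero_rep Q n) f m = path_action Q n' (zero_rep Q n') f m"
    proof (rule rep_vectors_eqI[OF path_action_closed])
      show "path_action Q n' (zero_rep Q n') f m \<in> rep_vectors Q n" unfolding c by (rule path_action_closed)
    qed (simp only: act_zero_rep[OF f(2) m] act_zero_rep[OF f(2) m'])
    then show ?thesis unfolding f(1) E.smult_cl[OF f(2) m] E'.smult_cl[OF f(2) m'] .
  qed
  then show ?thesis
    unfolding module_isomorphic_def by (intro exI[of _ id]) (simp add: c)
qed

definition ss_seq :: "(nat \<Rightarrow> 'v \<Rightarrow> nat) \<Rightarrow> nat \<Rightarrow> ('v, 'a, 'k) iso_class" where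
  "ss_seq n = (\<lambda>l\<in>{..L}. iso_class Q I (ss_module Q (n l)))"

text \<open>A point whose module is semisimple has zero arrows, so a semisimple sequence amounts to
  a table of natural numbers \<open>n l v\<close> with prescribed sums over
  \<open>l\<close>.\<close>

lemma semisimple_seqs_iff:
  "\<S> \<in> semisimple_seqs Q I d \<longleftrightarrow> (\<exists>n. \<S> = ss_seq n \<and> (\<forall>v\<in>verts Q. (\<Sum>l\<le>L. n l v) = d v))"
proof
  assume "\<S> \<in> semisimple_seqs Q I d"
  then obtain n z where s: "\<S> = (\<lambda>l\<in>{..L}. iso_class Q I (rep_module Q (n l) (z l)))"
    "\<forall>l\<le>L. z l \<in> Rep Q I (n l) \<and> semisimple_module \<Lambda> (rep_module Q (n l) (z l))"
    "\<forall>v\<in>verts Q. (\<Sum>l\<le>L. n l v) = d v"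
    unfolding semisimple_seqs_def by blast
  have "z l = zero_rep Q (n l)" if "l \<le> L" for l
    using s(2) that quiver_rep.semisimple_imp_zero[OF quiver_repI] by blast
  then have "\<S> = ss_seq n" unfolding s(1) ss_seq_def by (intro restrict_ext) simp
  then show "\<exists>n. \<S> = ss_seq n \<and> (\<forall>v\<in>verts Q. (\<Sum>l\<le>L. n l v) = d v)" using s(3) by blast
next
  assume "\<exists>n. \<S> = ss_seq n \<and> (\<forall>v\<in>verts Q. (\<Sum>l\<le>L. n l v) = d v)"
  then obtain n where "\<S> = ss_seq n" "\<forall>v\<in>verts Q. (\<Sum>l\<le>L. n l v) = d v" by blast
  then show "\<S> \<in> semisimple_seqs Q I d"
    unfolding semisimple_seqs_def ss_seq_def
    by (intro CollectI exI[of _ n] exI[of _ "\<lambda>l. zero_rep Q (n l)"] conjI allI impI)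
      (simp_all add: zero_rep_in_Rep semisimple_ss_module)
qed

lemma ss_seq_cong:
  assumes "\<And>l v. l \<le> L \<Longrightarrow> v \<in> verts Q \<Longrightarrow> n l v = n' l v"
  shows "ss_seq n = ss_seq n'"
  unfolding ss_seq_def
  by (intro restrict_ext) (use assms in \<open>auto simp: iso_class_eq_ss_iff intro!: ss_module_cong\<close>)

text \<open>The numbers \<open>n l v\<close> are bounded by \<open>d v\<close>, and
  \<open>ss_seq\<close> sees only indices \<open>l \<le> L\<close> and vertices, so the tables may
  be taken from a finite set of extensional functions.\<close>

lemma finite_semisimple_seqs: "finite (semisimple_seqs Q I d)"
proof -
  let ?N = "(\<Pi>\<^sub>E l\<in>{..L}. \<Pi>\<^sub>E v\<in>verts Q. {..d v})"
  have "semisimple_seqs Q I d \<subseteq> ss_seq ` ?N"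
  proof
    fix \<S> assume "\<S> \<in> semisimple_seqs Q I d"
    then obtain n where n: "\<S> = ss_seq n" "\<forall>v\<in>verts Q. (\<Sum>l\<le>L. n l v) = d v"
      unfolding semisimple_seqs_iff by blast
    have "n l v \<le> d v" if "l \<le> L" "v \<in> verts Q" for l v
      using member_le_sum[of l "{..L}" "\<lambda>l. n l v"] n(2) that by auto
    then have "(\<lambda>l\<in>{..L}. \<lambda>v\<in>verts Q. n l v) \<in> ?N" by auto
    moreover have "\<S> = ss_seq (\<lambda>l\<in>{..L}. \<lambda>v\<in>verts Q. n l v)"
      unfolding n(1) by (rule ss_seq_cong) simp
    ultimately show "\<S> \<in> ss_seq ` ?N" by blast
  qed
  then show ?thesis by (rule finite_subset) (intro finite_imageI finite_PiE; simp)
qed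

end

section \<open>Radical powers of a module and the radical layering\<close>

section \<open>Radical layers and governed filtrations\<close>

context quiver_rep
begin

lemma smult_a_inv:
  assumes r: "r \<in> carrier \<Lambda>" and m: "m \<in> carrier M"
  shows "r \<odot>\<^bsub>M\<^esub> (\<ominus>\<^bsub>M\<^esub> m) = \<ominus>\<^bsub>M\<^esub> (r \<odot>\<^bsub>M\<^esub> m)"
proof -
  have n: "\<ominus>\<^bsub>M\<^esub> m \<in> carrier M" by (rule M.a_inv_closed[OF m])
  have "r \<odot>\<^bsub>M\<^esub> (\<ominus>\<^bsub>M\<^esub> m) \<oplus>v r \<odot>\<^bsub>M\<^esub> m = r \<odot>\<^bsub>M\<^esub> vzero"
    unfolding smult_add[OF r n m, symmetric] M.l_neg[OF m] ..
  also have "\<dots> = vzero" by (rule smult_zero_vec[OF r])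
  finally have "\<ominus>\<^bsub>M\<^esub> (r \<odot>\<^bsub>M\<^esub> m) = r \<odot>\<^bsub>M\<^esub> (\<ominus>\<^bsub>M\<^esub> m)"
    by (rule M.minus_equality[OF _ smult_closed[OF r m] smult_closed[OF r n]])
  then show ?thesis by simp
qed

text \<open>Induction over the generated subgroup. With \<open>A = A'\<close> it shows stability
  under scalars; with \<open>r\<close> in the radical it shows that the radical carries each radical
  power of the module into the next.\<close>

lemma ideal_smult_transfer:
  assumes A: "A \<subseteq> carrier \<Lambda>" and r: "r \<in> carrier \<Lambda>" and rA: "\<And>a. a \<in> A \<Longrightarrow> r \<otimes>\<^bsub>\<Lambda>\<^esub> a \<in> A'"
    and m: "m \<in> ideal_smult A M"
  shows "m \<in> carrier M \<and> r \<odot>\<^bsub>M\<^esub> m \<in> ideal_smult A' M"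
  using m unfolding ideal_smult_def
proof (induction m rule: generate.induct)
  case one
  have "r \<odot>\<^bsub>M\<^esub> vzero = \<one>\<^bsub>add_monoid M\<^esub>" using smult_zero_vec[OF r] by simp
  then show ?case using generate.one[of "add_monoid M"] M.zero_closed by (metis monoid.simps(2))
next
  case (incl h)
  then obtain a m where h: "h = a \<odot>\<^bsub>M\<^esub> m" "a \<in> A" "m \<in> carrier M" by blast
  have ac: "a \<in> carrier \<Lambda>" using A h(2) by blast
  have "r \<odot>\<^bsub>M\<^esub> h = (r \<otimes>\<^bsub>\<Lambda>\<^esub> a) \<odot>\<^bsub>M\<^esub> m" unfolding h(1) by (rule smult_assoc[OF r ac h(3), symmetric])
  then have "r \<odot>\<^bsub>M\<^esub> h \<in> {a \<odot>\<^bsub>M\<^esub> m |a m. a \<in> A' \<and> m \<in> carrier M}" using rA[OF h(2)] h(3) by blast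
  then show ?case using smult_closed[OF ac h(3)] h(1) by (auto intro: generate.incl)
next
  case (inv h)
  then obtain a m where h: "h = a \<odot>\<^bsub>M\<^esub> m" "a \<in> A" "m \<in> carrier M" by blast
  have ac: "a \<in> carrier \<Lambda>" using A h(2) by blast
  have hc: "h \<in> carrier M" unfolding h(1) by (rule smult_closed[OF ac h(3)])
  have e: "inv\<^bsub>add_monoid M\<^esub> k = \<ominus>\<^bsub>M\<^esub> k" for k by (simp add: a_inv_def)
  have "r \<odot>\<^bsub>M\<^esub> h = (r \<otimes>\<^bsub>\<Lambda>\<^esub> a) \<odot>\<^bsub>M\<^esub> m" unfolding h(1) by (rule smult_assoc[OF r ac h(3), symmetric])
  then have "r \<odot>\<^bsub>M\<^esub> h \<in> {a \<odot>\<^bsub>M\<^esub> m |a m. a \<in> A' \<and> m \<in> carrier M}" using rA[OF h(2)] h(3) by blast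
  then have "inv\<^bsub>add_monoid M\<^esub> (r \<odot>\<^bsub>M\<^esub> h) \<in> generate (add_monoid M) {a \<odot>\<^bsub>M\<^esub> m |a m. a \<in> A' \<and> m \<in> carrier M}"
    by (rule generate.inv)
  then show ?case unfolding e smult_a_inv[OF r hc] using M.a_inv_closed[OF hc] by blast
next
  case (eng h1 h2)
  then have c: "h1 \<in> carrier M" "h2 \<in> carrier M" by blast+
  have e: "h1 \<otimes>\<^bsub>add_monoid M\<^esub> h2 = h1 \<oplus>v h2" for h1 h2 by simp
  have "r \<odot>\<^bsub>M\<^esub> (h1 \<oplus>v h2) = (r \<odot>\<^bsub>M\<^esub> h1) \<otimes>\<^bsub>add_monoid M\<^esub> (r \<odot>\<^bsub>M\<^esub> h2)"
    unfolding smult_add[OF r c] e ..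
  also have "\<dots> \<in> generate (add_monoid M) {a \<odot>\<^bsub>M\<^esub> m |a m. a \<in> A' \<and> m \<in> carrier M}"
    using eng by (intro generate.eng) blast+
  finally show ?case unfolding e using M.a_closed[OF c] by blast
qed

abbreviation R :: "nat \<Rightarrow> ('v \<Rightarrow> 'k vec) set" where "R l \<equiv> radical_power Q I M l"

lemma radical_power_transfer:
  assumes "r \<in> carrier \<Lambda>" "\<And>a. a \<in> ideal_power \<Lambda> Jac k \<Longrightarrow> r \<otimes>\<^bsub>\<Lambda>\<^esub> a \<in> ideal_power \<Lambda> Jac l" "m \<in> R k"
  shows "m \<in> carrier M \<and> r \<odot>\<^bsub>M\<^esub> m \<in> R l"
  using ideal_smult_transfer[OF Jac_power_carrier assms(1,2)] assms(3) unfolding radical_power_def by blast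

lemma radical_power_closed: "R l \<subseteq> carrier M"
  using radical_power_transfer[OF \<Lambda>.one_closed Jac_power_left[OF \<Lambda>.one_closed]] by blast

lemma radical_power_submodule: "submodule (R l) \<Lambda> M"
proof (rule submodule.intro)
  have "{a \<odot>\<^bsub>M\<^esub> m |a m. a \<in> ideal_power \<Lambda> Jac l \<and> m \<in> carrier M} \<subseteq> carrier M"
    using smult_closed subsetD[OF Jac_power_carrier] by auto
  then show "subgroup (R l) (add_monoid M)"
    unfolding radical_power_def ideal_smult_def by (rule M.add.generate_is_subgroup)
  show "submodule_axioms (R l) \<Lambda> M"
    by (rule submodule_axioms.intro) (use radical_power_transfer[OF _ Jac_power_left] in blast)
qed

lemma radical_power_0: "R 0 = carrier M"
proof (intro equalityI radical_power_closed subsetI)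
  fix m assume m: "m \<in> carrier M"
  have "\<one>\<^bsub>\<Lambda>\<^esub> \<odot>\<^bsub>M\<^esub> m \<in> R 0"
    unfolding radical_power_def ideal_smult_def ideal_power.simps
    using m \<Lambda>.one_closed by (intro generate.incl CollectI exI[of _ "\<one>\<^bsub>\<Lambda>\<^esub>"] exI[of _ m] conjI refl)
  then show "m \<in> R 0" unfolding smult_one[OF m] .
qed

lemma radical_power_antimono: "R (Suc l) \<subseteq> R l"
proof -
  have "{a \<odot>\<^bsub>M\<^esub> m |a m. a \<in> ideal_power \<Lambda> Jac (Suc l) \<and> m \<in> carrier M}
    \<subseteq> {a \<odot>\<^bsub>M\<^esub> m |a m. a \<in> ideal_power \<Lambda> Jac l \<and> m \<in> carrier M}"
    using Jac_power_antimono[of l] by blast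
  then show ?thesis unfolding radical_power_def ideal_smult_def by (rule M.add.mono_generate)
qed

lemma radical_power_final: "R (Suc L) = {vzero}"
proof -
  have "{a \<odot>\<^bsub>M\<^esub> m |a m. a \<in> ideal_power \<Lambda> Jac (Suc L) \<and> m \<in> carrier M} \<subseteq> {vzero}"
  proof
    fix y assume "y \<in> {a \<odot>\<^bsub>M\<^esub> m |a m. a \<in> ideal_power \<Lambda> Jac (Suc L) \<and> m \<in> carrier M}"
    then obtain a m where y: "y = a \<odot>\<^bsub>M\<^esub> m" "a \<in> ideal_power \<Lambda> Jac (Suc L)" "m \<in> carrier M" by blast
    have mr: "m \<in> rep_vectors Q d" using y(3) by simp
    have k0: "0 \<in> carrier KQ" by simp
    have "a = cl 0" using Jac_power_zero[OF y(2)] cl.hom_zero by simp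
    then have "y = act 0 m" unfolding y(1) using smult_cl[OF k0 mr] by simp
    also have "\<dots> = vzero" using act_I[OF _ mr, of 0] additive_subgroup.zero_closed[OF idl.additive_subgroup_axioms] by simp
    finally show "y \<in> {vzero}" by simp
  qed
  then have "R (Suc L) \<subseteq> {vzero}"
    unfolding radical_power_def ideal_smult_def
    using M.add.generate_subgroup_incl[of _ "{vzero}"] M.add.triv_subgroup by simp
  then show ?thesis using submodule_zero[OF radical_power_submodule] by blast
qed

lemma radical_power_arrow:
  assumes "f \<in> long_paths Q 1" "m \<in> R l"
  shows "act f m \<in> R (Suc l)"
proof -
  have fJ: "cl f \<in> Jac" by (rule long_paths_subset_Jac[OF assms(1)])
  have fc: "f \<in> carrier KQ" by (rule long_paths_carrier[OF assms(1)])
  have m: "m \<in> rep_vectors Q d" using radical_power_closed assms(2) by auto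
  have "cl f \<odot>\<^bsub>M\<^esub> m \<in> R (Suc l)"
    using radical_power_transfer[OF cl.hom_closed[OF fc] Jac_power_Suc_I[OF fJ] assms(2)] by blast
  then show ?thesis using smult_cl[OF fc m] by simp
qed

lemma governs_ss_seq_iff:
  "governs_filtration Q I (ss_seq n) M F \<longleftrightarrow> F 0 = carrier M \<and> F (Suc L) = {vzero} \<and>
    (\<forall>l\<le>Suc L. submodule (F l) \<Lambda> M) \<and>
    (\<forall>l\<le>L. F (Suc l) \<subseteq> F l \<and> module_isomorphic \<Lambda> (ss_module Q (n l)) (quot_module (M\<lparr>carrier := F l\<rparr>) (F (Suc l))))"
  unfolding governs_filtration_def by (simp add: ss_seq_def iso_class_eq_ss_iff)

text \<open>Radical powers are submodules, hence graded, and arrows, whose classes lie in the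
  radical, map each into the next. So the layers have zero arrows, and the radical layering governs
  the filtration by radical powers.\<close>

lemma radical_layering_governs:
  obtains n where "radical_layering Q I M = ss_seq n" "governs_filtration Q I (ss_seq n) M R"
proof -
  have "\<forall>l. \<exists>U. R l = graded_vectors Q d U \<and> (\<forall>v\<in>verts Q. lin_subspace (d v) (U v))"
  proof
    fix l
    obtain U where "R l = graded_vectors Q d U" "\<And>v. v \<in> verts Q \<Longrightarrow> lin_subspace (d v) (U v)"
      using submodule_graded[OF radical_power_submodule] by metis
    then show "\<exists>U. R l = graded_vectors Q d U \<and> (\<forall>v\<in>verts Q. lin_subspace (d v) (U v))" by blast
  qed
  then obtain U where RU: "\<And>l. R l = graded_vectors Q d (U l)"
    and U: "\<And>l v. v \<in> verts Q \<Longrightarrow> lin_subspace (d v) (U l v)" by metis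
  have vv: "vertex_vector Q d v u \<in> R l \<longleftrightarrow> u \<in> U l v" if "v \<in> verts Q" for l v u
    unfolding RU by (rule vertex_vector_in_graded[OF U that])
  have sub: "U (Suc l) v \<subseteq> U l v" if v: "v \<in> verts Q" for l v
  proof
    fix u assume "u \<in> U (Suc l) v"
    then have "vertex_vector Q d v u \<in> R (Suc l)" unfolding vv[OF v] .
    then have "vertex_vector Q d v u \<in> R l" using radical_power_antimono by blast
    then show "u \<in> U l v" unfolding vv[OF v] .
  qed
  have arr: "x \<alpha> *\<^sub>v u \<in> U (Suc l) (head Q \<alpha>)" if \<alpha>: "\<alpha> \<in> arcs Q" and u: "u \<in> U l (tail Q \<alpha>)" for l \<alpha> u
  proof -
    have t: "tail Q \<alpha> \<in> verts Q" "head Q \<alpha> \<in> verts Q" using \<alpha> by auto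
    have m: "vertex_vector Q d (tail Q \<alpha>) u \<in> R l" using u unfolding vv[OF t(1)] .
    then have mr: "vertex_vector Q d (tail Q \<alpha>) u \<in> rep_vectors Q d" using radical_power_closed by auto
    have "Poly_Mapping.single (tail Q \<alpha>, [\<alpha>]) (1 :: 'k) \<in> long_paths Q 1"
      using arrow_path[OF \<alpha>] by (simp add: long_paths_def)
    then have "act (Poly_Mapping.single (tail Q \<alpha>, [\<alpha>]) 1) (vertex_vector Q d (tail Q \<alpha>) u) \<in> R (Suc l)"
      using radical_power_arrow m by blast
    moreover have "vertex_vector Q d (tail Q \<alpha>) u (tail Q \<alpha>) = u" using t by (simp add: vertex_vector_def)
    ultimately have "vertex_vector Q d (head Q \<alpha>) (x \<alpha> *\<^sub>v u) \<in> R (Suc l)"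
      by (simp only: act_arrow[OF \<alpha> mr])
    then show ?thesis unfolding vv[OF t(2)] .
  qed
  have "\<forall>l v. \<exists>n B. v \<in> verts Q \<longrightarrow> quot_basis (d v) n B (U l v) (U (Suc l) v)"
    using quot_basis_exists[OF U U] by blast
  then obtain n B where B: "\<And>l v. v \<in> verts Q \<Longrightarrow> quot_basis (d v) (n l v) (B l v) (U l v) (U (Suc l) v)"
    by metis
  have iso: "module_isomorphic \<Lambda> (ss_module Q (n l)) (quot_module (M\<lparr>carrier := R l\<rparr>) (R (Suc l)))" for l
    unfolding RU[of l] RU[of "Suc l"] by (rule quot_isomorphic_ss[OF U U sub arr B])
  have "governs_filtration Q I (ss_seq n) M R"
    unfolding governs_ss_seq_iff
    using radical_power_0 radical_power_final radical_power_submodule radical_power_antimono iso by blast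
  moreover have "radical_layering Q I M = ss_seq n"
    unfolding radical_layering_def ss_seq_def
    by (intro restrict_ext) (use iso in \<open>simp add: iso_class_eq_ss_iff\<close>)
  ultimately show ?thesis using that by blast
qed

end

section \<open>Governed filtrations as vanishing of matrix entries\<close>

context admissible_quiver
begin

text \<open>In coordinates adapted to a flag, step \<open>l\<close> at \<open>v\<close> is the
  vanishing of the first \<open>\<Sum>k<l. n k v\<close> coordinates. The positions are those that
  must vanish for every arrow to carry step \<open>l\<close> into step \<open>Suc l\<close>, for all
  \<open>l \<le> L\<close>.\<close>

definition flag_zeros :: "(nat \<Rightarrow> 'v \<Rightarrow> nat) \<Rightarrow> ('a \<times> nat \<times> nat) set" where
  "flag_zeros n = {(\<alpha>, i, j). \<exists>l\<le>L. (\<Sum>k<l. n k (tail Q \<alpha>)) \<le> j \<and> i < (\<Sum>k<Suc l. n k (head Q \<alpha>))}"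

text \<open>The bound \<open>i < n\<close> keeps out indices beyond the dimension, at which entries
  of a vector carry no meaning.\<close>

lemma lin_subspace_vanishing:
  assumes g: "g \<in> carrier_mat n n"
  shows "lin_subspace n {u \<in> carrier_vec n. \<forall>i<k. i < n \<longrightarrow> (g *\<^sub>v u) $ i = (0 :: 'k)}"
  unfolding lin_subspace_def
  using mult_mat_zero_vec[OF g] mult_add_distrib_mat_vec[OF g] mult_mat_vec[OF g] g
  by (auto simp del: index_mult_mat_vec)

end

context quiver_rep
begin

text \<open>Because the quotients are semisimple, arrows map each step of the filtration into the
  next. The columns of \<open>g'\<close> are a basis adapted to the flag at each vertex, and in
  these coordinates the arrows have the required zeros.\<close>

lemma governs_imp_flag:
  assumes gov: "governs_filtration Q I (ss_seq n) M F"
  shows "(\<forall>v\<in>verts Q. (\<Sum>l\<le>L. n l v) = d v) \<and>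
    (\<exists>g g'. gl_pair Q d g g' \<and> base_change Q g g' x \<in> block_locus Q d (flag_zeros n))"
proof -
  have F0: "F 0 = carrier M" and FL: "F (Suc L) = {vzero}"
    and Fs: "\<And>l. l \<le> Suc L \<Longrightarrow> submodule (F l) \<Lambda> M" and Fm: "\<And>l. l \<le> L \<Longrightarrow> F (Suc l) \<subseteq> F l"
    and iso: "\<And>l. l \<le> L \<Longrightarrow> module_isomorphic \<Lambda> (ss_module Q (n l)) (quot_module (M\<lparr>carrier := F l\<rparr>) (F (Suc l)))"
    using gov unfolding governs_ss_seq_iff by auto
  have "\<forall>l. \<exists>U. l \<le> Suc L \<longrightarrow> F l = graded_vectors Q d U \<and> (\<forall>v\<in>verts Q. lin_subspace (d v) (U v))"
  proof
    fix l
    show "\<exists>U. l \<le> Suc L \<longrightarrow> F l = graded_vectors Q d U \<and> (\<forall>v\<in>verts Q. lin_subspace (d v) (U v))"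
    proof (cases "l \<le> Suc L")
      case True
      obtain U where "F l = graded_vectors Q d U" "\<And>v. v \<in> verts Q \<Longrightarrow> lin_subspace (d v) (U v)"
        using submodule_graded[OF Fs[OF True]] by metis
      then show ?thesis by blast
    qed simp
  qed
  then obtain U where FU: "\<And>l. l \<le> Suc L \<Longrightarrow> F l = graded_vectors Q d (U l)"
    and U: "\<And>l v. l \<le> Suc L \<Longrightarrow> v \<in> verts Q \<Longrightarrow> lin_subspace (d v) (U l v)" by metis
  have vv: "vertex_vector Q d v u \<in> F l \<longleftrightarrow> u \<in> U l v" if "l \<le> Suc L" "v \<in> verts Q" for l v u
    using vertex_vector_in_graded[OF U[OF that(1)] that(2)] FU[OF that(1)] by simp
  have sub: "U (Suc l) v \<subseteq> U l v" if "l \<le> L" "v \<in> verts Q" for l v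
    using vv[of "Suc l" v] vv[of l v] Fm[OF that(1)] that by auto
  have arr: "x \<alpha> *\<^sub>v u \<in> U (Suc l) (head Q \<alpha>)" if l: "l \<le> L" and \<alpha>: "\<alpha> \<in> arcs Q" and u: "u \<in> U l (tail Q \<alpha>)" for l \<alpha> u
  proof -
    have l2: "l \<le> Suc L" "Suc l \<le> Suc L" using l by simp_all
    show ?thesis
      by (rule quot_iso_arrows[OF iso[OF l, unfolded FU[OF l2(1)] FU[OF l2(2)]] U[OF l2(1)]
          Fs[OF l2(2), unfolded FU[OF l2(2)]] \<alpha> u])
  qed
  have qb: "\<exists>B. quot_basis (d v) (n l v) B (U l v) (U (Suc l) v)" if l: "l \<le> L" and v: "v \<in> verts Q" for l v
  proof -
    have l2: "l \<le> Suc L" "Suc l \<le> Suc L" using l by simp_all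
    have "\<forall>v. \<exists>m B. v \<in> verts Q \<longrightarrow> quot_basis (d v) m B (U l v) (U (Suc l) v)"
      using quot_basis_exists[OF U[OF l2(1)] U[OF l2(2)]] by blast
    then obtain m B where B: "\<And>v. v \<in> verts Q \<Longrightarrow> quot_basis (d v) (m v) (B v) (U l v) (U (Suc l) v)" by metis
    have "module_isomorphic \<Lambda> (ss_module Q m) (quot_module (M\<lparr>carrier := F l\<rparr>) (F (Suc l)))"
      unfolding FU[OF l2(1)] FU[OF l2(2)]
      by (rule quot_isomorphic_ss[OF U[OF l2(1)] U[OF l2(2)] sub[OF l] arr[OF l] B])
    from module_isomorphic_trans[OF iso[OF l] ss_module_sym[OF this]]
    \<comment> \<open>The dimension found from the subspaces is the one prescribed by the sequence,
      as isomorphic modules with zero arrows have equal dimension vectors.\<close>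
    have "n l v = m v" using ss_module_dim_eq v by blast
    then show ?thesis using B[OF v] by auto
  qed
  have U0: "U 0 v = carrier_vec (d v)" if v: "v \<in> verts Q" for v
  proof
    show "U 0 v \<subseteq> carrier_vec (d v)" using lin_subspaceD(1)[OF U[OF _ v]] by blast
    show "carrier_vec (d v) \<subseteq> U 0 v"
    proof
      fix u :: "'k vec" assume "u \<in> carrier_vec (d v)"
      then have "vertex_vector Q d v u \<in> F 0"
        unfolding F0 by (auto simp: vertex_vector_def intro!: restrict_rep_vectors)
      then show "u \<in> U 0 v" using vv[OF _ v] by blast
    qed
  qed
  have UL: "U (Suc L) v = {0\<^sub>v (d v)}" if v: "v \<in> verts Q" for v
  proof
    show "{0\<^sub>v (d v)} \<subseteq> U (Suc L) v" using lin_subspaceD(2)[OF U[OF _ v]] by simp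
    show "U (Suc L) v \<subseteq> {0\<^sub>v (d v)}"
    proof
      fix u assume "u \<in> U (Suc L) v"
      then have "vertex_vector Q d v u = vzero" using vv[OF _ v, of "Suc L" u] FL by auto
      from fun_cong[OF this, of v] show "u \<in> {0\<^sub>v (d v)}" using v by (simp add: vertex_vector_def)
    qed
  qed
  have "\<exists>g g'. (\<Sum>l\<le>L. n l v) = d v \<and> g \<in> carrier_mat (d v) (d v) \<and> g' \<in> carrier_mat (d v) (d v) \<and>
      g * g' = 1\<^sub>m (d v) \<and> g' * g = 1\<^sub>m (d v) \<and>
      (\<forall>l\<le>Suc L. \<forall>c\<in>carrier_vec (d v). g' *\<^sub>v c \<in> U l v \<longleftrightarrow> (\<forall>i<(\<Sum>k<l. n k v). c $ i = 0))"
    if v: "v \<in> verts Q" for v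
  proof -
    have "\<forall>l. \<exists>B. l \<le> L \<longrightarrow> quot_basis (d v) (n l v) B (U l v) (U (Suc l) v)" using qb[OF _ v] by blast
    then obtain B where B: "\<And>l. l \<le> L \<Longrightarrow> quot_basis (d v) (n l v) (B l) (U l v) (U (Suc l) v)" by metis
    obtain b where b: "quot_basis (d v) (\<Sum>l<Suc L. n l v) b (U 0 v) (U (Suc L) v)"
      "\<forall>j\<le>Suc L. \<forall>c\<in>carrier_vec (\<Sum>l<Suc L. n l v). b *\<^sub>v c \<in> U j v \<longleftrightarrow> (\<forall>i<(\<Sum>l<j. n l v). c $ i = 0)"
      using flag_basis[of "Suc L" "d v" "\<lambda>l. U l v" "\<lambda>l. n l v" B] U v sub B by (auto simp: less_Suc_eq_le)
    note full = quot_basis_full[OF b(1)[unfolded U0[OF v] UL[OF v]]]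
    have bc: "b \<in> carrier_mat (d v) (d v)" using b(1) full(1) by (simp add: quot_basis_def)
    obtain g where "g \<in> carrier_mat (d v) (d v)" "b * g = 1\<^sub>m (d v)" "g * b = 1\<^sub>m (d v)" using full(2) by blast
    then show ?thesis
      using bc b(2) full(1) by (intro exI[of _ g] exI[of _ b]) (simp add: lessThan_Suc_atMost)
  qed
  then have "\<forall>v. \<exists>g g'. v \<in> verts Q \<longrightarrow> (\<Sum>l\<le>L. n l v) = d v \<and> g \<in> carrier_mat (d v) (d v) \<and> g' \<in> carrier_mat (d v) (d v) \<and>
      g * g' = 1\<^sub>m (d v) \<and> g' * g = 1\<^sub>m (d v) \<and>
      (\<forall>l\<le>Suc L. \<forall>c\<in>carrier_vec (d v). g' *\<^sub>v c \<in> U l v \<longleftrightarrow> (\<forall>i<(\<Sum>k<l. n k v). c $ i = 0))" by blast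
  then obtain g g' where g: "\<And>v. v \<in> verts Q \<Longrightarrow> (\<Sum>l\<le>L. n l v) = d v \<and> g v \<in> carrier_mat (d v) (d v) \<and> g' v \<in> carrier_mat (d v) (d v) \<and>
      g v * g' v = 1\<^sub>m (d v) \<and> g' v * g v = 1\<^sub>m (d v) \<and>
      (\<forall>l\<le>Suc L. \<forall>c\<in>carrier_vec (d v). g' v *\<^sub>v c \<in> U l v \<longleftrightarrow> (\<forall>i<(\<Sum>k<l. n k v). c $ i = 0))" by metis
  have gl: "gl_pair Q d g g'" unfolding gl_pair_def using g by blast
  have "base_change Q g g' x \<in> block_locus Q d (flag_zeros n)"
    unfolding block_locus_def
  proof (intro CollectI conjI allI impI base_change_closed[OF gl rep_space])
    fix \<alpha> i j assume "(\<alpha>, i, j) \<in> coords Q d \<inter> flag_zeros n"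
    then obtain l where \<alpha>: "\<alpha> \<in> arcs Q" and i: "i < d (head Q \<alpha>)" and j: "j < d (tail Q \<alpha>)" and l: "l \<le> L"
      and jl: "(\<Sum>k<l. n k (tail Q \<alpha>)) \<le> j" and il: "i < (\<Sum>k<Suc l. n k (head Q \<alpha>))"
      by (auto simp: coords_def flag_zeros_def)
    let ?h = "head Q \<alpha>" and ?t = "tail Q \<alpha>"
    have ht: "?h \<in> verts Q" "?t \<in> verts Q" using \<alpha> by auto
    have gh: "g ?h \<in> carrier_mat (d ?h) (d ?h)" "g' ?h \<in> carrier_mat (d ?h) (d ?h)" "g' ?h * g ?h = 1\<^sub>m (d ?h)"
      and gt: "g' ?t \<in> carrier_mat (d ?t) (d ?t)" using g ht by auto
    have X: "x \<alpha> \<in> carrier_mat (d ?h) (d ?t)" by (rule rep_space_carrier[OF rep_space \<alpha>])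
    let ?e = "unit_vec (d ?t) j :: 'k vec"
    \<comment> \<open>Since \<open>j\<close> is at least the offset of step \<open>l\<close>, the
      initial coordinates of the unit vector vanish, so column \<open>j\<close> of \<open>g'\<close>
      lies in that step.\<close>
    have "g' ?t *\<^sub>v ?e \<in> U l ?t"
      using g[OF ht(2)] l j jl by simp
    then have 1: "x \<alpha> *\<^sub>v (g' ?t *\<^sub>v ?e) \<in> U (Suc l) ?h" by (rule arr[OF l \<alpha>])
    define c where "c = g ?h *\<^sub>v (x \<alpha> *\<^sub>v (g' ?t *\<^sub>v ?e))"
    have c: "c \<in> carrier_vec (d ?h)" using gh X by (intro carrier_vecI) (simp add: c_def)
    have y: "x \<alpha> *\<^sub>v (g' ?t *\<^sub>v ?e) \<in> carrier_vec (d ?h)" using X by (intro carrier_vecI) simp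
    have "g' ?h *\<^sub>v c = x \<alpha> *\<^sub>v (g' ?t *\<^sub>v ?e)"
      unfolding c_def using assoc_mult_mat_vec[OF gh(2,1) y, symmetric] gh(3) y by simp
    then have "g' ?h *\<^sub>v c \<in> U (Suc l) ?h" using 1 by simp
    then have "c $ i = 0" using g[OF ht(1)] c l il by simp
    moreover have "c = col (g ?h * x \<alpha> * g' ?t) j"
    proof -
      have "(g ?h * x \<alpha> * g' ?t) *\<^sub>v ?e = c"
        unfolding c_def using gh gt X by (simp add: assoc_mult_mat_vec[of _ "d ?h" "d ?t" _ "d ?t"] assoc_mult_mat_vec[of _ "d ?h" "d ?h" _ "d ?t"])
      moreover have "(g ?h * x \<alpha> * g' ?t) *\<^sub>v ?e = col (g ?h * x \<alpha> * g' ?t) j"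
      proof -
        have "Y *\<^sub>v ?e = col Y j" if "Y \<in> carrier_mat (d ?h) (d ?t)" for Y
          using that j by (intro eq_vecI) auto
        then show ?thesis using gh gt X by (simp add: mult_carrier_mat[of _ "d ?h" "d ?t"] mult_carrier_mat[of _ "d ?h" "d ?h"])
      qed
      ultimately show ?thesis by simp
    qed
    ultimately show "base_change Q g g' x \<alpha> $$ (i, j) = 0"
      using \<alpha> i j gh gt X by (simp add: base_change_def)
  qed
  then show ?thesis using gl g by blast
qed

text \<open>The flag is the preimage under \<open>g\<close> of the coordinate flag with offsets
  given by \<open>n\<close>; the zeros of the transformed matrices say that each arrow raises the
  step by one.\<close>

lemma flag_imp_governs:
  assumes dim: "\<And>v. v \<in> verts Q \<Longrightarrow> (\<Sum>l\<le>L. n l v) = d v" and gl: "gl_pair Q d g g'"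
    and locus: "base_change Q g g' x \<in> block_locus Q d (flag_zeros n)"
  shows "\<exists>F. governs_filtration Q I (ss_seq n) M F"
proof -
  let ?off = "\<lambda>l v. \<Sum>k<l. n k v"
  define U where "U l v = {u \<in> carrier_vec (d v). \<forall>i<?off l v. i < d v \<longrightarrow> (g v *\<^sub>v u) $ i = 0}" for l v
  have gc: "g v \<in> carrier_mat (d v) (d v)" "g' v \<in> carrier_mat (d v) (d v)" "g v * g' v = 1\<^sub>m (d v)" "g' v * g v = 1\<^sub>m (d v)"
    if "v \<in> verts Q" for v using gl that by (auto simp: gl_pair_def)
  have U: "lin_subspace (d v) (U l v)" if "v \<in> verts Q" for l v
    unfolding U_def by (rule lin_subspace_vanishing[OF gc(1)[OF that]])
  have sub: "U (Suc l) v \<subseteq> U l v" for l v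
  proof -
    have "?off l v \<le> ?off (Suc l) v" by simp
    then show ?thesis unfolding U_def by auto
  qed
  have offd: "?off l v \<le> d v" if "l \<le> Suc L" "v \<in> verts Q" for l v
  proof -
    have "?off l v \<le> (\<Sum>k\<le>L. n k v)" using that(1) by (intro sum_mono2) auto
    then show ?thesis using dim[OF that(2)] by simp
  qed
  have arr: "x \<alpha> *\<^sub>v u \<in> U (Suc l) (head Q \<alpha>)" if l: "l \<le> L" and \<alpha>: "\<alpha> \<in> arcs Q" and u: "u \<in> U l (tail Q \<alpha>)" for l \<alpha> u
  proof -
    let ?h = "head Q \<alpha>" and ?t = "tail Q \<alpha>"
    have ht: "?h \<in> verts Q" "?t \<in> verts Q" using \<alpha> by auto
    have X: "x \<alpha> \<in> carrier_mat (d ?h) (d ?t)" by (rule rep_space_carrier[OF rep_space \<alpha>])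
    have uc: "u \<in> carrier_vec (d ?t)" using u by (simp add: U_def)
    let ?Y = "g ?h * x \<alpha> * g' ?t"
    have Y: "?Y \<in> carrier_mat (d ?h) (d ?t)" using gc[OF ht(1)] gc[OF ht(2)] X by (intro mult_carrier_mat)
    have Yz: "?Y $$ (i, j) = 0" if "i < d ?h" "j < d ?t" "(\<alpha>, i, j) \<in> flag_zeros n" for i j
    proof -
      have "(\<alpha>, i, j) \<in> coords Q d \<inter> flag_zeros n" using that \<alpha> by (simp add: coords_def)
      then have "base_change Q g g' x \<alpha> $$ (i, j) = 0" using locus by (auto simp: block_locus_def)
      then show ?thesis using \<alpha> by (simp add: base_change_def)
    qed
    have gu: "g ?t *\<^sub>v u \<in> carrier_vec (d ?t)" using gc[OF ht(2)] by (intro carrier_vecI) simp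
    have "g ?h *\<^sub>v (x \<alpha> *\<^sub>v u) = ?Y *\<^sub>v (g ?t *\<^sub>v u)"
    proof -
      have "?Y *\<^sub>v (g ?t *\<^sub>v u) = (g ?h * x \<alpha>) *\<^sub>v (g' ?t *\<^sub>v (g ?t *\<^sub>v u))"
        by (rule assoc_mult_mat_vec[OF mult_carrier_mat[OF gc(1)[OF ht(1)] X] gc(2)[OF ht(2)] gu])
      also have "g' ?t *\<^sub>v (g ?t *\<^sub>v u) = u"
        using assoc_mult_mat_vec[OF gc(2,1)[OF ht(2)] uc] gc(4)[OF ht(2)] uc by simp
      also have "(g ?h * x \<alpha>) *\<^sub>v u = g ?h *\<^sub>v (x \<alpha> *\<^sub>v u)"
        by (rule assoc_mult_mat_vec[OF gc(1)[OF ht(1)] X uc])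
      finally show ?thesis by simp
    qed
    moreover have "(?Y *\<^sub>v (g ?t *\<^sub>v u)) $ i = 0" if i: "i < ?off (Suc l) ?h" "i < d ?h" for i
    proof -
      have "(?Y *\<^sub>v (g ?t *\<^sub>v u)) $ i = row ?Y i \<bullet> (g ?t *\<^sub>v u)"
        using i Y by (intro index_mult_mat_vec) (simp only: carrier_matD)
      also have "\<dots> = (\<Sum>j = 0..<d ?t. ?Y $$ (i, j) * (g ?t *\<^sub>v u) $ j)"
        unfolding scalar_prod_def carrier_vecD[OF gu] using i carrier_matD[OF Y]
        by (intro sum.cong refl arg_cong2[where f = "(*)"] index_row) (simp_all only: atLeastLessThan_iff)
      \<comment> \<open>Terms with \<open>j\<close> below the offset vanish because \<open>u\<close>
        lies in step \<open>l\<close>, the others because their position belongs to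
        \<open>flag_zeros n\<close>.\<close>
      also have "\<dots> = 0"
      proof (intro sum.neutral ballI)
        fix j assume j: "j \<in> {0..<d ?t}"
        show "?Y $$ (i, j) * (g ?t *\<^sub>v u) $ j = 0"
        proof (cases "j < ?off l ?t")
          case True
          then have "(g ?t *\<^sub>v u) $ j = 0" using u j by (simp add: U_def)
          then show ?thesis by simp
        next
          case False
          then have "(\<alpha>, i, j) \<in> flag_zeros n" using l i by (auto simp: flag_zeros_def intro!: exI[of _ l])
          then have "?Y $$ (i, j) = 0" using Yz i j by simp
          then show ?thesis by simp
        qed
      qed
      finally show ?thesis .
    qed
    ultimately show ?thesis using X unfolding U_def by (auto intro!: carrier_vecI)
  qed
  have qb: "\<exists>B. quot_basis (d v) (n l v) B (U l v) (U (Suc l) v)" if l: "l \<le> L" and v: "v \<in> verts Q" for l v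
  proof -
    \<comment> \<open>The inclusion of the \<open>l\<close>-th block of coordinates;
      \<open>g' v\<close> carries it back to a basis of step \<open>l\<close> modulo step
      \<open>Suc l\<close>.\<close>
    define E where "E = mat (d v) (n l v) (\<lambda>(i, j). if i = ?off l v + j then (1 :: 'k) else 0)"
    have E: "E \<in> carrier_mat (d v) (n l v)" by (simp add: E_def)
    have o: "?off l v + n l v \<le> d v" using offd[of "Suc l" v] l v by simp
    have Ec: "(E *\<^sub>v c) $ i = (if ?off l v \<le> i \<and> i < ?off l v + n l v then c $ (i - ?off l v) else 0)"
      if "c \<in> carrier_vec (n l v)" "i < d v" for c i
    proof -
      have "(E *\<^sub>v c) $ i = (\<Sum>j = 0..<n l v. if j = i - ?off l v \<and> ?off l v \<le> i then c $ j else 0)"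
        using that by (auto simp: E_def scalar_prod_def intro!: sum.cong)
      also have "\<dots> = (if ?off l v \<le> i \<and> i < ?off l v + n l v then c $ (i - ?off l v) else 0)"
        by (cases "?off l v \<le> i") (auto simp: sum.delta)
      finally show ?thesis .
    qed
    note G = gc[OF v]
    have B: "g' v * E \<in> carrier_mat (d v) (n l v)" using G E by simp
    have Ecc: "E *\<^sub>v c \<in> carrier_vec (d v)" for c using E by (intro carrier_vecI) simp
    have gB: "g v *\<^sub>v ((g' v * E) *\<^sub>v c) = E *\<^sub>v c" if c: "c \<in> carrier_vec (n l v)" for c
      using assoc_mult_mat_vec[OF G(2) E c] assoc_mult_mat_vec[OF G(1,2) Ecc[of c]] G(3) Ecc[of c] by simp
    have "quot_basis (d v) (n l v) (g' v * E) (U l v) (U (Suc l) v)"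
      unfolding quot_basis_def
    proof (intro conjI ballI impI B)
      fix c :: "'k vec" assume c: "c \<in> carrier_vec (n l v)"
      have Bc: "(g' v * E) *\<^sub>v c \<in> carrier_vec (d v)" using B by (intro carrier_vecI) (simp only: dim_mult_mat_vec carrier_matD)
      then show "(g' v * E) *\<^sub>v c \<in> U l v" unfolding U_def using gB[OF c] Ec[OF c] by simp
      assume z: "(g' v * E) *\<^sub>v c \<in> U (Suc l) v"
      show "c = 0\<^sub>v (n l v)"
      proof (rule eq_vecI)
        fix j assume "j < dim_vec (0\<^sub>v (n l v) :: 'k vec)"
        then have j: "j < n l v" by simp
        have "(E *\<^sub>v c) $ (?off l v + j) = 0" using z gB[OF c] j o unfolding U_def by simp
        then show "c $ j = 0\<^sub>v (n l v) $ j" using Ec[OF c, of "?off l v + j"] j o by simp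
      qed (use c in simp)
    next
      fix u assume u: "u \<in> U l v"
      have uc: "u \<in> carrier_vec (d v)" using u by (simp add: U_def)
      define c where "c = vec (n l v) (\<lambda>j. (g v *\<^sub>v u) $ (?off l v + j))"
      have c: "c \<in> carrier_vec (n l v)" by (simp add: c_def)
      let ?b = "(g' v * E) *\<^sub>v c"
      have bc: "?b \<in> carrier_vec (d v)" using B by (intro carrier_vecI) (simp only: dim_mult_mat_vec carrier_matD)
      have "u - ?b \<in> U (Suc l) v"
        unfolding U_def
      proof (intro CollectI conjI allI impI)
        show "u - ?b \<in> carrier_vec (d v)" using uc bc by simp
        fix i assume i: "i < ?off (Suc l) v" "i < d v"
        have "g v *\<^sub>v (u - ?b) = g v *\<^sub>v u - E *\<^sub>v c"
          using mult_minus_distrib_mat_vec[OF G(1) uc bc] gB[OF c] by simp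
        then have "(g v *\<^sub>v (u - ?b)) $ i = (g v *\<^sub>v u) $ i - (E *\<^sub>v c) $ i"
          using i carrier_vecD[OF Ecc[of c]] by simp
        also have "\<dots> = 0"
          using i u Ec[OF c i(2)] by (cases "i < ?off l v") (auto simp: U_def c_def)
        finally show "(g v *\<^sub>v (u - ?b)) $ i = 0" .
      qed
      moreover have "a = b + (a - b)" if "a \<in> carrier_vec (d v)" "b \<in> carrier_vec (d v)" for a b :: "'k vec"
        using that by (intro eq_vecI) auto
      note this[OF uc bc]
      ultimately show "\<exists>c\<in>carrier_vec (n l v). \<exists>w\<in>U (Suc l) v. u = (g' v * E) *\<^sub>v c + w" using c by blast
    qed
    then show ?thesis by blast
  qed
  define F where "F l = graded_vectors Q d (U l)" for l
  have U0: "U 0 = (\<lambda>v. carrier_vec (d v))" by (simp add: U_def fun_eq_iff)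
  have UL: "U (Suc L) v = {0\<^sub>v (d v)}" if v: "v \<in> verts Q" for v
  proof -
    have o: "?off (Suc L) v = d v" using dim[OF v] by (simp add: lessThan_Suc_atMost)
    have "u = 0\<^sub>v (d v)" if u: "u \<in> U (Suc L) v" for u
    proof -
      have uc: "u \<in> carrier_vec (d v)" using u by (simp add: U_def)
      have "g v *\<^sub>v u = 0\<^sub>v (d v)"
        using u gc(1)[OF v] unfolding U_def o by (intro eq_vecI) auto
      then have "g' v *\<^sub>v (g v *\<^sub>v u) = 0\<^sub>v (d v)" using mult_mat_zero_vec[OF gc(2)[OF v]] by simp
      then show ?thesis using assoc_mult_mat_vec[OF gc(2,1)[OF v] uc] gc(4)[OF v] uc by simp
    qed
    then show ?thesis using lin_subspaceD(2)[OF U[OF v]] by blast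
  qed
  have "governs_filtration Q I (ss_seq n) M F"
    unfolding governs_ss_seq_iff
  proof (intro conjI allI impI)
    show "F 0 = carrier M" by (simp add: F_def U0 graded_vectors_carrier)
    show "F (Suc L) = {vzero}"
    proof (intro equalityI subsetI)
      fix m assume m: "m \<in> F (Suc L)"
      then have "m \<in> rep_vectors Q d" by (simp add: F_def graded_vectors_def)
      moreover have "m v = vzero v" if "v \<in> verts Q" for v
        using m UL[OF that] that by (auto simp: F_def graded_vectors_def)
      ultimately have "m = vzero" using vzero_closed by (intro rep_vectors_eqI)
      then show "m \<in> {vzero}" by simp
    next
      fix m assume "m \<in> {vzero}"
      then show "m \<in> F (Suc L)" using vzero_closed lin_subspaceD(2)[OF U] by (auto simp: F_def graded_vectors_def)
    qed
  next
    fix l assume "l \<le> Suc L"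
    show "submodule (F l) \<Lambda> M"
      unfolding F_def
    proof (rule graded_submodule[OF U])
      fix \<alpha> u assume \<alpha>: "\<alpha> \<in> arcs Q" and u: "u \<in> U l (tail Q \<alpha>)"
      show "x \<alpha> *\<^sub>v u \<in> U l (head Q \<alpha>)"
      \<comment> \<open>Step \<open>Suc L\<close> is not covered by \<open>arr\<close>, but it is
        zero and therefore stable.\<close>
      proof (cases "l \<le> L")
        case True
        then show ?thesis using arr[OF True \<alpha> u] sub by blast
      next
        case False
        then have "l = Suc L" using \<open>l \<le> Suc L\<close> by simp
        moreover have ht: "tail Q \<alpha> \<in> verts Q" "head Q \<alpha> \<in> verts Q" using \<alpha> by auto
        ultimately have "u = 0\<^sub>v (d (tail Q \<alpha>))" using u UL by auto
        then have "x \<alpha> *\<^sub>v u = 0\<^sub>v (d (head Q \<alpha>))"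
          using mult_mat_zero_vec[OF rep_space_carrier[OF rep_space \<alpha>]] by simp
        then show ?thesis using lin_subspaceD(2)[OF U[OF ht(2)]] by simp
      qed
    qed
  next
    fix l assume l: "l \<le> L"
    show "F (Suc l) \<subseteq> F l" unfolding F_def by (rule graded_vectors_mono) (rule sub)
    have "\<forall>v. \<exists>B. v \<in> verts Q \<longrightarrow> quot_basis (d v) (n l v) B (U l v) (U (Suc l) v)" using qb[OF l] by blast
    then obtain B where B: "\<And>v. v \<in> verts Q \<Longrightarrow> quot_basis (d v) (n l v) (B v) (U l v) (U (Suc l) v)" by metis
    show "module_isomorphic \<Lambda> (ss_module Q (n l)) (quot_module (M\<lparr>carrier := F l\<rparr>) (F (Suc l)))"
      unfolding F_def by (rule quot_isomorphic_ss[OF U U sub arr[OF l] B])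
  qed
  then show ?thesis by blast
qed

end

section \<open>Irreducible sets, and counting closed conditions\<close>

section \<open>Semicontinuity and irreducible components\<close>

lemma irreducible_in_subtopologyD:
  assumes "irreducible_in (subtopology T Y) S"
  shows "irreducible_in T S"
  unfolding irreducible_in_def
proof (intro conjI allI impI)
  show "S \<subseteq> topspace T" "S \<noteq> {}" using assms by (auto simp: irreducible_in_def)
  fix A B assume AB: "closedin T A \<and> closedin T B \<and> S \<subseteq> A \<union> B"
  have "closedin (subtopology T Y) (A \<inter> Y)" "closedin (subtopology T Y) (B \<inter> Y)"
    using AB by (auto simp: closedin_subtopology)
  moreover have "S \<subseteq> (A \<inter> Y) \<union> (B \<inter> Y)" using AB assms by (auto simp: irreducible_in_def)
  ultimately have "S \<subseteq> A \<inter> Y \<or> S \<subseteq> B \<inter> Y" using assms unfolding irreducible_in_def by blast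
  then show "S \<subseteq> A \<or> S \<subseteq> B" by blast
qed

lemma irreducible_in_subtopologyI:
  assumes "irreducible_in T S" "S \<subseteq> Y"
  shows "irreducible_in (subtopology T Y) S"
  unfolding irreducible_in_def
proof (intro conjI allI impI)
  show "S \<subseteq> topspace (subtopology T Y)" "S \<noteq> {}" using assms by (auto simp: irreducible_in_def)
  fix A B assume AB: "closedin (subtopology T Y) A \<and> closedin (subtopology T Y) B \<and> S \<subseteq> A \<union> B"
  then obtain A' B' where "closedin T A'" "A = A' \<inter> Y" "closedin T B'" "B = B' \<inter> Y"
    by (auto simp: closedin_subtopology)
  moreover from this have "S \<subseteq> A' \<union> B'" using AB by blast
  ultimately have "S \<subseteq> A' \<or> S \<subseteq> B'" using assms(1) unfolding irreducible_in_def by blast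
  then show "S \<subseteq> A \<or> S \<subseteq> B" using \<open>A = A' \<inter> Y\<close> \<open>B = B' \<inter> Y\<close> assms(2) by blast
qed

lemma irreducible_in_closure:
  assumes "irreducible_in T S"
  shows "irreducible_in T (T closure_of S)"
  unfolding irreducible_in_def
proof (intro conjI allI impI closure_of_subset_topspace)
  have S: "S \<subseteq> T closure_of S" using assms by (intro closure_of_subset) (simp add: irreducible_in_def)
  then show "T closure_of S \<noteq> {}" using assms by (auto simp: irreducible_in_def)
  fix A B assume AB: "closedin T A \<and> closedin T B \<and> T closure_of S \<subseteq> A \<union> B"
  then have "S \<subseteq> A \<or> S \<subseteq> B" using S assms unfolding irreducible_in_def by blast
  then show "T closure_of S \<subseteq> A \<or> T closure_of S \<subseteq> B" 
    using AB closure_of_minimal[of S A T] closure_of_minimal[of S B T] by blast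
qed

lemma irreducible_in_Union:
  assumes D: "irreducible_in T D" and fin: "finite \<A>"
  shows "(\<And>A. A \<in> \<A> \<Longrightarrow> closedin T (f A)) \<Longrightarrow> D \<subseteq> (\<Union>A\<in>\<A>. f A) \<Longrightarrow> \<exists>A\<in>\<A>. D \<subseteq> f A"
  using fin
proof (induction \<A> rule: finite_induct)
  case empty then show ?case using D by (simp add: irreducible_in_def)
next
  case (insert A \<A>)
  have "closedin T (\<Union>A\<in>\<A>. f A)" using insert by (intro closedin_Union) auto
  moreover have "closedin T (f A)" "D \<subseteq> f A \<union> (\<Union>A\<in>\<A>. f A)" using insert.prems by auto
  ultimately have "D \<subseteq> f A \<or> D \<subseteq> (\<Union>A\<in>\<A>. f A)" using D unfolding irreducible_in_def by blast
  then show ?case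
  proof
    assume "D \<subseteq> (\<Union>A\<in>\<A>. f A)"
    then have "\<exists>A\<in>\<A>. D \<subseteq> f A" using insert.IH insert.prems(1) by simp
    then show ?thesis by blast
  qed blast
qed

text \<open>Here \<open>Y i\<close> are the strata and \<open>Z i\<close> the closed sets of points governed by \<open>i\<close>.\<close>

lemma irreducible_component_closure:
  assumes fin: "finite J" and cover: "topspace T \<subseteq> (\<Union>i\<in>J. Y i)"
    and closed: "\<And>i. i \<in> J \<Longrightarrow> closedin T (Z i)" and YZ: "\<And>i. i \<in> J \<Longrightarrow> Y i \<subseteq> Z i"
    and C: "irreducible_component (subtopology T (Y i)) C"
    and x: "x \<in> C" "\<And>j. j \<in> J \<Longrightarrow> x \<in> Z j \<Longrightarrow> j = i"
  shows "irreducible_component T (T closure_of C)"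
  unfolding irreducible_component_def
proof (intro conjI allI impI)
  have irr: "irreducible_in (subtopology T (Y i)) C"
    and max: "\<And>S. irreducible_in (subtopology T (Y i)) S \<Longrightarrow> C \<subseteq> S \<Longrightarrow> S = C"
    using C by (auto simp: irreducible_component_def)
  have CT: "irreducible_in T C" by (rule irreducible_in_subtopologyD[OF irr])
  then show "irreducible_in T (T closure_of C)" by (rule irreducible_in_closure)
  have CY: "C \<subseteq> Y i" "C \<subseteq> topspace T" using irr by (auto simp: irreducible_in_def)
  fix D0 assume D0: "irreducible_in T D0 \<and> T closure_of C \<subseteq> D0"
  \<comment> \<open>The irreducible set \<open>D0\<close> is not assumed closed; its closure is
    still irreducible and allows the density argument below.\<close>
  define D where "D = T closure_of D0"
  have D: "irreducible_in T D" "closedin T D" using D0 by (auto simp: D_def irreducible_in_closure)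
  have D0D: "D0 \<subseteq> D" unfolding D_def using D0 by (intro closure_of_subset) (simp add: irreducible_in_def)
  have CD: "C \<subseteq> D" using closure_of_subset[OF CY(2)] D0 D0D by blast
  have DT: "D \<subseteq> topspace T" using D(1) by (simp add: irreducible_in_def)
  \<comment> \<open>The strata need not be closed, so irreducibility is applied to the closures of
    their intersections with \<open>D\<close>.\<close>
  have "D \<subseteq> (\<Union>j\<in>J. T closure_of (D \<inter> Y j))"
  proof
    fix y assume y: "y \<in> D"
    then obtain j where "j \<in> J" "y \<in> Y j" using DT cover by blast
    moreover have "D \<inter> Y j \<subseteq> T closure_of (D \<inter> Y j)" using DT by (intro closure_of_subset) blast
    ultimately show "y \<in> (\<Union>j\<in>J. T closure_of (D \<inter> Y j))" using y by blast
  qed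
  then obtain j where j: "j \<in> J" "D \<subseteq> T closure_of (D \<inter> Y j)"
    using irreducible_in_Union[OF D(1) fin, of "\<lambda>j. T closure_of (D \<inter> Y j)"] by auto
  have "T closure_of (D \<inter> Y j) \<subseteq> Z j" using YZ[OF j(1)] closed[OF j(1)] by (intro closure_of_minimal) auto
  then have "x \<in> Z j" using j(2) CD x(1) by blast
  then have "j = i" using x(2) j(1) by blast
  define E where "E = D \<inter> Y i"
  have DE: "D \<subseteq> T closure_of E" using j(2) \<open>j = i\<close> by (simp add: E_def)
  \<comment> \<open>A dense subset of an irreducible set is irreducible.\<close>
  have "irreducible_in T E"
    unfolding irreducible_in_def
  proof (intro conjI allI impI)
    show "E \<subseteq> topspace T" using DT by (auto simp: E_def)
    show "E \<noteq> {}" using x(1) CD CY by (auto simp: E_def)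
    fix A B assume AB: "closedin T A \<and> closedin T B \<and> E \<subseteq> A \<union> B"
    then have "T closure_of E \<subseteq> A \<union> B" by (intro closure_of_minimal) auto
    then have "D \<subseteq> A \<or> D \<subseteq> B" using AB DE D(1) unfolding irreducible_in_def by blast
    then show "E \<subseteq> A \<or> E \<subseteq> B" by (auto simp: E_def)
  qed
  then have "irreducible_in (subtopology T (Y i)) E"
    by (rule irreducible_in_subtopologyI) (simp add: E_def)
  moreover have "C \<subseteq> E" using CD CY by (auto simp: E_def)
  ultimately have "E = C" by (rule max)
  \<comment> \<open>\<open>D0\<close> lies in \<open>D\<close>, which lies in the closure of
    \<open>E\<close>; as \<open>E = C\<close>, this closure is contained in
    \<open>D0\<close>.\<close>
  then show "D0 = T closure_of C" using D0 D0D DE by blast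
qed

lemma closedin_card_ge:
  assumes fin: "finite J" and closed: "\<And>i. i \<in> J \<Longrightarrow> closedin T (Z i)"
  shows "closedin T {x \<in> topspace T. a \<le> card {i \<in> J. x \<in> Z i}}"
proof -
  let ?N = "{N. N \<subseteq> J \<and> card N = a}"
  have "{x \<in> topspace T. a \<le> card {i \<in> J. x \<in> Z i}} = (\<Union>N\<in>?N. topspace T \<inter> (\<Inter>i\<in>N. Z i))"
  proof (intro equalityI subsetI)
    fix x assume x: "x \<in> {x \<in> topspace T. a \<le> card {i \<in> J. x \<in> Z i}}"
    then obtain N where "N \<subseteq> {i \<in> J. x \<in> Z i}" "card N = a"
      using obtain_subset_with_card_n[of a "{i \<in> J. x \<in> Z i}"] by auto
    then show "x \<in> (\<Union>N\<in>?N. topspace T \<inter> (\<Inter>i\<in>N. Z i))" using x by blast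
  next
    fix x assume "x \<in> (\<Union>N\<in>?N. topspace T \<inter> (\<Inter>i\<in>N. Z i))"
    then obtain N where N: "N \<subseteq> J" "card N = a" "x \<in> topspace T" "\<And>i. i \<in> N \<Longrightarrow> x \<in> Z i" by blast
    then have "card N \<le> card {i \<in> J. x \<in> Z i}" using fin by (intro card_mono) auto
    then show "x \<in> {x \<in> topspace T. a \<le> card {i \<in> J. x \<in> Z i}}" using N by simp
  qed
  moreover have "closedin T (topspace T \<inter> (\<Inter>i\<in>N. Z i))" if "N \<in> ?N" for N
  \<comment> \<open>This case arises for \<open>a = 0\<close>. An empty intersection is the
    universe, whence the cut with \<open>topspace T\<close>.\<close>
  proof (cases "N = {}")
    case False
    then have "closedin T (\<Inter>i\<in>N. Z i)" using that closed by (intro closedin_Inter) auto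
    then show ?thesis by blast
  qed simp
  moreover have "finite ?N" using fin by simp
  ultimately show ?thesis by (simp only:) (intro closedin_Union finite_imageI; blast)
qed

section \<open>Closedness of the governed sets, and the two claims\<close>

locale alg_closed_quiver = admissible_quiver Q I
  for Q :: "('v, 'a) pre_digraph" and I :: "(('v, 'a) qpath \<Rightarrow>\<^sub>0 'k::alg_closed_field) set"
begin

definition governed :: "('v \<Rightarrow> nat) \<Rightarrow> (nat \<Rightarrow> ('v, 'a, 'k) iso_class) \<Rightarrow> ('a \<Rightarrow> 'k mat) set" where
  "governed d \<S> = {x \<in> Rep Q I d. \<exists>F. governs_filtration Q I \<S> (rep_module Q d x) F}"

lemma topspace_Rep: "topspace (Rep_topology Q I d) = Rep Q I d"
  by (auto simp: topspace_zariski Rep_def)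

text \<open>Being governed is membership in the saturation of a coordinate subspace. The conditions
  defining \<open>flag_zeros n\<close> bound \<open>i\<close> only from above and \<open>j\<close>
  only from below, so its positions propagate upwards and to the right.\<close>

lemma closedin_governed:
  assumes "\<S> \<in> semisimple_seqs Q I d"
  shows "closedin (Rep_topology Q I d) (governed d \<S>)"
proof -
  obtain n where n: "\<S> = ss_seq n" "\<forall>v\<in>verts Q. (\<Sum>l\<le>L. n l v) = d v"
    using assms unfolding semisimple_seqs_iff by blast
  let ?G = "{x \<in> rep_space Q d. \<exists>g g'. gl_pair Q d g g' \<and> base_change Q g g' x \<in> block_locus Q d (flag_zeros n)}
    :: ('a \<Rightarrow> 'k mat) set"
  have "closedin (zariski Q d) ?G"
  proof (rule closedin_gl_saturation)
    fix \<alpha> i j i' j' assume "(\<alpha>, i, j) \<in> flag_zeros n" "i' \<le> i" "j \<le> (j' :: nat)"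
    then show "(\<alpha>, i', j') \<in> flag_zeros n" by (auto simp: flag_zeros_def intro: order_trans le_less_trans)
  qed
  moreover have "governed d \<S> = ?G \<inter> Rep Q I d"
  proof (rule Set.set_eqI)
    fix x
    show "x \<in> governed d \<S> \<longleftrightarrow> x \<in> ?G \<inter> Rep Q I d"
    proof (cases "x \<in> Rep Q I d")
      case True
      interpret X: quiver_rep Q I d x by (rule quiver_repI[OF True])
      have "(\<exists>F. governs_filtration Q I (ss_seq n) X.M F) \<longleftrightarrow>
          (\<exists>g g'. gl_pair Q d g g' \<and> base_change Q g g' x \<in> block_locus Q d (flag_zeros n))"
        using X.governs_imp_flag X.flag_imp_governs n(2) by metis
      then show ?thesis using True X.rep_space by (simp add: governed_def n(1))
    qed (simp add: governed_def)
  qed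
  ultimately show ?thesis unfolding closedin_subtopology by blast
qed

definition realizable_seqs :: "('v \<Rightarrow> nat) \<Rightarrow> (nat \<Rightarrow> ('v, 'a, 'k) iso_class) set" where
  "realizable_seqs d = {\<S> \<in> semisimple_seqs Q I d. realizable Q I \<S>}"

lemma finite_realizable_seqs: "finite (realizable_seqs d)"
  using finite_semisimple_seqs by (simp add: realizable_seqs_def)

text \<open>\<open>realizable\<close> admits any dimension vector, but the layers of a filtration of
  the module of \<open>x\<close> have dimensions adding up to \<open>d\<close>. This confines the
  count to a finite set of sequences.\<close>

lemma governed_realizable:
  assumes x: "x \<in> Rep Q I d" and "realizable Q I \<S>" "governs_filtration Q I \<S> (rep_module Q d x) F"
  shows "\<S> \<in> realizable_seqs d"
proof -
  interpret X: quiver_rep Q I d x by (rule quiver_repI[OF x])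
  obtain n where n: "\<S> = ss_seq n" using assms(2) unfolding realizable_def semisimple_seqs_iff by blast
  then have "\<forall>v\<in>verts Q. (\<Sum>l\<le>L. n l v) = d v" using X.governs_imp_flag assms(3) by blast
  then have "\<S> \<in> semisimple_seqs Q I d" unfolding semisimple_seqs_iff using n by blast
  then show ?thesis using assms(2) by (simp add: realizable_seqs_def)
qed

text \<open>The set counted lies in the finite set \<open>realizable_seqs d\<close>, so
  \<open>card\<close> is its true number of elements and not the default value 0.\<close>

lemma Gamma_eq:
  assumes x: "x \<in> Rep Q I d"
  shows "Gamma Q I (rep_module Q d x) = card {\<S> \<in> realizable_seqs d. x \<in> governed d \<S>}"
proof -
  have "{\<S>. realizable Q I \<S> \<and> (\<exists>F. governs_filtration Q I \<S> (rep_module Q d x) F)} =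
      {\<S> \<in> realizable_seqs d. x \<in> governed d \<S>}"
    using governed_realizable[OF x] x by (auto simp: governed_def realizable_seqs_def)
  then show ?thesis by (simp add: Gamma_def)
qed

text \<open>A stratum containing a point is nonempty, so its sequence is realizable, and it governs
  the filtration of the module of that point by radical powers.\<close>

lemma Rep_layer_governed:
  assumes x: "x \<in> Rep_layer Q I d \<S>"
  shows "\<S> \<in> realizable_seqs d" "x \<in> governed d \<S>"
proof -
  have r: "x \<in> Rep Q I d" and S: "\<S> = radical_layering Q I (rep_module Q d x)"
    using x by (auto simp: Rep_layer_def)
  interpret X: quiver_rep Q I d x by (rule quiver_repI[OF r])
  obtain n where n: "radical_layering Q I X.M = ss_seq n" "governs_filtration Q I (ss_seq n) X.M X.R"
    using X.radical_layering_governs by metis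
  have "\<forall>v\<in>verts Q. (\<Sum>l\<le>L. n l v) = d v" using X.governs_imp_flag[OF n(2)] by blast
  then have "\<S> \<in> semisimple_seqs Q I d" unfolding semisimple_seqs_iff S n(1) by blast
  then show "\<S> \<in> realizable_seqs d" using x by (auto simp: realizable_seqs_def realizable_def)
  show "x \<in> governed d \<S>" using r n(2) unfolding governed_def S n(1) by blast
qed

lemma closedin_Gamma_ge: "closedin (Rep_topology Q I d) {x \<in> Rep Q I d. a \<le> Gamma Q I (rep_module Q d x)}"
proof -
  have "{x \<in> Rep Q I d. a \<le> Gamma Q I (rep_module Q d x)} =
      {x \<in> topspace (Rep_topology Q I d). a \<le> card {\<S> \<in> realizable_seqs d. x \<in> governed d \<S>}}"
    unfolding topspace_Rep using Gamma_eq by auto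
  also have "closedin (Rep_topology Q I d) \<dots>"
    by (rule closedin_card_ge[OF finite_realizable_seqs closedin_governed]) (simp add: realizable_seqs_def)
  finally show ?thesis .
qed

lemma irreducible_component_closure_Rep_layer:
  assumes C: "irreducible_component (subtopology (Rep_topology Q I d) (Rep_layer Q I d \<S>)) C"
    and x: "x \<in> C" "Gamma Q I (rep_module Q d x) = 1"
  shows "irreducible_component (Rep_topology Q I d) (Rep_topology Q I d closure_of C)"
proof (rule irreducible_component_closure[where Y = "Rep_layer Q I d" and Z = "governed d",
      OF finite_realizable_seqs _ _ _ C x(1)])
  show "topspace (Rep_topology Q I d) \<subseteq> (\<Union>\<S>\<in>realizable_seqs d. Rep_layer Q I d \<S>)"
  proof
    fix y assume "y \<in> topspace (Rep_topology Q I d)"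
    then have "y \<in> Rep_layer Q I d (radical_layering Q I (rep_module Q d y))"
      unfolding topspace_Rep by (simp add: Rep_layer_def)
    then show "y \<in> (\<Union>\<S>\<in>realizable_seqs d. Rep_layer Q I d \<S>)" using Rep_layer_governed(1) by blast
  qed
  show "closedin (Rep_topology Q I d) (governed d \<S>)" if "\<S> \<in> realizable_seqs d" for \<S>
    using that by (intro closedin_governed) (simp add: realizable_seqs_def)
  show "Rep_layer Q I d \<S> \<subseteq> governed d \<S>" for \<S> using Rep_layer_governed(2) by blast
  fix \<S>' assume S': "\<S>' \<in> realizable_seqs d" "x \<in> governed d \<S>'"
  have "x \<in> Rep_layer Q I d \<S>"
    using C x(1) by (auto simp: irreducible_component_def irreducible_in_def)
  note S = Rep_layer_governed[OF this]
  have "x \<in> Rep Q I d" using S'(2) by (simp add: governed_def)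
  then have "card {\<S> \<in> realizable_seqs d. x \<in> governed d \<S>} = 1" using Gamma_eq x(2) by simp
  \<comment> \<open>The sequence of the stratum is itself among those counted at \<open>x\<close>,
    so it is the only one.\<close>
  then obtain \<S>0 where single: "{\<S> \<in> realizable_seqs d. x \<in> governed d \<S>} = {\<S>0}" by (rule card_1_singletonE)
  have "\<T> = \<S>0" if "\<T> \<in> realizable_seqs d" "x \<in> governed d \<T>" for \<T>
  proof -
    have "\<T> \<in> {\<S> \<in> realizable_seqs d. x \<in> governed d \<S>}" using that by simp
    then show ?thesis unfolding single by simp
  qed
  from this[OF S] this[OF S'] show "\<S>' = \<S>" by simp
qed

end

theorem corollaryB:
  fixes Q :: "('v, 'a) pre_digraph"
    and I :: "(('v, 'a) qpath \<Rightarrow>\<^sub>0 'k::alg_closed_field) set"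
    and d :: "'v \<Rightarrow> nat"
  assumes "fin_digraph Q"
    and "admissible_ideal Q I"
  shows "(\<forall>a::nat. closedin (Rep_topology Q I d)
            {x \<in> Rep Q I d. a \<le> Gamma Q I (rep_module Q d x)}) \<and>
         (\<forall>\<S> C. \<S> \<in> semisimple_seqs Q I d \<longrightarrow>
            irreducible_component (subtopology (Rep_topology Q I d) (Rep_layer Q I d \<S>)) C \<longrightarrow>
            1 \<in> (\<lambda>x. Gamma Q I (rep_module Q d x)) ` C \<longrightarrow>
            irreducible_component (Rep_topology Q I d) (Rep_topology Q I d closure_of C))"
proof -
  interpret fin_digraph Q by fact
  interpret alg_closed_quiver Q I
    by (intro alg_closed_quiver.intro admissible_quiver.intro admissible_quiver_axioms.intro assms)
  show ?thesis
    using closedin_Gamma_ge irreducible_component_closure_Rep_layer by (auto simp: eq_commute[of 1])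
qed

end
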